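(* Let $\theta>1$ and let $V$ be twice continuously differentiable on $[0,+\infty)$ with $\lim_{x\to+\infty}V(x)/\log x=+\infty$. Suppose that (i) $V''(x)x+V'(x)>0$ for all $x>0$, and (ii) $V''(x)\ge0$ for all $x>0$. Then the equilibrium measure $\mu_{V,\theta}$ is supported on a single interval $[0,b]$, where $$b=c\,\frac{(1+\theta)^{1+1/\theta}}{\theta}$$ and $c$ is the unique solution $c\in(0,+\infty)$ of $$\frac{1}{2\pi i}\oint_\gamma\frac{V'(J_c(s))J_c(s)}{s}\,ds=1+\theta.$$ Moreover $\mu_{V,\theta}$ has density $$\psi(x)=\frac{1}{2\pi^2x}\int_0^b\big(V''(y)y+V'(y)\big)\log\left|\frac{I_+(y)-I_-(x)}{I_+(y)-I_+(x)}\right|dy,\qquad x\in(0,b).$$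
   Context: The equilibrium measure $\mu_{V,\theta}$ is the unique probability measure on $[0,+\infty)$ minimizing $$I_{V,\theta}(\mu)=\frac12\iint\log\frac{1}{|x-y|}d\mu(x)d\mu(y)+\frac12\iint\log\frac{1}{|x^\theta-y^\theta|}d\mu(x)d\mu(y)+\int V\,d\mu$$ among all probability measures on $[0,+\infty)$. For $c>0$, $J_c(s)=c(s+1)\left(\frac{s+1}{s}\right)^{1/\theta}$, with the branch analytic in $\mathbb C\setminus[-1,0]$ and such that $J_c(s)\sim cs$ as $s\to\infty$. Its real critical points are $-1$ and $s_b=1/\theta$, with $J_c(-1)=0$ and $J_c(1/\theta)=b$. There are two complex conjugate arcs $\gamma_1$ (in the upper half-plane) and $\gamma_2$ (in the lower half-plane) joining $-1$ and $1/\theta$ on which $J_c$ is real; each is mapped bijectively onto $[0,b]$ by $J_c$ (the arcs do not depend on $c$). $\gamma=\gamma_1\cup\gamma_2$ is oriented counterclockwise. For $x\in[0,b]$, $I_+(x)\in\gamma_1$ and $I_-(x)\in\gamma_2$ denote the preimages of $x$ under $J_c$. *)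

theory Defs
  imports "HOL-Probability.Probability" "HOL-Complex_Analysis.Complex_Analysis"
begin

text \<open>The map J_c (principal branch of the power; analytic off [-1,0], J_c(s) ~ c s at infinity).\<close>
definition Jc :: "real \<Rightarrow> real \<Rightarrow> complex \<Rightarrow> complex" where
  "Jc \<theta> c s = complex_of_real c * (s + 1) * ((s + 1) / s) powr complex_of_real (1 / \<theta>)"

definition bc :: "real \<Rightarrow> real \<Rightarrow> real" where
  "bc \<theta> c = c * (1 + \<theta>) powr (1 + 1 / \<theta>) / \<theta>"

text \<open>Preimages of x in [0,b] on the upper arc gamma_1 and lower arc gamma_2
  (the closed arcs are exactly the non-cut preimages of [0,b] in the closed upper / lower half-plane).\<close>
definition Iplus :: "real \<Rightarrow> real \<Rightarrow> real \<Rightarrow> complex" where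
  "Iplus \<theta> c x = (THE s. 0 \<le> Im s \<and> s \<notin> complex_of_real ` {-1<..0} \<and> Jc \<theta> c s = complex_of_real x)"

definition Iminus :: "real \<Rightarrow> real \<Rightarrow> real \<Rightarrow> complex" where
  "Iminus \<theta> c x = (THE s. Im s \<le> 0 \<and> s \<notin> complex_of_real ` {-1<..0} \<and> Jc \<theta> c s = complex_of_real x)"

text \<open>The closed curve gamma = gamma_1 \<union> gamma_2, counterclockwise, as a path on [0,1]:
  first gamma_1 from 1/theta (x = b) to -1 (x = 0), then gamma_2 from -1 back to 1/theta.\<close>
definition gammapath :: "real \<Rightarrow> real \<Rightarrow> real \<Rightarrow> complex" where
  "gammapath \<theta> c t = (if t \<le> 1/2 then Iplus \<theta> c (bc \<theta> c * (1 - 2 * t))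
                       else Iminus \<theta> c (bc \<theta> c * (2 * t - 1)))"

definition eq_kernel :: "real \<Rightarrow> (real \<Rightarrow> real) \<Rightarrow> real \<times> real \<Rightarrow> ereal" where
  "eq_kernel \<theta> V z = (let x = fst z; y = snd z in
     if x = y then \<infinity>
     else ereal (ln (1 / \<bar>x - y\<bar>) / 2 + ln (1 / \<bar>x powr \<theta> - y powr \<theta>\<bar>) / 2 + (V x + V y) / 2))"

definition energy :: "real \<Rightarrow> (real \<Rightarrow> real) \<Rightarrow> real measure \<Rightarrow> ereal" where
  "energy \<theta> V \<mu> =
     enn2ereal (\<integral>\<^sup>+ z. e2ennreal (eq_kernel \<theta> V z) \<partial>(\<mu> \<Otimes>\<^sub>M \<mu>))
   - enn2ereal (\<integral>\<^sup>+ z. e2ennreal (- eq_kernel \<theta> V z) \<partial>(\<mu> \<Otimes>\<^sub>M \<mu>))"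

definition prob_on_halfline :: "real measure \<Rightarrow> bool" where
  "prob_on_halfline \<mu> \<longleftrightarrow> prob_space \<mu> \<and> sets \<mu> = sets borel \<and> emeasure \<mu> {0..} = 1"

definition is_equilibrium_measure :: "real \<Rightarrow> (real \<Rightarrow> real) \<Rightarrow> real measure \<Rightarrow> bool" where
  "is_equilibrium_measure \<theta> V \<mu> \<longleftrightarrow> prob_on_halfline \<mu> \<and>
     (\<forall>\<nu>. prob_on_halfline \<nu> \<longrightarrow> energy \<theta> V \<mu> \<le> energy \<theta> V \<nu>)"

definition measure_support :: "real measure \<Rightarrow> real set" where
  "measure_support \<mu> = {x. \<forall>e>0. emeasure \<mu> (ball x e) > 0}"

definition psi :: "real \<Rightarrow> real \<Rightarrow> (real \<Rightarrow> real) \<Rightarrow> (real \<Rightarrow> real) \<Rightarrow> real \<Rightarrow> real" where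
  "psi \<theta> c V1 V2 x = 1 / (2 * pi\<^sup>2 * x) *
     integral {0..bc \<theta> c} (\<lambda>y. (V2 y * y + V1 y) *
        ln (cmod ((Iplus \<theta> c y - Iminus \<theta> c x) / (Iplus \<theta> c y - Iplus \<theta> c x))))"

end

theory Submission
  imports Defs "HOL-Real_Asymp.Real_Asymp"
begin

text \<open>
  Put \<open>I\<^sub>+(cX(\<phi>)) = r(\<phi>) e\<^sup>i\<^sup>\<phi>\<close> on the upper arc. By the sine law both \<open>r\<close> and \<open>X\<close> are explicit in \<open>\<phi>\<close>, and
  the kernel of the density is the Green function \<open>G(y, x) = ln \<bar>(I\<^sub>+(y) - I\<^sub>-(x)) / (I\<^sub>+(y) - I\<^sub>+(x))\<bar>\<close> of the domain
  bounded by \<open>\<gamma>\<close> and the real axis, so \<open>\<psi>\<close> is a superposition, with weight \<open>W(y) = (y V'(y))'\<close>, of the measures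
  \<open>G(y, u) du / (2 \<pi>\<^sup>2 u)\<close>. The potential of each of these for the kernel
  \<open>ln \<bar>x - u\<bar> + ln \<bar>x\<^sup>\<theta> - u\<^sup>\<theta>\<bar>\<close> is, up to a constant, \<open>max (ln x) (ln y)\<close> on the support and at most that beyond it:
  integrate \<open>ln ((x - J) / (x' - J))\<close> times a holomorphic completion of \<open>G\<close> over the dilated arcs \<open>\<lambda> \<gamma>\<close>, \<open>\<lambda> > 1\<close>,
  and compare \<open>\<lambda> \<rightarrow> 1\<close> with \<open>\<lambda> \<rightarrow> \<infinity>\<close>. The interior of the curve, which carries the second logarithm, becomes the
  exterior for \<open>1/\<theta>\<close> under \<open>s \<mapsto> 1 / s\<close>. Integrating against \<open>W\<close> gives the Euler-Lagrange conditions, the equation for \<open>c\<close>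
  is the condition of total mass one, and strict positivity of the logarithmic energy of neutral signed
  measures makes the solution the unique minimiser.
\<close>

subsection \<open>Positive definiteness of the logarithmic kernel\<close>

text \<open>On the arc J is real and the form \<open>J_log_rate\<close> ds/s equals d ln J, so the
  real part of ln ((x - J)/(y - J)) \<open>extlog\<close> d ln J is the wanted logarithm times the
  Green function, minus a step function times the conjugate of the Green function. That second term
  is the obstacle. It survives for each of the two logarithms; it disappears for their sum, because
  the conjugates belonging to th and 1/th add up to 2 pi on one side of the pole and to 0 on the
  other, so only an integral of d ln J is left, and this is where max (ln x) (ln y) comes from. The
  additive constant of the conjugate is forced: \<open>J_log_rate\<close> has a pole at the end -1
  of the arc, and \<open>extlog\<close> is normalised to vanish there. Near the real axis only real
  parts are under control, hence a limit theorem for real parts. All logarithmic singularities are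
  majorised by the power -1/4 of an angular distance, so that a product of two of them is still
  integrable. In the minimisation strictness comes from ln |x - y| alone; for |x^th - y^th| a
  nonnegative energy is enough.\<close>

definition trunc_log :: "real => real => real" where
 "trunc_log L d = (if d < L then ln (L / d) + d / L - 1 else 0)"

text \<open>What is left of \<open>- ln d\<close> after the truncated kernel and its constant are
  removed, as a function of d/L. Its value 1 at 0 is the constant in the limit of the truncated
  energies.\<close>

definition log_tail :: "real => real" where
 "log_tail u = (if u < 1 then 1 - u else - ln u)"

lemma trunc_log_decomp: "L > 0 ==> d > 0 ==> - ln d = trunc_log L d - ln L + log_tail (d / L)"
 by (simp add: trunc_log_def log_tail_def ln_div)

lemma trunc_log_nonneg: assumes "L > 0" "d > 0" shows "trunc_log L d >= 0"
proof -
 have "ln (d / L) <= d / L - 1" using assms by (intro ln_le_minus_one) auto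
 thus ?thesis using assms by (simp add: trunc_log_def ln_div)
qed

text \<open>The truncated kernel is a mixture of the tent functions max 0 (l - d) over the widths l
  < L. The weight 1/l^2 produces the logarithm, through the antiderivative ln l + d/l, and the cut
  at L keeps the integral finite.\<close>

lemma nn_integral_trunc_log:
 assumes "L > 0" "d > 0"
 shows "(\<integral>\<^sup>+l. ennreal (indicator {0<..<L} l / l\<^sup>2) * ennreal (l - d) \<partial>lborel) = ennreal (trunc_log L d)"
proof -
 have e: "ennreal (indicator {0<..<L} l / l\<^sup>2) * ennreal (l - d) = ennreal ((l - d) / l\<^sup>2) * indicator {d..<L} l" for l
 proof (cases "0 < l & l < L & d <= l")
  case True
  thus ?thesis using assms by (simp add: ennreal_mult[symmetric] mult.commute)
 next
  case False
  thus ?thesis using assms by (auto simp: indicator_def ennreal_neg)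
 qed
 show ?thesis
 proof (cases "d < L")
  case True
  have "(\<integral>\<^sup>+l. ennreal ((l - d) / l\<^sup>2) * indicator {d..<L} l \<partial>lborel) = (\<integral>\<^sup>+l. ennreal ((l - d) / l\<^sup>2) * indicator {d..L} l \<partial>lborel)"
   by (rule nn_integral_cong_AE) (use AE_lborel_singleton[of L] in \<open>auto simp: indicator_def elim!: eventually_mono\<close>)
  also have "... = ennreal ((ln L + d / L) - (ln d + d / d))"
  proof (rule nn_integral_FTC_Icc)
   fix x assume "x \<in> {d..L}"
   hence x: "d <= x" "x <= L" by auto
   show "((%l. ln l + d / l) has_real_derivative (x - d) / x\<^sup>2) (at x)"
    using x assms by (auto intro!: derivative_eq_intros simp: field_simps power2_eq_square)
   show "0 <= (x - d) / x\<^sup>2" using x by simp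
  qed (use True assms in auto)
  finally show ?thesis unfolding e using True assms by (simp add: trunc_log_def ln_div algebra_simps)
 next
  case False
  hence "{d..<L} = {}" by auto
  thus ?thesis unfolding e using False by (simp add: trunc_log_def)
 qed
qed

text \<open>A tent function is the autocorrelation of a window: both points are in the window
  exactly for left ends p in an interval of length l - |x - y|. With the mixture over l, the
  truncated kernel becomes a superposition of products, hence positive definite.\<close>

lemma nn_integral_window_overlap:
 fixes x y l :: real assumes "l > 0"
 shows "(\<integral>\<^sup>+p. indicator {p<..p+l} x * indicator {p<..p+l} y \<partial>lborel) = ennreal (l - \<bar>x - y\<bar>)"
proof -
 have "(\<integral>\<^sup>+p. indicator {p<..p+l} x * indicator {p<..p+l} y \<partial>lborel) = (\<integral>\<^sup>+p. indicator {max x y - l..<min x y} p \<partial>lborel)"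
  by (rule nn_integral_cong) (auto simp: indicator_def)
 also have "... = emeasure lborel {max x y - l..<min x y}" by simp
 also have "... = ennreal (l - \<bar>x - y\<bar>)"
 proof (cases "max x y - l <= min x y")
  case True
  have e: "l - \<bar>x - y\<bar> = min x y - (max x y - l)" by auto
  show ?thesis unfolding e using True by simp
 next
  case False
  hence "{max x y - l..<min x y} = {}" "l - \<bar>x - y\<bar> <= 0" by auto
  thus ?thesis by (simp add: ennreal_neg)
 qed
 finally show ?thesis .
qed

text \<open>The pair z = (l, p) is a width and a left end. Expanded bilinearly for N - M in both
  slots, the product of window masses is a square.\<close>

definition window_product :: "real => real measure => real measure => real \<times> real => real" where
 "window_product L M N z = indicator {0<..<L} (fst z) / (fst z)\<^sup>2 *
   (measure M {snd z<..snd z + fst z} * measure N {snd z<..snd z + fst z})"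

text \<open>Tonelli in the four variables l, p, x, y. The diagonal must be null: there the window
  integral is infinite, whereas \<open>trunc_log L 0\<close> takes the finite value given by the
  convention ln 0 = 0.\<close>

lemma window_product_integral:
 fixes M N :: "real measure"
 assumes M: "prob_space M" "sets M = sets borel" and N: "prob_space N" "sets N = sets borel" and L: "L > 0"
  and int: "integrable (M \<Otimes>\<^sub>M N) (%z. trunc_log L \<bar>fst z - snd z\<bar>)"
  and ne: "AE z in M \<Otimes>\<^sub>M N. fst z ~= snd z"
 shows "has_bochner_integral (lborel \<Otimes>\<^sub>M lborel) (window_product L M N) (\<integral>z. trunc_log L \<bar>fst z - snd z\<bar> \<partial>(M \<Otimes>\<^sub>M N))"
proof -
 interpret M: prob_space M by fact
 interpret N: prob_space N by fact
 interpret P: pair_prob_space M N ..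
 interpret Q: pair_sigma_finite lborel "lborel :: real measure" ..
 interpret PQ: pair_sigma_finite "lborel \<Otimes>\<^sub>M (lborel :: real measure)" "M \<Otimes>\<^sub>M N" ..
 note [measurable_cong] = M(2) N(2)
 let ?w = "%z :: real \<times> real. ennreal (indicator {0<..<L} (fst z) / (fst z)\<^sup>2)"
 let ?i = "%(z :: real \<times> real) x :: real. indicator {snd z<..snd z + fst z} x :: ennreal"
 have mi: "(%(z, x). ?i z x) \<in> borel_measurable ((lborel \<Otimes>\<^sub>M lborel) \<Otimes>\<^sub>M borel)"
 proof -
  have "Measurable.pred ((lborel \<Otimes>\<^sub>M lborel) \<Otimes>\<^sub>M borel) (%w :: (real \<times> real) \<times> real. snd (fst w) < snd w & snd w <= snd (fst w) + fst (fst w))"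
   by measurable
  hence "(%w :: (real \<times> real) \<times> real. indicator {w. snd (fst w) < snd w & snd w <= snd (fst w) + fst (fst w)} w :: ennreal) \<in> borel_measurable ((lborel \<Otimes>\<^sub>M lborel) \<Otimes>\<^sub>M borel)"
   by (intro borel_measurable_indicator) (simp add: pred_def space_pair_measure)
  also have "(%w :: (real \<times> real) \<times> real. indicator {w. snd (fst w) < snd w & snd w <= snd (fst w) + fst (fst w)} w :: ennreal) = (%(z, x). ?i z x)"
   by (auto simp: fun_eq_iff indicator_def)
  finally show ?thesis .
 qed
 have miM[measurable]: "(%(z, x). ?i z x) \<in> borel_measurable ((lborel \<Otimes>\<^sub>M lborel) \<Otimes>\<^sub>M M)"
  and miN[measurable]: "(%(z, x). ?i z x) \<in> borel_measurable ((lborel \<Otimes>\<^sub>M lborel) \<Otimes>\<^sub>M N)"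
  using mi by (simp_all cong: measurable_cong_sets)
 have em: "emeasure A {p<..p+l} = (\<integral>\<^sup>+x. ?i (l, p) x \<partial>A)" if "sets A = sets borel" for A :: "real measure" and p l
  using that by simp
 have meM: "(%z. measure M {snd z<..snd z + fst z}) \<in> borel_measurable (lborel \<Otimes>\<^sub>M lborel)"
 proof -
  have "(%z. \<integral>\<^sup>+x. ?i z x \<partial>M) \<in> borel_measurable (lborel \<Otimes>\<^sub>M lborel)"
   by (rule M.borel_measurable_nn_integral[OF miM])
  hence "(%z. enn2real (\<integral>\<^sup>+x. ?i z x \<partial>M)) \<in> borel_measurable (lborel \<Otimes>\<^sub>M lborel)" by measurable
  thus ?thesis by (simp add: measure_def M(2))
 qed
 have meN: "(%z. measure N {snd z<..snd z + fst z}) \<in> borel_measurable (lborel \<Otimes>\<^sub>M lborel)"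
 proof -
  have "(%z. \<integral>\<^sup>+x. ?i z x \<partial>N) \<in> borel_measurable (lborel \<Otimes>\<^sub>M lborel)"
   by (rule N.borel_measurable_nn_integral[OF miN])
  hence "(%z. enn2real (\<integral>\<^sup>+x. ?i z x \<partial>N)) \<in> borel_measurable (lborel \<Otimes>\<^sub>M lborel)" by measurable
  thus ?thesis by (simp add: measure_def N(2))
 qed
 have mw: "?w \<in> borel_measurable (lborel \<Otimes>\<^sub>M lborel)" by measurable
 have meas: "window_product L M N \<in> borel_measurable (lborel \<Otimes>\<^sub>M lborel)"
  unfolding window_product_def using meM meN by measurable
 define Ph where "Ph = (%(z :: real \<times> real, v :: real \<times> real). ?w z * (?i z (fst v) * ?i z (snd v)))"
 have m1: "(%u :: (real \<times> real) \<times> (real \<times> real). (fst u, fst (snd u))) \<in> measurable ((lborel \<Otimes>\<^sub>M lborel) \<Otimes>\<^sub>M (M \<Otimes>\<^sub>M N)) ((lborel \<Otimes>\<^sub>M lborel) \<Otimes>\<^sub>M borel)"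
  by measurable
 have m2: "(%u :: (real \<times> real) \<times> (real \<times> real). (fst u, snd (snd u))) \<in> measurable ((lborel \<Otimes>\<^sub>M lborel) \<Otimes>\<^sub>M (M \<Otimes>\<^sub>M N)) ((lborel \<Otimes>\<^sub>M lborel) \<Otimes>\<^sub>M borel)"
  by measurable
 have m3: "(%u :: (real \<times> real) \<times> (real \<times> real). fst u) \<in> measurable ((lborel \<Otimes>\<^sub>M lborel) \<Otimes>\<^sub>M (M \<Otimes>\<^sub>M N)) (lborel \<Otimes>\<^sub>M lborel)"
  by measurable
 have "(%u. ?w (fst u) * (?i (fst u) (fst (snd u)) * ?i (fst u) (snd (snd u)))) \<in> borel_measurable ((lborel \<Otimes>\<^sub>M lborel) \<Otimes>\<^sub>M (M \<Otimes>\<^sub>M N))"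
  using measurable_compose[OF m1 mi] measurable_compose[OF m2 mi] measurable_compose[OF m3 mw]
  by (intro borel_measurable_times_ennreal) simp_all
 hence mPh: "Ph \<in> borel_measurable ((lborel \<Otimes>\<^sub>M lborel) \<Otimes>\<^sub>M (M \<Otimes>\<^sub>M N))" by (simp add: Ph_def case_prod_beta)
 have step1: "ennreal (window_product L M N z) = (\<integral>\<^sup>+v. Ph (z, v) \<partial>(M \<Otimes>\<^sub>M N))" for z
 proof -
  have mz: "?i z \<in> borel_measurable M" "?i z \<in> borel_measurable N" by measurable
  have "(\<integral>\<^sup>+v. ?i z (fst v) * ?i z (snd v) \<partial>(M \<Otimes>\<^sub>M N)) = (\<integral>\<^sup>+x. \<integral>\<^sup>+y. ?i z x * ?i z y \<partial>N \<partial>M)"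
   using N.nn_integral_fst[of "%v. ?i z (fst v) * ?i z (snd v)" M] mz by simp
  also have "... = emeasure M {snd z<..snd z + fst z} * emeasure N {snd z<..snd z + fst z}"
   by (simp add: nn_integral_cmult nn_integral_multc M(2) N(2))
  finally have "(\<integral>\<^sup>+v. Ph (z, v) \<partial>(M \<Otimes>\<^sub>M N)) = ?w z * (emeasure M {snd z<..snd z + fst z} * emeasure N {snd z<..snd z + fst z})"
   using mz by (simp add: Ph_def nn_integral_cmult)
  moreover have "0 <= indicator {0<..<L} (fst z) / (fst z)\<^sup>2" by simp
  ultimately show ?thesis
   by (simp only: window_product_def M.emeasure_eq_measure N.emeasure_eq_measure ennreal_mult measure_nonneg mult_nonneg_nonneg)
 qed
 have step2: "(\<integral>\<^sup>+z. Ph (z, v) \<partial>(lborel \<Otimes>\<^sub>M lborel)) = ennreal (trunc_log L \<bar>fst v - snd v\<bar>)" if "fst v ~= snd v" for v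
 proof -
  have mz: "(%z. ?w z * (?i z (fst v) * ?i z (snd v))) \<in> borel_measurable (lborel \<Otimes>\<^sub>M lborel)"
  proof -
   have "v \<in> space (M \<Otimes>\<^sub>M N)"
    by (simp add: space_pair_measure sets_eq_imp_space_eq[OF M(2)] sets_eq_imp_space_eq[OF N(2)] mem_Times_iff)
   from measurable_compose[OF measurable_Pair2'[OF this] mPh] show ?thesis by (simp add: Ph_def)
  qed
  have "(\<integral>\<^sup>+z. Ph (z, v) \<partial>(lborel \<Otimes>\<^sub>M lborel)) = (\<integral>\<^sup>+l. \<integral>\<^sup>+p. ?w (l, p) * (?i (l, p) (fst v) * ?i (l, p) (snd v)) \<partial>lborel \<partial>lborel)"
   using lborel.nn_integral_fst[OF mz] by (simp add: Ph_def)
  also have "... = (\<integral>\<^sup>+l. ennreal (indicator {0<..<L} l / l\<^sup>2) * ennreal (l - \<bar>fst v - snd v\<bar>) \<partial>lborel)"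
  proof (rule nn_integral_cong)
   fix l :: real
   show "(\<integral>\<^sup>+p. ?w (l, p) * (?i (l, p) (fst v) * ?i (l, p) (snd v)) \<partial>lborel) = ennreal (indicator {0<..<L} l / l\<^sup>2) * ennreal (l - \<bar>fst v - snd v\<bar>)"
   proof (cases "l > 0")
    case True
    have mp: "(%p. indicator {p<..p+l} x :: ennreal) \<in> borel_measurable lborel" for x
    proof -
     have "(%p. indicator {p<..p+l} x :: ennreal) = indicator {x - l..<x}" by (auto simp: indicator_def fun_eq_iff)
     thus ?thesis by simp
    qed
    show ?thesis using nn_integral_window_overlap[OF True, of "fst v" "snd v"] mp by (simp add: nn_integral_cmult)
   qed simp
  qed
  also have "... = ennreal (trunc_log L \<bar>fst v - snd v\<bar>)" by (rule nn_integral_trunc_log) (use L that in auto)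
  finally show ?thesis .
 qed
 have "(\<integral>\<^sup>+z. ennreal (window_product L M N z) \<partial>(lborel \<Otimes>\<^sub>M lborel)) = (\<integral>\<^sup>+z. \<integral>\<^sup>+v. Ph (z, v) \<partial>(M \<Otimes>\<^sub>M N) \<partial>(lborel \<Otimes>\<^sub>M lborel))"
  unfolding step1 ..
 also have "... = (\<integral>\<^sup>+v. \<integral>\<^sup>+z. Ph (z, v) \<partial>(lborel \<Otimes>\<^sub>M lborel) \<partial>(M \<Otimes>\<^sub>M N))"
  using PQ.Fubini[OF mPh] by simp
 also have "... = (\<integral>\<^sup>+v. ennreal (trunc_log L \<bar>fst v - snd v\<bar>) \<partial>(M \<Otimes>\<^sub>M N))"
  by (rule nn_integral_cong_AE) (use ne step2 in \<open>auto elim!: eventually_mono\<close>)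
 also have "... = ennreal (\<integral>z. trunc_log L \<bar>fst z - snd z\<bar> \<partial>(M \<Otimes>\<^sub>M N))"
  by (rule nn_integral_eq_integral[OF int]) (use ne trunc_log_nonneg[OF L] in \<open>auto elim!: eventually_mono\<close>)
 finally have nn: "(\<integral>\<^sup>+z. ennreal (window_product L M N z) \<partial>(lborel \<Otimes>\<^sub>M lborel)) = ennreal (\<integral>z. trunc_log L \<bar>fst z - snd z\<bar> \<partial>(M \<Otimes>\<^sub>M N))" .
 have pos: "AE z in M \<Otimes>\<^sub>M N. 0 <= trunc_log L \<bar>fst z - snd z\<bar>"
  using ne trunc_log_nonneg[OF L] by (auto elim!: eventually_mono)
 show ?thesis
  by (rule has_bochner_integral_nn_integral[OF meas _ _ nn])
    (use integral_nonneg_AE[OF pos] in \<open>auto simp: window_product_def\<close>)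
qed

lemma integrable_pair_fst:
 fixes f :: "'a => real"
 assumes "prob_space M" "prob_space N" "integrable M f"
 shows "integrable (M \<Otimes>\<^sub>M N) (%z. f (fst z))" "(\<integral>z. f (fst z) \<partial>(M \<Otimes>\<^sub>M N)) = (\<integral>x. f x \<partial>M)"
proof -
 have d: "distr (M \<Otimes>\<^sub>M N) M fst = M" by (rule prob_space.distr_pair_fst[OF assms(2)])
 have m: "f \<in> borel_measurable M" using assms(3) by simp
 have "integrable (distr (M \<Otimes>\<^sub>M N) M fst) f" using assms(3) d by simp
 thus "integrable (M \<Otimes>\<^sub>M N) (%z. f (fst z))" by (subst (asm) integrable_distr_eq[OF measurable_fst m])
 show "(\<integral>z. f (fst z) \<partial>(M \<Otimes>\<^sub>M N)) = (\<integral>x. f x \<partial>M)"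
  using integral_distr[OF measurable_fst m, of N] d by simp
qed

lemma integrable_pair_snd:
 fixes f :: "'a => real"
 assumes "prob_space M" "prob_space N" "integrable N f"
 shows "integrable (M \<Otimes>\<^sub>M N) (%z. f (snd z))" "(\<integral>z. f (snd z) \<partial>(M \<Otimes>\<^sub>M N)) = (\<integral>x. f x \<partial>N)"
proof -
 interpret M: prob_space M by fact
 interpret N: prob_space N by fact
 interpret P: pair_sigma_finite N M ..
 have i: "integrable (N \<Otimes>\<^sub>M M) (%z. f (fst z))" by (rule integrable_pair_fst[OF assms(2,1,3)])
 thus "integrable (M \<Otimes>\<^sub>M N) (%z. f (snd z))" using P.integrable_product_swap[OF i] by (simp add: case_prod_beta')
 have "(\<integral>z. f (snd z) \<partial>(M \<Otimes>\<^sub>M N)) = (\<integral>z. f (fst z) \<partial>(N \<Otimes>\<^sub>M M))"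
  using P.integral_product_swap[of "%z. f (fst z)"] i by (simp add: case_prod_beta')
 thus "(\<integral>z. f (snd z) \<partial>(M \<Otimes>\<^sub>M N)) = (\<integral>x. f x \<partial>N)" using integrable_pair_fst(2)[OF assms(2,1,3)] by simp
qed

lemma trunc_log_bound:
 assumes "L >= 1" "d > 0" shows "\<bar>trunc_log L d\<bar> <= \<bar>ln d\<bar> + (ln L + 1)"
proof (cases "d < L")
 case True
 have "ln L >= 0" using assms by simp
 have "d / L <= 1" using True assms by simp
 hence "trunc_log L d <= ln L - ln d" using True assms by (simp add: trunc_log_def ln_div)
 thus ?thesis using trunc_log_nonneg[of L d] assms \<open>ln L >= 0\<close> by linarith
next
 case False
 thus ?thesis using assms by (simp add: trunc_log_def)
qed

text \<open>A majorant independent of L that splits into a function of x and a function of y, so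
  that the logarithmic moments of the two marginals dominate the passage L -> infinity on the
  product.\<close>

lemma log_tail_bound:
 assumes "L >= 1" shows "\<bar>log_tail (\<bar>x - y\<bar> / L)\<bar> <= 1 + ln (1 + \<bar>x\<bar>) + ln (1 + \<bar>y\<bar>)"
proof -
 define d where "d = \<bar>x - y\<bar>"
 have nn: "0 <= ln (1 + \<bar>x\<bar>)" "0 <= ln (1 + \<bar>y\<bar>)" by simp_all
 show ?thesis
 proof (cases "d / L < 1")
  case True
  have "0 <= d / L" using assms by (simp add: d_def)
  hence "\<bar>log_tail (d / L)\<bar> <= 1" using True by (simp add: log_tail_def)
  thus ?thesis using nn unfolding d_def by linarith
 next
  case False
  hence dL: "d >= L" using assms by (simp add: field_simps)
  have "0 <= ln (d / L)" using False by simp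
  moreover have "ln (d / L) <= ln d" using dL assms by (intro ln_mono) (auto simp: divide_le_eq mult_le_cancel_left1)
  moreover have "ln d <= ln ((1 + \<bar>x\<bar>) * (1 + \<bar>y\<bar>))"
  proof (rule ln_mono)
   have "d <= \<bar>x\<bar> + \<bar>y\<bar>" by (simp add: d_def)
   also have "... <= (1 + \<bar>x\<bar>) * (1 + \<bar>y\<bar>)" by (simp add: algebra_simps)
   finally show "d <= (1 + \<bar>x\<bar>) * (1 + \<bar>y\<bar>)" .
   show "0 < d" using dL assms by linarith
  qed
  moreover have "ln ((1 + \<bar>x\<bar>) * (1 + \<bar>y\<bar>)) = ln (1 + \<bar>x\<bar>) + ln (1 + \<bar>y\<bar>)" by (rule ln_mult_pos) auto
  moreover have "log_tail (d / L) = - ln (d / L)" using False by (simp add: log_tail_def)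
  ultimately show ?thesis unfolding d_def[symmetric] by linarith
 qed
qed

lemma log_tail_measurable[measurable]: "log_tail \<in> borel_measurable borel"
 unfolding log_tail_def[abs_def] by measurable

lemma trunc_log_measurable[measurable]: "trunc_log L \<in> borel_measurable borel"
 unfolding trunc_log_def[abs_def] by measurable

text \<open>With masses cancelling, the logarithmic energy of \<open>N - M\<close> is the limit of the truncated energies,
  and these are integrals of squares of \<open>N - M\<close> over windows.\<close>
lemma trunc_energy_limit:
 fixes M N :: "real measure"
 assumes M: "prob_space M" "sets M = sets borel" and N: "prob_space N" "sets N = sets borel"
  and int: "integrable (M \<Otimes>\<^sub>M N) (%z. ln \<bar>fst z - snd z\<bar>)"
  and ne: "AE z in M \<Otimes>\<^sub>M N. fst z ~= snd z"
  and lM: "integrable M (%x. ln (1 + \<bar>x\<bar>))" and lN: "integrable N (%x. ln (1 + \<bar>x\<bar>))"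
 shows "L >= 1 ==> integrable (M \<Otimes>\<^sub>M N) (%z. trunc_log L \<bar>fst z - snd z\<bar>)"
  "(%n. (\<integral>z. trunc_log (real n + 1) \<bar>fst z - snd z\<bar> \<partial>(M \<Otimes>\<^sub>M N)) - ln (real n + 1))
   \<longlonglongrightarrow> (\<integral>z. - ln \<bar>fst z - snd z\<bar> \<partial>(M \<Otimes>\<^sub>M N)) - 1"
proof -
 interpret M: prob_space M by fact
 interpret N: prob_space N by fact
 interpret P: pair_prob_space M N ..
 note [measurable_cong] = M(2) N(2)
 show ti: "integrable (M \<Otimes>\<^sub>M N) (%z. trunc_log L \<bar>fst z - snd z\<bar>)" if L: "L >= 1" for L
 proof (rule Bochner_Integration.integrable_bound)
  show "integrable (M \<Otimes>\<^sub>M N) (%z. \<bar>ln \<bar>fst z - snd z\<bar>\<bar> + (ln L + 1))" using int by simp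
  show "(%z. trunc_log L \<bar>fst z - snd z\<bar>) \<in> borel_measurable (M \<Otimes>\<^sub>M N)" by measurable
  show "AE z in M \<Otimes>\<^sub>M N. norm (trunc_log L \<bar>fst z - snd z\<bar>) <= norm (\<bar>ln \<bar>fst z - snd z\<bar>\<bar> + (ln L + 1))"
   using ne
  proof eventually_elim
   fix z :: "real \<times> real" assume z: "fst z ~= snd z"
   have "ln L >= 0" using L by simp
   thus "norm (trunc_log L \<bar>fst z - snd z\<bar>) <= norm (\<bar>ln \<bar>fst z - snd z\<bar>\<bar> + (ln L + 1))"
    using trunc_log_bound[OF L, of "\<bar>fst z - snd z\<bar>"] z by simp
  qed
 qed
 define w where "w = (%z :: real \<times> real. 1 + ln (1 + \<bar>fst z\<bar>) + ln (1 + \<bar>snd z\<bar>))"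
 have wint: "integrable (M \<Otimes>\<^sub>M N) w"
 proof -
  have "integrable (M \<Otimes>\<^sub>M N) (%z. ln (1 + \<bar>fst z\<bar>))"
   by (rule integrable_pair_fst[OF M(1) N(1) lM])
  moreover have "integrable (M \<Otimes>\<^sub>M N) (%z. ln (1 + \<bar>snd z\<bar>))"
   by (rule integrable_pair_snd[OF M(1) N(1) lN])
  ultimately show ?thesis unfolding w_def by simp
 qed
 have tail: "(%n. \<integral>z. log_tail (\<bar>fst z - snd z\<bar> / (real n + 1)) \<partial>(M \<Otimes>\<^sub>M N)) \<longlonglongrightarrow> (\<integral>z. 1 \<partial>(M \<Otimes>\<^sub>M N))"
 proof (rule integral_dominated_convergence[OF _ _ wint])
  show "AE z in M \<Otimes>\<^sub>M N. (%n. log_tail (\<bar>fst z - snd z\<bar> / (real n + 1))) \<longlonglongrightarrow> 1"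
  proof (rule AE_I2)
   fix z :: "real \<times> real"
   define d where "d = \<bar>fst z - snd z\<bar>"
   have "(%n. 1 - d / (real n + 1)) \<longlonglongrightarrow> 1" by real_asymp
   moreover have "\<forall>\<^sub>F n in sequentially. d < real n + 1" by real_asymp
   hence "\<forall>\<^sub>F n in sequentially. 1 - d / (real n + 1) = log_tail (d / (real n + 1))"
    by eventually_elim (simp add: log_tail_def)
   ultimately show "(%n. log_tail (\<bar>fst z - snd z\<bar> / (real n + 1))) \<longlonglongrightarrow> 1"
    unfolding d_def[symmetric] by (rule Lim_transform_eventually)
  qed
  show "AE z in M \<Otimes>\<^sub>M N. norm (log_tail (\<bar>fst z - snd z\<bar> / (real n + 1))) <= w z" for n
   using log_tail_bound[of "real n + 1"] by (auto simp: w_def)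
 qed (measurable)
 have eq: "(\<integral>z. - ln \<bar>fst z - snd z\<bar> \<partial>(M \<Otimes>\<^sub>M N)) - (\<integral>z. log_tail (\<bar>fst z - snd z\<bar> / (real n + 1)) \<partial>(M \<Otimes>\<^sub>M N))
   = (\<integral>z. trunc_log (real n + 1) \<bar>fst z - snd z\<bar> \<partial>(M \<Otimes>\<^sub>M N)) - ln (real n + 1)" for n
 proof -
  have n1: "real n + 1 >= 1" by simp
  have tint: "integrable (M \<Otimes>\<^sub>M N) (%z. log_tail (\<bar>fst z - snd z\<bar> / (real n + 1)))"
   by (rule Bochner_Integration.integrable_bound[OF wint])
     (use log_tail_bound[OF n1] in \<open>auto simp: w_def intro!: AE_I2 order_trans[OF log_tail_bound[OF n1]]\<close>)
  have "(\<integral>z. - ln \<bar>fst z - snd z\<bar> \<partial>(M \<Otimes>\<^sub>M N)) = (\<integral>z. trunc_log (real n + 1) \<bar>fst z - snd z\<bar> - ln (real n + 1) + log_tail (\<bar>fst z - snd z\<bar> / (real n + 1)) \<partial>(M \<Otimes>\<^sub>M N))"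
  proof (rule integral_cong_AE)
   show "AE z in M \<Otimes>\<^sub>M N. - ln \<bar>fst z - snd z\<bar> = trunc_log (real n + 1) \<bar>fst z - snd z\<bar> - ln (real n + 1) + log_tail (\<bar>fst z - snd z\<bar> / (real n + 1))"
    using ne by eventually_elim (use n1 in \<open>auto intro!: trunc_log_decomp\<close>)
  qed measurable
  also have "... = (\<integral>z. trunc_log (real n + 1) \<bar>fst z - snd z\<bar> \<partial>(M \<Otimes>\<^sub>M N)) - ln (real n + 1) + (\<integral>z. log_tail (\<bar>fst z - snd z\<bar> / (real n + 1)) \<partial>(M \<Otimes>\<^sub>M N))"
   using ti[OF n1] tint by (simp add: P.prob_space)
  finally show ?thesis by simp
 qed
 show "(%n. (\<integral>z. trunc_log (real n + 1) \<bar>fst z - snd z\<bar> \<partial>(M \<Otimes>\<^sub>M N)) - ln (real n + 1))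
   \<longlonglongrightarrow> (\<integral>z. - ln \<bar>fst z - snd z\<bar> \<partial>(M \<Otimes>\<^sub>M N)) - 1"
  unfolding eq[symmetric] using tendsto_diff[OF tendsto_const tail] by (simp add: P.prob_space)
qed

text \<open>Equal windows of one fixed width make the difference of the distribution functions
  periodic with that width; since it tends to 0 at infinity, it vanishes.\<close>

lemma equal_windows_imp_equal:
 fixes M N :: "real measure"
 assumes M: "prob_space M" "sets M = sets borel" and N: "prob_space N" "sets N = sets borel"
  and l: "l > 0" and eq: "AE p in lborel. measure M {p<..p+l} = measure N {p<..p+l}"
 shows "M = N"
proof -
 interpret M: prob_space M by fact
 interpret N: prob_space N by fact
 have spM: "space M = UNIV" "space N = UNIV" using sets_eq_imp_space_eq[OF M(2)] sets_eq_imp_space_eq[OF N(2)] by auto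
 interpret M: real_distribution M by unfold_locales (use M spM in auto)
 interpret N: real_distribution N by unfold_locales (use N spM in auto)
 define h where "h = (%p. cdf M p - cdf N p)"
 define D where "D = (%p. h (p + l) - h p)"
 have DA: "D p = measure M {p<..p+l} - measure N {p<..p+l}" for p
  using M.cdf_diff_eq[of p "p + l"] N.cdf_diff_eq[of p "p + l"] l by (simp add: D_def h_def)
 have hc: "(h \<longlongrightarrow> h p) (at_right p)" for p
  using M.cdf_is_right_cont[of p] N.cdf_is_right_cont[of p] unfolding h_def continuous_within by (intro tendsto_diff) auto
 have hc2: "((%q. h (q + l)) \<longlongrightarrow> h (p + l)) (at_right p)" for p
 proof -
  have "filterlim (%q. q + l) (at_right (p + l)) (at_right p)"
   unfolding filterlim_at by (auto intro!: tendsto_eq_intros simp: eventually_at_filter)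
  from filterlim_compose[OF hc this] show ?thesis .
 qed
 have D0: "D p = 0" for p
 proof (rule ccontr)
  assume n: "D p ~= 0"
  \<comment> \<open>Right continuity improves equality for almost every left end to equality for
    every left end.\<close>
  have "(D \<longlongrightarrow> D p) (at_right p)" unfolding D_def by (intro tendsto_diff hc hc2)
  hence "\<forall>\<^sub>F q in at_right p. D q ~= 0" using n by (rule tendsto_imp_eventually_ne)
  then obtain c where c: "c > p" "!!q. p < q ==> q < c ==> D q ~= 0" unfolding eventually_at_right_field by blast
  have "AE q in lborel. D q = 0" using eq by (auto simp: DA elim!: eventually_mono)
  hence "AE q in lborel. q \<notin> {p<..<c}" by eventually_elim (use c in auto)
  hence "emeasure lborel {p<..<c} = 0" by (subst (asm) AE_iff_measurable[of "{p<..<c}"]) auto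
  thus False using c(1) by simp
 qed
 have step: "h (p + real n * l) = h p" for p n
 proof (induction n)
  case (Suc n)
  have "h (p + real n * l + l) = h (p + real n * l)" using D0[of "p + real n * l"] by (simp add: D_def)
  thus ?case using Suc by (simp add: algebra_simps)
 qed simp
 have "h p = 0" for p
 proof -
  have "(h \<longlongrightarrow> 1 - 1) at_top" unfolding h_def by (intro tendsto_diff M.cdf_lim_at_top_prob N.cdf_lim_at_top_prob)
  moreover have "filterlim (%n. p + real n * l) at_top sequentially" using l by real_asymp
  ultimately have "(%n. h (p + real n * l)) \<longlonglongrightarrow> 0" using filterlim_compose by fastforce
  thus ?thesis unfolding step by (simp add: LIMSEQ_const_iff)
 qed
 hence "cdf M = cdf N" by (simp add: h_def fun_eq_iff)
 thus ?thesis by (rule cdf_unique[OF M.real_distribution_axioms N.real_distribution_axioms])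
qed

text \<open>The truncated energies are integrals of squares over a set of windows that grows with L,
  so the limit E is at least F 1, and F 1 is nonnegative. If E = 0, the two measures already agree
  on almost all windows of width below 1, which determines them.\<close>

lemma log_energy_positive:
 fixes M N :: "real measure"
 assumes M: "prob_space M" "sets M = sets borel" and N: "prob_space N" "sets N = sets borel"
  and iMM: "integrable (M \<Otimes>\<^sub>M M) (%z. ln \<bar>fst z - snd z\<bar>)" and nMM: "AE z in M \<Otimes>\<^sub>M M. fst z ~= snd z"
  and iMN: "integrable (M \<Otimes>\<^sub>M N) (%z. ln \<bar>fst z - snd z\<bar>)" and nMN: "AE z in M \<Otimes>\<^sub>M N. fst z ~= snd z"
  and iNN: "integrable (N \<Otimes>\<^sub>M N) (%z. ln \<bar>fst z - snd z\<bar>)" and nNN: "AE z in N \<Otimes>\<^sub>M N. fst z ~= snd z"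
  and lM: "integrable M (%x. ln (1 + \<bar>x\<bar>))" and lN: "integrable N (%x. ln (1 + \<bar>x\<bar>))"
 defines "E \<equiv> (\<integral>z. - ln \<bar>fst z - snd z\<bar> \<partial>(M \<Otimes>\<^sub>M M)) + (\<integral>z. - ln \<bar>fst z - snd z\<bar> \<partial>(N \<Otimes>\<^sub>M N))
   - 2 * (\<integral>z. - ln \<bar>fst z - snd z\<bar> \<partial>(M \<Otimes>\<^sub>M N))"
 shows "E >= 0" "E = 0 ==> M = N"
proof -
 define G where "G = (%L A B. \<integral>z. trunc_log L \<bar>fst z - snd z\<bar> \<partial>(A \<Otimes>\<^sub>M B))"
 define F where "F = (%L. G L M M + G L N N - 2 * G L M N)"
 note tMM = trunc_energy_limit[OF M M iMM nMM lM lM]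
 note tNN = trunc_energy_limit[OF N N iNN nNN lN lN]
 note tMN = trunc_energy_limit[OF M N iMN nMN lM lN]
 have lim: "(%n. F (real n + 1)) \<longlonglongrightarrow> E"
 proof -
  have "(%n. (G (real n + 1) M M - ln (real n + 1)) + (G (real n + 1) N N - ln (real n + 1)) - 2 * (G (real n + 1) M N - ln (real n + 1)))
   \<longlonglongrightarrow> ((\<integral>z. - ln \<bar>fst z - snd z\<bar> \<partial>(M \<Otimes>\<^sub>M M)) - 1) + ((\<integral>z. - ln \<bar>fst z - snd z\<bar> \<partial>(N \<Otimes>\<^sub>M N)) - 1) - 2 * ((\<integral>z. - ln \<bar>fst z - snd z\<bar> \<partial>(M \<Otimes>\<^sub>M N)) - 1)"
   unfolding G_def by (intro tendsto_intros tMM(2) tNN(2) tMN(2))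
  thus ?thesis unfolding F_def E_def by (simp add: algebra_simps)
 qed
 define Q where "Q = (lborel :: real measure) \<Otimes>\<^sub>M (lborel :: real measure)"
 define S where "S = (%L (z :: real \<times> real). indicator {0<..<L} (fst z) / (fst z)\<^sup>2 * (measure M {snd z<..snd z + fst z} - measure N {snd z<..snd z + fst z})\<^sup>2)"
 have hb: "has_bochner_integral Q (S L) (F L)" if L: "L >= 1" for L
 proof -
  have L0: "L > 0" using L by simp
  have "has_bochner_integral Q (%z. window_product L M M z + window_product L N N z - 2 * window_product L M N z) (F L)"
   unfolding F_def G_def Q_def
   by (intro has_bochner_integral_diff has_bochner_integral_add has_bochner_integral_mult_right
     window_product_integral[OF M M L0 tMM(1)[OF L] nMM] window_product_integral[OF N N L0 tNN(1)[OF L] nNN]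
     window_product_integral[OF M N L0 tMN(1)[OF L] nMN])
  moreover have "(%z. window_product L M M z + window_product L N N z - 2 * window_product L M N z) = S L"
   by (rule ext) (simp add: window_product_def S_def power2_eq_square algebra_simps)
  ultimately show ?thesis by simp
 qed
 have mono: "F 1 <= F L" if L: "L >= 1" for L
 proof -
  have "integral\<^sup>L Q (S 1) <= integral\<^sup>L Q (S L)"
  proof (rule integral_mono)
   show "integrable Q (S 1)" "integrable Q (S L)" using hb[of 1] hb[OF L] by (auto simp: has_bochner_integral_iff)
   show "S 1 z <= S L z" for z unfolding S_def using L
    by (intro mult_right_mono divide_right_mono) (auto simp: indicator_def)
  qed
  thus ?thesis using hb[of 1] hb[OF L] by (simp add: has_bochner_integral_iff)
 qed
 have F1: "F 1 >= 0"
 proof -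
  have "0 <= integral\<^sup>L Q (S 1)" by (rule integral_nonneg_AE) (auto simp: S_def)
  thus ?thesis using hb[of 1] by (simp add: has_bochner_integral_iff)
 qed
 have FE: "F 1 <= E" by (rule LIMSEQ_le_const[OF lim]) (use mono in auto)
 show "E >= 0" using F1 FE by simp
 assume "E = 0"
 hence "integral\<^sup>L Q (S 1) = 0" using F1 FE hb[of 1] by (simp add: has_bochner_integral_iff)
 moreover have "integrable Q (S 1)" using hb[of 1] by (simp add: has_bochner_integral_iff)
 ultimately have "AE z in Q. S 1 z = 0" by (subst (asm) integral_nonneg_eq_0_iff_AE) (auto simp: S_def)
 hence "AE l in lborel. AE p in lborel. S 1 (l, p) = 0" unfolding Q_def by (rule lborel_pair.AE_pair)
 hence ae: "AE l in lborel. l \<in> {0<..<1} --> (AE p in lborel. measure M {p<..p+l} = measure N {p<..p+l})"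
 proof eventually_elim
  fix l :: real assume a: "AE p in lborel. S 1 (l, p) = 0"
  show "l \<in> {0<..<1} --> (AE p in lborel. measure M {p<..p+l} = measure N {p<..p+l})"
  proof
   assume l: "l \<in> {0<..<1}"
   show "AE p in lborel. measure M {p<..p+l} = measure N {p<..p+l}"
    using a by eventually_elim (use l in \<open>simp add: S_def\<close>)
  qed
 qed
 \<comment> \<open>A single good width is enough for \<open>equal_windows_imp_equal\<close>.\<close>
 have "\<exists>l\<in>{0<..<1}. AE p in lborel. measure M {p<..p+l} = measure N {p<..p+l}"
 proof (rule ccontr)
  assume "~ ?thesis"
  with ae have "AE l in lborel. l \<notin> {0<..<1::real}" by (auto elim!: eventually_mono)
  hence "emeasure lborel {0<..<1::real} = 0" by (subst (asm) AE_iff_measurable[of "{0<..<1}"]) auto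
  thus False by simp
 qed
 thus "M = N" using equal_windows_imp_equal[OF M N] by auto
qed

subsection \<open>Energy minimisation\<close>

lemma prob_on_halflineD:
 assumes "prob_on_halfline M"
 shows "prob_space M" "sets M = sets borel" "AE x in M. 0 <= x"
proof -
 show M: "prob_space M" "sets M = sets borel" using assms by (auto simp: prob_on_halfline_def)
 interpret prob_space M by fact
 have "prob {0..} = 1" using assms by (simp add: prob_on_halfline_def emeasure_eq_measure)
 thus "AE x in M. 0 <= x" using prob_eq_1[of "{0..}"] M by simp
qed

lemma AE_pair_both:
 assumes "prob_space M" "prob_space N" "AE x in M. P x" "AE y in N. Q y"
 shows "AE z in M \<Otimes>\<^sub>M N. P (fst z) & Q (snd z)"
proof -
 interpret M: prob_space M by fact
 interpret N: prob_space N by fact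
 interpret S: pair_sigma_finite N M ..
 have dM: "distr (M \<Otimes>\<^sub>M N) M fst = M" by (rule N.distr_pair_fst)
 have dN: "distr (M \<Otimes>\<^sub>M N) N snd = N"
 proof -
  have "distr (M \<Otimes>\<^sub>M N) N snd = distr (distr (N \<Otimes>\<^sub>M M) (M \<Otimes>\<^sub>M N) (%(x, y). (y, x))) N snd"
   by (subst pair_sigma_finite.distr_pair_swap[of M N]) (unfold_locales, simp)
  also have "... = distr (N \<Otimes>\<^sub>M M) N fst"
   by (subst distr_distr) (auto simp: comp_def case_prod_beta measurable_split_conv intro!: measurable_Pair)
  also have "... = N" by (rule M.distr_pair_fst)
  finally show ?thesis .
 qed
 have "AE x in distr (M \<Otimes>\<^sub>M N) M fst. P x" unfolding dM by (rule assms(3))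
 hence "AE z in M \<Otimes>\<^sub>M N. P (fst z)" by (rule AE_distrD[OF measurable_fst])
 moreover have "AE y in distr (M \<Otimes>\<^sub>M N) N snd. Q y" unfolding dN by (rule assms(4))
 hence "AE z in M \<Otimes>\<^sub>M N. Q (snd z)" by (rule AE_distrD[OF measurable_snd])
 ultimately show ?thesis by eventually_elim simp
qed

text \<open>Used with f u = u^th: the kernel ln |x^th - y^th| for M and N is the kernel ln |x - y|
  for their images, so positivity has to be shown for one kernel only.\<close>

lemma pushforward_pair:
 fixes f :: "real => real"
 assumes M: "prob_space M" "sets M = sets borel" and N: "prob_space N" "sets N = sets borel"
  and f: "f \<in> borel_measurable borel"
 defines "P \<equiv> distr M borel f \<Otimes>\<^sub>M distr N borel f"
 shows "integrable P (%z. ln \<bar>fst z - snd z\<bar>) \<longleftrightarrow> integrable (M \<Otimes>\<^sub>M N) (%z. ln \<bar>f (fst z) - f (snd z)\<bar>)"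
  "(\<integral>z. ln \<bar>fst z - snd z\<bar> \<partial>P) = (\<integral>z. ln \<bar>f (fst z) - f (snd z)\<bar> \<partial>(M \<Otimes>\<^sub>M N))"
  "AE z in M \<Otimes>\<^sub>M N. f (fst z) ~= f (snd z) ==> AE z in P. fst z ~= snd z"
proof -
 interpret M: prob_space M by fact
 interpret N: prob_space N by fact
 note [measurable_cong] = M(2) N(2)
 note [measurable] = f
 have fN: "f \<in> measurable N borel" by measurable
 have fM: "f \<in> measurable M borel" by measurable
 interpret D: prob_space "distr N borel f" by (rule N.prob_space_distr[OF fN])
 have d: "P = distr (M \<Otimes>\<^sub>M N) (borel \<Otimes>\<^sub>M borel) (%(x, y). (f x, f y))"
  unfolding P_def by (rule pair_measure_distr[OF fM fN]) (rule D.sigma_finite_measure_axioms)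
 have m: "(%(x, y). (f x, f y)) \<in> measurable (M \<Otimes>\<^sub>M N) (borel \<Otimes>\<^sub>M borel)" by measurable
 have l: "(%z :: real \<times> real. ln \<bar>fst z - snd z\<bar>) \<in> borel_measurable (borel \<Otimes>\<^sub>M borel)" by measurable
 show "integrable P (%z. ln \<bar>fst z - snd z\<bar>) \<longleftrightarrow> integrable (M \<Otimes>\<^sub>M N) (%z. ln \<bar>f (fst z) - f (snd z)\<bar>)"
  unfolding d integrable_distr_eq[OF m l] by (simp add: case_prod_beta)
 show "(\<integral>z. ln \<bar>fst z - snd z\<bar> \<partial>P) = (\<integral>z. ln \<bar>f (fst z) - f (snd z)\<bar> \<partial>(M \<Otimes>\<^sub>M N))"
  unfolding d integral_distr[OF m l] by (simp add: case_prod_beta)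
 have s: "{z \<in> space (borel \<Otimes>\<^sub>M borel). fst z ~= (snd z :: real)} \<in> sets (borel \<Otimes>\<^sub>M borel)" by measurable
 show "AE z in P. fst z ~= snd z" if "AE z in M \<Otimes>\<^sub>M N. f (fst z) ~= f (snd z)"
  unfolding d AE_distr_iff[OF m s] using that by (simp add: case_prod_beta)
qed

text \<open>After scaling by x this is t^th + (1 - t)^th <= 1 on the unit interval, where a power
  with exponent at least 1 lies below the identity.\<close>

lemma powr_superadditive:
 fixes th u x :: real
 assumes "th >= 1" "0 <= u" "u < x" shows "(x - u) powr th <= x powr th - u powr th"
proof -
 define t where "t = u / x"
 have t: "0 <= t" "t <= 1" "u = x * t" "x - u = x * (1 - t)" using assms by (auto simp: t_def field_simps)
 have "t powr th <= t powr 1" by (rule powr_mono') (use t assms(1) in auto)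
 moreover have "(1 - t) powr th <= (1 - t) powr 1" by (rule powr_mono') (use t assms(1) in auto)
 ultimately have "(1 - t) powr th + t powr th <= 1" using t by simp
 from mult_left_mono[OF this, of "x powr th"]
 have "(x * (1 - t)) powr th + (x * t) powr th <= x powr th"
  using assms t(1,2) by (simp add: powr_mult distrib_left)
 thus ?thesis unfolding t(4) using t(3) by simp
qed

text \<open>The lower bound is superadditivity of the power. Together the two sides control the
  second logarithm by the first one and by ln (1 + x) + ln (1 + y), so no separate study of its
  singularity is needed.\<close>

lemma ln_abs_powr_diff_bounds:
 fixes th x y :: real
 assumes th: "th >= 1" and xy: "0 <= x" "0 <= y" "x ~= y"
 shows "x powr th ~= y powr th" "th * ln \<bar>x - y\<bar> <= ln \<bar>x powr th - y powr th\<bar>"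
  "ln \<bar>x powr th - y powr th\<bar> <= th * (ln (1 + x) + ln (1 + y))"
proof -
 have *: "u powr th < v powr th & th * ln (v - u) <= ln (v powr th - u powr th)
   & ln (v powr th - u powr th) <= th * (ln (1 + v) + ln (1 + u))" if uv: "0 <= u" "u < v" for u v :: real
 proof -
  have s: "(v - u) powr th <= v powr th - u powr th" by (rule powr_superadditive[OF th uv])
  have pos: "0 < (v - u) powr th" using uv by simp
  have d: "0 < v powr th - u powr th" by (rule less_le_trans[OF pos s])
  have "ln ((v - u) powr th) <= ln (v powr th - u powr th)" by (rule ln_mono[OF s pos])
  hence 1: "th * ln (v - u) <= ln (v powr th - u powr th)" using uv by (simp add: ln_powr)
  have "v powr th <= (1 + v) powr th" using uv th by (intro powr_mono2) auto
  hence "v powr th - u powr th <= (1 + v) powr th" using powr_ge_zero[of u th] by linarith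
  hence "ln (v powr th - u powr th) <= ln ((1 + v) powr th)" using d by (rule ln_mono)
  also have "... = th * ln (1 + v)" using uv by (simp add: ln_powr)
  also have "... <= th * (ln (1 + v) + ln (1 + u))" using uv th by (intro mult_left_mono) auto
  finally show ?thesis using 1 d by linarith
 qed
 consider "x < y" | "y < x" using xy(3) by linarith
 hence "x powr th ~= y powr th & th * ln \<bar>x - y\<bar> <= ln \<bar>x powr th - y powr th\<bar> &
  ln \<bar>x powr th - y powr th\<bar> <= th * (ln (1 + x) + ln (1 + y))"
 proof cases
  case 1
  have e: "\<bar>x - y\<bar> = y - x" "\<bar>x powr th - y powr th\<bar> = y powr th - x powr th" using *[OF xy(1) 1] 1 by auto
  show ?thesis unfolding e using *[OF xy(1) 1] by (auto simp: add.commute)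
 next
  case 2
  have e: "\<bar>x - y\<bar> = x - y" "\<bar>x powr th - y powr th\<bar> = x powr th - y powr th" using *[OF xy(2) 2] 2 by auto
  show ?thesis unfolding e using *[OF xy(2) 2] by auto
 qed
 thus "x powr th ~= y powr th" "th * ln \<bar>x - y\<bar> <= ln \<bar>x powr th - y powr th\<bar>"
  "ln \<bar>x powr th - y powr th\<bar> <= th * (ln (1 + x) + ln (1 + y))" by auto
qed

text \<open>Of the th + 4 units of ln (1 + x), 1 + th pay for the upper bounds of the two
  logarithms. The remaining positive multiple makes ln (1 + x) integrable for every measure of
  finite energy.\<close>

locale log_gas =
 fixes th C0 :: real and V :: "real => real"
 assumes theta: "th > 1" and C0: "C0 >= 0" and V_cont: "continuous_on {0..} V"
  and V_lower: "!!x. x >= 0 ==> V x >= (th + 4) * ln (1 + x) - C0"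
begin

section \<open>The real-valued kernel and measures of finite energy\<close>

definition clip_V :: "real => real" where "clip_V x = V (max 0 x)"

definition clip_powr :: "real => real" where "clip_powr x = max 0 x powr th"

definition log_dist :: "real \<times> real => real" where "log_dist z = ln \<bar>fst z - snd z\<bar>"

definition log_powr_dist :: "real \<times> real => real" where
 "log_powr_dist z = ln \<bar>clip_powr (fst z) - clip_powr (snd z)\<bar>"

definition real_kernel :: "real \<times> real => real" where
 "real_kernel z = (clip_V (fst z) + clip_V (snd z) - log_dist z - log_powr_dist z) / 2"

definition finite_energy :: "real measure => bool" where
 "finite_energy M \<longleftrightarrow> integrable (M \<Otimes>\<^sub>M M) log_dist & (AE z in M \<Otimes>\<^sub>M M. fst z ~= snd z) &
   integrable (M \<Otimes>\<^sub>M M) log_powr_dist & integrable M clip_V & integrable M (%x. ln (1 + \<bar>x\<bar>))"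

definition real_energy :: "real measure => real" where
 "real_energy M = (\<integral>x. clip_V x \<partial>M) - (\<integral>z. log_dist z \<partial>(M \<Otimes>\<^sub>M M)) / 2 - (\<integral>z. log_powr_dist z \<partial>(M \<Otimes>\<^sub>M M)) / 2"

lemma clip_V_measurable[measurable]: "clip_V \<in> borel_measurable borel"
 unfolding clip_V_def[abs_def]
 by (intro borel_measurable_continuous_onI continuous_on_compose2[OF V_cont] continuous_intros) auto

lemma clip_powr_measurable[measurable]: "clip_powr \<in> borel_measurable borel"
 unfolding clip_powr_def[abs_def] by measurable

lemma log_dist_measurable[measurable]: "log_dist \<in> borel_measurable (borel \<Otimes>\<^sub>M borel)"
 unfolding log_dist_def[abs_def] by measurable

lemma log_powr_dist_measurable[measurable]: "log_powr_dist \<in> borel_measurable (borel \<Otimes>\<^sub>M borel)"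
 unfolding log_powr_dist_def[abs_def] by measurable

lemma real_kernel_measurable[measurable]: "real_kernel \<in> borel_measurable (borel \<Otimes>\<^sub>M borel)"
 unfolding real_kernel_def[abs_def] by measurable

lemma log_dist_le:
 fixes x y :: real
 assumes "0 <= x" "0 <= y" "x ~= y" shows "ln \<bar>x - y\<bar> <= ln (1 + x) + ln (1 + y)"
proof -
 have "\<bar>x - y\<bar> <= x + y" using assms by auto
 also have "... <= (1 + x) * (1 + y)" using mult_nonneg_nonneg[OF assms(1,2)] by (simp add: algebra_simps)
 finally have "ln \<bar>x - y\<bar> <= ln ((1 + x) * (1 + y))" using assms by (intro ln_mono) auto
 also have "... = ln (1 + x) + ln (1 + y)" using assms by (intro ln_mult_pos) auto
 finally show ?thesis .
qed

lemma log_powr_dist_bounds: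
 assumes "0 <= x" "0 <= y" "x ~= y"
 shows "clip_powr x ~= clip_powr y" "th * ln \<bar>x - y\<bar> <= ln \<bar>clip_powr x - clip_powr y\<bar>"
  "ln \<bar>clip_powr x - clip_powr y\<bar> <= th * (ln (1 + x) + ln (1 + y))"
proof -
 have e: "clip_powr x = x powr th" "clip_powr y = y powr th" using assms by (simp_all add: clip_powr_def)
 have "th >= 1" using theta by simp
 from ln_abs_powr_diff_bounds[OF this assms]
 show "clip_powr x ~= clip_powr y" "th * ln \<bar>x - y\<bar> <= ln \<bar>clip_powr x - clip_powr y\<bar>"
  "ln \<bar>clip_powr x - clip_powr y\<bar> <= th * (ln (1 + x) + ln (1 + y))" unfolding e by auto
qed

text \<open>Each of the three parts of the kernel is nonnegative once \<open>ln (1 + x) + ln (1 + y)\<close> is moved from the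
  potential to the logarithms, so that finite energy makes each of them integrable.\<close>
lemma real_kernel_parts:
 assumes "0 <= x" "0 <= y" "x ~= y"
 defines "a1 \<equiv> ln (1 + x) + ln (1 + y) - log_dist (x, y)"
  and "a2 \<equiv> th * (ln (1 + x) + ln (1 + y)) - log_powr_dist (x, y)"
  and "v \<equiv> %x. clip_V x - (1 + th) * ln (1 + x) + C0"
 shows "0 <= a1" "0 <= a2" "3 * ln (1 + x) <= v x" "3 * ln (1 + y) <= v y"
  "real_kernel (x, y) + C0 = a1 / 2 + a2 / 2 + (v x + v y) / 2"
proof -
 show "0 <= a1" using log_dist_le[OF assms(1-3)] by (simp add: a1_def log_dist_def)
 show "0 <= a2" using log_powr_dist_bounds(3)[OF assms(1-3)] by (simp add: a2_def log_powr_dist_def)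
 show "3 * ln (1 + x) <= v x" "3 * ln (1 + y) <= v y"
  using V_lower[of x] V_lower[of y] assms(1,2) by (simp_all add: v_def clip_V_def max_def algebra_simps)
 show "real_kernel (x, y) + C0 = a1 / 2 + a2 / 2 + (v x + v y) / 2"
  by (simp add: real_kernel_def a1_def a2_def v_def field_simps)
qed

lemma real_kernel_lower:
 assumes "0 <= x" "0 <= y" "x ~= y" shows "- C0 <= real_kernel (x, y)"
proof -
 note p = real_kernel_parts[OF assms]
 have l: "0 <= 3 * ln (1 + x)" "0 <= 3 * ln (1 + y)" using assms by auto
 note v = order_trans[OF l(1) p(3)] order_trans[OF l(2) p(4)]
 have "0 <= real_kernel (x, y) + C0" unfolding p(5)
  by (intro add_nonneg_nonneg divide_nonneg_nonneg p(1,2) v) simp_all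
 thus ?thesis by simp
qed

lemma eq_kernel_eq:
 assumes "0 <= fst z" "0 <= snd z"
 shows "eq_kernel th V z = (if fst z = snd z then \<infinity> else ereal (real_kernel z))"
proof (cases "fst z = snd z")
 case False
 have "clip_powr (fst z) ~= clip_powr (snd z)" by (rule log_powr_dist_bounds(1)[OF assms False])
 hence "fst z powr th ~= snd z powr th" using assms by (simp add: clip_powr_def max_def)
 thus ?thesis using False assms
  by (simp add: eq_kernel_def Let_def real_kernel_def log_dist_def log_powr_dist_def clip_V_def clip_powr_def max_def ln_div add_divide_distrib diff_divide_distrib)
qed (simp add: eq_kernel_def)

text \<open>The negative part of the kernel is at most C0, so the subtracted integral in
  \<open>energy\<close> is finite and the difference is never infinity minus infinity. As
  \<open>eq_kernel\<close> is infinite on the diagonal, finite energy forces the diagonal to be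
  null.\<close>

lemma energy_alternative:
 assumes M: "prob_on_halfline M"
 shows "energy th V M = \<infinity> | (AE z in M \<Otimes>\<^sub>M M. fst z ~= snd z) & integrable (M \<Otimes>\<^sub>M M) real_kernel"
  "(AE z in M \<Otimes>\<^sub>M M. fst z ~= snd z) ==> integrable (M \<Otimes>\<^sub>M M) real_kernel ==> energy th V M = ereal (\<integral>z. real_kernel z \<partial>(M \<Otimes>\<^sub>M M))"
proof -
 note M' = prob_on_halflineD[OF M]
 interpret M: prob_space M by (rule M'(1))
 interpret P: pair_prob_space M M ..
 note [measurable_cong] = M'(2)
 have pos: "AE z in M \<Otimes>\<^sub>M M. 0 <= fst z & 0 <= snd z" by (rule AE_pair_both[OF M'(1,1,3,3)])
 define p where "p = (%z. if fst z = snd z then top else ennreal (real_kernel z))"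
 define n where "n = (%z. if fst z = snd z then 0 else ennreal (- real_kernel z))"
 have pm: "p \<in> borel_measurable (M \<Otimes>\<^sub>M M)" "n \<in> borel_measurable (M \<Otimes>\<^sub>M M)" unfolding p_def n_def by measurable
 have P: "(\<integral>\<^sup>+z. e2ennreal (eq_kernel th V z) \<partial>(M \<Otimes>\<^sub>M M)) = (\<integral>\<^sup>+z. p z \<partial>(M \<Otimes>\<^sub>M M))"
  by (rule nn_integral_cong_AE) (use pos in \<open>eventually_elim, simp add: eq_kernel_eq p_def\<close>)
 have N: "(\<integral>\<^sup>+z. e2ennreal (- eq_kernel th V z) \<partial>(M \<Otimes>\<^sub>M M)) = (\<integral>\<^sup>+z. n z \<partial>(M \<Otimes>\<^sub>M M))"
  by (rule nn_integral_cong_AE) (use pos in \<open>eventually_elim, simp add: eq_kernel_eq n_def e2ennreal_neg\<close>)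
 have "(\<integral>\<^sup>+z. n z \<partial>(M \<Otimes>\<^sub>M M)) <= (\<integral>\<^sup>+z. ennreal C0 \<partial>(M \<Otimes>\<^sub>M M))"
 proof (rule nn_integral_mono_AE)
  show "AE z in M \<Otimes>\<^sub>M M. n z <= ennreal C0" using pos
  proof eventually_elim
   fix z :: "real \<times> real" assume z: "0 <= fst z & 0 <= snd z"
   show "n z <= ennreal C0"
   proof (cases "fst z = snd z")
    case False
    hence "- real_kernel z <= C0" using real_kernel_lower[of "fst z" "snd z"] z by simp
    thus ?thesis using False by (simp add: n_def ennreal_leI)
   qed (simp add: n_def)
  qed
 qed
 also have "... < \<infinity>" by (simp add: P.emeasure_space_1)
 finally have Nfin: "(\<integral>\<^sup>+z. n z \<partial>(M \<Otimes>\<^sub>M M)) < \<infinity>" .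
 then obtain n0 where n0: "n0 >= 0" "(\<integral>\<^sup>+z. n z \<partial>(M \<Otimes>\<^sub>M M)) = ennreal n0"
  by (cases "(\<integral>\<^sup>+z. n z \<partial>(M \<Otimes>\<^sub>M M))") auto
 have E: "energy th V M = enn2ereal (\<integral>\<^sup>+z. p z \<partial>(M \<Otimes>\<^sub>M M)) - ereal n0"
  unfolding energy_def P N n0(2) using n0(1) by simp
 have off: "(\<integral>\<^sup>+z. p z \<partial>(M \<Otimes>\<^sub>M M)) = (\<integral>\<^sup>+z. ennreal (real_kernel z) \<partial>(M \<Otimes>\<^sub>M M))"
  "(\<integral>\<^sup>+z. n z \<partial>(M \<Otimes>\<^sub>M M)) = (\<integral>\<^sup>+z. ennreal (- real_kernel z) \<partial>(M \<Otimes>\<^sub>M M))"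
  if "AE z in M \<Otimes>\<^sub>M M. fst z ~= snd z"
  by (rule nn_integral_cong_AE, use that in \<open>eventually_elim, simp add: p_def n_def\<close>)+
 show "energy th V M = \<infinity> | (AE z in M \<Otimes>\<^sub>M M. fst z ~= snd z) & integrable (M \<Otimes>\<^sub>M M) real_kernel"
 proof (cases "(\<integral>\<^sup>+z. p z \<partial>(M \<Otimes>\<^sub>M M)) = \<infinity>")
  case True
  thus ?thesis unfolding E by simp
 next
  case False
  have "AE z in M \<Otimes>\<^sub>M M. p z ~= \<infinity>" by (rule nn_integral_PInf_AE[OF pm(1) False])
  hence ne: "AE z in M \<Otimes>\<^sub>M M. fst z ~= snd z" by eventually_elim (auto simp: p_def)
  have "integrable (M \<Otimes>\<^sub>M M) real_kernel"
   unfolding real_integrable_def off[OF ne, symmetric] using False Nfin by auto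
  thus ?thesis using ne by simp
 qed
 assume ne: "AE z in M \<Otimes>\<^sub>M M. fst z ~= snd z" and int: "integrable (M \<Otimes>\<^sub>M M) real_kernel"
 have "(\<integral>\<^sup>+z. p z \<partial>(M \<Otimes>\<^sub>M M)) ~= \<infinity>" unfolding off[OF ne] using int by (simp add: real_integrable_def)
 then obtain p0 where p0: "p0 >= 0" "(\<integral>\<^sup>+z. p z \<partial>(M \<Otimes>\<^sub>M M)) = ennreal p0"
  by (cases "(\<integral>\<^sup>+z. p z \<partial>(M \<Otimes>\<^sub>M M))") auto
 have "(\<integral>z. real_kernel z \<partial>(M \<Otimes>\<^sub>M M)) = p0 - n0"
  unfolding real_lebesgue_integral_def[OF int] off[OF ne, symmetric] p0(2) n0(2) using p0 n0 by simp
 thus "energy th V M = ereal (\<integral>z. real_kernel z \<partial>(M \<Otimes>\<^sub>M M))"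
  unfolding E p0(2) using p0(1) by simp
qed

text \<open>Kernel plus C0 is half a sum of nonnegative parts, so each part is dominated by twice
  that sum and is integrable by itself. The logarithmic moment comes out first, and subtracting it
  again yields the two logarithms and the potential.\<close>

lemma energy_cases:
 assumes M: "prob_on_halfline M"
 shows "energy th V M = \<infinity> | finite_energy M" "finite_energy M ==> energy th V M = ereal (real_energy M)"
proof -
 note M' = prob_on_halflineD[OF M]
 interpret M: prob_space M by (rule M'(1))
 interpret P: pair_prob_space M M ..
 note [measurable_cong] = M'(2)
 have pos: "AE z in M \<Otimes>\<^sub>M M. 0 <= fst z & 0 <= snd z" by (rule AE_pair_both[OF M'(1,1,3,3)])
 show "energy th V M = \<infinity> | finite_energy M"
 proof (rule disjCI)
  assume "~ finite_energy M"
  show "energy th V M = \<infinity>"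
  proof (rule ccontr)
   assume "energy th V M ~= \<infinity>"
   hence ne: "AE z in M \<Otimes>\<^sub>M M. fst z ~= snd z" and int: "integrable (M \<Otimes>\<^sub>M M) real_kernel"
    using energy_alternative(1)[OF M] by auto
   define w where "w = (%x :: real. ln (1 + \<bar>x\<bar>))"
   have [measurable]: "w \<in> borel_measurable borel" unfolding w_def by measurable
   define a1 where "a1 = (%z. w (fst z) + w (snd z) - log_dist z)"
   define a2 where "a2 = (%z. th * (w (fst z) + w (snd z)) - log_powr_dist z)"
   define v where "v = (%x. clip_V x - (1 + th) * w x + C0)"
   have [measurable]: "v \<in> borel_measurable borel" unfolding v_def by measurable
   have kC: "integrable (M \<Otimes>\<^sub>M M) (%z. 2 * (real_kernel z + C0))" using int by simp
   have parts: "AE z in M \<Otimes>\<^sub>M M. 0 <= a1 z & 0 <= a2 z & 0 <= w (fst z) & 3 * w (fst z) <= v (fst z) & 0 <= v (snd z) &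
     2 * (real_kernel z + C0) = a1 z + a2 z + v (fst z) + v (snd z)"
    using pos ne
   proof eventually_elim
    fix z :: "real \<times> real" assume z: "0 <= fst z & 0 <= snd z" "fst z ~= snd z"
    have e: "w (fst z) = ln (1 + fst z)" "w (snd z) = ln (1 + snd z)" using z by (simp_all add: w_def)
    note p = real_kernel_parts[of "fst z" "snd z", OF conjunct1[OF z(1)] conjunct2[OF z(1)] z(2), unfolded prod.collapse]
    have "0 <= w (fst z)" "0 <= w (snd z)" by (simp_all add: w_def)
    moreover have "0 <= a1 z" "0 <= a2 z" unfolding a1_def a2_def e by (rule p(1), rule p(2))
    moreover have "3 * w (fst z) <= v (fst z)" "3 * w (snd z) <= v (snd z)" unfolding v_def e by (rule p(3), rule p(4))
    moreover have eq: "real_kernel z + C0 = a1 z / 2 + a2 z / 2 + (v (fst z) + v (snd z)) / 2"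
     unfolding a1_def a2_def v_def e by (rule p(5))
    have "2 * (real_kernel z + C0) = a1 z + a2 z + v (fst z) + v (snd z)" unfolding eq by (simp add: field_simps)
    ultimately show "0 <= a1 z & 0 <= a2 z & 0 <= w (fst z) & 3 * w (fst z) <= v (fst z) & 0 <= v (snd z) &
     2 * (real_kernel z + C0) = a1 z + a2 z + v (fst z) + v (snd z)"
     by (intro conjI) (assumption | linarith)+
   qed
   have b1: "AE z in M \<Otimes>\<^sub>M M. norm (a1 z) <= norm (2 * (real_kernel z + C0))"
    using parts by eventually_elim (elim conjE, unfold real_norm_def, linarith)
   have b2: "AE z in M \<Otimes>\<^sub>M M. norm (a2 z) <= norm (2 * (real_kernel z + C0))"
    using parts by eventually_elim (elim conjE, unfold real_norm_def, linarith)
   have b3: "AE z in M \<Otimes>\<^sub>M M. norm (v (fst z)) <= norm (2 * (real_kernel z + C0))"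
    using parts by eventually_elim (elim conjE, unfold real_norm_def, linarith)
   have ia1: "integrable (M \<Otimes>\<^sub>M M) a1"
    by (rule Bochner_Integration.integrable_bound[OF kC _ b1]) (simp add: a1_def)
   have ia2: "integrable (M \<Otimes>\<^sub>M M) a2"
    by (rule Bochner_Integration.integrable_bound[OF kC _ b2]) (simp add: a2_def)
   \<comment> \<open>Integrability on the product descends to the marginal because \<open>M\<close>
     is the image of the product measure under the first projection.\<close>
   have "integrable (M \<Otimes>\<^sub>M M) (%z. v (fst z))"
    by (rule Bochner_Integration.integrable_bound[OF kC _ b3]) simp
   hence "integrable (distr (M \<Otimes>\<^sub>M M) M fst) v"
    by (subst integrable_distr_eq) (auto simp: measurable_cong_sets[OF M'(2) refl])
   hence iv: "integrable M v" by (simp add: M.distr_pair_fst)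
   have "AE x in M. norm (w x) <= norm (v x)" using M'(3)
   proof eventually_elim
    fix x :: real assume x: "0 <= x"
    have "0 <= w x" by (simp add: w_def)
    moreover have "3 * w x <= v x"
     using V_lower[of x] x by (simp add: v_def w_def clip_V_def max_def algebra_simps)
    ultimately show "norm (w x) <= norm (v x)" by simp
   qed
   hence iw: "integrable M w"
    by (intro Bochner_Integration.integrable_bound[OF iv]) simp_all
   have iV: "integrable M clip_V"
   proof -
    have "integrable M (%x. v x + (1 + th) * w x - C0)" using iv iw by simp
    thus ?thesis by (simp add: v_def)
   qed
   have iw2: "integrable (M \<Otimes>\<^sub>M M) (%z. w (fst z) + w (snd z))"
    using integrable_pair_fst(1)[OF M'(1,1) iw] integrable_pair_snd(1)[OF M'(1,1) iw] by simp
   have "integrable (M \<Otimes>\<^sub>M M) (%z. (w (fst z) + w (snd z)) - a1 z)" using iw2 ia1 by (rule Bochner_Integration.integrable_diff)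
   hence i1: "integrable (M \<Otimes>\<^sub>M M) log_dist" by (simp add: a1_def)
   have "integrable (M \<Otimes>\<^sub>M M) (%z. th * (w (fst z) + w (snd z)) - a2 z)" using iw2 ia2 by simp
   hence i2: "integrable (M \<Otimes>\<^sub>M M) log_powr_dist" by (simp add: a2_def)
   have "finite_energy M" unfolding finite_energy_def using i1 i2 iV iw ne by (simp add: w_def)
   thus False using `~ finite_energy M` by simp
  qed
 qed
 assume fin: "finite_energy M"
 have i: "integrable (M \<Otimes>\<^sub>M M) log_dist" "integrable (M \<Otimes>\<^sub>M M) log_powr_dist" "integrable M clip_V" and ne: "AE z in M \<Otimes>\<^sub>M M. fst z ~= snd z"
  using fin by (auto simp: finite_energy_def)
 note f = integrable_pair_fst[OF M'(1,1) i(3)] and s = integrable_pair_snd[OF M'(1,1) i(3)]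
 have int: "integrable (M \<Otimes>\<^sub>M M) real_kernel" unfolding real_kernel_def[abs_def] using i f(1) s(1) by simp
 have "(\<integral>z. real_kernel z \<partial>(M \<Otimes>\<^sub>M M)) = real_energy M"
  unfolding real_kernel_def[abs_def] real_energy_def using i f s by (simp add: field_simps)
 thus "energy th V M = ereal (real_energy M)" using energy_alternative(2)[OF M ne int] by simp
qed

end

lemma AE_pair_atomless:
 assumes M: "prob_space M" "sets M = sets borel" and N: "prob_space N" "sets N = sets borel"
  and at: "!!x. AE y in N. y ~= (x :: real)"
 shows "AE z in M \<Otimes>\<^sub>M N. fst z ~= snd z"
proof -
 interpret M: prob_space M by (rule M(1))
 interpret N: prob_space N by (rule N(1))
 interpret P: pair_prob_space M N ..
 note [measurable_cong] = M(2) N(2)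
 show ?thesis
 proof (rule P.AE_pair_measure)
  show "{z \<in> space (M \<Otimes>\<^sub>M N). fst z ~= snd z} \<in> sets (M \<Otimes>\<^sub>M N)" by measurable
  show "AE x in M. AE y in N. fst (x, y) ~= snd (x, y)"
   using at by (auto simp: eq_commute)
 qed
qed

text \<open>An atom at c would put positive product mass on the diagonal point (c, c).\<close>

lemma atomless_of_AE_pair:
 assumes M: "prob_space M" "sets M = sets borel" and ne: "AE z in M \<Otimes>\<^sub>M M. fst z ~= snd z"
 shows "AE y in M. y ~= (c :: real)"
proof -
 interpret M: prob_space M by (rule M(1))
 interpret P: pair_prob_space M M ..
 have "AE x in M. AE y in M. x ~= y" using P.AE_pair[OF ne] by simp
 hence *: "AE x in M. x = c --> (AE y in M. y ~= c)" by eventually_elim (auto simp: eq_commute)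
 show ?thesis
 proof (rule ccontr)
  assume n: "~ (AE y in M. y ~= c)"
  from * have "AE x in M. x ~= c" by eventually_elim (use n in auto)
  with n show False by simp
 qed
qed

section \<open>The variational argument\<close>

context log_gas
begin

text \<open>The energy is quadratic, so its increment from \<open>\<mu>\<close> to N is half the sum
  of the two logarithmic energies of N - \<open>\<mu>\<close> plus the integral of V - U against N -
  \<open>\<mu>\<close>, where U is the potential of \<open>\<mu>\<close>. Both contributions are
  nonnegative, and the first vanishes only for N = \<open>\<mu>\<close>. The Euler-Lagrange
  conditions leave out the points 0 and b, which a measure of finite energy does not charge.\<close>

lemma optimal_measure:
 assumes mu: "prob_on_halfline \<mu>" and b: "AE u in \<mu>. 0 < u & u < b"
  and i0: "!!x. x >= 0 ==> integrable \<mu> (%u. ln \<bar>x - u\<bar>)"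
  and K: "!!x. x >= 0 ==> (\<integral>u. \<bar>ln \<bar>x - u\<bar>\<bar> \<partial>\<mu>) <= K * (1 + ln (1 + x))"
  and at: "!!x. AE u in \<mu>. u ~= x"
  and EL1: "!!x. 0 < x ==> x < b ==> V x - (\<integral>u. ln \<bar>x - u\<bar> + ln \<bar>x powr th - u powr th\<bar> \<partial>\<mu>) = l"
  and EL2: "!!x. b < x ==> V x - (\<integral>u. ln \<bar>x - u\<bar> + ln \<bar>x powr th - u powr th\<bar> \<partial>\<mu>) >= l"
 shows "is_equilibrium_measure th V \<mu>" "!!\<nu>. is_equilibrium_measure th V \<nu> ==> \<nu> = \<mu>"
proof -
 note mu' = prob_on_halflineD[OF mu]
 interpret mu: prob_space \<mu> by (rule mu'(1))
 define U where "U = (%x. \<integral>u. log_dist (x, u) + log_powr_dist (x, u) \<partial>\<mu>)"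
 have lmu: "integrable \<mu> (%x. ln (1 + \<bar>x\<bar>))"
 proof (rule mu.integrable_const_bound)
  show "AE u in \<mu>. norm (ln (1 + \<bar>u\<bar>)) <= ln (1 + \<bar>b\<bar>)" using b by eventually_elim (auto intro!: ln_mono)
  show "(%u. ln (1 + \<bar>u\<bar>)) \<in> borel_measurable \<mu>" using mu'(2) by (simp cong: measurable_cong_sets)
 qed
 \<comment> \<open>Stated for arbitrary N so that it also covers N = \<open>\<mu>\<close>. The bound
   with K makes the inner integral over \<open>\<mu>\<close> integrable against any N with a
   logarithmic moment.\<close>
 have mixed: "integrable (N \<Otimes>\<^sub>M \<mu>) log_dist" "integrable (N \<Otimes>\<^sub>M \<mu>) log_powr_dist" "AE z in N \<Otimes>\<^sub>M \<mu>. fst z ~= snd z"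
  "integrable N U" "(\<integral>x. U x \<partial>N) = (\<integral>z. log_dist z \<partial>(N \<Otimes>\<^sub>M \<mu>)) + (\<integral>z. log_powr_dist z \<partial>(N \<Otimes>\<^sub>M \<mu>))"
  if N: "prob_on_halfline N" and lN: "integrable N (%x. ln (1 + \<bar>x\<bar>))" for N
 proof -
  note N' = prob_on_halflineD[OF N]
  interpret N: prob_space N by (rule N'(1))
  interpret P: pair_prob_space N \<mu> ..
  note [measurable_cong] = N'(2) mu'(2)
  show ne: "AE z in N \<Otimes>\<^sub>M \<mu>. fst z ~= snd z" by (rule AE_pair_atomless[OF N'(1,2) mu'(1,2) at])
  show 1: "integrable (N \<Otimes>\<^sub>M \<mu>) log_dist"
  proof (rule P.Fubini_integrable)
   show "log_dist \<in> borel_measurable (N \<Otimes>\<^sub>M \<mu>)" by measurable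
   show "integrable N (%x. \<integral>y. norm (log_dist (x, y)) \<partial>\<mu>)"
   proof (rule Bochner_Integration.integrable_bound)
    show "integrable N (%x. \<bar>K\<bar> * (1 + ln (1 + \<bar>x\<bar>)))" using lN N.integrable_const by (intro integrable_mult_right Bochner_Integration.integrable_add) auto
    show "(%x. \<integral>y. norm (log_dist (x, y)) \<partial>\<mu>) \<in> borel_measurable N" by measurable
    show "AE x in N. norm (\<integral>y. norm (log_dist (x, y)) \<partial>\<mu>) <= norm (\<bar>K\<bar> * (1 + ln (1 + \<bar>x\<bar>)))"
     using N'(3)
    proof eventually_elim
     fix x :: real assume x: "0 <= x"
     have "0 <= (\<integral>y. \<bar>ln \<bar>x - y\<bar>\<bar> \<partial>\<mu>)" by (rule integral_nonneg_AE) simp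
     moreover have "K * (1 + ln (1 + x)) <= \<bar>K\<bar> * (1 + ln (1 + x))" using x by (intro mult_right_mono) auto
     ultimately show "norm (\<integral>y. norm (log_dist (x, y)) \<partial>\<mu>) <= norm (\<bar>K\<bar> * (1 + ln (1 + \<bar>x\<bar>)))"
      using K[OF x] x by (simp add: log_dist_def)
    qed
   qed
   show "AE x in N. integrable \<mu> (%y. log_dist (x, y))"
    using N'(3) by eventually_elim (use i0 in \<open>simp add: log_dist_def\<close>)
  qed
  have pos: "AE z in N \<Otimes>\<^sub>M \<mu>. 0 <= fst z & 0 <= snd z" by (rule AE_pair_both[OF N'(1) mu'(1) N'(3) mu'(3)])
  show 2: "integrable (N \<Otimes>\<^sub>M \<mu>) log_powr_dist"
  proof (rule Bochner_Integration.integrable_bound)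
   show "integrable (N \<Otimes>\<^sub>M \<mu>) (%z. th * \<bar>log_dist z\<bar> + th * (ln (1 + \<bar>fst z\<bar>) + ln (1 + \<bar>snd z\<bar>)))"
    using 1 integrable_pair_fst(1)[OF N'(1) mu'(1) lN] integrable_pair_snd(1)[OF N'(1) mu'(1) lmu] by simp
   show "log_powr_dist \<in> borel_measurable (N \<Otimes>\<^sub>M \<mu>)" by measurable
   show "AE z in N \<Otimes>\<^sub>M \<mu>. norm (log_powr_dist z) <= norm (th * \<bar>log_dist z\<bar> + th * (ln (1 + \<bar>fst z\<bar>) + ln (1 + \<bar>snd z\<bar>)))"
    using pos ne
   proof eventually_elim
    fix z :: "real \<times> real" assume z: "0 <= fst z & 0 <= snd z" "fst z ~= snd z"
    have z1: "0 <= fst z" "0 <= snd z" using z by auto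
    note lb = log_powr_dist_bounds(2,3)[OF z1 z(2)]
    have "0 <= th * (ln (1 + fst z) + ln (1 + snd z))" using z1 theta by simp
    moreover have "th * (- \<bar>ln \<bar>fst z - snd z\<bar>\<bar>) <= th * ln \<bar>fst z - snd z\<bar>" using theta by (intro mult_left_mono) auto
    hence "- (th * \<bar>ln \<bar>fst z - snd z\<bar>\<bar>) <= th * ln \<bar>fst z - snd z\<bar>" by simp
    moreover have "0 <= th * \<bar>ln \<bar>fst z - snd z\<bar>\<bar>" using theta by simp
    ultimately have "\<bar>log_powr_dist z\<bar> <= th * \<bar>log_dist z\<bar> + th * (ln (1 + fst z) + ln (1 + snd z))"
     using lb unfolding log_powr_dist_def log_dist_def abs_le_iff by linarith
    thus "norm (log_powr_dist z) <= norm (th * \<bar>log_dist z\<bar> + th * (ln (1 + \<bar>fst z\<bar>) + ln (1 + \<bar>snd z\<bar>)))"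
     unfolding real_norm_def abs_of_nonneg[OF z1(1)] abs_of_nonneg[OF z1(2)] by (rule order_trans[OF _ abs_ge_self])
   qed
  qed
  have 3: "integrable (N \<Otimes>\<^sub>M \<mu>) (%z. log_dist z + log_powr_dist z)" using 1 2 by simp
  show "integrable N U" unfolding U_def using P.integrable_fst'[OF 3] by simp
  show "(\<integral>x. U x \<partial>N) = (\<integral>z. log_dist z \<partial>(N \<Otimes>\<^sub>M \<mu>)) + (\<integral>z. log_powr_dist z \<partial>(N \<Otimes>\<^sub>M \<mu>))"
   unfolding U_def using P.integral_fst'[OF 3] 1 2 by simp
 qed
 note mm = mixed[OF mu lmu]
 have iV: "integrable \<mu> clip_V"
 proof -
  have "compact (V ` {0..b})" by (intro compact_continuous_image continuous_on_subset[OF V_cont]) auto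
  then obtain B where "\<forall>u\<in>{0..b}. \<bar>V u\<bar> <= B" using compact_imp_bounded[of "V ` {0..b}"] unfolding bounded_iff by auto
 hence B: "!!u. u \<in> {0..b} ==> \<bar>V u\<bar> <= B" by blast
  show ?thesis
  proof (rule mu.integrable_const_bound)
   show "AE u in \<mu>. norm (clip_V u) <= B" using b by eventually_elim (use B in \<open>auto simp: clip_V_def max_def\<close>)
   show "clip_V \<in> borel_measurable \<mu>" using mu'(2) by (simp cong: measurable_cong_sets)
  qed
 qed
 have fin: "finite_energy \<mu>" unfolding finite_energy_def using mm iV lmu by simp
 have Ueq: "U x = (\<integral>u. ln \<bar>x - u\<bar> + ln \<bar>x powr th - u powr th\<bar> \<partial>\<mu>)" if x: "0 < x" for x
  unfolding U_def
 proof (rule integral_cong_AE)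
  note [measurable_cong] = mu'(2)
  have [measurable]: "(%u. (x, u)) \<in> measurable \<mu> (borel \<Otimes>\<^sub>M borel)" by measurable
  show "(%u. log_dist (x, u) + log_powr_dist (x, u)) \<in> borel_measurable \<mu>" by measurable
  show "(%u. ln \<bar>x - u\<bar> + ln \<bar>x powr th - u powr th\<bar>) \<in> borel_measurable \<mu>" by measurable
  show "AE u in \<mu>. log_dist (x, u) + log_powr_dist (x, u) = ln \<bar>x - u\<bar> + ln \<bar>x powr th - u powr th\<bar>"
   using mu'(3) by eventually_elim (use x in \<open>simp add: log_dist_def log_powr_dist_def clip_powr_def max_def\<close>)
 qed
 have Umu: "(\<integral>x. clip_V x - U x \<partial>\<mu>) = l"
 proof -
  have "(\<integral>x. clip_V x - U x \<partial>\<mu>) = (\<integral>x. l \<partial>\<mu>)"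
  proof (rule integral_cong_AE)
   show "(%x. clip_V x - U x) \<in> borel_measurable \<mu>" using iV mm(4) by simp
   show "AE x in \<mu>. clip_V x - U x = l" using b by eventually_elim (use EL1 Ueq in \<open>auto simp: clip_V_def max_def\<close>)
  qed simp
  thus ?thesis by (simp add: mu.prob_space)
 qed
 have main: "real_energy \<mu> <= real_energy N & (real_energy N <= real_energy \<mu> --> N = \<mu>)" if N: "prob_on_halfline N" and finN: "finite_energy N" for N
 proof -
  note N' = prob_on_halflineD[OF N]
  interpret N: prob_space N by (rule N'(1))
  have f: "integrable (N \<Otimes>\<^sub>M N) log_dist" "AE z in N \<Otimes>\<^sub>M N. fst z ~= snd z" "integrable (N \<Otimes>\<^sub>M N) log_powr_dist" "integrable N clip_V" "integrable N (%x. ln (1 + \<bar>x\<bar>))"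
   using finN by (auto simp: finite_energy_def)
  note mN = mixed[OF N f(5)]
  define D1 where "D1 = (\<integral>z. - log_dist z \<partial>(N \<Otimes>\<^sub>M N)) + (\<integral>z. - log_dist z \<partial>(\<mu> \<Otimes>\<^sub>M \<mu>)) - 2 * (\<integral>z. - log_dist z \<partial>(N \<Otimes>\<^sub>M \<mu>))"
  define D2 where "D2 = (\<integral>z. - log_powr_dist z \<partial>(N \<Otimes>\<^sub>M N)) + (\<integral>z. - log_powr_dist z \<partial>(\<mu> \<Otimes>\<^sub>M \<mu>)) - 2 * (\<integral>z. - log_powr_dist z \<partial>(N \<Otimes>\<^sub>M \<mu>))"
  note L1 = log_energy_positive[OF N'(1,2) mu'(1,2), folded log_dist_def, OF f(1,2) mN(1,3) mm(1,3) f(5) lmu, folded D1_def]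
  \<comment> \<open>This is positivity for ln |x - y| applied to the images under x -> x^th. The
    images have logarithmic moments because ln (1 + x^th) <= ln 2 + th ln (1 + x).\<close>
  have D2: "D2 >= 0"
  proof -
   have dM: "prob_space (distr A borel clip_powr)" if "prob_space A" "sets A = sets borel" for A :: "real measure"
    using that by (intro prob_space.prob_space_distr) (auto cong: measurable_cong_sets)
   have inj: "AE z in A \<Otimes>\<^sub>M B. clip_powr (fst z) ~= clip_powr (snd z)"
    if "prob_on_halfline A" "prob_on_halfline B" "AE z in A \<Otimes>\<^sub>M B. fst z ~= snd z" for A B
    using that(3) AE_pair_both[OF prob_on_halflineD(1)[OF that(1)] prob_on_halflineD(1)[OF that(2)] prob_on_halflineD(3)[OF that(1)] prob_on_halflineD(3)[OF that(2)]]
    by eventually_elim (use log_powr_dist_bounds(1) in auto)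
   have li: "integrable (distr A borel clip_powr) (%x. ln (1 + \<bar>x\<bar>))"
    if A: "prob_on_halfline A" "integrable A (%x. ln (1 + \<bar>x\<bar>))" for A
   proof -
    note A' = prob_on_halflineD[OF A(1)]
    note [measurable_cong] = A'(2)
    have "integrable A (%x. ln (1 + \<bar>clip_powr x\<bar>))"
    proof (rule Bochner_Integration.integrable_bound)
     show "integrable A (%x. ln 2 + th * ln (1 + \<bar>x\<bar>))"
      using A(2) A'(1) by (simp add: prob_space.finite_measure finite_measure.integrable_const)
     show "(%x. ln (1 + \<bar>clip_powr x\<bar>)) \<in> borel_measurable A" by measurable
     show "AE x in A. norm (ln (1 + \<bar>clip_powr x\<bar>)) <= norm (ln 2 + th * ln (1 + \<bar>x\<bar>))" using A'(3)
     proof eventually_elim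
      fix x :: real assume x: "0 <= x"
      have "1 <= (1 + x) powr th" using x theta by (intro ge_one_powr_ge_zero) auto
      moreover have "x powr th <= (1 + x) powr th" using x theta by (intro powr_mono2) auto
      ultimately have "ln (1 + x powr th) <= ln (2 * (1 + x) powr th)" by (intro ln_mono) (auto simp: add_pos_nonneg)
      also have "... = ln 2 + th * ln (1 + x)" using x by (subst ln_mult_pos) (auto simp: ln_powr)
      finally have "ln (1 + x powr th) <= ln 2 + th * ln (1 + x)" .
      moreover have "0 <= ln (1 + x powr th)" by simp
      ultimately show "norm (ln (1 + \<bar>clip_powr x\<bar>)) <= norm (ln 2 + th * ln (1 + \<bar>x\<bar>))" using x
       unfolding clip_powr_def real_norm_def max_absorb2[OF x] abs_of_nonneg[OF x] abs_of_nonneg[OF powr_ge_zero] by linarith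
     qed
    qed
    thus ?thesis by (subst integrable_distr_eq) auto
   qed
   have nonneg: "0 <= (\<integral>z. - ln \<bar>fst z - snd z\<bar> \<partial>(distr N borel clip_powr \<Otimes>\<^sub>M distr N borel clip_powr))
     + (\<integral>z. - ln \<bar>fst z - snd z\<bar> \<partial>(distr \<mu> borel clip_powr \<Otimes>\<^sub>M distr \<mu> borel clip_powr))
     - 2 * (\<integral>z. - ln \<bar>fst z - snd z\<bar> \<partial>(distr N borel clip_powr \<Otimes>\<^sub>M distr \<mu> borel clip_powr))"
   proof (rule log_energy_positive(1))
    show "prob_space (distr N borel clip_powr)" by (rule dM[OF N'(1,2)])
    show "prob_space (distr \<mu> borel clip_powr)" by (rule dM[OF mu'(1,2)])
    show "integrable (distr N borel clip_powr \<Otimes>\<^sub>M distr N borel clip_powr) (%z. ln \<bar>fst z - snd z\<bar>)"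
     unfolding pushforward_pair(1)[OF N'(1,2) N'(1,2) clip_powr_measurable] using f(3) by (simp add: log_powr_dist_def[abs_def])
    show "integrable (distr N borel clip_powr \<Otimes>\<^sub>M distr \<mu> borel clip_powr) (%z. ln \<bar>fst z - snd z\<bar>)"
     unfolding pushforward_pair(1)[OF N'(1,2) mu'(1,2) clip_powr_measurable] using mN(2) by (simp add: log_powr_dist_def[abs_def])
    show "integrable (distr \<mu> borel clip_powr \<Otimes>\<^sub>M distr \<mu> borel clip_powr) (%z. ln \<bar>fst z - snd z\<bar>)"
     unfolding pushforward_pair(1)[OF mu'(1,2) mu'(1,2) clip_powr_measurable] using mm(2) by (simp add: log_powr_dist_def[abs_def])
    show "AE z in distr N borel clip_powr \<Otimes>\<^sub>M distr N borel clip_powr. fst z ~= snd z"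
     by (rule pushforward_pair(3)[OF N'(1,2) N'(1,2) clip_powr_measurable inj[OF N N f(2)]])
    show "AE z in distr N borel clip_powr \<Otimes>\<^sub>M distr \<mu> borel clip_powr. fst z ~= snd z"
     by (rule pushforward_pair(3)[OF N'(1,2) mu'(1,2) clip_powr_measurable inj[OF N mu mN(3)]])
    show "AE z in distr \<mu> borel clip_powr \<Otimes>\<^sub>M distr \<mu> borel clip_powr. fst z ~= snd z"
     by (rule pushforward_pair(3)[OF mu'(1,2) mu'(1,2) clip_powr_measurable inj[OF mu mu mm(3)]])
   qed (use li[OF N f(5)] li[OF mu lmu] in simp_all)
   thus ?thesis
    unfolding D2_def using pushforward_pair(2)[OF N'(1,2) N'(1,2) clip_powr_measurable]
     pushforward_pair(2)[OF N'(1,2) mu'(1,2) clip_powr_measurable] pushforward_pair(2)[OF mu'(1,2) mu'(1,2) clip_powr_measurable]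
    by (simp add: log_powr_dist_def)
  qed
  \<comment> \<open>The three exceptional sets, the negative half-line and the points 0 and b, are
    null for N.\<close>
  have UN: "(\<integral>x. clip_V x - U x \<partial>N) >= l"
  proof -
   have "AE x in N. l <= clip_V x - U x"
    using N'(3) atomless_of_AE_pair[OF N'(1,2) f(2), of 0] atomless_of_AE_pair[OF N'(1,2) f(2), of b]
   proof eventually_elim
    fix x assume x: "0 <= x" "x ~= 0" "x ~= b"
    thus "l <= clip_V x - U x" using EL1[of x] EL2[of x] Ueq[of x] by (cases "x < b") (auto simp: clip_V_def max_def)
   qed
   hence "(\<integral>x. l \<partial>N) <= (\<integral>x. clip_V x - U x \<partial>N)" using f(4) mN(4) by (intro integral_mono_AE) auto
   thus ?thesis by (simp add: N.prob_space)
  qed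
  \<comment> \<open>Completing the square in N - \<open>\<mu>\<close>; the cross terms are the
    integral of U against N.\<close>
  have diff: "real_energy N - real_energy \<mu> = (D1 + D2) / 2 + (\<integral>x. clip_V x - U x \<partial>N) - (\<integral>x. clip_V x - U x \<partial>\<mu>)"
  proof -
   have "(\<integral>x. clip_V x - U x \<partial>N) = (\<integral>x. clip_V x \<partial>N) - ((\<integral>z. log_dist z \<partial>(N \<Otimes>\<^sub>M \<mu>)) + (\<integral>z. log_powr_dist z \<partial>(N \<Otimes>\<^sub>M \<mu>)))"
    using mN(4,5) f(4) by simp
   moreover have "(\<integral>x. clip_V x - U x \<partial>\<mu>) = (\<integral>x. clip_V x \<partial>\<mu>) - ((\<integral>z. log_dist z \<partial>(\<mu> \<Otimes>\<^sub>M \<mu>)) + (\<integral>z. log_powr_dist z \<partial>(\<mu> \<Otimes>\<^sub>M \<mu>)))"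
    using mm(4,5) iV by simp
   ultimately show ?thesis unfolding real_energy_def D1_def D2_def by (simp add: field_simps)
  qed
  have "real_energy N - real_energy \<mu> >= (D1 + D2) / 2" using diff UN Umu by linarith
  thus ?thesis using L1 D2 by auto
 qed
 have eN: "energy th V \<mu> = ereal (real_energy \<mu>)" by (rule energy_cases(2)[OF mu fin])
 show "is_equilibrium_measure th V \<mu>"
  unfolding is_equilibrium_measure_def
 proof (intro conjI allI impI mu)
  fix N assume N: "prob_on_halfline N"
  show "energy th V \<mu> <= energy th V N"
   using energy_cases[OF N] main[OF N] eN by auto
 qed
 fix N assume eq: "is_equilibrium_measure th V N"
 hence N: "prob_on_halfline N" and le: "energy th V N <= energy th V \<mu>" using mu by (auto simp: is_equilibrium_measure_def)
 have "energy th V N ~= \<infinity>" using le eN by auto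
 hence finN: "finite_energy N" using energy_cases(1)[OF N] by auto
 have "real_energy N <= real_energy \<mu>" using le eN energy_cases(2)[OF N finN] by simp
 thus "N = \<mu>" by (rule mp[OF conjunct2[OF main[OF N finN]]])
qed

end

subsection \<open>The arc in polar coordinates\<close>

text \<open>Consider the triangle with vertices -1, 0 and s = r e^(i ph). J is real at s when its
  angle at -1 is ph/(1 + th); then the angle at s is th ph/(1 + th), and the sine law gives |s|. The
  value at 0 is the limit.\<close>

definition arcr :: "real => real => real" where
 "arcr th ph = (if ph = 0 then 1 / th else sin (ph / (1 + th)) / sin (th * ph / (1 + th)))"

text \<open>The side |s + 1| of the same triangle, again with its limit at 0.\<close>

definition arc_shift :: "real => real => real" where
 "arc_shift th ph = (if ph = 0 then (1 + th) / th else sin ph / sin (th * ph / (1 + th)))"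

definition arcp :: "real => real => complex" where
 "arcp th ph = of_real (arcr th ph) * cis ph"

text \<open>The real value X of J at the point of angle ph, for c = 1. It decreases from the right
  end of the support to 0.\<close>

definition arcv :: "real => real => real" where
 "arcv th ph = arc_shift th ph * (arc_shift th ph / arcr th ph) powr (1 / th)"

text \<open>Minus the derivative of ln X with respect to the angle.\<close>

definition arc_rate :: "real => real => real" where
 "arc_rate th ph = th / (1 + th) * cot (th * ph / (1 + th))
   + cot (ph / (1 + th)) / (th * (1 + th)) - (1 + 1 / th) * cot ph"

text \<open>The derivative of ln r with respect to the angle.\<close>

definition arc_logder :: "real => real => real" where
 "arc_logder th ph = (cot (ph / (1 + th)) - th * cot (th * ph / (1 + th))) / (1 + th)"

lemma arcas:
 assumes "th > 0" "0 < ph" "ph <= pi"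
 shows "0 < ph / (1 + th)" "ph / (1 + th) < pi" "0 < th * ph / (1 + th)" "th * ph / (1 + th) < pi"
  "sin (ph / (1 + th)) > 0" "sin (th * ph / (1 + th)) > 0"
  "ph / (1 + th) + th * ph / (1 + th) = ph"
proof -
 show 1: "0 < ph / (1 + th)" "0 < th * ph / (1 + th)" using assms by auto
 have "ph / (1 + th) + th * ph / (1 + th) = (1 + th) * ph / (1 + th)"
  by (simp add: add_divide_distrib[symmetric] ring_distribs)
 thus 3: "ph / (1 + th) + th * ph / (1 + th) = ph" using assms by simp
 show 2: "ph / (1 + th) < pi" "th * ph / (1 + th) < pi" using 1 3 assms by linarith+
 show "sin (ph / (1 + th)) > 0" "sin (th * ph / (1 + th)) > 0" using 1 2 by (auto intro: sin_gt_zero)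
qed

lemma arcr_pos: "th > 0 ==> 0 <= ph ==> ph <= pi ==> arcr th ph > 0"
 using arcas[of th ph] by (auto simp: arcr_def)

lemma arc_shift_nonneg: "th > 0 ==> 0 <= ph ==> ph <= pi ==> arc_shift th ph >= 0"
 using arcas[of th ph] sin_ge_zero[of ph] by (auto simp: arc_shift_def)

lemma arc_shift_pos: "th > 0 ==> 0 <= ph ==> ph < pi ==> arc_shift th ph > 0"
 using arcas[of th ph] sin_gt_zero[of ph] by (auto simp: arc_shift_def)

text \<open>The sine law once more, now with directions: the angle at -1 is the argument of s + 1.
  The identity behind it is the addition formula for sin ((u + v) - u).\<close>

lemma arcp_add_1:
 assumes "th > 0" "0 <= ph" "ph <= pi"
 shows "arcp th ph + 1 = of_real (arc_shift th ph) * cis (ph / (1 + th))"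
proof (cases "ph = 0")
 case True
 thus ?thesis using assms by (simp add: arcp_def arcr_def arc_shift_def field_simps)
next
 case False
 define u v where "u = ph / (1 + th)" and "v = th * ph / (1 + th)"
 have *: "sin v > 0" "ph = u + v" using arcas[of th ph] False assms by (auto simp: u_def v_def)
 have sv: "sin v = sin (u+v) * cos u - cos (u+v) * sin u" using sin_diff[of "u+v" u] by simp
 have r: "arcr th ph = sin u / sin v" "arc_shift th ph = sin (u+v) / sin v"
  unfolding arcr_def arc_shift_def u_def[symmetric] v_def[symmetric] using False
  by (simp_all flip: *(2))
 have "sin u / sin v * cos (u+v) + 1 = sin (u+v) / sin v * cos u"
  using sv *(1) by (simp add: field_simps)
 thus ?thesis unfolding arcp_def r u_def[symmetric] unfolding *(2)
  by (simp add: complex_eq_iff)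
qed

lemma arc_shift_eq_norm:
 "th > 0 ==> 0 <= ph ==> ph <= pi ==> arc_shift th ph = norm (arcp th ph + 1)"
 using arcp_add_1[of th ph] arc_shift_nonneg[of th ph] by (simp add: norm_mult)

lemma continuous_on_arcr:
 assumes "th > 0" shows "continuous_on {0..pi} (arcr th)"
proof -
 have "continuous (at x within {0..pi}) (arcr th)" if x: "x \<in> {0..pi}" for x
 proof (cases "x = 0")
  case True
  have "((%ph. sin (ph / (1 + th)) / sin (th * ph / (1 + th))) \<longlongrightarrow> inverse (1 + th) * (inverse th * (1 + th))) (at_right 0)"
   using assms by real_asymp
  also have "inverse (1 + th) * (inverse th * (1 + th)) = 1/th" using assms by (simp add: field_simps)
  finally have "((%ph. sin (ph / (1 + th)) / sin (th * ph / (1 + th))) \<longlongrightarrow> 1/th) (at_right 0)" .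
  hence "(arcr th \<longlongrightarrow> 1/th) (at_right 0)"
   by (rule Lim_transform_eventually) (auto simp: eventually_at_filter arcr_def)
  hence "(arcr th \<longlongrightarrow> 1/th) (at 0 within {0..pi})"
   by (simp add: at_within_Icc_at_right)
  thus ?thesis using True by (simp add: continuous_within arcr_def)
 next
  case False
  have c: "isCont (%ph. sin (ph / (1 + th)) / sin (th * ph / (1 + th))) x"
   using arcas[of th x] assms False x by (intro continuous_intros) auto
  have "eventually (%y. y \<in> -{0}) (nhds x)" by (rule eventually_nhds_in_open) (use False in auto)
  hence e: "\<forall>\<^sub>F y in nhds x. sin (y / (1 + th)) / sin (th * y / (1 + th)) = arcr th y"
   by eventually_elim (auto simp: arcr_def)
  show ?thesis using isCont_cong[OF e] c continuous_at_imp_continuous_at_within by blast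
 qed
 thus ?thesis by (simp add: continuous_on_eq_continuous_within)
qed

lemma continuous_on_arcp: "th > 0 ==> continuous_on {0..pi} (arcp th)"
 unfolding arcp_def by (intro continuous_intros continuous_on_arcr) auto

lemma continuous_on_arc_shift: "th > 0 ==> continuous_on {0..pi} (arc_shift th)"
 by (subst continuous_on_cong[OF refl arc_shift_eq_norm])
   (auto intro!: continuous_intros continuous_on_arcp)

lemma continuous_on_arcv:
 assumes "th > 0" shows "continuous_on {0..pi} (arcv th)"
 unfolding arcv_def
proof (intro continuous_on_mult continuous_on_powr' continuous_on_divide continuous_on_const
  continuous_on_arc_shift[OF assms] continuous_on_arcr[OF assms] ballI conjI impI)
 fix x assume x: "x \<in> {0..pi}"
 hence r: "arcr th x > 0" using arcr_pos assms by simp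
 thus "arcr th x ~= 0" by simp
 show "0 <= arc_shift th x / arcr th x" using r arc_shift_nonneg[OF assms] x by simp
qed (use assms in auto)

lemma arcv_0: "th > 0 ==> arcv th 0 = (1 + th) powr (1 + 1/th) / th"
 by (simp add: arcv_def arc_shift_def arcr_def powr_add)

lemma arcv_pi: "th > 0 ==> arcv th pi = 0"
 by (simp add: arcv_def arc_shift_def)

lemma arcv_pos: "th > 0 ==> 0 <= ph ==> ph < pi ==> arcv th ph > 0"
 using arc_shift_pos[of th ph] arcr_pos[of th ph] by (simp add: arcv_def)

lemma arcr_deriv:
 assumes "th > 0" "0 < ph" "ph < pi"
 shows "(arcr th has_real_derivative arcr th ph * arc_logder th ph) (at ph)"
proof -
 note a = arcas[of th ph]
 have "((%ph. sin (ph / (1 + th)) / sin (th * ph / (1 + th))) has_real_derivative 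
   arcr th ph * arc_logder th ph) (at ph)"
  using a assms apply (auto intro!: derivative_eq_intros simp: arcr_def arc_logder_def cot_def)
  by (simp add: divide_simps)
 moreover have "eventually (%y. y \<in> -{0}) (nhds ph)" by (rule eventually_nhds_in_open) (use assms in auto)
 hence e: "\<forall>\<^sub>F y in nhds ph. sin (y / (1 + th)) / sin (th * y / (1 + th)) = arcr th y"
  by eventually_elim (auto simp: arcr_def)
 ultimately show ?thesis using DERIV_cong_ev[OF refl e refl] by simp
qed

lemma arcp_deriv:
 assumes "th > 0" "0 < ph" "ph < pi"
 shows "(arcp th has_vector_derivative arcp th ph * (of_real (arc_logder th ph) + \<i>)) (at ph)"
proof -
 have "((%x. of_real (arcr th x) :: complex) has_vector_derivative of_real (arcr th ph * arc_logder th ph)) (at ph)"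
  using arcr_deriv[OF assms] 
  by (metis has_real_derivative_iff_has_vector_derivative has_vector_derivative_of_real)
 moreover have "(cis has_vector_derivative \<i> * cis ph) (at ph)"
  unfolding cis_conv_exp by (rule has_vector_derivative_real_field) (auto intro!: derivative_eq_intros)
 ultimately have "((%x. of_real (arcr th x) * cis x) has_vector_derivative
    of_real (arcr th ph) * (\<i> * cis ph) + of_real (arcr th ph * arc_logder th ph) * cis ph) (at ph)"
  by (rule has_vector_derivative_mult)
 thus ?thesis unfolding arcp_def by (simp add: algebra_simps)
qed

text \<open>The poles of the two cotangents at 0 cancel, and at the other end both arguments stay
  below pi.\<close>

lemma arc_logder_bounded:
 assumes "th > 0" obtains C where "C > 0" "!!ph. 0 < ph ==> ph < pi ==> \<bar>arc_logder th ph\<bar> <= C"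
proof -
 define f where "f = (%ph. if ph = 0 then 0 else arc_logder th ph)"
 have "continuous (at x within {0..pi}) f" if x: "x \<in> {0..pi}" for x
 proof (cases "x = 0")
  case True
  have "((%ph. (cos (ph / (1 + th)) / sin (ph / (1 + th)) - th * (cos (th * ph / (1 + th)) / sin (th * ph / (1 + th)))) / (1 + th)) \<longlongrightarrow> 0) (at_right 0)"
   using assms by real_asymp
  hence "(f \<longlongrightarrow> 0) (at_right 0)"
   by (rule Lim_transform_eventually) (auto simp: eventually_at_filter f_def arc_logder_def cot_def)
  hence "(f \<longlongrightarrow> 0) (at 0 within {0..pi})"
   by (simp add: at_within_Icc_at_right)
  thus ?thesis using True by (simp add: continuous_within f_def)
 next
  case False
  have c: "isCont (arc_logder th) x"
   using arcas[of th x] assms False x unfolding arc_logder_def cot_def by (intro continuous_intros) auto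
  have "eventually (%y. y \<in> -{0}) (nhds x)" by (rule eventually_nhds_in_open) (use False in auto)
  hence e: "\<forall>\<^sub>F y in nhds x. arc_logder th y = f y"
   by eventually_elim (auto simp: f_def)
  show ?thesis using isCont_cong[OF e] c continuous_at_imp_continuous_at_within by blast
 qed
 hence "continuous_on {0..pi} f" by (simp add: continuous_on_eq_continuous_within)
 hence "bounded (f ` {0..pi})" by (intro compact_imp_bounded compact_continuous_image) auto
 then obtain C where "C > 0" "!!ph. ph \<in> {0..pi} ==> \<bar>f ph\<bar> <= C" by (auto simp: bounded_pos)
 hence "\<bar>arc_logder th ph\<bar> <= C" if "0 < ph" "ph < pi" for ph
  using that by (metis f_def atLeastAtMost_iff less_eq_real_def less_numeral_extra(3))
 thus ?thesis using that[OF \<open>C > 0\<close>] by blast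
qed

text \<open>With the cotangents P and Q of the angles at -1 and at s, cot ph is (P Q - 1)/(P + Q),
  and the numerator of the rate becomes a sum of squares.\<close>

lemma arc_rate_pos:
 assumes "th > 0" "0 < ph" "ph < pi" shows "arc_rate th ph > 0"
proof -
 define u v where "u = ph / (1 + th)" and "v = th * ph / (1 + th)"
 have *: "sin u > 0" "sin v > 0" "ph = u + v" using arcas[of th ph] assms by (auto simp: u_def v_def)
 have s: "sin (u+v) > 0" using assms * by (metis sin_gt_zero)
 define P Q where "P = cot u" and "Q = cot v"
 have PQ: "P + Q = sin (u+v) / (sin u * sin v)" using * by (simp add: P_def Q_def cot_def sin_add field_simps)
 hence pos: "P + Q > 0" using * s by simp
 have "P * Q - 1 = cos (u+v) / (sin u * sin v)" using * by (simp add: P_def Q_def cot_def cos_add field_simps)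
 hence c: "cot (u+v) = (P*Q - 1) / (P + Q)" using PQ * s by (simp add: cot_def)
 have c': "cot ph = (P*Q - 1) / (P + Q)" using c by (simp flip: *(3))
 have "arc_rate th ph = th / (1 + th) * Q + P / (th * (1 + th)) - (1 + 1 / th) * ((P*Q - 1) / (P + Q))"
  unfolding arc_rate_def u_def[symmetric] v_def[symmetric] P_def[symmetric] Q_def[symmetric] c' by simp
 \<comment> \<open>The coefficient of P Q is th^2 + 1 - (1 + th)^2 = -2 th, which completes the
   square.\<close>
 also have "... = ((P - th*Q)^2 + (1+th)^2) / (th * (1+th) * (P+Q))"
 proof -
  have "P + Q ~= 0" "th ~= 0" "1 + th ~= 0" using pos assms by auto
  thus ?thesis by (simp add: divide_simps) (simp add: algebra_simps power2_eq_square)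
 qed
 also have "... > 0" using pos assms by (intro divide_pos_pos add_nonneg_pos[of "_\<^sup>2"] mult_pos_pos[of _ "P + Q"]) auto
 finally show ?thesis .
qed

lemma ln_sin_deriv:
 fixes k x :: real assumes "sin (k * x) > 0"
 shows "((%x. ln (sin (k * x))) has_real_derivative k * cot (k * x)) (at x)"
 using assms by (auto intro!: derivative_eq_intros simp: cot_def)

lemma arcv_deriv:
 assumes "th > 0" "0 < ph" "ph < pi"
 shows "(arcv th has_real_derivative - (arcv th ph * arc_rate th ph)) (at ph)"
proof -
 define k l where "k = th / (1 + th)" and "l = 1 / (1 + th)"
 have kl: "th * x / (1 + th) = k * x" "x / (1 + th) = l * x" for x by (simp_all add: k_def l_def)
 define f where "f = (%ph. exp ((1 + 1/th) * ln (sin (1 * ph)) - ln (sin (k * ph)) - 1/th * ln (sin (l * ph))))"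
 have eq: "f x = arcv th x" if "x \<in> {0<..<pi}" for x
 proof -
  have s: "sin x > 0" "sin (k * x) > 0" "sin (l * x) > 0" "x ~= 0"
   using arcas[of th x] assms that unfolding kl(1) kl(2)[of x] by (auto intro: sin_gt_zero)
  have "arcv th x = sin x / sin (k * x) * (sin x / sin (l * x)) powr (1/th)"
   using s by (simp add: arcv_def arc_shift_def arcr_def kl(1) kl(2)[of x])
  also have "... = exp (ln (sin x) - ln (sin (k * x)) + (1/th) * (ln (sin x) - ln (sin (l * x))))"
   using s by (simp add: exp_add powr_def ln_div exp_diff)
  also have "... = f x" unfolding f_def by (simp add: algebra_simps)
  finally show ?thesis by simp
 qed
 have s: "sin (1 * ph) > 0" "sin (k * ph) > 0" "sin (l * ph) > 0"
   using arcas[of th ph] assms unfolding kl(1) kl(2)[of ph] by (auto intro: sin_gt_zero)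
 have "((%ph. (1 + 1/th) * ln (sin (1 * ph)) - ln (sin (k * ph)) - 1/th * ln (sin (l * ph))) has_real_derivative
   (1 + 1/th) * (1 * cot (1 * ph)) - k * cot (k * ph) - 1/th * (l * cot (l * ph))) (at ph)"
  by (intro DERIV_diff DERIV_cmult ln_sin_deriv s)
 from DERIV_chain2[OF DERIV_exp this]
 have "(f has_real_derivative f ph * ((1 + 1/th) * (1 * cot (1 * ph)) - k * cot (k * ph) - 1/th * (l * cot (l * ph)))) (at ph)"
  unfolding f_def .
 also have "f ph * ((1 + 1/th) * (1 * cot (1 * ph)) - k * cot (k * ph) - 1/th * (l * cot (l * ph)))
   = - (arcv th ph * arc_rate th ph)"
  unfolding arc_rate_def kl(1) kl(2)[of ph] using eq[of ph] assms by (simp add: k_def l_def algebra_simps)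
 finally have d: "(f has_real_derivative - (arcv th ph * arc_rate th ph)) (at ph)" .
 have "eventually (%y. y \<in> {0<..<pi}) (nhds ph)" by (rule eventually_nhds_in_open) (use assms in auto)
 hence e: "\<forall>\<^sub>F y in nhds ph. f y = arcv th y" by eventually_elim (use eq in auto)
 show ?thesis using DERIV_cong_ev[OF refl e refl] d by simp
qed

lemma arcv_strict_antimono:
 assumes "th > 0" "0 <= x" "x < y" "y <= pi" shows "arcv th y < arcv th x"
proof (rule DERIV_neg_imp_decreasing_open[OF assms(3)])
 show "\<exists>l. (arcv th has_real_derivative l) (at z) & l < 0" if "x < z" "z < y" for z
 proof -
  have z: "th > 0" "0 < z" "z < pi" "0 <= z" using assms that by auto
  have "arcv th z * arc_rate th z > 0"
   using arcv_pos[OF z(1,4,3)] arc_rate_pos[OF z(1-3)] by (rule mult_pos_pos)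
  hence "- (arcv th z * arc_rate th z) < 0" by linarith
  thus ?thesis using arcv_deriv[OF z(1-3)] by blast
 qed
 show "continuous_on {x..y} (arcv th)"
  by (rule continuous_on_subset[OF continuous_on_arcv]) (use assms in auto)
qed

lemma arcv_inj: "th > 0 ==> inj_on (arcv th) {0..pi}"
proof (rule linorder_inj_onI)
 show "arcv th x ~= arcv th y" if "th > 0" "x < y" "x \<in> {0..pi}" "y \<in> {0..pi}" for x y
  using arcv_strict_antimono[of th x y] that by (metis atLeastAtMost_iff less_irrefl)
qed linarith

lemma arcv_image: "th > 0 ==> arcv th ` {0..pi} = {0..arcv th 0}"
proof (intro equalityI subsetI)
 fix y assume t: "th > 0" and y: "y \<in> {0..arcv th 0}"
 have "\<exists>x\<ge>0. x <= pi & arcv th x = y"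
  by (rule IVT2') (use y arcv_pi[OF t] continuous_on_arcv[OF t] in auto)
 thus "y \<in> arcv th ` {0..pi}" by auto
next
 fix y assume t: "th > 0" and "y \<in> arcv th ` {0..pi}"
 then obtain x where x: "0 <= x" "x <= pi" "y = arcv th x" by auto
 have "x = 0 | arcv th x < arcv th 0" "x = pi | arcv th pi < arcv th x"
  using arcv_strict_antimono[of th 0 x] arcv_strict_antimono[of th x pi] t x by linarith+
 thus "y \<in> {0..arcv th 0}" using x arcv_pi[OF t] by auto
qed

subsection \<open>Logarithmic integrals along dilated arcs\<close>

lemma continuous_on_arc_logder:
 assumes "th > 0" shows "continuous_on {0<..<pi} (arc_logder th)"
 unfolding arc_logder_def cot_def
proof (intro continuous_intros ballI)
 fix x assume "x \<in> {0<..<pi}"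
 hence "sin (x / (1 + th)) > 0" "sin (th * x / (1 + th)) > 0" using arcas[of th x] assms by auto
 thus "sin (x / (1 + th)) ~= 0" "sin (th * x / (1 + th)) ~= 0" by simp_all
qed (use assms in auto)

text \<open>The form ds/s along any dilate of the arc, per unit of angle.\<close>

abbreviation arc_log_deriv :: "real => real => complex" where
 "arc_log_deriv th ph \<equiv> of_real (arc_logder th ph) + \<i>"

text \<open>Cauchy's theorem for g(s) ds/s on the region between two dilates and two rays, in the
  form of an exchange of integrals: the same double integrand is the l-derivative of g times ds/s
  along the arc, and the angular derivative of g/l along the ray.\<close>

lemma arc_scaling_homotopy:
 assumes "th > 0" "open S" "g holomorphic_on S" "0 < l1" "l1 <= l2" "0 < p1" "p1 <= p2" "p2 < pi"
  and inS: "!!l ph. l \<in> {l1..l2} ==> ph \<in> {p1..p2} ==> of_real l * arcp th ph \<in> S"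
 shows "integral {p1..p2} (%ph. (g (of_real l2 * arcp th ph) - g (of_real l1 * arcp th ph)) * arc_log_deriv th ph)
    = integral {l1..l2} (%l. (g (of_real l * arcp th p2) - g (of_real l * arcp th p1)) / of_real l)"
proof -
 define K where "K = (%l ph. deriv g (of_real l * arcp th ph) * arcp th ph * arc_log_deriv th ph)"
 have gd: "(g has_field_derivative deriv g s) (at s)" if "s \<in> S" for s
  using holomorphic_derivI[OF assms(3,2) that] .
 have 1: "((%l. K l ph) has_integral (g (of_real l2 * arcp th ph) - g (of_real l1 * arcp th ph)) * arc_log_deriv th ph) {l1..l2}"
  if p: "ph \<in> {p1..p2}" for ph
 proof -
  have "((%l. g (of_real l * arcp th ph) * arc_log_deriv th ph) has_vector_derivative K l ph) (at l within {l1..l2})"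
   if l: "l \<in> {l1..l2}" for l
  proof -
   have "((%l. of_real l * arcp th ph) has_vector_derivative arcp th ph) (at l)"
    by (auto intro!: derivative_eq_intros)
   from field_vector_diff_chain_at[OF this gd[OF inS[OF l p]]]
   have "((%l. g (of_real l * arcp th ph)) has_vector_derivative arcp th ph * deriv g (of_real l * arcp th ph)) (at l)"
    by (simp add: o_def)
   from has_vector_derivative_mult_left[OF this, of "arc_log_deriv th ph"]
   show ?thesis unfolding K_def by (simp add: mult.commute has_vector_derivative_at_within)
  qed
  from fundamental_theorem_of_calculus[OF assms(5) this] show ?thesis by (simp add: left_diff_distrib)
 qed
 have 2: "((%ph. K l ph) has_integral (g (of_real l * arcp th p2) - g (of_real l * arcp th p1)) / of_real l) {p1..p2}"
  if l: "l \<in> {l1..l2}" for l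
 proof -
  have "((%ph. g (of_real l * arcp th ph) / of_real l) has_vector_derivative K l ph) (at ph within {p1..p2})"
   if p: "ph \<in> {p1..p2}" for ph
  proof -
   have "(arcp th has_vector_derivative arcp th ph * arc_log_deriv th ph) (at ph)"
    by (rule arcp_deriv) (use p assms in auto)
   from has_vector_derivative_mult_right[OF this, of "of_real l"]
   have "((%ph. of_real l * arcp th ph) has_vector_derivative of_real l * (arcp th ph * arc_log_deriv th ph)) (at ph)" .
   from field_vector_diff_chain_at[OF this gd[OF inS[OF l p]]]
   have "((%ph. g (of_real l * arcp th ph)) has_vector_derivative 
      of_real l * (arcp th ph * arc_log_deriv th ph) * deriv g (of_real l * arcp th ph)) (at ph)"
    by (simp add: o_def)
   from has_vector_derivative_divide[OF this, of "of_real l"]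
   have "((%ph. g (of_real l * arcp th ph) / of_real l) has_vector_derivative K l ph) (at ph)" 
    unfolding K_def using l assms(4) by (simp add: mult_ac)
   thus ?thesis by (rule has_vector_derivative_at_within)
  qed
  from fundamental_theorem_of_calculus[OF assms(7) this] show ?thesis by (simp add: diff_divide_distrib)
 qed
 have cp: "continuous_on (cbox (l1,p1) (l2,p2)) (%z. arcp th (snd z))"
  by (rule continuous_on_compose2[OF continuous_on_arcp[OF assms(1)]])
    (use assms in \<open>auto intro!: continuous_intros\<close>)
 have cl: "continuous_on (cbox (l1,p1) (l2,p2)) (%z. arc_logder th (snd z))"
  by (rule continuous_on_compose2[OF continuous_on_arc_logder[OF assms(1)]])
    (use assms in \<open>auto intro!: continuous_intros\<close>)
 have "continuous_on S (deriv g)"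
  using assms(2,3) holomorphic_deriv holomorphic_on_imp_continuous_on by blast
 hence cd: "continuous_on (cbox (l1,p1) (l2,p2)) (%z. deriv g (of_real (fst z) * arcp th (snd z)))"
  by (rule continuous_on_compose2) (use inS in \<open>auto intro!: continuous_intros cp\<close>)
 have cK: "continuous_on (cbox (l1,p1) (l2,p2)) (%(l,p). K l p)"
  unfolding K_def case_prod_beta by (intro continuous_intros cp cl cd)
 have "integral {p1..p2} (%ph. (g (of_real l2 * arcp th ph) - g (of_real l1 * arcp th ph)) * arc_log_deriv th ph)
   = integral {p1..p2} (%ph. integral {l1..l2} (%l. K l ph))"
  by (rule Henstock_Kurzweil_Integration.integral_cong) (rule integral_unique[OF 1, symmetric])
 also have "... = integral {l1..l2} (%l. integral {p1..p2} (K l))"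
  using integral_swap_continuous[OF cK] by (simp add: cbox_interval)
 also have "... = integral {l1..l2} (%l. (g (of_real l * arcp th p2) - g (of_real l * arcp th p1)) / of_real l)"
  by (rule Henstock_Kurzweil_Integration.integral_cong) (rule integral_unique[OF 2])
 finally show ?thesis .
qed

text \<open>Replaces an integral over a growing subinterval by one of a truncated function over a
  fixed domain without the exceptional points, as dominated convergence requires.\<close>

lemma integral_restrict_Diff_finite:
 fixes f :: "real => 'a::euclidean_space"
 assumes "finite F" "J \<subseteq> T" "f integrable_on J"
 shows "(%x. if x \<in> J then f x else 0) integrable_on (T - F)"
  "integral (T - F) (%x. if x \<in> J then f x else 0) = integral J f"
proof -
 have n: "negligible (J - J \<inter> (T - F) \<union> (J \<inter> (T - F) - J))"
  by (rule negligible_subset[OF negligible_finite[OF assms(1)]]) (use assms(2) in auto)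
 have n1: "negligible {x \<in> J - J \<inter> (T - F). f x ~= 0}" "negligible {x \<in> J \<inter> (T - F) - J. f x ~= 0}"
  by (rule negligible_subset[OF n], auto)+
 show "(%x. if x \<in> J then f x else 0) integrable_on (T - F)"
  unfolding integrable_restrict_Int using integrable_spike_set[OF assms(3) n1] .
 show "integral (T - F) (%x. if x \<in> J then f x else 0) = integral J f"
  unfolding integral_restrict_Int by (rule integral_spike_set[OF n1(2,1)])
qed

text \<open>The region is bounded by the dilates a -> 1 and b -> infinity and by rays at angles
  tending to 0 and pi. B dominates g on the dilates, F collecting the singular angles. On the rays
  only Re g is assumed to be O(1/l), so Re g dl/l is dominated by dl/l^2; E collects the dilations
  without an edge limit.\<close>

lemma arc_contour_limit:
 fixes g :: "complex => complex" and g1 :: "real => complex" and e0 B :: "real => real"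
 assumes th: "th > 0" and S: "open S" "g holomorphic_on S"
  and inS: "!!l ph. l > 1 ==> 0 < ph ==> ph < pi ==> of_real l * arcp th ph \<in> S"
  and F: "finite F" and B: "B integrable_on {0<..<pi}"
  and bd: "!!l ph. l > 1 ==> ph \<in> {0<..<pi} - F ==> norm (g (of_real l * arcp th ph)) <= B ph"
  and lim1: "!!ph. ph \<in> {0<..<pi} - F ==> ((%l. g (of_real l * arcp th ph)) \<longlongrightarrow> g1 ph) (at_right 1)"
  and liminf: "!!ph. ph \<in> {0<..<pi} - F ==> ((%l. g (of_real l * arcp th ph)) \<longlongrightarrow> \<i> * of_real L) at_top"
  and d: "0 < d" "d < pi / 2"
  and edge: "!!l ph. l > 1 ==> ph \<in> {0<..<d} \<union> {pi-d<..<pi} ==> \<bar>Re (g (of_real l * arcp th ph))\<bar> <= C / l"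
  and E: "finite E"
  and e0: "!!l. l \<in> {1<..} - E ==> ((%ph. Re (g (of_real l * arcp th ph))) \<longlongrightarrow> e0 l) (at_right 0)"
  and epi: "!!l. l \<in> {1<..} - E ==> ((%ph. Re (g (of_real l * arcp th ph))) \<longlongrightarrow> 0) (at_left pi)"
 shows "(%ph. g1 ph * arc_log_deriv th ph) integrable_on {0<..<pi}"
  "(%l. e0 l / l) integrable_on {1<..}"
  "Re (integral {0<..<pi} (%ph. g1 ph * arc_log_deriv th ph)) = - pi * L + integral {1<..} (%l. e0 l / l)"
proof -
 \<comment> \<open>The shift by 2 gives h < 1 for all n, so that ep n stays below d and a n below b
   n.\<close>
 define h where "h = (%n::nat. inverse (real n + 2))"
 have h0: "h \<longlonglongrightarrow> 0" unfolding h_def by real_asymp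
 have hp: "0 < h n" "h n < 1" for n by (auto simp: h_def field_simps)
 define ep where "ep = (%n. d * h n)"
 define a where "a = (%n. 1 + h n)"
 define b where "b = (%n::nat. real n + 2)"
 have ep0: "0 < ep n" "ep n < d" "pi - ep n < pi" "ep n < pi - ep n" "pi - d < pi - ep n" for n
 proof -
  show "0 < ep n" using d hp unfolding ep_def by simp
  show "ep n < d" using d hp[of n] unfolding ep_def by simp
  thus "ep n < pi - ep n" "pi - d < pi - ep n" using d by linarith+
  show "pi - ep n < pi" using `0 < ep n` by simp
 qed
 have ab: "1 < a n" "a n < b n" "1 < b n" for n using hp[of n] by (auto simp: a_def b_def)
 have "ep \<longlonglongrightarrow> 0" unfolding ep_def using tendsto_mult[OF tendsto_const[of d] h0] by simp
 hence e0lim: "filterlim ep (at_right 0) sequentially"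
  using ep0(1) by (simp add: filterlim_at less_imp_neq[THEN not_sym])
 have "(%n. pi - ep n) \<longlonglongrightarrow> pi - 0" by (intro tendsto_diff tendsto_const \<open>ep \<longlonglongrightarrow> 0\<close>)
 hence epilim: "filterlim (%n. pi - ep n) (at_left pi) sequentially"
  using ep0(1) by (simp add: filterlim_at less_imp_neq[THEN not_sym])
 have "a \<longlonglongrightarrow> 1 + 0" unfolding a_def by (intro tendsto_add tendsto_const h0)
 hence alim: "filterlim a (at_right 1) sequentially"
  using ab(1) by (simp add: filterlim_at less_imp_neq[THEN not_sym])
 have blim: "filterlim b at_top sequentially" unfolding b_def by real_asymp
 define q where "q = arc_log_deriv th"
 define J where "J = (%n. {ep n..pi - ep n})"
 define T where "T = {0<..<pi}"
 have JT: "J n \<subseteq> T" for n unfolding J_def T_def using ep0[of n] by auto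
 have inJ: "\<forall>\<^sub>F n in sequentially. ph \<in> J n" if "ph \<in> T" for ph
 proof -
  have "\<forall>\<^sub>F n in sequentially. ep n < ph" "\<forall>\<^sub>F n in sequentially. ep n < pi - ph"
   using order_tendstoD(2)[OF \<open>ep \<longlonglongrightarrow> 0\<close>] that by (auto simp: T_def)
  thus ?thesis by eventually_elim (auto simp: J_def)
 qed
 obtain C1 where C1: "C1 > 0" "!!ph. 0 < ph ==> ph < pi ==> \<bar>arc_logder th ph\<bar> <= C1"
  using arc_logder_bounded[OF th] by blast
 have qb: "norm (q ph) <= C1 + 1" if "ph \<in> T" for ph
  unfolding q_def using C1(2)[of ph] that norm_triangle_ineq[of "of_real (arc_logder th ph)" \<i>] by (auto simp: T_def)
 have cint: "(%ph. g (of_real l * arcp th ph) * q ph) integrable_on J n" if "l > 1" for l n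
  unfolding J_def
 proof (rule integrable_continuous_interval)
  have "continuous_on (J n) (%ph. g (of_real l * arcp th ph))"
   using holomorphic_on_imp_continuous_on[OF S(2)]
   by (rule continuous_on_compose2)
     (use JT[of n] that inS in \<open>auto simp: T_def intro!: continuous_intros continuous_on_subset[OF continuous_on_arcp[OF th]]\<close>)
  moreover have "continuous_on (J n) q" unfolding q_def
   by (intro continuous_intros continuous_on_subset[OF continuous_on_arc_logder[OF th]]) (use JT in \<open>auto simp: T_def\<close>)
  ultimately show "continuous_on {ep n..pi - ep n} (%ph. g (of_real l * arcp th ph) * q ph)"
   unfolding J_def by (intro continuous_intros)
 qed
 have Bint: "(%ph. B ph * (C1 + 1)) integrable_on (T - F)"
 proof -
  have "B integrable_on (T - F)"
   by (rule integrable_spike_set[OF B]) (auto intro: negligible_subset[OF negligible_finite[OF F]] simp: T_def)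
  thus ?thesis by (rule integrable_on_mult_left)
 qed
 have main: "G integrable_on (T - F) & (%n. integral (J n) (%ph. g (of_real (c n) * arcp th ph) * q ph)) \<longlonglongrightarrow> integral (T - F) G"
  if c: "!!n. c n > 1" and lim: "!!ph. ph \<in> T - F ==> (%n. g (of_real (c n) * arcp th ph) * q ph) \<longlonglongrightarrow> G ph" for c G
 proof -
  let ?f = "%n ph. if ph \<in> J n then g (of_real (c n) * arcp th ph) * q ph else 0"
  have 1: "?f n integrable_on (T - F)" for n using integral_restrict_Diff_finite(1)[OF F JT cint[OF c]] .
  have 2: "norm (?f n ph) <= B ph * (C1 + 1)" if "ph \<in> T - F" for n ph
  proof -
   have "norm (g (of_real (c n) * arcp th ph)) <= B ph" using bd[OF c] that by (simp add: T_def)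
   thus ?thesis using qb[of ph] that C1(1) order_trans[OF norm_ge_zero, of _ "B ph"]
    by (auto simp: norm_mult intro!: mult_mono)
  qed
  have 3: "(%n. ?f n ph) \<longlonglongrightarrow> G ph" if "ph \<in> T - F" for ph
   by (rule Lim_transform_eventually[OF lim[OF that]]) (use inJ[of ph] that in \<open>auto elim!: eventually_mono\<close>)
  have "G integrable_on (T - F)" "(%n. integral (T - F) (?f n)) \<longlonglongrightarrow> integral (T - F) G"
   using dominated_convergence[OF 1 Bint 2 3] by auto
  thus ?thesis using integral_restrict_Diff_finite(2)[OF F JT cint[OF c]] by simp
 qed
 have l1: "(%n. g (of_real (a n) * arcp th ph) * q ph) \<longlonglongrightarrow> g1 ph * q ph" if "ph \<in> T - F" for ph
  using filterlim_compose[OF lim1 alim] that by (intro tendsto_mult tendsto_const) (auto simp: T_def)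
 note m1 = conjunct1[OF main[OF ab(1) l1]] conjunct2[OF main[OF ab(1) l1]]
 have l2: "(%n. g (of_real (b n) * arcp th ph) * q ph) \<longlonglongrightarrow> \<i> * of_real L * q ph" if "ph \<in> T - F" for ph
  using filterlim_compose[OF liminf blim] that by (intro tendsto_mult tendsto_const) (auto simp: T_def)
 note m2 = conjunct1[OF main[OF ab(3) l2]] conjunct2[OF main[OF ab(3) l2]]
 have neg: "negligible {x \<in> A - B. f x ~= 0}" if "A - B \<subseteq> F" for A B and f :: "real => complex"
  by (rule negligible_subset[OF negligible_finite[OF F]]) (use that in auto)
 show "(%ph. g1 ph * arc_log_deriv th ph) integrable_on {0<..<pi}"
  using integrable_spike_set[OF m1(1) neg neg, of "{0<..<pi}"] unfolding q_def T_def by blast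
 have i1: "integral (T - F) (%ph. g1 ph * q ph) = integral {0<..<pi} (%ph. g1 ph * arc_log_deriv th ph)"
  unfolding q_def T_def by (rule integral_spike_set; rule neg; blast)
 \<comment> \<open>Since q is a real function plus i, the real part of i L q is the constant - L:
   the contribution of infinity does not depend on the shape of the arc.\<close>
 have "Re (integral (T - F) (%ph. \<i> * of_real L * q ph)) = integral (T - F) (%ph. Re (\<i> * of_real L * q ph))"
  using integral_linear[OF m2(1) bounded_linear_Re] by (simp only: o_def)
 also have "... = integral (T - F) (%ph. - L)" by (simp add: q_def)
 also have "... = integral {0..pi} (%ph. - L)"
  by (rule integral_spike_set; rule negligible_subset[of "insert 0 (insert pi F)"]) (use F in \<open>auto simp: T_def\<close>)
 also have "... = - pi * L" by simp
 finally have i2: "Re (integral (T - F) (%ph. \<i> * of_real L * q ph)) = - pi * L" .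

 define R where "R = (%n l. Re (g (of_real l * arcp th (pi - ep n)) - g (of_real l * arcp th (ep n))) / l)"
 define U where "U = {1<..} - E"
 have abU: "{a n..b n} \<subseteq> {1<..}" for n using ab[of n] by auto
 have gc: "continuous_on {a n..b n} (%l. g (of_real l * arcp th ph))" if "ph \<in> T" for n ph
  using holomorphic_on_imp_continuous_on[OF S(2)]
  by (rule continuous_on_compose2) (use abU[of n] that inS in \<open>auto simp: T_def intro!: continuous_intros\<close>)
 have eT: "ep n \<in> T" "pi - ep n \<in> T" for n using ep0[of n] d by (auto simp: T_def)
 have ci: "(%l. (g (of_real l * arcp th (pi - ep n)) - g (of_real l * arcp th (ep n))) / of_real l) integrable_on {a n..b n}" for n
  by (intro integrable_continuous_interval continuous_intros gc eT) (use ab[of n] in auto)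
 have Rint: "R n integrable_on {a n..b n}" for n
  using integrable_linear[OF ci bounded_linear_Re, of n] by (simp add: o_def R_def)
 have eqn: "Re (integral (J n) (%ph. g (of_real (b n) * arcp th ph) * q ph) - integral (J n) (%ph. g (of_real (a n) * arcp th ph) * q ph))
   = integral U (%l. if l \<in> {a n..b n} then R n l else 0)" for n
 proof -
  have "integral (J n) (%ph. g (of_real (b n) * arcp th ph) * q ph) - integral (J n) (%ph. g (of_real (a n) * arcp th ph) * q ph)
    = integral (J n) (%ph. (g (of_real (b n) * arcp th ph) - g (of_real (a n) * arcp th ph)) * q ph)"
   unfolding left_diff_distrib
   by (rule integral_diff[symmetric]) (use cint ab in auto)
  also have "... = integral {a n..b n} (%l. (g (of_real l * arcp th (pi - ep n)) - g (of_real l * arcp th (ep n))) / of_real l)"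
   unfolding J_def q_def by (rule arc_scaling_homotopy[OF th S]) (use ab[of n] ep0[of n] inS in auto)
  finally have "Re (integral (J n) (%ph. g (of_real (b n) * arcp th ph) * q ph) - integral (J n) (%ph. g (of_real (a n) * arcp th ph) * q ph))
   = integral {a n..b n} (R n)"
   using integral_linear[OF ci bounded_linear_Re, of n] by (simp add: o_def R_def)
  thus ?thesis unfolding U_def using integral_restrict_Diff_finite(2)[OF E abU Rint] by simp
 qed
 have cc: "continuous_on {1<..} (%l::real. 2 * C / l\<^sup>2)" by (intro continuous_intros) auto
 have "(%l::real. 2 * C * (1 / l ^ 2)) integrable_on {1..}"
  using has_integral_inverse_power_to_inf[of 2 1] by (intro integrable_on_mult_right) (auto simp: integrable_on_def)
 hence hU: "(%l::real. 2 * C * (1 / l ^ 2)) integrable_on U"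
 proof (rule integrable_spike_set)
  have "negligible (insert 1 E)" using E by (intro negligible_finite) simp
  thus "negligible {x \<in> {1..} - U. 2 * C * (1 / x\<^sup>2) ~= 0}" "negligible {x \<in> U - {1..}. 2 * C * (1 / x\<^sup>2) ~= 0}"
   by (rule negligible_subset, force simp: U_def)+
 qed
 have R1: "(%l. if l \<in> {a n..b n} then R n l else 0) integrable_on U" for n
  unfolding U_def by (rule integral_restrict_Diff_finite(1)[OF E abU Rint])
 have R2: "norm (if l \<in> {a n..b n} then R n l else 0) <= 2 * C * (1 / l ^ 2)" if "l \<in> U" for n l
 proof -
  have l: "l > 1" using that by (auto simp: U_def)
  have "\<bar>Re (g (of_real l * arcp th (pi - ep n)))\<bar> <= C / l" "\<bar>Re (g (of_real l * arcp th (ep n)))\<bar> <= C / l"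
   using edge[OF l] ep0[of n] by auto
  hence "\<bar>Re (g (of_real l * arcp th (pi - ep n)) - g (of_real l * arcp th (ep n)))\<bar> <= 2 * (C / l)" by simp
  hence "\<bar>Re (g (of_real l * arcp th (pi - ep n)) - g (of_real l * arcp th (ep n)))\<bar> / l <= 2 * (C / l) / l"
   by (rule divide_right_mono) (use l in simp)
  hence "\<bar>R n l\<bar> <= 2 * (C / l) / l" unfolding R_def abs_divide using l by simp
  also have "... = 2 * C * (1 / l ^ 2)" by (simp add: power2_eq_square)
  finally have *: "\<bar>R n l\<bar> <= 2 * C * (1 / l ^ 2)" .
  thus ?thesis using order_trans[OF abs_ge_zero *] by simp
 qed
 have R3: "(%n. if l \<in> {a n..b n} then R n l else 0) \<longlonglongrightarrow> - (e0 l / l)" if l: "l \<in> U" for l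
 proof -
  have lE: "l \<in> {1<..} - E" and "l ~= 0" using l by (auto simp: U_def)
  have "(%n. R n l) \<longlonglongrightarrow> (0 - e0 l) / l" unfolding R_def minus_complex.sel
   by (intro tendsto_divide tendsto_diff tendsto_const \<open>l ~= 0\<close>
     filterlim_compose[OF e0[OF lE] e0lim] filterlim_compose[OF epi[OF lE] epilim])
  have e1: "\<forall>\<^sub>F n in sequentially. a n < l" using order_tendstoD(2)[OF \<open>a \<longlonglongrightarrow> 1 + 0\<close>, of l] l by (simp add: U_def)
  have e2: "\<forall>\<^sub>F n in sequentially. b n >= l" using blim by (simp add: filterlim_at_top)
  from eventually_conj[OF e1 e2] have "\<forall>\<^sub>F n in sequentially. R n l = (if l \<in> {a n..b n} then R n l else 0)"
   by (rule eventually_mono) auto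
  from Lim_transform_eventually[OF \<open>(%n. R n l) \<longlonglongrightarrow> (0 - e0 l) / l\<close> this] show ?thesis by simp
 qed
 note dc = dominated_convergence[OF R1 hU R2 R3]
 have ei: "(%l. e0 l / l) integrable_on U" using integrable_neg[OF dc(1)] by simp
 show "(%l. e0 l / l) integrable_on {1<..}"
  using ei
 proof (rule integrable_spike_set)
  show "negligible {x \<in> U - {1<..}. e0 x / x ~= 0}" "negligible {x \<in> {1<..} - U. e0 x / x ~= 0}"
   by (rule negligible_subset[OF negligible_finite[OF E]], force simp: U_def)+
 qed
 have i3: "integral U (%l. - (e0 l / l)) = - integral {1<..} (%l. e0 l / l)"
 proof -
  have "integral U (%l. e0 l / l) = integral {1<..} (%l. e0 l / l)"
   by (rule integral_spike_set; (rule negligible_subset[OF negligible_finite[OF E]])?) (auto simp: U_def)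
  thus ?thesis by simp
 qed
 have "(%n. Re (integral (J n) (%ph. g (of_real (b n) * arcp th ph) * q ph) - integral (J n) (%ph. g (of_real (a n) * arcp th ph) * q ph)))
   \<longlonglongrightarrow> Re (integral (T - F) (%ph. \<i> * of_real L * q ph) - integral (T - F) (%ph. g1 ph * q ph))"
  by (intro tendsto_intros m1 m2)
 moreover have "(%n. Re (integral (J n) (%ph. g (of_real (b n) * arcp th ph) * q ph) - integral (J n) (%ph. g (of_real (a n) * arcp th ph) * q ph)))
   \<longlonglongrightarrow> integral U (%l. - (e0 l / l))"
  unfolding eqn using dc(2) .
 ultimately have "Re (integral (T - F) (%ph. \<i> * of_real L * q ph) - integral (T - F) (%ph. g1 ph * q ph)) = integral U (%l. - (e0 l / l))"
  by (rule LIMSEQ_unique)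
 thus "Re (integral {0<..<pi} (%ph. g1 ph * arc_log_deriv th ph)) = - pi * L + integral {1<..} (%l. e0 l / l)"
  unfolding minus_complex.sel i1 i2 i3 by linarith
qed

text \<open>A logarithm whose branch cut is the negative imaginary axis, so that it is analytic up to the real
  axis when approached from the upper half-plane.\<close>
definition up_ln :: "complex => complex" where
 "up_ln z = Ln (- \<i> * z) + \<i> * of_real (pi / 2)"

lemma up_ln_cis:
 assumes "r > 0" "0 <= ph" "ph <= pi"
 shows "up_ln (of_real r * cis ph) = of_real (ln r) + \<i> * of_real ph"
proof -
 define w where "w = of_real (ln r) + \<i> * of_real (ph - pi/2)"
 have "exp w = of_real r * cis (ph - pi/2)"
  unfolding w_def exp_add using assms(1) by (simp add: cis_conv_exp exp_of_real mult.commute)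
 also have "cis (ph - pi/2) = - \<i> * cis ph" by (simp add: complex_eq_iff cos_diff sin_diff)
 finally have "- \<i> * (of_real r * cis ph) = exp w" by simp
 moreover have "Ln (exp w) = w"
 proof (rule Ln_exp)
  have "Im w = ph - pi/2" by (simp add: w_def)
  thus "- pi < Im w" "Im w <= pi" using assms pi_gt_zero by linarith+
 qed
 ultimately have "up_ln (of_real r * cis ph) = w + \<i> * of_real (pi/2)" unfolding up_ln_def by simp
 thus ?thesis by (simp add: w_def algebra_simps)
qed

lemma Re_up_ln: "z ~= 0 ==> Re (up_ln z) = ln (norm z)"
 by (simp add: up_ln_def norm_mult)

lemma upper_not_cut: "0 <= Im z ==> z ~= 0 ==> - \<i> * z \<notin> \<real>\<^sub>\<le>\<^sub>0"
 by (auto simp: complex_nonpos_Reals_iff complex_eq_iff)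

lemma up_ln_deriv:
 assumes "0 <= Im z" "z ~= 0" shows "(up_ln has_field_derivative 1 / z) (at z)"
proof -
 have d: "((%z. - \<i> * z) has_field_derivative - \<i>) (at z)"
  using DERIV_cmult_Id[of "- \<i>" z UNIV] .
 have "(Ln has_field_derivative inverse (- \<i> * z)) (at (- \<i> * z))"
  by (rule has_field_derivative_Ln[OF upper_not_cut[OF assms]])
 from DERIV_add[OF DERIV_chain2[OF this d] DERIV_const[of "\<i> * of_real (pi/2)"]]
 have D: "(up_ln has_field_derivative inverse (- \<i> * z) * (- \<i>)) (at z)"
  unfolding up_ln_def[abs_def] by simp
 have "inverse (- \<i> * z) * (- \<i>) * z = inverse (- \<i> * z) * (- \<i> * z)" by (simp only: mult.assoc)
 also have "... = 1" by (rule left_inverse) (use assms in simp)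
 finally have "inverse (- \<i> * z) * (- \<i>) = 1 / z" using assms(2) by (metis nonzero_mult_div_cancel_right)
 with D show ?thesis by metis
qed

section \<open>The map J for c = 1 on the closed upper half-plane and outside the arc\<close>

definition J_map :: "real => complex => complex" where
 "J_map th s = (s + 1) * exp ((up_ln (s + 1) - up_ln s) / of_real th)"

text \<open>The logarithmic derivative s J'(s)/J(s). Its zero is the critical point 1/th and its
  pole is -1, the two ends of the arc.\<close>

definition J_log_rate :: "real => complex => complex" where
 "J_log_rate th s = 1 - of_real (1 + 1 / th) / (s + 1)"

text \<open>Once the arguments of s and s + 1 are known, J has argument al + (al - ph)/th; all
  statements on where J is real or has positive imaginary part are read off from this angle.\<close>

lemma J_map_polar:
 assumes "th > 0" "s = of_real r * cis ph" "s + 1 = of_real k * cis al" "r > 0" "k > 0"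
  "0 <= ph" "ph <= pi" "0 <= al" "al <= pi"
 shows "J_map th s = of_real (k * (k / r) powr (1 / th)) * cis (al + (al - ph) / th)"
proof -
 have u1: "up_ln (s + 1) = of_real (ln k) + \<i> * of_real al" unfolding assms(3) by (rule up_ln_cis) (use assms in auto)
 have u2: "up_ln s = of_real (ln r) + \<i> * of_real ph" unfolding assms(2) by (rule up_ln_cis) (use assms in auto)
 have "up_ln (s + 1) - up_ln s = of_real (ln (k / r)) + \<i> * of_real (al - ph)"
  unfolding u1 u2 using assms(4,5) by (simp add: ln_div algebra_simps)
 hence "(up_ln (s + 1) - up_ln s) / of_real th = of_real (1/th * ln (k / r)) + \<i> * of_real ((al - ph) / th)"
  by (simp add: add_divide_distrib)
 hence "exp ((up_ln (s + 1) - up_ln s) / of_real th) = of_real ((k / r) powr (1 / th)) * cis ((al - ph) / th)"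
  using assms(4,5) by (simp add: exp_add cis_conv_exp powr_def exp_of_real[symmetric])
 thus ?thesis unfolding J_map_def assms(3) by (simp add: cis_mult[symmetric])
qed

lemma J_map_arc:
 assumes "th > 0" "0 <= ph" "ph <= pi"
 shows "J_map th (arcp th ph) = of_real (arcv th ph)"
proof (cases "ph = pi")
 case True
 have "arcp th pi + 1 = 0" using arcp_add_1[of th pi] assms by (simp add: arc_shift_def)
 thus ?thesis using True arcv_pi assms by (simp add: J_map_def)
next
 case False
 define al where "al = ph / (1 + th)"
 have a: "0 <= al" "al <= pi" "al + (al - ph) / th = 0"
 proof -
  show "0 <= al" using assms by (simp add: al_def)
  have "al <= ph" using assms by (simp add: al_def field_simps)
  thus "al <= pi" using assms by simp
  have "al * (1 + th) = ph" using assms by (simp add: al_def)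
  thus "al + (al - ph) / th = 0" using assms by (simp add: field_simps)
 qed
 have "J_map th (arcp th ph) = of_real (arc_shift th ph * (arc_shift th ph / arcr th ph) powr (1 / th)) * cis (al + (al - ph) / th)"
  by (rule J_map_polar) (use assms False a arc_shift_pos[of th ph] arcr_pos[of th ph] arcp_add_1[of th ph]
    in \<open>simp_all add: arcp_def al_def\<close>)
 thus ?thesis by (simp add: a arcv_def)
qed

lemma J_map_deriv:
 assumes "th > 0" "0 <= Im s" "s ~= 0" "s ~= -1"
 shows "(J_map th has_field_derivative J_map th s * J_log_rate th s / s) (at s)"
proof -
 have n: "s + 1 ~= 0" using assms(4) by (metis add_eq_0_iff2 add.commute)
 have d1: "(up_ln has_field_derivative 1 / s) (at s)" by (rule up_ln_deriv) (use assms in auto)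
 have d2: "((%s. up_ln (s + 1)) has_field_derivative 1 / (s+1)) (at s)"
  using up_ln_deriv[of "s+1"] n assms DERIV_shift[of up_ln "1/(s+1)" s 1] by simp
 have "((%s. (up_ln (s + 1) - up_ln s) / of_real th) has_field_derivative (1/(s+1) - 1/s) / of_real th) (at s)"
  by (intro DERIV_cdivide DERIV_diff d1 d2)
 from DERIV_chain2[OF DERIV_exp this]
 have "(J_map th has_field_derivative 1 * exp ((up_ln (s + 1) - up_ln s) / of_real th) + exp ((up_ln (s + 1) - up_ln s) / of_real th) * ((1/(s+1) - 1/s) / of_real th) * (s+1)) (at s)"
  unfolding J_map_def[abs_def] by (intro DERIV_mult) (auto intro!: derivative_eq_intros)
 moreover have "1 * E + E * ((1/(s+1) - 1/s) / of_real th) * (s+1) = (s+1) * E * J_log_rate th s / s" for E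
 proof -
  have r: "(s+1) * J_log_rate th s = s - 1 / of_real th"
   unfolding J_log_rate_def using n by (simp add: right_diff_distrib)
  have "(1/(s+1) - 1/s) * (s+1) = 1 - (s+1) / s" using n by (simp add: left_diff_distrib)
  also have "... = - 1 / s" using assms by (simp add: add_divide_distrib)
  finally have l: "(1/(s+1) - 1/s) * (s+1) = - 1 / s" .
  have "1 * E + E * ((1/(s+1) - 1/s) / of_real th) * (s+1) = E + E / of_real th * ((1/(s+1) - 1/s) * (s+1))" by simp
  also have "... = E * (s - 1 / of_real th) / s" unfolding l using assms by (simp add: field_simps)
  also have "... = (s+1) * E * J_log_rate th s / s" unfolding r[symmetric] by simp
  finally show ?thesis .
 qed
 ultimately show ?thesis unfolding J_map_def by metis
qed

lemma norm_J_map: "th > 0 ==> s ~= 0 ==> s ~= -1 ==> norm (J_map th s) = norm (s+1) * (norm (s+1) / norm s) powr (1/th)"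
proof -
 assume a: "th > 0" "s ~= 0" "s ~= -1"
 have n: "s + 1 ~= 0" using a(3) by (metis add_eq_0_iff2 add.commute)
 have "Re ((up_ln (s + 1) - up_ln s) / of_real th) = (1/th) * ln (norm (s+1) / norm s)"
  using n a by (simp add: Re_up_ln ln_div Re_divide_of_real)
 thus ?thesis unfolding J_map_def norm_mult norm_exp_eq_Re using n a by (simp add: powr_def)
qed

text \<open>\<open>up_ln (s + 1)\<close> has a default value at s = -1, but the factor s + 1 gives
  the value 0 there, and 0 is also the limit because |s + 1|/|s| <= 1 nearby.\<close>

lemma isCont_J_map_neg1:
 assumes "th > 0" shows "isCont (J_map th) (-1)"
proof -
 have "(J_map th \<longlongrightarrow> 0) (at (-1))"
 proof (rule tendsto_norm_zero_cancel, rule tendsto_sandwich)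
  show "\<forall>\<^sub>F s in at (-1). 0 <= norm (J_map th s)" by simp
  show "\<forall>\<^sub>F s in at (-1). norm (J_map th s) <= norm (s+1) * (1 powr (1/th))"
   unfolding eventually_at
  proof (intro exI[of _ "1/2"] conjI ballI impI)
   fix s :: complex assume *: "s ~= -1 & dist s (-1) < 1/2"
   hence s: "norm (s+1) < 1/2" by (simp add: dist_norm)
   have "norm s >= 1/2" using norm_triangle_ineq4[of "s+1" s] s by simp
   hence "s ~= 0" "norm (s+1) / norm s <= 1" using s by (auto simp: divide_le_eq)
   have "(norm (s+1) / norm s) powr (1/th) <= 1"
    by (rule powr_le1) (use assms \<open>norm (s+1) / norm s <= 1\<close> in auto)
   thus "norm (J_map th s) <= norm (s+1) * (1 powr (1/th))"
    using * assms \<open>s ~= 0\<close> by (simp add: norm_J_map mult_left_le)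
  qed simp
  show "((%s. norm (s+1) * (1 powr (1/th))) \<longlongrightarrow> 0) (at (-1::complex))"
   by (auto intro!: tendsto_eq_intros)
 qed auto
 thus ?thesis by (simp add: isCont_def J_map_def)
qed

lemma sin_diff_pos_imp_less:
 assumes "sin (a - b) > 0" "0 <= a" "a <= pi" "0 <= b" "b <= pi" shows "b < a"
proof (rule ccontr)
 assume "~ b < a"
 hence "sin (b - a) >= 0" using assms by (intro sin_ge_zero) auto
 moreover have "sin (a - b) = - sin (b - a)" by (metis minus_diff_eq sin_minus)
 ultimately show False using assms(1) by linarith
qed

text \<open>Dilating the arc keeps the argument of s and moves s + 1 strictly between its directions
  on the arc and at infinity. Both inequalities are signs of imaginary parts after rotating s + 1 by
  - ph and by - ph/(1 + th).\<close>

lemma arc_exterior_angle: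
 assumes "th > 0" "l > 1" "0 < ph" "ph < pi"
 obtains k al where "of_real l * arcp th ph + 1 = of_real k * cis al" "k > 0" "ph / (1 + th) < al" "al < ph" "0 < al"
proof -
 define r where "r = arcr th ph"
 have r: "r > 0" using arcr_pos[of th ph] assms by (simp add: r_def)
 define z where "z = of_real l * arcp th ph + 1"
 define al where "al = Arg z"
 define k where "k = norm z"
 define u where "u = ph / (1 + th)"
 have u: "0 < u" "u < pi" using arcas[of th ph] assms by (auto simp: u_def)
 have zp: "z = of_real (l * r) * cis ph + 1" unfolding z_def arcp_def r_def by simp
 have Im: "Im z > 0" unfolding zp using assms r by (simp add: sin_gt_zero)
 have zk: "z = of_real k * cis al" using rcis_cmod_Arg[of z] by (simp add: rcis_def k_def al_def)
 have k: "k > 0" using Im unfolding k_def by auto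
 have al0: "0 < al" "al < pi" using Im Arg_lt_pi[of z] by (auto simp: al_def)
 have "Im (z * cis (- ph)) = Im (of_real (l * r) + cis (-ph))"
  unfolding zp by (simp add: distrib_right cis_mult)
 hence "k * sin (al - ph) = - sin ph" unfolding zk by (simp add: cis_mult sin_diff algebra_simps)
 moreover have "sin (al - ph) = - sin (ph - al)" by (metis minus_diff_eq sin_minus)
 ultimately have "k * sin (ph - al) = sin ph" by simp
 hence "sin (ph - al) > 0" using k sin_gt_zero[OF assms(3,4)] by (metis zero_less_mult_pos)
 hence 1: "al < ph" by (rule sin_diff_pos_imp_less) (use al0 assms in auto)
 have "z = of_real l * (arcp th ph + 1) - of_real (l - 1)" unfolding z_def by (simp add: algebra_simps)
 also have "... = of_real (l * arc_shift th ph) * cis u - of_real (l - 1)"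
  using arcp_add_1[of th ph] assms by (simp add: u_def)
 finally have "Im (z * cis (- u)) = Im (of_real (l * arc_shift th ph) - of_real (l-1) * cis (-u))"
  by (simp add: left_diff_distrib cis_mult)
 hence "k * sin (al - u) = (l - 1) * sin u" unfolding zk by (simp add: cis_mult sin_diff algebra_simps)
 moreover have "(l - 1) * sin u > 0" using assms(2) sin_gt_zero[OF u] by simp
 ultimately have "sin (al - u) > 0" using k by (metis zero_less_mult_pos)
 hence 2: "u < al" by (rule sin_diff_pos_imp_less) (use al0 u in auto)
 show ?thesis using that[of k al] zk k 1 2 al0 unfolding z_def u_def by blast
qed

text \<open>The argument al + (al - ph)/th of J increases with al, from 0 at al = ph/(1 + th) to ph
  at al = ph, so it stays strictly inside (0, pi).\<close>

lemma Im_J_map_exterior: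
 assumes "th > 0" "l > 1" "0 < ph" "ph < pi"
 shows "Im (J_map th (of_real l * arcp th ph)) > 0"
proof -
 from arc_exterior_angle[OF assms] obtain k al where ka: "of_real l * arcp th ph + 1 = of_real k * cis al"
  "k > 0" "ph / (1 + th) < al" "al < ph" "0 < al" by blast
 define r where "r = l * arcr th ph"
 have r: "r > 0" using arcr_pos[of th ph] assms by (simp add: r_def)
 have J: "J_map th (of_real l * arcp th ph) = of_real (k * (k / r) powr (1 / th)) * cis (al + (al - ph) / th)"
  by (rule J_map_polar) (use ka r assms in \<open>auto simp: r_def arcp_def\<close>)
 have "(al - ph) / th < 0" using ka assms by (simp add: divide_less_0_iff)
 hence 1: "al + (al - ph) / th < pi" using ka assms by linarith
 have "ph < al * (1 + th)" using ka(3) assms by (simp add: divide_less_eq)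
 hence 2: "0 < al + (al - ph) / th" using assms by (simp add: field_simps)
 have "sin (al + (al - ph) / th) > 0" by (rule sin_gt_zero[OF 2 1])
 thus ?thesis unfolding J using ka r by simp
qed

section \<open>Distances in polar coordinates\<close>

lemma sin_ge_half: 
 fixes x :: real assumes "0 <= x" "x <= pi / 2" shows "sin x >= x / 2"
proof (cases "x <= pi/3")
 \<comment> \<open>sin x - x/2 has derivative cos x - 1/2, which changes sign at pi/3: compare with
   0 on the left and with pi/2 on the right.\<close>
 case True
 have "(%x. sin x - x/2) 0 <= (%x. sin x - x/2) x"
 proof (rule DERIV_nonneg_imp_nondecreasing[OF assms(1)])
  fix t assume t: "0 <= t" "t <= x"
  have "cos t >= cos (pi/3)" using t True by (intro cos_monotone_0_pi_le) auto
  thus "\<exists>y. ((%x. sin x - x/2) has_real_derivative y) (at t) & 0 <= y"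
   by (intro exI[of _ "cos t - 1/2"]) (auto intro!: derivative_eq_intros simp: cos_60)
 qed
 thus ?thesis by simp
next
 case False
 have "(%x. sin x - x/2) x >= (%x. sin x - x/2) (pi/2)"
 proof (rule DERIV_nonpos_imp_nonincreasing[OF assms(2)])
  fix t assume t: "x <= t" "t <= pi/2"
  have "cos t <= cos (pi/3)" using t False by (intro cos_monotone_0_pi_le) auto
  thus "\<exists>y. ((%x. sin x - x/2) has_real_derivative y) (at t) & y <= 0"
   by (intro exI[of _ "cos t - 1/2"]) (auto intro!: derivative_eq_intros simp: cos_60)
 qed
 thus ?thesis using pi_less_4 by simp
qed

lemma polar_dist_sq:
 "(norm (of_real r * cis a - of_real t * cis b))\<^sup>2 = (r - t)\<^sup>2 + 4 * r * t * (sin ((a - b) / 2))\<^sup>2"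
proof -
 have "(norm (of_real r * cis a - of_real t * cis b))\<^sup>2 = (r * cos a - t * cos b)\<^sup>2 + (r * sin a - t * sin b)\<^sup>2"
  by (simp add: cmod_power2)
 also have "... = r\<^sup>2 * ((sin a)\<^sup>2 + (cos a)\<^sup>2) + t\<^sup>2 * ((sin b)\<^sup>2 + (cos b)\<^sup>2) - 2 * r * t * cos (a - b)"
  unfolding cos_diff by algebra
 also have "cos (a - b) = 1 - 2 * (sin ((a-b)/2))\<^sup>2" 
 proof -
  have "2 * ((a-b)/2) = a - b" by simp
  thus ?thesis using cos_double_sin[of "(a-b)/2"] by metis
 qed
 finally show ?thesis by (simp add: power2_eq_square algebra_simps)
qed

text \<open>The radial part of the distance is dropped. The angular part alone gives majorants that
  depend on the angle only, uniformly in the dilation.\<close>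

lemma polar_dist_lower:
 assumes "r >= 0" "t >= 0" "\<bar>a - b\<bar> <= pi"
 shows "(norm (of_real r * cis a - of_real t * cis b))\<^sup>2 >= r * t * (a - b)\<^sup>2 / 4"
proof -
 have "(sin ((a - b) / 2))\<^sup>2 = (sin (\<bar>a - b\<bar> / 2))\<^sup>2" 
 proof (cases "a >= b")
  case False
  hence e: "\<bar>a - b\<bar> = b - a" by simp
  have "(a - b) / 2 = - ((b - a) / 2)" by (metis minus_diff_eq minus_divide_left)
  thus ?thesis unfolding e by (simp only: sin_minus power2_minus)
 qed simp
 moreover have "sin (\<bar>a - b\<bar> / 2) >= \<bar>a - b\<bar> / 4" using sin_ge_half[of "\<bar>a-b\<bar>/2"] assms by simp
 hence "(sin (\<bar>a - b\<bar> / 2))\<^sup>2 >= (\<bar>a - b\<bar> / 4)\<^sup>2" by (intro power_mono) auto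
 ultimately have "(sin ((a - b) / 2))\<^sup>2 >= (a - b)\<^sup>2 / 16" by (simp add: power_divide)
 hence "4 * (r * t) * (sin ((a - b) / 2))\<^sup>2 >= 4 * (r * t) * ((a - b)\<^sup>2 / 16)"
  using assms by (intro mult_left_mono) auto
 moreover have "4 * (r * t) * ((a - b)\<^sup>2 / 16) = r * t * (a - b)\<^sup>2 / 4" by simp
 moreover have "4 * r * t * (sin ((a - b) / 2))\<^sup>2 = 4 * (r * t) * (sin ((a - b) / 2))\<^sup>2" by simp
 ultimately show ?thesis unfolding polar_dist_sq using zero_le_power2[of "r - t"] by linarith
qed

subsection \<open>The complexified Green function of the arc\<close>

text \<open>A holomorphic function with real part ln (|s - cnj a|/|s - a|) for a on the arc.
  Dividing by a before taking \<open>Ln\<close> places the cut on the ray from a through 0, away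
  from the exterior of the arc; ln |a| undoes the scaling, and the imaginary constant makes the
  value at -1 equal to 0.\<close>

definition extlog :: "real => real => complex => complex" where
 "extlog th p s = up_ln (s - cnj (arcp th p)) - Ln (s / arcp th p - 1)
   - of_real (ln (norm (arcp th p))) - \<i> * of_real (p - 2 * p / (1 + th))"

lemma norm_arcp: "th > 0 ==> 0 <= ph ==> ph <= pi ==> norm (arcp th ph) = arcr th ph"
 using arcr_pos[of th ph] by (simp add: arcp_def norm_mult)

lemma Im_arcp_pos: "th > 0 ==> 0 < ph ==> ph < pi ==> Im (arcp th ph) > 0"
 using arcr_pos[of th ph] by (simp add: arcp_def sin_gt_zero)

lemma arcp_nz: "th > 0 ==> 0 <= ph ==> ph <= pi ==> arcp th ph ~= 0"
 using norm_arcp[of th ph] arcr_pos[of th ph] by auto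

lemma Im_scaled_arc_nonneg: "th > 0 ==> l > 0 ==> 0 <= ph ==> ph <= pi ==> Im (of_real l * arcp th ph) >= 0"
 using arcr_pos[of th ph] by (simp add: arcp_def sin_ge_zero)

text \<open>A point of a dilated arc meets the cut only if it has the same argument as a, and then
  it lies between 0 and a. Hence \<open>extlog\<close> is analytic on all dilates with l >
  1.\<close>

lemma arc_cut:
 assumes "th > 0" "0 < p" "p < pi" "l > 0" "0 <= ph" "ph <= pi"
  "of_real l * arcp th ph / arcp th p - 1 \<in> \<real>\<^sub>\<le>\<^sub>0"
 shows "ph = p & l <= 1"
proof -
 define k where "k = l * arcr th ph / arcr th p"
 have r: "arcr th ph > 0" "arcr th p > 0" using assms arcr_pos by auto
 have k: "k > 0" using r assms by (simp add: k_def)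
 have "of_real l * arcp th ph / arcp th p = of_real k * (cis ph / cis p)"
  by (simp add: k_def arcp_def)
 hence eq: "of_real l * arcp th ph / arcp th p = of_real k * cis (ph - p)" by (simp only: cis_divide)
 have *: "k * sin (ph - p) = 0" "k * cos (ph - p) <= 1"
  using assms(7) unfolding eq complex_nonpos_Reals_iff by auto
 hence "sin (ph - p) = 0" using k by simp
 hence "ph - p = 0" by (rule sin_eq_0_pi[rotated 2]) (use assms in auto)
 hence "ph = p" by simp
 moreover from this * have "k <= 1" by simp
 ultimately show ?thesis using r by (simp add: k_def)
qed

lemma extlog_deriv:
 assumes "th > 0" "0 < p" "p < pi" "0 <= Im s" "s / arcp th p - 1 \<notin> \<real>\<^sub>\<le>\<^sub>0"
 shows "(extlog th p has_field_derivative 1 / (s - cnj (arcp th p)) - 1 / (s - arcp th p)) (at s)"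
proof -
 define a where "a = arcp th p"
 have a: "Im a > 0" "a ~= 0" using Im_arcp_pos[of th p] assms by (auto simp: a_def)
 have 1: "0 <= Im (s - cnj a)" "s - cnj a ~= 0" using a assms(4) by (auto simp: complex_eq_iff)
 have d1: "((%s. up_ln (s - cnj a)) has_field_derivative 1 / (s - cnj a)) (at s)"
  using up_ln_deriv[OF 1] DERIV_shift[of up_ln "1/(s - cnj a)" s "- cnj a"] by simp
 have d2: "((%s. s / a - 1) has_field_derivative 1 / a) (at s)"
  using a by (auto intro!: derivative_eq_intros)
 have d3: "((%s. Ln (s / a - 1)) has_field_derivative inverse (s / a - 1) * (1 / a)) (at s)"
  by (rule DERIV_chain2[OF has_field_derivative_Ln d2]) (use assms(5) a_def in simp)
 have "s / a - 1 ~= 0" using assms(5) by (auto simp: a_def)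
 hence "s - a ~= 0" using a(2) by auto
 hence e: "inverse (s / a - 1) * (1 / a) = 1 / (s - a)" using a by (simp add: divide_simps)
 have "((%s. up_ln (s - cnj a) - Ln (s / a - 1) - of_real (ln (norm a)) - \<i> * of_real (p - 2 * p / (1 + th)))
   has_field_derivative 1 / (s - cnj a) - 1 / (s - a) - 0 - 0) (at s)"
  by (intro DERIV_diff d1 d3[unfolded e] DERIV_const)
 thus ?thesis unfolding extlog_def[abs_def] a_def by simp
qed

lemma Re_extlog:
 assumes "th > 0" "0 < p" "p < pi" "s ~= arcp th p" "s ~= cnj (arcp th p)"
 shows "Re (extlog th p s) = ln (norm (s - cnj (arcp th p)) / norm (s - arcp th p))"
proof -
 define a where "a = arcp th p"
 have a: "a ~= 0" using arcp_nz[of th p] assms by (auto simp: a_def)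
 have n: "s - a ~= 0" "s - cnj a ~= 0" "s / a - 1 ~= 0" using assms a by (auto simp: a_def)
 have "norm (s / a - 1) = norm (s - a) / norm a" using a by (simp add: norm_divide[symmetric] diff_divide_distrib)
 hence "Re (Ln (s / a - 1)) = ln (norm (s - a)) - ln (norm a)" using n a by (simp add: ln_div)
 thus ?thesis unfolding extlog_def a_def[symmetric] using n by (simp add: Re_up_ln ln_div)
qed

text \<open>This fixes the constant in \<open>extlog\<close>. The zero cancels the pole of
  \<open>J_log_rate\<close> at -1, without which the products below would not be integrable up to
  the end of the arc.\<close>

lemma extlog_neg1:
 assumes "th > 0" "0 < p" "p < pi" shows "extlog th p (-1) = 0"
proof -
 define a where "a = arcp th p"
 define al where "al = p / (1 + th)"
 define r R where "r = arcr th p" and "R = arc_shift th p"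
 have rR: "r > 0" "R > 0" using arcr_pos[of th p] arc_shift_pos[of th p] assms by (auto simp: r_def R_def)
 have al0: "0 < al" "al < p" using arcas(1,3,7)[of th p] assms unfolding al_def by linarith+
 have a: "a = of_real r * cis p" by (simp add: a_def arcp_def r_def)
 have a1: "a + 1 = of_real R * cis al" unfolding a_def R_def al_def by (rule arcp_add_1) (use assms in auto)
 have "-1 - cnj a = - cnj (a + 1)" by simp
 also have "... = of_real R * cis (pi - al)" unfolding a1 by (simp add: complex_eq_iff)
 finally have 1: "up_ln (-1 - cnj a) = of_real (ln R) + \<i> * of_real (pi - al)"
  using up_ln_cis[OF rR(2), of "pi - al"] al0 assms by simp
 have "a ~= 0" using rR a by simp
 hence "-1 / a - 1 = - ((a + 1) / a)" by (simp add: add_divide_distrib)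
 also have "... = - (of_real (R / r) * cis (al - p))" unfolding a1 unfolding a by (simp flip: cis_divide)
 also have "... = of_real (R / r) * cis (al - p + pi)" by (simp add: complex_eq_iff)
 also have "... = exp (of_real (ln (R / r)) + \<i> * of_real (al - p + pi))"
  using rR by (simp add: exp_add cis_conv_exp exp_of_real)
 finally have "Ln (-1 / a - 1) = Ln (exp (of_real (ln (R / r)) + \<i> * of_real (al - p + pi)))" by simp
 also have "... = of_real (ln (R / r)) + \<i> * of_real (al - p + pi)"
  by (rule Ln_exp) (use al0 assms in simp_all)
 finally have 2: "Ln (-1 / a - 1) = of_real (ln (R / r)) + \<i> * of_real (al - p + pi)" .
 have na: "norm a = r" using a rR by (simp add: norm_mult)
 have p: "2 * p / (1 + th) = 2 * al" by (simp add: al_def)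
 show ?thesis unfolding extlog_def a_def[symmetric] 1 2 na p using rR
  by (simp add: complex_eq_iff ln_div)
qed

lemma abs_Im_extlog:
 assumes "th > 0" "0 < p" "p < pi" "s ~= arcp th p" "s ~= cnj (arcp th p)"
 shows "\<bar>Im (extlog th p s)\<bar> <= 4 * pi"
proof -
 have L: "\<bar>Im (Ln z)\<bar> <= pi" if "z ~= 0" for z using mpi_less_Im_Ln[OF that] Im_Ln_le_pi[OF that] by (auto simp: abs_le_iff)
 have "\<bar>p - 2 * p / (1 + th)\<bar> <= pi"
 proof -
  have "0 <= p / (1+th)" "p / (1+th) <= p" using assms by (auto simp: field_simps)
  moreover have "2 * p / (1+th) = 2 * (p / (1+th))" by simp
  ultimately show ?thesis using assms by linarith
 qed
 moreover have "s / arcp th p - 1 ~= 0" using assms arcp_nz[of th p] by (auto simp: field_simps)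
 hence "\<bar>Im (Ln (s / arcp th p - 1))\<bar> <= pi" by (rule L)
 moreover have "\<bar>Im (up_ln (s - cnj (arcp th p)))\<bar> <= pi + pi/2" 
 proof -
  define z where "z = - \<i> * (s - cnj (arcp th p))"
  have "\<bar>Im (Ln z)\<bar> <= pi" by (rule L) (use assms(5) in \<open>simp add: z_def\<close>)
  moreover have "Im (up_ln (s - cnj (arcp th p))) = Im (Ln z) + pi/2" by (simp add: up_ln_def z_def)
  ultimately show ?thesis using pi_gt_zero by linarith
 qed
 ultimately show ?thesis unfolding extlog_def by simp
qed

text \<open>The two squared distances differ by 4 Im s Im a, and the smaller one is bounded below
  through the angles; in the quotient both radii cancel, so the bound is uniform in r.\<close>

lemma Re_extlog_bounds:
 assumes "th > 0" "0 < p" "p < pi" "r > 0" "0 <= ph" "ph <= pi" "ph ~= p"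
 shows "0 <= Re (extlog th p (of_real r * cis ph))"
  "Re (extlog th p (of_real r * cis ph)) <= ln (1 + 16 * sin ph * sin p / (ph - p)\<^sup>2) / 2"
proof -
 define t where "t = arcr th p"
 have t: "t > 0" using arcr_pos[of th p] assms by (simp add: t_def)
 define s where "s = of_real r * cis ph"
 define a where "a = arcp th p"
 have a: "a = of_real t * cis p" "cnj a = of_real t * cis (-p)" by (simp_all add: a_def arcp_def t_def cis_cnj)
 define A B where "A = (norm (s - a))\<^sup>2" and "B = (norm (s - cnj a))\<^sup>2"
 have sp: "sin p > 0" "sin ph >= 0" using assms by (auto intro: sin_gt_zero sin_ge_zero)
 have low: "A >= r * t * (ph - p)\<^sup>2 / 4" unfolding A_def s_def a by (rule polar_dist_lower) (use assms t in auto)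
 moreover have dp: "r * t * (ph - p)\<^sup>2 > 0" using assms t by simp
 ultimately have A: "A > 0" by linarith
 have BA: "B = A + 4 * r * t * sin ph * sin p" unfolding A_def B_def s_def a cmod_power2
  by (simp add: power2_eq_square algebra_simps)
 have "4 * r * t * sin ph * sin p >= 0" using assms t sp by simp
 hence B: "B >= A" using BA by simp
 have ne: "s ~= a" "s ~= cnj a" using A B by (auto simp: A_def B_def)
 have "Re (extlog th p s) = ln (norm (s - cnj a) / norm (s - a))"
  using Re_extlog[OF assms(1-3)] ne unfolding a_def by simp
 also have "... = ln (B / A) / 2"
  using ne unfolding A_def B_def by (simp add: ln_div ln_realpow diff_divide_distrib)
 finally have eq: "Re (extlog th p s) = ln (B / A) / 2" .
 show "0 <= Re (extlog th p (of_real r * cis ph))" 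
 proof -
  have "1 <= B / A" using A B by simp
  hence "0 <= ln (B / A)" by (rule ln_ge_zero)
  thus ?thesis using eq unfolding s_def by linarith
 qed
 \<comment> \<open>Only the angular lower bound for A enters here.\<close>
 have "B / A = 1 + (4 * r * t * sin ph * sin p) / A" using BA A by (simp add: add_divide_distrib)
 also have "(4 * r * t * sin ph * sin p) / A <= (4 * r * t * sin ph * sin p) / (r * t * (ph - p)\<^sup>2 / 4)"
  by (rule divide_left_mono[OF low]) (use assms t sp A dp in \<open>auto intro!: mult_pos_pos\<close>)
 also have "... = 16 * sin ph * sin p / (ph - p)\<^sup>2" using assms t by (simp add: field_simps)
 finally have "B / A <= 1 + 16 * sin ph * sin p / (ph - p)\<^sup>2" by simp
 hence "ln (B / A) <= ln (1 + 16 * sin ph * sin p / (ph - p)\<^sup>2)" 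
  by (intro ln_mono) (use A B in auto)
 thus "Re (extlog th p (of_real r * cis ph)) <= ln (1 + 16 * sin ph * sin p / (ph - p)\<^sup>2) / 2"
  using eq by (simp add: s_def)
qed

lemma Ln_scale: "r > 0 ==> z ~= 0 ==> Ln (of_real r * z) = of_real (ln r) + Ln z"
 by (simp add: Ln_times_of_real Ln_of_real)

text \<open>ln l cancels between the two logarithms, and what remains is the difference of arguments
  together with the constant of \<open>extlog\<close>. This limit later becomes the mass contributed
  by one pole.\<close>

lemma extlog_at_infinity:
 assumes "th > 0" "0 < p" "p < pi" "0 < ph" "ph < pi"
 shows "((%l. extlog th p (of_real l * arcp th ph)) \<longlongrightarrow> \<i> * of_real (2 * p / (1 + th))) at_top"
proof -
 define a z where "a = arcp th p" and "z = arcp th ph"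
 have a: "a ~= 0" and z: "z ~= 0" "Im z > 0" using arcp_nz[of th] Im_arcp_pos[of th ph] assms by (auto simp: a_def z_def)
 define c :: complex where "c = of_real (ln (norm a)) + \<i> * of_real (p - 2 * p / (1 + th))"
 have r: "arcr th ph > 0" "arcr th p > 0" using assms arcr_pos by auto
 have cut: "z / a \<notin> \<real>\<^sub>\<le>\<^sub>0"
 proof
  assume *: "z / a \<in> \<real>\<^sub>\<le>\<^sub>0"
  hence "of_real 1 * arcp th ph / arcp th p - 1 \<in> \<real>\<^sub>\<le>\<^sub>0" by (auto simp: complex_nonpos_Reals_iff a_def z_def)
  hence "ph = p" using arc_cut[of th p 1 ph] assms by simp
  thus False using * a by (simp add: a_def z_def)
 qed
 have inv0: "((%l::real. of_real (inverse l) :: complex) \<longlongrightarrow> of_real 0) at_top"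
  by (intro tendsto_of_real tendsto_inverse_0_at_top filterlim_ident)
 have t1: "((%l. up_ln (z - cnj a * of_real (inverse l))) \<longlongrightarrow> up_ln z) at_top"
 proof (rule isCont_tendsto_compose[OF DERIV_isCont[OF up_ln_deriv]])
  have "((%l. z - cnj a * of_real (inverse l)) \<longlongrightarrow> z - cnj a * of_real 0) at_top"
   by (intro tendsto_intros inv0)
  thus "((%l. z - cnj a * of_real (inverse l)) \<longlongrightarrow> z) at_top" by simp
 qed (use z in auto)
 have t2: "((%l. Ln (z / a - of_real (inverse l))) \<longlongrightarrow> Ln (z / a)) at_top"
 proof (rule isCont_tendsto_compose[OF continuous_at_Ln[OF cut]])
  have "((%l. z / a - of_real (inverse l)) \<longlongrightarrow> z / a - of_real 0) at_top"
   by (intro tendsto_diff tendsto_const inv0)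
  thus "((%l. z / a - of_real (inverse l)) \<longlongrightarrow> z / a) at_top" by simp
 qed
 have t: "((%l. up_ln (z - cnj a * of_real (inverse l)) - Ln (z / a - of_real (inverse l)) - c) \<longlongrightarrow> up_ln z - Ln (z / a) - c) at_top"
  by (intro tendsto_diff t1 t2 tendsto_const)
 have ev: "\<forall>\<^sub>F l in at_top. up_ln (z - cnj a * of_real (inverse l)) - Ln (z / a - of_real (inverse l)) - c = extlog th p (of_real l * arcp th ph)"
  using eventually_gt_at_top[of 1]
 proof eventually_elim
  fix l :: real assume l: "l > 1"
  have Im1: "Im (z - cnj a * of_real (inverse l)) > 0" using z l Im_arcp_pos[of th p] assms by (simp add: a_def add_pos_nonneg)
  hence n1: "z - cnj a * of_real (inverse l) ~= 0" by (metis less_irrefl zero_complex.sel(2))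
  have "of_real l * z / a - 1 ~= 0"
   using arc_cut[of th p l ph] assms l unfolding z_def a_def by force
  hence n2: "z / a - of_real (inverse l) ~= 0" using l a by (auto simp: field_simps)
  have e1: "up_ln (of_real l * z - cnj a) = of_real (ln l) + up_ln (z - cnj a * of_real (inverse l))"
  proof -
   have "- \<i> * (of_real l * z - cnj a) = of_real l * (- \<i> * (z - cnj a * of_real (inverse l)))"
    using l by (simp add: field_simps)
   moreover have "Ln (of_real l * (- \<i> * (z - cnj a * of_real (inverse l)))) = of_real (ln l) + Ln (- \<i> * (z - cnj a * of_real (inverse l)))"
    by (rule Ln_scale) (use l n1 in auto)
   ultimately show ?thesis unfolding up_ln_def by (simp only: add.assoc)
  qed
  have e2: "Ln (of_real l * z / a - 1) = of_real (ln l) + Ln (z / a - of_real (inverse l))"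
  proof -
   have "of_real l * z / a - 1 = of_real l * (z / a - of_real (inverse l))" using l by (simp add: field_simps)
   moreover have "Ln (of_real l * (z / a - of_real (inverse l))) = of_real (ln l) + Ln (z / a - of_real (inverse l))"
    by (rule Ln_scale) (use l n2 in auto)
   ultimately show ?thesis by (simp only:)
  qed
  show "up_ln (z - cnj a * of_real (inverse l)) - Ln (z / a - of_real (inverse l)) - c = extlog th p (of_real l * arcp th ph)"
   unfolding extlog_def z_def[symmetric] a_def[symmetric] e1 e2 c_def by simp
 qed
 have u1: "up_ln z = of_real (ln (arcr th ph)) + \<i> * of_real ph"
  unfolding z_def arcp_def by (rule up_ln_cis) (use r assms in auto)
 have "z / a = of_real (arcr th ph / arcr th p) * cis (ph - p)"
  unfolding z_def a_def arcp_def by (simp flip: cis_divide)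
 also have "... = exp (of_real (ln (arcr th ph / arcr th p)) + \<i> * of_real (ph - p))"
  using r by (simp add: exp_add cis_conv_exp exp_of_real)
 finally have "Ln (z / a) = Ln (exp (of_real (ln (arcr th ph / arcr th p)) + \<i> * of_real (ph - p)))" by simp
 also have "... = of_real (ln (arcr th ph / arcr th p)) + \<i> * of_real (ph - p)"
  by (rule Ln_exp) (use assms in simp_all)
 finally have u2: "Ln (z / a) = of_real (ln (arcr th ph / arcr th p)) + \<i> * of_real (ph - p)" .
 have na: "norm a = arcr th p" unfolding a_def by (rule norm_arcp) (use assms in auto)
 have "up_ln z - Ln (z / a) - c = \<i> * of_real (2 * p / (1 + th))"
  unfolding u1 u2 c_def na using r by (simp add: complex_eq_iff ln_div)
 thus ?thesis using Lim_transform_eventually[OF t ev] by simp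
qed

text \<open>A branch of ln (x - w), up to an additive constant, whose cut is the vertical ray below
  x. It is therefore analytic up to the real axis from above, and its imaginary part jumps from pi/2
  to - pi/2 as w passes x from left to right.\<close>

definition real_log_dist :: "real => complex => complex" where
 "real_log_dist x w = Ln (\<i> * (of_real x - w))"

lemma real_log_dist_not_cut: "0 <= Im w ==> w ~= of_real x ==> \<i> * (of_real x - w) \<notin> \<real>\<^sub>\<le>\<^sub>0"
 by (auto simp: complex_nonpos_Reals_iff complex_eq_iff)

lemma real_log_dist_deriv:
 assumes "0 <= Im w" "w ~= of_real x"
 shows "(real_log_dist x has_field_derivative inverse (\<i> * (of_real x - w)) * (\<i> * (0 - 1))) (at w)"
proof -
 have d: "((%w. \<i> * (of_real x - w)) has_field_derivative \<i> * (0 - 1)) (at w)"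
  by (intro DERIV_cmult DERIV_diff DERIV_const DERIV_ident)
 show ?thesis unfolding real_log_dist_def[abs_def]
  by (rule DERIV_chain2[OF has_field_derivative_Ln[OF real_log_dist_not_cut[OF assms]] d])
qed

lemma Re_real_log_dist: "w ~= of_real x ==> Re (real_log_dist x w) = ln (norm (of_real x - w))"
 by (simp add: real_log_dist_def norm_mult)

lemma abs_Im_real_log_dist: "0 <= Im w ==> w ~= of_real x ==> \<bar>Im (real_log_dist x w)\<bar> <= pi / 2"
 unfolding real_log_dist_def by (subst Re_Ln_pos_le) auto

lemma real_log_dist_of_real:
 "u < x ==> real_log_dist x (of_real u) = of_real (ln (x - u)) + \<i> * of_real (pi/2)"
 "u > x ==> real_log_dist x (of_real u) = of_real (ln (u - x)) - \<i> * of_real (pi/2)"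
proof -
 assume "u < x"
 hence "real_log_dist x (of_real u) = Ln (of_real (x - u) * \<i>)" unfolding real_log_dist_def by (simp add: mult.commute)
 also have "... = of_real (ln (x - u)) + Ln \<i>" by (subst Ln_scale) (use \<open>u < x\<close> in auto)
 finally show "real_log_dist x (of_real u) = of_real (ln (x - u)) + \<i> * of_real (pi/2)" by simp
next
 assume "u > x"
 hence "real_log_dist x (of_real u) = Ln (of_real (u - x) * (- \<i>))" unfolding real_log_dist_def by (simp add: algebra_simps)
 also have "... = of_real (ln (u - x)) + Ln (- \<i>)" by (subst Ln_scale) (use \<open>u > x\<close> in auto)
 finally show "real_log_dist x (of_real u) = of_real (ln (u - x)) - \<i> * of_real (pi/2)" by simp
qed

text \<open>The mean value inequality is applied in the real parameter, along the segment from x to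
  y, which stays at distance at least norm w - M from w. This yields decay of the logarithmic ratio
  at infinity.\<close>

lemma real_log_dist_diff_bound:
 assumes "0 <= Im w" "0 < x" "x <= M" "0 < y" "y <= M" "M < norm w"
 shows "norm (real_log_dist x w - real_log_dist y w) <= \<bar>x - y\<bar> / (norm w - M)"
proof -
 define f where "f = (%t. Ln (\<i> * (t - w)))"
 have seg: "\<exists>u. t = of_real u & norm t <= M" if "t \<in> closed_segment (of_real x :: complex) (of_real y)" for t
 proof -
  have "t \<in> of_real ` closed_segment x y" using that by (simp only: closed_segment_of_real)
  then obtain u where u: "t = of_real u" "u \<in> closed_segment x y" by (rule imageE)
  hence "0 < u" "u <= M" using assms by (auto simp: closed_segment_eq_real_ivl split: if_splits)
  thus ?thesis using u by auto
 qed
 have "norm (f (of_real x) - f (of_real y)) <= (1 / (norm w - M)) * norm (of_real x - of_real y :: complex)"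
 proof (rule field_differentiable_bound[OF convex_closed_segment])
  fix t assume t: "t \<in> closed_segment (of_real x :: complex) (of_real y)"
  obtain u where u: "t = of_real u" "norm t <= M" using seg[OF t] by blast
  have ne: "w ~= t" using u assms by auto
  have d: "((%t. \<i> * (t - w)) has_field_derivative \<i> * (1 - 0)) (at t)"
   by (intro DERIV_cmult DERIV_diff DERIV_const DERIV_ident)
  have "\<i> * (t - w) \<notin> \<real>\<^sub>\<le>\<^sub>0" using real_log_dist_not_cut[of w u] assms(1) ne u by auto
  from DERIV_chain2[OF has_field_derivative_Ln[OF this] d]
  have "(f has_field_derivative inverse (\<i> * (t - w)) * (\<i> * (1 - 0))) (at t)"
   unfolding f_def .
  moreover have "inverse (\<i> * (t - w)) * (\<i> * (1 - 0)) = inverse (t - w)" using ne by (simp add: field_simps)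
  ultimately have "(f has_field_derivative inverse (t - w)) (at t)" by (simp only:)
  thus "(f has_field_derivative inverse (t - w)) (at t within closed_segment (of_real x) (of_real y))"
   by (rule has_field_derivative_at_within)
  have "norm (t - w) >= norm w - M" using norm_triangle_ineq2[of w t] u by (simp add: norm_minus_commute)
  thus "norm (inverse (t - w)) <= 1 / (norm w - M)" using assms(6) unfolding inverse_eq_divide norm_divide by (simp add: frac_le)
 qed auto
 thus ?thesis unfolding f_def real_log_dist_def by (simp flip: of_real_diff)
qed

lemma J_map_lower:
 assumes "th > 0" "norm s >= 2" shows "norm (J_map th s) >= (1/2) powr (1/th) / 2 * norm s"
proof -
 have s: "s ~= 0" "s ~= -1" using assms by auto
 have "norm (s + 1) >= norm s - 1" using norm_triangle_ineq2[of s "-1"] by simp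
 hence n: "norm (s + 1) >= norm s / 2" using assms by linarith
 hence "norm (s + 1) / norm s >= 1 / 2" using s by (simp add: field_simps)
 hence "(norm (s + 1) / norm s) powr (1/th) >= (1/2) powr (1/th)" using assms by (intro powr_mono2) auto
 hence "norm (s + 1) * (norm (s+1) / norm s) powr (1/th) >= (norm s / 2) * (1/2) powr (1/th)"
  using n by (intro mult_mono) auto
 thus ?thesis using norm_J_map[OF assms(1) s] by (simp add: mult_ac)
qed

section \<open>Integrable majorants for logarithmic singularities\<close>

lemma abs_powr_has_integral:
 fixes a b c e :: real assumes "e > -1" "a <= b"
 shows "((%x. \<bar>x - c\<bar> powr e) has_integral (max 0 (b - c) powr (e+1) - max 0 (c - b) powr (e+1)) / (e+1)
  - (max 0 (a - c) powr (e+1) - max 0 (c - a) powr (e+1)) / (e+1)) {a..b}"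
proof -
 define F where "F = (%x. (max 0 (x - c) powr (e+1) - max 0 (c - x) powr (e+1)) / (e+1))"
 have "((%x. \<bar>x - c\<bar> powr e) has_integral F b - F a) {a..b}"
 proof (rule fundamental_theorem_of_calculus_interior_strong[of "{c}"])
  show "continuous_on {a..b} F" unfolding F_def
   by (intro continuous_intros continuous_on_powr' continuous_on_max) (use assms in auto)
  fix x assume x: "x \<in> {a<..<b} - {c}"
  show "(F has_vector_derivative \<bar>x - c\<bar> powr e) (at x)"
  proof (cases "x > c")
   case True
   have "((%x. (x - c) powr (e+1) / (e+1)) has_real_derivative \<bar>x - c\<bar> powr e) (at x)"
    using True assms by (auto intro!: derivative_eq_intros simp: powr_diff)
   hence "(F has_real_derivative \<bar>x - c\<bar> powr e) (at x)"
    by (rule has_field_derivative_transform_within_open[where S="{c<..}"]) (use True in \<open>auto simp: F_def max_def\<close>)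
   thus ?thesis by (simp add: has_real_derivative_iff_has_vector_derivative)
  next
   case False
   hence xc: "x < c" using x by auto
   have "((%x. - ((c - x) powr (e+1) / (e+1))) has_real_derivative \<bar>x - c\<bar> powr e) (at x)"
    using xc assms by (auto intro!: derivative_eq_intros simp: powr_diff)
   hence "(F has_real_derivative \<bar>x - c\<bar> powr e) (at x)"
    by (rule has_field_derivative_transform_within_open[where S="{..<c}"]) (use xc in \<open>auto simp: F_def max_def\<close>)
   thus ?thesis by (simp add: has_real_derivative_iff_has_vector_derivative)
  qed
 qed (use assms in auto)
 thus ?thesis by (simp only: F_def)
qed

lemma abs_powr_integrable_on:
 fixes a b c e :: real assumes "e > -1" shows "(%x. \<bar>x - c\<bar> powr e) integrable_on {a..b}"
 using abs_powr_has_integral[OF assms, of a b c] by (cases "a <= b") auto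

text \<open>Angular distances are below pi, hence below 4. The exponent -1/4 is chosen because the
  product of two such singularities, -1/2, remains integrable; the numerical factors are
  crude.\<close>

lemma log_powr_bounds:
 fixes d :: real assumes "0 < d" "d < 4"
 shows "1 <= 2 * d powr (-1/4)" "ln (1 + 16 / d\<^sup>2) <= 16 * d powr (-1/4)" "\<bar>ln d\<bar> <= 8 * d powr (-1/4)"
proof -
 have q: "(4::real) powr (1/4) <= 2" 
 proof -
  have "(4::real) powr (1/4) <= 16 powr (1/4)" by (intro powr_mono2) auto
  also have "... = (2 powr 4) powr (1/4)" by simp
  also have "... = 2" unfolding powr_powr by simp
  finally show ?thesis .
 qed
 have "d powr (1/4) <= 4 powr (1/4)" using assms by (intro powr_mono2) auto
 hence d2: "d powr (1/4) <= 2" using q by linarith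
 have dm: "d powr (-1/4) = 1 / d powr (1/4)" using powr_minus_divide[of d "1/4"] by simp
 show 1: "1 <= 2 * d powr (-1/4)" unfolding dm using d2 assms by (simp add: le_divide_eq)
 have "ln (1 + 16 / d\<^sup>2) <= ln (32 / d\<^sup>2)"
 proof -
  have "d\<^sup>2 <= 16" using assms power_mono[of d 4 2] by simp
  hence "1 <= 16 / d\<^sup>2" using assms by simp
  hence "1 + 16 / d\<^sup>2 <= 32 / d\<^sup>2" by simp
  moreover have "0 < 1 + 16 / d\<^sup>2" by (intro add_pos_nonneg) auto
  ultimately show ?thesis by (rule ln_mono)
 qed
 also have "... <= 8 * (32 / d\<^sup>2) powr (1/8)"
 proof -
  have "d\<^sup>2 <= 16" using assms power_mono[of d 4 2] by simp
  hence "1 <= 32 / d\<^sup>2" using assms by simp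
  from ln_powr_bound[OF this, of "1/8"] show ?thesis by simp
 qed
 also have "(32 / d\<^sup>2) powr (1/8) <= 2 * d powr (-1/4)"
 proof -
  have "(32::real) powr (1/8) <= 256 powr (1/8)" by (intro powr_mono2) auto
  also have "... = (2 powr 8) powr (1/8)" by simp
  also have "... = 2" unfolding powr_powr by simp
  finally have a: "(32::real) powr (1/8) <= 2" .
  have "d\<^sup>2 = d powr 2" using assms by simp
  hence "(d\<^sup>2) powr (1/8) = d powr (2 * (1/8))" by (simp only: powr_powr)
  hence "(d\<^sup>2) powr (1/8) = d powr (1/4)" by simp
  hence "(32 / d\<^sup>2) powr (1/8) = 32 powr (1/8) * d powr (-1/4)"
   using assms dm by (simp add: powr_divide)
  thus ?thesis using a mult_right_mono[of "32 powr (1/8)" 2 "d powr (-1/4)"] by simp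
 qed
 finally show "ln (1 + 16 / d\<^sup>2) <= 16 * d powr (-1/4)" by simp
 show "\<bar>ln d\<bar> <= 8 * d powr (-1/4)"
 proof (cases "d < 1")
  case True
  define u where "u = d powr (-1/4)"
  have "(1/d) powr (1/4) = u" using dm assms by (simp add: powr_divide u_def)
  moreover have "ln (1/d) <= (1/d) powr (1/4) / (1/4)" by (rule ln_powr_bound) (use True assms in auto)
  moreover have "ln (1/d) = - ln d" using assms by (simp add: ln_div)
  ultimately have "- ln d <= 4 * u" by simp
  moreover have "u >= 0" "\<bar>ln d\<bar> = - ln d" using True assms by (simp_all add: u_def)
  ultimately have "\<bar>ln d\<bar> <= 8 * u" by linarith
  thus ?thesis by (simp add: u_def)
 next
  case False
  hence "0 <= ln d" "ln d <= d - 1" using ln_le_minus_one[of d] by auto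
  hence "\<bar>ln d\<bar> <= 3" using assms by simp
  thus ?thesis using 1 by simp
 qed
qed

lemma scaled_arc_props:
 assumes "th > 0" "0 < p" "p < pi" "l > 1" "0 < ph" "ph < pi"
 defines "s \<equiv> of_real l * arcp th ph"
 shows "Im s > 0" "s ~= 0" "s ~= -1" "s ~= arcp th p" "s ~= cnj (arcp th p)"
  "s / arcp th p - 1 \<notin> \<real>\<^sub>\<le>\<^sub>0" "s = of_real (l * arcr th ph) * cis ph" "l * arcr th ph > 0"
proof -
 show Im: "Im s > 0" using Im_arcp_pos[of th ph] assms by simp
 thus "s ~= 0" "s ~= -1" by auto
 show cut: "s / arcp th p - 1 \<notin> \<real>\<^sub>\<le>\<^sub>0" using arc_cut[of th p l ph] assms by auto
 have ap: "Im (arcp th p) > 0" "arcp th p ~= 0" using Im_arcp_pos[of th p] assms by auto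
 show "s ~= arcp th p" using cut ap by auto
 show "s ~= cnj (arcp th p)" using Im ap by auto
 show "s = of_real (l * arcr th ph) * cis ph" by (simp add: s_def arcp_def)
 show "l * arcr th ph > 0" using arcr_pos[of th ph] assms by simp
qed

lemma norm_extlog_bound:
 assumes "th > 0" "0 < p" "p < pi" "l > 1" "0 < ph" "ph < pi" "ph ~= p"
 shows "norm (extlog th p (of_real l * arcp th ph)) <= 40 * \<bar>ph - p\<bar> powr (-1/4)"
proof -
 note sp = scaled_arc_props[OF assms(1-6)]
 define s where "s = of_real l * arcp th ph"
 define d where "d = \<bar>ph - p\<bar>"
 have d: "0 < d" "d < 4" using assms pi_less_4 by (auto simp: d_def)
 have Re: "0 <= Re (extlog th p s)" "Re (extlog th p s) <= ln (1 + 16 * sin ph * sin p / (ph - p)\<^sup>2) / 2"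
  using Re_extlog_bounds[OF assms(1-3) sp(8) _ _ assms(7)] assms unfolding sp(7)[symmetric] s_def by auto
 have sn: "0 <= sin ph" "sin ph <= 1" "0 <= sin p" "sin p <= 1" using assms by (auto intro!: sin_ge_zero)
 have "sin ph * sin p <= 1" "0 <= sin ph * sin p" using mult_le_one[OF sn(2,3,4)] sn by auto
 hence "16 * sin ph * sin p / (ph - p)\<^sup>2 <= 16 / d\<^sup>2" "0 <= 16 * sin ph * sin p / (ph - p)\<^sup>2"
  by (auto simp: d_def mult.assoc intro!: divide_right_mono divide_nonneg_nonneg)
 hence "ln (1 + 16 * sin ph * sin p / (ph - p)\<^sup>2) <= ln (1 + 16 / d\<^sup>2)"
  by (subst ln_le_cancel_iff) auto
 hence R: "\<bar>Re (extlog th p s)\<bar> <= 8 * d powr (-1/4)" using Re log_powr_bounds(2)[OF d] by simp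
 have "\<bar>Im (extlog th p s)\<bar> <= 4 * pi" unfolding s_def by (rule abs_Im_extlog[OF assms(1-3) sp(4,5)])
 also have "... <= 16" using pi_less_4 by simp
 also have "... <= 32 * d powr (-1/4)" using log_powr_bounds(1)[OF d] by simp
 finally show ?thesis using R cmod_le[of "extlog th p s"] unfolding s_def d_def by simp
qed

text \<open>Close to -1 the zero of \<open>extlog\<close> absorbs the pole of
  \<open>J_log_rate\<close>; away from -1 the second factor is bounded and only the logarithmic
  singularity at the pole p remains.\<close>

lemma extlog_rate_bound:
 assumes "th > 0" "0 < p" "p < pi"
 obtains C where "C > 0" "!!l ph. l > 1 ==> 0 < ph ==> ph < pi ==> ph ~= p ==>
  norm (extlog th p (of_real l * arcp th ph) * J_log_rate th (of_real l * arcp th ph)) <= C * \<bar>ph - p\<bar> powr (-1/4)"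
proof -
 define D where "D = 1 / (-1 - cnj (arcp th p)) - 1 / (-1 - arcp th p)"
 have "-1 / arcp th p - 1 \<notin> \<real>\<^sub>\<le>\<^sub>0"
 proof
  assume *: "-1 / arcp th p - 1 \<in> \<real>\<^sub>\<le>\<^sub>0"
  have "arcp th pi = -1" using arcp_add_1[of th pi] assms by (simp add: arc_shift_def add_eq_0_iff2)
  thus False using arc_cut[of th p 1 pi] * assms by simp
 qed
 hence "(extlog th p has_field_derivative D) (at (-1))"
  unfolding D_def by (intro extlog_deriv assms) auto
 hence "((%s. (extlog th p s - 0) / (s - -1)) \<longlongrightarrow> D) (at (-1))"
  using extlog_neg1[OF assms] by (simp add: has_field_derivative_iff)
 \<comment> \<open>Near -1 the difference quotient of \<open>extlog\<close> is bounded by one more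
   than its limit.\<close>
 hence "\<forall>\<^sub>F s in at (-1). norm ((extlog th p s - 0) / (s - -1)) < norm D + 1"
  by (intro order_tendstoD(2)[OF tendsto_norm]) auto
 then obtain dl where dl: "dl > 0" "!!s. s ~= -1 ==> dist s (-1) < dl ==> norm (extlog th p s / (s + 1)) < norm D + 1"
  unfolding eventually_at by auto
 define K where "K = norm D + 1"
 define K0 where "K0 = 1 + 1/th"
 have K: "K > 0" "K0 > 0" using assms by (auto simp: K_def K0_def add_nonneg_pos add_pos_pos)
 have hb: "norm (J_log_rate th s) <= 1 + K0 / norm (s + 1)" for s
  unfolding J_log_rate_def K0_def[symmetric]
  using norm_triangle_ineq4[of 1 "of_real K0 / (s+1)"] K by (simp add: norm_divide)
 show thesis
 proof (rule that[of "2 * K * (dl + K0) + 40 * (1 + K0 / dl)"])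
  show "2 * K * (dl + K0) + 40 * (1 + K0 / dl) > 0" using K dl(1) by (intro add_pos_pos mult_pos_pos divide_pos_pos) auto
  fix l ph :: real assume a: "l > 1" "0 < ph" "ph < pi" "ph ~= p"
  define s where "s = of_real l * arcp th ph"
  define u where "u = \<bar>ph - p\<bar> powr (-1/4)"
  have u: "u >= 0" "1 <= 2 * u" using log_powr_bounds(1)[of "\<bar>ph - p\<bar>"] a assms pi_less_4 by (auto simp: u_def)
  note sp = scaled_arc_props[OF assms a(1-3), folded s_def]
  have s1: "norm (s + 1) > 0" using sp(3) by (simp add: add_eq_0_iff2)
  have "norm (extlog th p s * J_log_rate th s) <= 2 * K * (dl + K0) * u + 40 * (1 + K0 / dl) * u"
  proof (cases "norm (s + 1) < dl")
   case True
   have "norm (extlog th p s / (s + 1)) < K" unfolding K_def by (rule dl(2)[OF sp(3)]) (use True in \<open>simp add: dist_norm\<close>)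
   hence "norm (extlog th p s) <= K * norm (s + 1)" using s1 by (simp add: norm_divide divide_less_eq)
   hence "norm (extlog th p s * J_log_rate th s) <= (K * norm (s+1)) * (1 + K0 / norm (s + 1))"
    unfolding norm_mult using hb[of s] K by (intro mult_mono) auto
   also have "... = K * (norm (s+1) + K0)" using s1 by (simp add: field_simps)
   also have "... <= K * (dl + K0) * 1" using K True by simp
   also have "... <= K * (dl + K0) * (2 * u)" using u K dl(1) by (intro mult_left_mono) auto
   also have "... <= 2 * K * (dl + K0) * u + 40 * (1 + K0 / dl) * u" using u K dl(1) by simp
   finally show ?thesis .
  next
   case False
   have "K0 / norm (s + 1) <= K0 / dl" using False K dl(1) s1 by (intro divide_left_mono mult_pos_pos) auto
   hence h: "norm (J_log_rate th s) <= 1 + K0 / dl" using hb[of s] by linarith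
   have "norm (extlog th p s * J_log_rate th s) <= (40 * u) * (1 + K0 / dl)"
    unfolding norm_mult using norm_extlog_bound[OF assms a] h K dl(1) unfolding s_def u_def
    by (intro mult_mono) auto
   moreover have "2 * K * (dl + K0) * u >= 0" using K dl(1) u by simp
   ultimately show ?thesis by (simp add: mult_ac)
  qed
  thus "norm (extlog th p (of_real l * arcp th ph) * J_log_rate th (of_real l * arcp th ph))
    <= (2 * K * (dl + K0) + 40 * (1 + K0 / dl)) * \<bar>ph - p\<bar> powr (-1/4)"
   unfolding s_def u_def by (simp add: distrib_right)
 qed
qed

section \<open>Real values of J and the logarithm near its singularity\<close>

definition J_real :: "real => real => real" where
 "J_real th t = (t + 1) * ((t + 1) / t) powr (1 / th)"

lemma J_map_pos_real: "th > 0 ==> t > 0 ==> J_map th (of_real t) = of_real (J_real th t)"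
 using J_map_polar[of th "of_real t" t 0 "t + 1" 0] by (simp add: J_real_def)

lemma J_map_neg_real:
 assumes "th > 0" "t > 1" shows "\<exists>v>0. J_map th (of_real (- t)) = of_real (- v)"
 using J_map_polar[of th "of_real (- t)" t pi "t - 1" pi] assms
 by (intro exI[of _ "(t - 1) * ((t - 1) / t) powr (1 / th)"]) simp

lemma J_real_deriv:
 assumes "th > 0" "t > 0"
 shows "((%t. ln (J_real th t)) has_real_derivative (1 - (1 + 1/th) / (t + 1)) / t) (at t)"
proof -
 have e: "(1 + B) * (1 / (t + 1)) - B * (1 / t) = (1 - (1 + B) / (t + 1)) / t" for B
  using assms(2) by (simp add: divide_simps) (simp add: algebra_simps)
 have d1: "((%t. ln (t + 1)) has_real_derivative 1 / (t + 1)) (at t)" "(ln has_real_derivative 1 / t) (at t)"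
  using assms by (auto intro!: derivative_eq_intros)
 have "((%t. (1 + 1/th) * ln (t + 1) - 1/th * ln t) has_real_derivative (1 - (1 + 1/th) / (t + 1)) / t) (at t)"
  unfolding e[symmetric] by (intro DERIV_diff DERIV_cmult d1)
 moreover have "(1 + 1/th) * ln (t + 1) - 1/th * ln t = ln (J_real th t)" if "t \<in> {0<..}" for t
 proof -
  have "((t + 1) / t) powr (1/th) > 0" using that by simp
  hence "ln (J_real th t) = ln (t + 1) + 1/th * ln ((t + 1) / t)"
   unfolding J_real_def using that by (subst ln_mult) (auto simp: ln_powr)
  also have "ln ((t + 1) / t) = ln (t + 1) - ln t" using that by (simp add: ln_div)
  finally show ?thesis by (simp add: algebra_simps)
 qed
 ultimately show ?thesis
  using has_field_derivative_transform_within_open[of _ _ t "{0<..}" "%t. ln (J_real th t)"] assms by simp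
qed

lemma J_real_pos: "t > 0 ==> J_real th t > 0"
 by (simp add: J_real_def)

lemma J_real_strict_mono:
 assumes "th > 0" "1 / th <= t" "t < u" shows "J_real th t < J_real th u"
proof -
 have t: "t > 0" using assms by (meson less_le_trans zero_less_divide_1_iff)
 have "ln (J_real th t) < ln (J_real th u)"
 proof (rule DERIV_pos_imp_increasing_open[OF assms(3)])
  fix x assume x: "t < x" "x < u"
  hence x0: "x > 0" "x > 1/th" using t assms by auto
  have "(1 + 1/th) / (x + 1) < 1" using x0 by simp
  hence "(1 - (1 + 1/th) / (x + 1)) / x > 0" using x0 by simp
  thus "\<exists>y. ((%t. ln (J_real th t)) has_real_derivative y) (at x) & 0 < y"
   using J_real_deriv[OF assms(1) x0(1)] by blast
 next
  show "continuous_on {t..u} (%t. ln (J_real th t))"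
   by (intro continuous_at_imp_continuous_on ballI DERIV_isCont[OF J_real_deriv[OF assms(1)]]) (use t in auto)
 qed
 thus ?thesis using J_real_pos t assms by simp
qed

lemma arcp_0: "arcp th 0 = of_real (1/th)"
 by (simp add: arcp_def arcr_def)

lemma arcp_pi: "th > 0 ==> arcp th pi = -1"
 using arcp_add_1[of th pi] by (simp add: arc_shift_def add_eq_0_iff2)

lemma J_real_at_end: "th > 0 ==> J_real th (1/th) = arcv th 0"
 using J_map_arc[of th 0] J_map_pos_real[of th "1/th"] by (simp add: arcp_0)

lemma arcv_le_end: "th > 0 ==> 0 <= ph ==> ph <= pi ==> arcv th ph \<in> {0..arcv th 0}"
 using arcv_image[of th] by (metis atLeastAtMost_iff imageI)

lemma arcp_inj_modulus: "arcp th ph = of_real (arcr th ph) * cis ph"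
 by (simp add: arcp_def)

text \<open>Strictly outside the arc Im J > 0, on the axis left of -1 J is negative, and on the axis
  right of 1/th it increases strictly from the end value. So a positive value different from the end
  value is taken exactly once: on the arc if it is smaller, on the axis if it is larger.\<close>

lemma exterior_preimage:
 assumes "th > 0" "x > 0" "x ~= arcv th 0"
 obtains rh phx where "rh > 0" "0 <= phx" "phx < pi" "of_real rh * cis phx ~= of_real (1/th)"
  "J_map th (of_real rh * cis phx) = of_real x"
  "!!l ph. l >= 1 ==> 0 <= ph ==> ph <= pi ==> J_map th (of_real l * arcp th ph) = of_real x ==> of_real l * arcp th ph = of_real rh * cis phx"
  "x < arcv th 0 ==> 0 < phx & arcv th phx = x"
  "x > arcv th 0 ==> phx = 0 & rh > 1/th & J_real th rh = x"
proof -
 define b where "b = arcv th 0"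
 have real_axis: "J_real th (l / th) = x & x >= b" if "l >= 1" "J_map th (of_real l * arcp th 0) = of_real x" for l
 proof -
  have "of_real l * arcp th 0 = of_real (l / th)" by (simp add: arcp_0)
  moreover have "l / th > 0" using that assms by simp
  ultimately have J: "J_real th (l / th) = x" using that(2) J_map_pos_real[OF assms(1), of "l / th"] by (metis of_real_eq_iff)
  moreover have "J_real th (1/th) <= J_real th (l/th)"
  proof (cases "l = 1")
   case False
   thus ?thesis using that(1) assms J_real_strict_mono[OF assms(1), of "1/th" "l/th"] by (simp add: divide_strict_right_mono)
  qed simp
  ultimately show ?thesis using J_real_at_end[OF assms(1)] by (simp add: b_def)
 qed
 have neg_axis: False if "l >= 1" "J_map th (of_real l * arcp th pi) = of_real x" for l
 proof (cases "l = 1")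
  case True
  thus False using that(2) J_map_arc[OF assms(1), of pi] arcv_pi[OF assms(1)] assms by simp
 next
  case False
  hence "l > 1" using that(1) by simp
  from J_map_neg_real[OF assms(1) this] obtain v where "v > 0" "J_map th (of_real (- l)) = of_real (- v)" by blast
  hence "x = - v" using that(2) arcp_pi[OF assms(1)] by (simp flip: of_real_minus)
  thus False using `v > 0` assms by simp
 qed
 have inter: "l = 1 & arcv th ph = x" if "l >= 1" "0 < ph" "ph < pi" "J_map th (of_real l * arcp th ph) = of_real x" for l ph
 proof (cases "l = 1")
  case True
  thus ?thesis using that J_map_arc[OF assms(1), of ph] by simp
 next
  case False
  thus ?thesis using Im_J_map_exterior[OF assms(1), of l ph] that by simp
 qed
 show thesis
 proof (cases "x < b")
  case True
  have "x \<in> {0..b}" using True assms by simp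
  hence "x \<in> arcv th ` {0..pi}" using arcv_image[OF assms(1)] by (simp add: b_def)
  then obtain phx where p: "0 <= phx" "phx <= pi" "arcv th phx = x" by auto
  have p': "phx ~= 0" "phx ~= pi" using p True assms arcv_pi[OF assms(1)] by (auto simp: b_def)
  show thesis
  proof (rule that[of "arcr th phx" phx], unfold arcp_inj_modulus[symmetric])
   show "arcr th phx > 0" using arcr_pos p assms by simp
   show "arcp th phx ~= of_real (1/th)" using Im_arcp_pos[of th phx] p p' assms by (auto simp: complex_eq_iff)
   show "J_map th (arcp th phx) = of_real x" using J_map_arc p assms by simp
   fix l ph :: real assume a: "l >= 1" "0 <= ph" "ph <= pi" "J_map th (of_real l * arcp th ph) = of_real x"
   have "ph ~= 0" using real_axis[of l] a True by auto
   moreover have "ph ~= pi" using neg_axis[of l] a by auto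
   ultimately have "l = 1" "arcv th ph = arcv th phx" using inter[of l ph] a p by auto
   hence "ph = phx" using arcv_inj[OF assms(1)] a p by (auto dest: inj_onD)
   thus "of_real l * arcp th ph = arcp th phx" using `l = 1` by simp
  qed (use p p' True b_def in auto)
 next
  case False
  hence xb: "x > b" using assms by (simp add: b_def)
  have pos: "t > 0" if "t \<in> {1/th..max (1/th) x}" for t
   using that assms(1) by (meson atLeastAtMost_iff less_le_trans zero_less_divide_1_iff)
  have cont: "continuous_on {1/th..max (1/th) x} (J_real th)"
   unfolding J_real_def
  proof (intro continuous_on_mult continuous_on_powr continuous_on_add continuous_on_divide continuous_on_id continuous_on_const ballI)
   fix t assume "t \<in> {1/th..max (1/th) x}"
   from pos[OF this] show "t ~= 0" "(t + 1) / t ~= 0" by auto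
  qed (use assms in auto)
  define m where "m = max (1/th) x"
  have m: "m > 0" using assms by (simp add: m_def)
  have "J_real th m >= m + 1"
  proof -
   have "((m + 1) / m) powr (1/th) >= 1" using m assms by (intro ge_one_powr_ge_zero) auto
   thus ?thesis unfolding J_real_def using m by (simp add: mult_le_cancel_left1)
  qed
  hence "J_real th m >= x" by (simp add: m_def)
  then obtain rh where r: "1/th <= rh" "rh <= m" "J_real th rh = x"
   using IVT'[of "J_real th" "1/th" x m] cont xb J_real_at_end[OF assms(1)] by (auto simp: m_def b_def)
  have r': "rh ~= 1/th" using r xb J_real_at_end[OF assms(1)] by (auto simp: b_def)
  have r0: "rh > 0" using r(1) assms by (meson less_le_trans zero_less_divide_1_iff)
  show thesis
  proof (rule that[of rh 0])
   show "of_real rh * cis 0 ~= of_real (1/th)" using r' by (metis cis_zero mult.right_neutral of_real_eq_iff)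
   show "J_map th (of_real rh * cis 0) = of_real x" using J_map_pos_real[OF assms(1) r0] r by simp
   fix l ph :: real assume a: "l >= 1" "0 <= ph" "ph <= pi" "J_map th (of_real l * arcp th ph) = of_real x"
   have "ph ~= pi" using neg_axis[of l] a by auto
   moreover have "~ (0 < ph & ph < pi)"
   proof
    assume "0 < ph & ph < pi"
    hence "arcv th ph = x" using inter[of l ph] a by blast
    thus False using arcv_le_end[OF assms(1), of ph] a xb by (auto simp: b_def)
   qed
   ultimately have p0: "ph = 0" using a by linarith
   have J: "J_real th (l/th) = J_real th rh" using real_axis[of l] a p0 r by auto
   have "1/th <= l/th" using a assms by (simp add: divide_right_mono)
   hence "l/th = rh" using J r J_real_strict_mono[OF assms(1), of "l/th" rh] J_real_strict_mono[OF assms(1), of rh "l/th"]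
    by (metis less_irrefl linorder_neqE_linordered_idom)
   thus "of_real l * arcp th ph = of_real rh * cis 0" by (auto simp: p0 arcp_0)
  qed (use r r' r0 xb False in \<open>auto simp: b_def\<close>)
 qed
qed

lemma arcr_lower:
 assumes "th > 0" obtains m where "m > 0" "!!ph. 0 <= ph ==> ph <= pi ==> m <= arcr th ph"
proof -
 obtain x where "x \<in> {0..pi}" "\<forall>y\<in>{0..pi}. arcr th x <= arcr th y"
  using continuous_attains_inf[of "{0..pi}" "arcr th"] continuous_on_arcr[OF assms] by auto
 thus ?thesis using that[of "arcr th x"] arcr_pos[OF assms] by auto
qed

lemma scaled_arc_upper:
 assumes "th > 0" "l >= 1" "0 <= ph" "ph <= pi"
 defines "s \<equiv> of_real l * arcp th ph"
 shows "Im s >= 0" "s ~= 0" "s ~= -1 ==> isCont (J_map th) s" "isCont (J_map th) s"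
proof -
 show 1: "Im s >= 0" unfolding s_def by (rule Im_scaled_arc_nonneg) (use assms in auto)
 show 2: "s ~= 0" using arcp_nz[of th ph] assms by simp
 show 3: "isCont (J_map th) s" if "s ~= -1" using DERIV_isCont[OF J_map_deriv[OF assms(1) 1 2 that]] .
 show "isCont (J_map th) s" using 3 isCont_J_map_neg1[OF assms(1)] by (cases "s = -1") auto
qed

text \<open>The divided difference of J at the preimage, completed by the derivative, is continuous
  and has no zero on the compact set of dilates up to Lm; its minimum is the constant c.\<close>

lemma J_map_zero_lower:
 assumes "th > 0" "x > 0" "rh > 0" "0 <= phx" "phx < pi" "of_real rh * cis phx ~= of_real (1/th)"
  "J_map th (of_real rh * cis phx) = of_real x"
  and uniq: "!!l ph. l >= 1 ==> 0 <= ph ==> ph <= pi ==> J_map th (of_real l * arcp th ph) = of_real x ==> of_real l * arcp th ph = of_real rh * cis phx"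
 obtains c M where "c > 0" "M > 0" "!!l ph. 1 <= l ==> l <= Lm ==> 0 <= ph ==> ph <= pi ==>
   c * norm (of_real l * arcp th ph - of_real rh * cis phx) <= norm (of_real x - J_map th (of_real l * arcp th ph))
   & norm (of_real x - J_map th (of_real l * arcp th ph)) <= M"
proof -
 define sx where "sx = of_real rh * cis phx"
 define f where "f = (%z :: real \<times> real. of_real (fst z) * arcp th (snd z))"
 define K where "K = f ` ({1..Lm} \<times> {0..pi})"
 have Kc: "compact K" unfolding K_def
 proof (rule compact_continuous_image)
  have "continuous_on ({1..Lm} \<times> {0..pi}) (%z. arcp th (snd z))"
   by (rule continuous_on_compose2[OF continuous_on_arcp[OF assms(1)]]) (auto intro!: continuous_intros)
  thus "continuous_on ({1..Lm} \<times> {0..pi}) f" unfolding f_def by (intro continuous_intros)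
  show "compact ({1..Lm} \<times> {0..pi})" by (intro compact_Times compact_Icc)
 qed
 have props: "isCont (J_map th) s" "J_map th s = of_real x ==> s = sx" if "s \<in> K" for s
  using that scaled_arc_upper(4)[OF assms(1)] uniq unfolding K_def f_def sx_def by auto
 have Im: "0 <= Im sx" using assms by (simp add: sx_def sin_ge_zero)
 have sx0: "sx ~= 0" using assms by (simp add: sx_def)
 have sx1: "sx ~= -1" using assms(2,7) by (auto simp: sx_def J_map_def)
 define D where "D = J_map th sx * J_log_rate th sx / sx"
 have D: "(J_map th has_field_derivative D) (at sx)" unfolding D_def by (rule J_map_deriv) (use assms Im sx0 sx1 in auto)
 \<comment> \<open>The only critical point is 1/th, which is the preimage of the excluded end
   value.\<close>
 have "J_log_rate th sx ~= 0"
 proof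
  assume "J_log_rate th sx = 0"
  moreover have "sx + 1 ~= 0" using sx1 by (simp add: add_eq_0_iff2)
  ultimately have "sx + 1 = of_real (1 + 1/th)" unfolding J_log_rate_def by (simp add: field_simps)
  hence "sx = of_real (1/th)" by (simp add: algebra_simps)
  thus False using assms(6) by (simp add: sx_def)
 qed
 hence D0: "D ~= 0" using assms(2,7) sx0 by (simp add: D_def sx_def)
 define H where "H = (%s. if s = sx then D else (J_map th s - of_real x) / (s - sx))"
 have "isCont H s" if s: "s \<in> K" for s
 proof (cases "s = sx")
  case True
  have "((%s. (J_map th s - of_real x) / (s - sx)) \<longlongrightarrow> D) (at sx)"
   using D assms(7) by (simp add: has_field_derivative_iff sx_def)
  hence "(H \<longlongrightarrow> D) (at sx)"
   by (rule Lim_transform_eventually) (auto simp: H_def eventually_at_filter)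
  thus ?thesis using True by (simp add: isCont_def H_def)
 next
  case False
  have "isCont (%s. (J_map th s - of_real x) / (s - sx)) s" using props(1)[OF s] False by (intro continuous_intros) auto
  moreover have "\<forall>\<^sub>F t in nhds s. t \<in> - {sx}" by (rule eventually_nhds_in_open) (use False in auto)
  hence e: "\<forall>\<^sub>F t in nhds s. (J_map th t - of_real x) / (t - sx) = H t" by eventually_elim (auto simp: H_def)
  ultimately show ?thesis using isCont_cong[OF e] by simp
 qed
 hence Hc: "continuous_on K (%s. norm (H s))" by (intro continuous_on_norm continuous_at_imp_continuous_on) auto
 have Jc: "continuous_on K (%s. of_real x - J_map th s)"
  by (intro continuous_on_diff continuous_on_const continuous_at_imp_continuous_on ballI props(1))
 hence "bounded ((%s. of_real x - J_map th s) ` K)" using Kc by (intro compact_imp_bounded compact_continuous_image)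
 then obtain M where M: "M > 0" "!!s. s \<in> K ==> norm (of_real x - J_map th s) <= M" by (auto simp: bounded_pos)
 have "\<exists>c>0. \<forall>s\<in>K. c <= norm (H s)"
 proof (cases "K = {}")
  case False
  obtain s0 where s0: "s0 \<in> K" "!!s. s \<in> K ==> norm (H s0) <= norm (H s)"
   using continuous_attains_inf[OF Kc False Hc] by auto
  have "H s0 ~= 0" using props(2)[OF s0(1)] D0 by (auto simp: H_def)
  thus ?thesis using s0 by (intro exI[of _ "norm (H s0)"]) auto
 qed (auto intro: exI[of _ 1])
 then obtain c where c: "c > 0" "!!s. s \<in> K ==> c <= norm (H s)" by auto
 show thesis
 proof (rule that[OF c(1) M(1)], intro conjI)
  fix l ph :: real assume "1 <= l" "l <= Lm" "0 <= ph" "ph <= pi"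
  hence s: "of_real l * arcp th ph \<in> K" by (force simp: K_def f_def)
  define s' where "s' = of_real l * arcp th ph"
  show "norm (of_real x - J_map th (of_real l * arcp th ph)) <= M" using M(2)[OF s] .
  have "c * norm (s' - sx) <= norm (of_real x - J_map th s')"
  proof (cases "s' = sx")
   case False
   hence "c <= norm (J_map th s' - of_real x) / norm (s' - sx)" using c(2)[OF s] by (simp add: s'_def H_def norm_divide)
   thus ?thesis using False by (simp add: le_divide_eq norm_minus_commute)
  qed simp
  thus "c * norm (of_real l * arcp th ph - of_real rh * cis phx) <= norm (of_real x - J_map th (of_real l * arcp th ph))"
   by (simp add: s'_def sx_def)
 qed
qed

text \<open>The inverse of X, extended by 0. For values beyond the end the preimage lies on the
  positive real axis, so 0 is again the angle at which x - J vanishes.\<close>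

definition arca :: "real => real => real" where
 "arca th x = (if x >= arcv th 0 then 0 else the_inv_into {0..pi} (arcv th) x)"

lemma arca_of_value:
 assumes "th > 0" "0 <= ph" "ph <= pi" shows "arca th (arcv th ph) = ph"
proof (cases "ph = 0")
 case False
 hence "arcv th ph < arcv th 0" using arcv_strict_antimono[of th 0 ph] assms by simp
 thus ?thesis using the_inv_into_f_f[OF arcv_inj[OF assms(1)], of ph] assms by (simp add: arca_def)
qed (simp add: arca_def)

lemma arca:
 assumes "th > 0" "0 <= x" "x <= arcv th 0"
 shows "arcv th (arca th x) = x" "0 <= arca th x" "arca th x <= pi"
proof -
 have "x \<in> arcv th ` {0..pi}" using arcv_image[OF assms(1)] assms by simp
 then obtain ph where "ph \<in> {0..pi}" "x = arcv th ph" by auto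
 thus "arcv th (arca th x) = x" "0 <= arca th x" "arca th x <= pi"
  using arca_of_value[OF assms(1)] by auto
qed

lemma arca_interior:
 assumes "th > 0" "0 < x" "x < arcv th 0" shows "0 < arca th x" "arca th x < pi"
proof -
 have "arca th x ~= 0" "arca th x ~= pi"
  using arca(1)[of th x] arcv_pi[of th] assms by (metis less_irrefl less_imp_le)+
 thus "0 < arca th x" "arca th x < pi" using arca(2,3)[of th x] assms by auto
qed

text \<open>|x - J| is at least a multiple of the distance to the preimage, and that distance is at
  least a multiple of the angular distance, so the logarithm is dominated by a power of the
  latter.\<close>

lemma Re_log_dist_bound:
 assumes "th > 0" "x > 0" "x ~= arcv th 0"
 obtains C where "C > 0" "!!l ph. 1 < l ==> l <= Lm ==> 0 < ph ==> ph < pi ==> ph ~= arca th x ==>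
  \<bar>Re (real_log_dist x (J_map th (of_real l * arcp th ph)))\<bar> <= C * \<bar>ph - arca th x\<bar> powr (-1/4)"
proof -
 from exterior_preimage[OF assms] obtain rh phx where P: "rh > 0" "0 <= phx" "phx < pi" "of_real rh * cis phx ~= of_real (1/th)"
  "J_map th (of_real rh * cis phx) = of_real x"
  "!!l ph. l >= 1 ==> 0 <= ph ==> ph <= pi ==> J_map th (of_real l * arcp th ph) = of_real x ==> of_real l * arcp th ph = of_real rh * cis phx"
  "x < arcv th 0 ==> 0 < phx & arcv th phx = x"
  "x > arcv th 0 ==> phx = 0 & rh > 1/th & J_real th rh = x" by metis
 have ang: "arca th x = phx"
 proof (cases "x < arcv th 0")
  case True
  thus ?thesis using P(7) arca_of_value[OF assms(1), of phx] P(2,3) by simp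
 next
  case False
  thus ?thesis using P(8) assms by (simp add: arca_def)
 qed
 from J_map_zero_lower[OF assms(1,2) P(1-6), of Lm] obtain c M where cM: "c > 0" "M > 0"
  "!!l ph. 1 <= l ==> l <= Lm ==> 0 <= ph ==> ph <= pi ==>
   c * norm (of_real l * arcp th ph - of_real rh * cis phx) <= norm (of_real x - J_map th (of_real l * arcp th ph))
   & norm (of_real x - J_map th (of_real l * arcp th ph)) <= M" by blast
 obtain m where m: "m > 0" "!!ph. 0 <= ph ==> ph <= pi ==> m <= arcr th ph" using arcr_lower[OF assms(1)] by blast
 define k where "k = sqrt (m * rh / 4)"
 have k: "k > 0" using m P by (simp add: k_def)
 define C where "C = 2 * \<bar>ln (c * k)\<bar> + 2 * \<bar>ln M\<bar> + 8"
 show thesis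
 proof (rule that[of C])
  show "C > 0" by (simp add: C_def)
  fix l ph :: real assume a: "1 < l" "l <= Lm" "0 < ph" "ph < pi" "ph ~= arca th x"
  define d where "d = \<bar>ph - phx\<bar>"
  have d: "0 < d" "d < 4" using a P ang pi_less_4 by (auto simp: d_def)
  define s where "s = of_real l * arcp th ph"
  have "(norm (s - of_real rh * cis phx))\<^sup>2 >= (l * arcr th ph) * rh * (ph - phx)\<^sup>2 / 4"
  proof -
   have s: "s = of_real (l * arcr th ph) * cis ph" by (simp add: s_def arcp_def)
   show ?thesis unfolding s by (rule polar_dist_lower) (use a P arcr_pos[OF assms(1), of ph] in \<open>auto simp: abs_if\<close>)
  qed
  moreover have "(l * arcr th ph) * rh * (ph - phx)\<^sup>2 / 4 >= (1 * m) * rh * (ph - phx)\<^sup>2 / 4"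
   using a m(1) m(2)[of ph] P(1) by (intro divide_right_mono mult_right_mono mult_mono) auto
  moreover have "(1 * m) * rh * (ph - phx)\<^sup>2 / 4 = (k * d)\<^sup>2" unfolding k_def d_def using m P by (simp add: power_mult_distrib)
  ultimately have "(k * d)\<^sup>2 <= (norm (s - of_real rh * cis phx))\<^sup>2" by linarith
  hence "k * d <= norm (s - of_real rh * cis phx)" by (rule power2_le_imp_le) simp
  hence "c * (k * d) <= c * norm (s - of_real rh * cis phx)" using cM(1) by (intro mult_left_mono) auto
  moreover have cm: "c * norm (s - of_real rh * cis phx) <= norm (of_real x - J_map th s)" "norm (of_real x - J_map th s) <= M"
   using cM(3)[of l ph] a by (auto simp: s_def)
  ultimately have N: "c * k * d <= norm (of_real x - J_map th s)" by (simp add: mult.assoc)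
  have ckd: "0 < c * k * d" using cM k d by simp
  have "ln (c * k * d) <= ln (norm (of_real x - J_map th s))" using N ckd by (rule ln_mono)
  moreover have "ln (c * k * d) = ln (c * k) + ln d" using cM k d by (simp add: ln_mult)
  moreover have "ln (norm (of_real x - J_map th s)) <= ln M" using cm(2) N ckd by (intro ln_mono) linarith+
  ultimately have "\<bar>ln (norm (of_real x - J_map th s))\<bar> <= \<bar>ln (c * k)\<bar> + \<bar>ln M\<bar> + \<bar>ln d\<bar>" by linarith
  moreover have "\<bar>ln (c * k)\<bar> <= 2 * \<bar>ln (c * k)\<bar> * d powr (-1/4)" "\<bar>ln M\<bar> <= 2 * \<bar>ln M\<bar> * d powr (-1/4)"
   using mult_left_mono[OF log_powr_bounds(1)[OF d], of "\<bar>ln (c * k)\<bar>"] mult_left_mono[OF log_powr_bounds(1)[OF d], of "\<bar>ln M\<bar>"]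
   by (simp_all add: mult_ac)
  ultimately have "\<bar>ln (norm (of_real x - J_map th s))\<bar> <= C * d powr (-1/4)"
   using log_powr_bounds(3)[OF d] unfolding C_def distrib_right by linarith
  moreover have "J_map th s ~= of_real x" using N ckd by auto
  ultimately show "\<bar>Re (real_log_dist x (J_map th (of_real l * arcp th ph)))\<bar> <= C * \<bar>ph - arca th x\<bar> powr (-1/4)"
   unfolding s_def ang d_def by (simp add: Re_real_log_dist)
 qed
qed

text \<open>The difference of two logarithms decays like 1/l although each one grows. This factor
  makes the contribution of infinity vanish and supplies the decay required on the edges. For l <=
  Lm it costs only a constant.\<close>

lemma log_ratio_bound:
 assumes "th > 0" "x > 0" "x ~= arcv th 0" "y > 0" "y ~= arcv th 0"
 defines "L \<equiv> %l ph. real_log_dist x (J_map th (of_real l * arcp th ph)) - real_log_dist y (J_map th (of_real l * arcp th ph))"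
 obtains C where "C > 0" "!!l ph. 1 < l ==> 0 < ph ==> ph < pi ==> \<bar>Im (L l ph)\<bar> <= C / l"
  "!!l ph. 1 < l ==> 0 < ph ==> ph < pi ==> ph ~= arca th x ==> ph ~= arca th y ==>
   norm (L l ph) <= C / l * (\<bar>ph - arca th x\<bar> powr (-1/4) + \<bar>ph - arca th y\<bar> powr (-1/4))"
proof -
 obtain m where m: "m > 0" "!!ph. 0 <= ph ==> ph <= pi ==> m <= arcr th ph" using arcr_lower[OF assms(1)] by blast
 define k where "k = (1/2::real) powr (1/th) / 2"
 have k: "k > 0" by (simp add: k_def)
 define M0 where "M0 = max x y"
 have M0: "x <= M0" "y <= M0" "M0 > 0" using assms by (auto simp: M0_def)
 \<comment> \<open>2/m ensures norm s >= 2, needed for the growth of J, and 2 M0/(k m) ensures norm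
   J >= 2 M0, so that norm J - M0 is at least half of norm J.\<close>
 define Lm where "Lm = max 1 (max (2/m) (2 * M0 / (k * m)))"
 have Lm: "Lm >= 1" "Lm >= 2/m" "Lm >= 2 * M0 / (k * m)" by (auto simp: Lm_def)
 obtain Cx where Cx: "Cx > 0" "!!l ph. 1 < l ==> l <= Lm ==> 0 < ph ==> ph < pi ==> ph ~= arca th x ==>
  \<bar>Re (real_log_dist x (J_map th (of_real l * arcp th ph)))\<bar> <= Cx * \<bar>ph - arca th x\<bar> powr (-1/4)"
  using Re_log_dist_bound[OF assms(1-3)] by blast
 obtain Cy where Cy: "Cy > 0" "!!l ph. 1 < l ==> l <= Lm ==> 0 < ph ==> ph < pi ==> ph ~= arca th y ==>
  \<bar>Re (real_log_dist y (J_map th (of_real l * arcp th ph)))\<bar> <= Cy * \<bar>ph - arca th y\<bar> powr (-1/4)"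
  using Re_log_dist_bound[OF assms(1,4,5)] by blast
 define C1 where "C1 = 2 * \<bar>x - y\<bar> / (k * m)"
 have C1: "C1 >= 0" using k m by (simp add: C1_def)
 have far: "norm (L l ph) <= C1 / l" if a: "l > Lm" "0 < ph" "ph < pi" for l ph
 proof -
  define s where "s = of_real l * arcp th ph"
  have l: "l > 1" using a Lm by simp
  have "norm s = l * arcr th ph" using norm_arcp[OF assms(1), of ph] a l by (simp add: s_def norm_mult)
  hence ns: "norm s >= l * m" using m(2)[of ph] a l by simp
  have "l * m >= Lm * m" using a m by simp
  moreover have "Lm * m >= 2" using Lm(2) m by (simp add: divide_le_eq)
  ultimately have "norm s >= 2" using ns by linarith
  hence "norm (J_map th s) >= k * norm s" using J_map_lower[OF assms(1)] by (simp add: k_def)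
  hence J: "norm (J_map th s) >= k * (l * m)" using ns k by (meson mult_left_mono less_imp_le order_trans)
  have "2 * M0 <= Lm * (k * m)" using Lm(3) m k by (simp add: divide_le_eq)
  also have "... <= l * (k * m)" using a m k by (intro mult_right_mono) auto
  finally have J2: "norm (J_map th s) >= 2 * M0" using J by (simp add: mult_ac)
  have Im: "Im (J_map th s) >= 0" using Im_J_map_exterior[OF assms(1) l a(2,3)] by (simp add: s_def)
  have "norm (L l ph) <= \<bar>x - y\<bar> / (norm (J_map th s) - M0)" unfolding L_def s_def[symmetric]
   by (rule real_log_dist_diff_bound[OF Im]) (use assms M0 J2 in auto)
  also have "... <= \<bar>x - y\<bar> / (norm (J_map th s) / 2)" using J2 M0 by (intro divide_left_mono mult_pos_pos) auto
  also have "... <= \<bar>x - y\<bar> / (k * (l * m) / 2)" using J k l m J2 M0 by (intro divide_left_mono divide_right_mono mult_pos_pos) auto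
  also have "... = C1 / l" unfolding C1_def using k m l by (simp add: field_simps)
  finally show ?thesis .
 qed
 have ImL: "\<bar>Im (L l ph)\<bar> <= pi" if a: "l > 1" "0 < ph" "ph < pi" for l ph
 proof -
  have J: "Im (J_map th (of_real l * arcp th ph)) > 0" using Im_J_map_exterior[OF assms(1) a] .
  hence "\<bar>Im (real_log_dist x (J_map th (of_real l * arcp th ph)))\<bar> <= pi/2"
   "\<bar>Im (real_log_dist y (J_map th (of_real l * arcp th ph)))\<bar> <= pi/2"
   by (intro abs_Im_real_log_dist; force)+
  thus ?thesis unfolding L_def minus_complex.sel by linarith
 qed
 define C where "C = 2 * C1 + Lm * (Cx + Cy + 2 * pi)"
 show thesis
 proof (rule that[of C])
  have "Lm * (Cx + Cy + 2 * pi) > 0" using Lm Cx Cy pi_gt_zero by (intro mult_pos_pos add_pos_pos) auto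
  thus "C > 0" using C1 by (simp add: C_def)
  fix l ph :: real assume a: "1 < l" "0 < ph" "ph < pi"
  show "\<bar>Im (L l ph)\<bar> <= C / l"
  proof (cases "l > Lm")
   case True
   have "\<bar>Im (L l ph)\<bar> <= C1 / l" using far[OF True a(2,3)] abs_Im_le_cmod[of "L l ph"] by linarith
   also have "... <= C / l" using a C1 Cx Cy Lm by (intro divide_right_mono) (auto simp: C_def intro!: add_increasing2)
   finally show ?thesis .
  next
   case False
   have "pi * l <= pi * Lm" using False by simp
   also have "... <= C" unfolding C_def distrib_left using C1 Cx Cy Lm by (simp add: add_increasing add_increasing2 mult.commute)
   finally have "pi <= C / l" using a by (simp add: le_divide_eq)
   thus ?thesis using ImL[OF a] by linarith
  qed
  assume n: "ph ~= arca th x" "ph ~= arca th y"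
  define u v where "u = \<bar>ph - arca th x\<bar> powr (-1/4)" and "v = \<bar>ph - arca th y\<bar> powr (-1/4)"
  have ang: "0 <= arca th t" "arca th t <= pi" if "t > 0" for t
   using arca(2,3)[OF assms(1), of t] that by (cases "t <= arcv th 0"; auto simp: arca_def)+
  have uv: "u >= 0" "v >= 0" "1 <= 2 * u" "1 <= 2 * v"
   using log_powr_bounds(1)[of "\<bar>ph - arca th x\<bar>"] log_powr_bounds(1)[of "\<bar>ph - arca th y\<bar>"] n a ang[OF assms(2)] ang[OF assms(4)] pi_less_4
   by (auto simp: u_def v_def)
  have "norm (L l ph) <= C / l * (u + v)"
  proof (cases "l > Lm")
   case True
   have "norm (L l ph) <= C1 / l * 1" using far[OF True a(2,3)] by simp
   also have "... <= C1 / l * (2 * (u + v))" using uv C1 a by (intro mult_left_mono) auto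
   also have "... = (2 * C1) / l * (u + v)" by simp
   also have "... <= C / l * (u + v)" using uv a Cx Cy Lm by (intro mult_right_mono divide_right_mono) (auto simp: C_def)
   finally show ?thesis .
  next
   case False
   have "norm (L l ph) <= \<bar>Re (L l ph)\<bar> + \<bar>Im (L l ph)\<bar>" by (rule cmod_le)
   also have "... <= (Cx * u + Cy * v) + pi"
    using Cx(2)[OF a(1) _ a(2,3) n(1)] Cy(2)[OF a(1) _ a(2,3) n(2)] False ImL[OF a] unfolding L_def u_def v_def minus_complex.sel by linarith
   also have "... <= (Cx + Cy + 2 * pi) * (u + v)"
   proof -
    have "pi * 1 <= pi * (2 * u)" using uv by (intro mult_left_mono) auto
    moreover have "(Cx + Cy + 2 * pi) * (u + v) = (Cx * u + Cy * v + pi * (2 * u)) + (Cx * v + Cy * u + pi * (2 * v))" by (simp add: algebra_simps)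
    moreover have "Cx * v + Cy * u + pi * (2 * v) >= 0" using Cx Cy uv by simp
    ultimately show ?thesis by linarith
   qed
   also have "... <= (C / l) * (u + v)"
   proof (rule mult_right_mono)
    have "(Cx + Cy + 2 * pi) * l <= (Cx + Cy + 2 * pi) * Lm" using False Cx Cy by (intro mult_left_mono) auto
    also have "... <= C" using C1 by (simp add: C_def mult.commute)
    finally show "Cx + Cy + 2 * pi <= C / l" using a by (simp add: le_divide_eq)
   qed (use uv in auto)
   finally show ?thesis .
  qed
  thus "norm (L l ph) <= C / l * (\<bar>ph - arca th x\<bar> powr (-1/4) + \<bar>ph - arca th y\<bar> powr (-1/4))"
   by (simp add: u_def v_def)
 qed
qed

text \<open>Both sides are the logarithmic derivative of J along the arc with respect to the angle,
  once by the chain rule and once from the explicit value X. In particular it is real.\<close>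

lemma J_log_rate_arc:
 assumes "th > 0" "0 < ph" "ph < pi"
 shows "J_log_rate th (arcp th ph) * arc_log_deriv th ph = - of_real (arc_rate th ph)"
proof -
 define s where "s = arcp th ph"
 have s: "Im s > 0" using Im_arcp_pos assms by (simp add: s_def)
 hence s0: "s ~= 0" "s ~= -1" by auto
 have X: "arcv th ph > 0" using arcv_pos assms by simp
 have J: "J_map th s = of_real (arcv th ph)" using J_map_arc assms by (simp add: s_def)
 have "(J_map th has_field_derivative J_map th s * J_log_rate th s / s) (at (arcp th ph))"
  using J_map_deriv[OF assms(1) _ s0] s by (simp add: s_def)
 from field_vector_diff_chain_at[OF arcp_deriv[OF assms] this]
 have 1: "((%t. J_map th (arcp th t)) has_vector_derivative s * arc_log_deriv th ph * (J_map th s * J_log_rate th s / s)) (at ph)"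
  by (simp add: o_def s_def)
 have "((%t. of_real (arcv th t) :: complex) has_vector_derivative of_real (- (arcv th ph * arc_rate th ph))) (at ph)"
  using arcv_deriv[OF assms] by (metis has_real_derivative_iff_has_vector_derivative has_vector_derivative_of_real)
 hence 2: "((%t. J_map th (arcp th t)) has_vector_derivative of_real (- (arcv th ph * arc_rate th ph))) (at ph)"
  by (rule has_vector_derivative_transform_within_open[of _ _ _ "{0<..<pi}"]) (use assms J_map_arc in auto)
 have "s * arc_log_deriv th ph * (J_map th s * J_log_rate th s / s) = of_real (- (arcv th ph * arc_rate th ph))"
  by (rule vector_derivative_unique_at[OF 1 2])
 hence "of_real (arcv th ph) * (J_log_rate th s * arc_log_deriv th ph) = of_real (arcv th ph) * (- of_real (arc_rate th ph))"
  unfolding J using s0 by (simp add: mult_ac)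
 thus ?thesis using X unfolding s_def by (metis mult_left_cancel of_real_eq_0_iff less_irrefl)
qed

text \<open>On the positive axis \<open>extlog\<close> has real part 0 and \<open>J_log_rate\<close>
  is real, so Re of the first and Im of the second vanish linearly in ph, uniformly in l. The factor
  ph compensates the singularity of the logarithm at angle 0 which occurs for x beyond the end of
  the support.\<close>

lemma Re_exterior_rate_edge:
 assumes "th > 0" "0 < p" "p < pi" "l > 1" "0 < ph" "ph < pi / 2" "0 < d" "d <= \<bar>ph - p\<bar>"
 defines "s \<equiv> of_real l * arcp th ph"
 shows "\<bar>Re (extlog th p s * J_log_rate th s)\<bar> <= (8 / d\<^sup>2 * (2 + 1/th) + 16 * (1 + 1/th)) * ph"
proof -
 have hp: "ph < pi" "ph ~= p" using assms by auto
 note sp = scaled_arc_props[OF assms(1-5) hp(1), folded s_def]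
 define K where "K = 1 + 1/th"
 have K: "K > 0" using assms by (simp add: K_def add_pos_pos)
 have Res: "Re s >= 0" unfolding sp(7) using sp(8) assms by (simp add: cos_ge_zero)
 have s1: "norm s <= norm (s + 1)" "norm (s + 1) >= 1"
 proof -
  show "norm s <= norm (s + 1)" unfolding cmod_def using Res by (intro real_sqrt_le_mono add_right_mono power_mono) auto
  show "norm (s + 1) >= 1" using complex_Re_le_cmod[of "s+1"] Res by simp
 qed
 have ns: "Im s <= norm s * ph"
 proof -
  have "norm s = l * arcr th ph" unfolding sp(7) norm_mult norm_cis norm_of_real using sp(8) by simp
  moreover have "Im s = l * arcr th ph * sin ph" unfolding sp(7) by simp
  ultimately have "Im s = norm s * sin ph" by simp
  also have "... <= norm s * ph" using assms by (intro mult_left_mono sin_x_le_x) auto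
  finally show ?thesis .
 qed
 have hI: "\<bar>Im (J_log_rate th s)\<bar> <= K * ph"
 proof -
  have "Im (J_log_rate th s) = K * Im s / (norm (s + 1))\<^sup>2"
   unfolding J_log_rate_def K_def[symmetric] by (simp add: Im_divide cmod_power2)
  hence "\<bar>Im (J_log_rate th s)\<bar> = K * Im s / (norm (s + 1))\<^sup>2" using K sp(1) by (simp add: abs_mult)
  also have "... <= K * (norm (s + 1) * ph) / (norm (s + 1))\<^sup>2"
   using K ns s1 assms by (intro divide_right_mono mult_left_mono order_trans[OF ns] mult_right_mono) auto
  also have "... = K * ph / norm (s + 1)" using s1 by (simp add: power2_eq_square)
  also have "... <= K * ph / 1" using s1 K assms by (intro divide_left_mono) auto
  finally show ?thesis by simp
 qed
 have hR: "\<bar>Re (J_log_rate th s)\<bar> <= 1 + K"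
 proof -
  have "norm (J_log_rate th s) <= 1 + K / norm (s + 1)"
   unfolding J_log_rate_def K_def[symmetric]
   using norm_triangle_ineq4[of 1 "of_real K / (s+1)"] K by (simp add: norm_divide)
  also have "K / norm (s + 1) <= K / 1" using s1 K by (intro divide_left_mono) auto
  finally show ?thesis using abs_Re_le_cmod[of "J_log_rate th s"] by simp
 qed
 have ER: "\<bar>Re (extlog th p s)\<bar> <= 8 / d\<^sup>2 * ph"
 proof -
  have Re: "0 <= Re (extlog th p s)" "Re (extlog th p s) <= ln (1 + 16 * sin ph * sin p / (ph - p)\<^sup>2) / 2"
   using Re_extlog_bounds[OF assms(1-3) sp(8) _ _ hp(2)] assms(5) hp unfolding sp(7)[symmetric] by auto
  have sn: "0 <= sin ph" "sin ph <= ph" "0 <= sin p" "sin p <= 1" using assms hp by (auto intro!: sin_ge_zero sin_x_le_x)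
  have "ln (1 + 16 * sin ph * sin p / (ph - p)\<^sup>2) <= 16 * sin ph * sin p / (ph - p)\<^sup>2"
   using sn by (intro ln_add_one_self_le_self) auto
  also have "... <= 16 * ph / (ph - p)\<^sup>2"
  proof (rule divide_right_mono)
   have "sin ph * sin p <= ph * 1" using sn assms by (intro mult_mono) auto
   thus "16 * sin ph * sin p <= 16 * ph" by simp
  qed simp
  also have "... <= 16 * ph / d\<^sup>2"
  proof (rule divide_left_mono)
   show "d\<^sup>2 <= (ph - p)\<^sup>2" using power_mono[OF assms(8), of 2] assms(7) by simp
  qed (use assms in auto)
  finally show ?thesis using Re by simp
 qed
 have EI: "\<bar>Im (extlog th p s)\<bar> <= 16"
  using abs_Im_extlog[OF assms(1-3) sp(4,5)] pi_less_4 by simp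
 have "\<bar>Re (extlog th p s * J_log_rate th s)\<bar> <= \<bar>Re (extlog th p s)\<bar> * \<bar>Re (J_log_rate th s)\<bar> + \<bar>Im (extlog th p s)\<bar> * \<bar>Im (J_log_rate th s)\<bar>"
  unfolding times_complex.sel by (simp add: abs_mult[symmetric])
 also have "... <= (8 / d\<^sup>2 * ph) * (1 + K) + 16 * (K * ph)"
  by (intro add_mono mult_mono ER hR EI hI) (use assms in auto)
 also have "... = (8 / d\<^sup>2 * (2 + 1/th) + 16 * (1 + 1/th)) * ph" by (simp add: K_def algebra_simps)
 finally show ?thesis .
qed

section \<open>Boundary values on the arc and on the real axis\<close>

definition arc_green :: "real => real => real => real" where
 "arc_green th p ph = Re (extlog th p (arcp th ph))"

definition arc_phase :: "real => real => real => real" where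
 "arc_phase th p ph = Im (extlog th p (arcp th ph))"

lemma isCont_exterior_rate:
 assumes "th > 0" "0 < p" "p < pi" "0 <= Im s" "s ~= -1" "s / arcp th p - 1 \<notin> \<real>\<^sub>\<le>\<^sub>0"
 shows "(%s. extlog th p s * J_log_rate th s) field_differentiable at s"
proof -
 have "s + 1 ~= 0" using assms(5) by (simp add: add_eq_0_iff2)
 hence "J_log_rate th field_differentiable at s" unfolding J_log_rate_def[abs_def]
  by (intro derivative_intros) auto
 moreover have "extlog th p field_differentiable at s"
  using extlog_deriv[OF assms(1-4,6)] unfolding field_differentiable_def by blast
 ultimately show ?thesis by (intro field_differentiable_mult)
qed

lemma log_dist_J_differentiable:
 assumes "th > 0" "0 <= Im s" "s ~= 0" "s ~= -1" "0 <= Im (J_map th s)" "J_map th s ~= of_real x"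
 shows "(%s. real_log_dist x (J_map th s)) field_differentiable at s"
 using DERIV_chain2[OF real_log_dist_deriv[OF assms(5,6)] J_map_deriv[OF assms(1-4)]]
 unfolding field_differentiable_def by blast

lemma open_exterior:
 assumes "th > 0"
 shows "open {s. 0 < Im s & 0 < Im (J_map th s) & s / a - 1 \<notin> \<real>\<^sub>\<le>\<^sub>0}"
proof -
 have "continuous_on {s. 0 < Im s} (J_map th)"
 proof (intro continuous_at_imp_continuous_on ballI)
  fix s assume "s \<in> {s. 0 < Im s}"
  hence "0 < Im s" by simp
  thus "isCont (J_map th) s" by (intro DERIV_isCont[OF J_map_deriv[OF assms]]) auto
 qed
 hence 1: "open ({s. 0 < Im s} \<inter> J_map th -` {w. 0 < Im w})"
  by (rule continuous_open_preimage) (auto simp: open_halfspace_Im_gt)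
 have 2: "open ((%s. s / a - 1) -` (- \<real>\<^sub>\<le>\<^sub>0))"
  unfolding divide_inverse by (intro open_vimage open_Compl closed_nonpos_Reals_complex continuous_intros)
 have "{s. 0 < Im s & 0 < Im (J_map th s) & s / a - 1 \<notin> \<real>\<^sub>\<le>\<^sub>0} = ({s. 0 < Im s} \<inter> J_map th -` {w. 0 < Im w}) \<inter> (%s. s / a - 1) -` (- \<real>\<^sub>\<le>\<^sub>0)"
  by auto
 thus ?thesis using open_Int[OF 1 2] by simp
qed

text \<open>A real point is equally far from a and from its conjugate.\<close>

lemma extlog_real:
 assumes "th > 0" "0 < p" "p < pi" shows "Re (extlog th p (of_real t)) = 0"
proof -
 have a: "Im (arcp th p) > 0" using Im_arcp_pos assms by simp
 hence n: "of_real t ~= arcp th p" "of_real t ~= cnj (arcp th p)" by (auto simp: complex_eq_iff)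
 have "norm (of_real t - cnj (arcp th p)) = norm (cnj (of_real t - arcp th p))" by simp
 hence "norm (of_real t - cnj (arcp th p)) = norm (of_real t - arcp th p)" unfolding complex_mod_cnj .
 thus ?thesis using Re_extlog[OF assms n] n by simp
qed

lemma J_log_rate_real: "J_log_rate th (of_real t) = of_real (1 - (1 + 1/th) / (t + 1))"
 by (simp add: J_log_rate_def)

text \<open>The derivative of the imaginary part along the axis is minus a Poisson kernel. Beyond
  the end of the support this replaces an unknown edge contribution by the boundary value at 1/th,
  at the price of an inequality.\<close>

lemma arc_phase_real_mono:
 assumes "th > 0" "0 < p" "p < pi" "1/th <= t"
 shows "Im (extlog th p (of_real t)) <= arc_phase th p 0"
proof -
 define a where "a = arcp th p"
 have a: "Im a > 0" using Im_arcp_pos assms by (simp add: a_def)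
 have "(%t. Im (extlog th p (of_real t))) t <= (%t. Im (extlog th p (of_real t))) (1/th)"
 proof (rule DERIV_nonpos_imp_nonincreasing[OF assms(4)])
  fix u assume u: "1/th <= u" "u <= t"
  have u0: "u > 0" using u(1) assms by (meson less_le_trans zero_less_divide_1_iff)
  have "of_real u / a - 1 \<notin> \<real>\<^sub>\<le>\<^sub>0"
  proof
   assume "of_real u / a - 1 \<in> \<real>\<^sub>\<le>\<^sub>0"
   hence "of_real (u * th) * arcp th 0 / arcp th p - 1 \<in> \<real>\<^sub>\<le>\<^sub>0"
    using assms(1) by (simp add: arcp_0 a_def)
   from arc_cut[OF assms(1-3) _ _ _ this] show False using u0 assms by simp
  qed
  hence "(extlog th p has_field_derivative 1 / (of_real u - cnj a) - 1 / (of_real u - a)) (at (of_real u))"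
   unfolding a_def by (intro extlog_deriv assms) auto
  hence "((%u. extlog th p (of_real u)) has_vector_derivative 1 / (of_real u - cnj a) - 1 / (of_real u - a)) (at u)"
   by (rule has_vector_derivative_real_field)
  from bounded_linear.has_vector_derivative[OF bounded_linear_Im this]
  have D: "((%u. Im (extlog th p (of_real u))) has_real_derivative Im (1 / (of_real u - cnj a) - 1 / (of_real u - a))) (at u)"
   by (simp add: has_real_derivative_iff_has_vector_derivative)
  have "Im (1 / (of_real u - cnj a) - 1 / (of_real u - a)) = - (2 * Im a / (norm (of_real u - a))\<^sup>2)"
   by (simp add: Im_divide cmod_power2 power2_commute)
  also have "... <= 0" using a by simp
  finally show "\<exists>y. ((%u. Im (extlog th p (of_real u))) has_real_derivative y) (at u) & y <= 0" using D by blast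
 qed
 thus ?thesis by (simp add: arc_phase_def arcp_0)
qed

subsection \<open>Logarithmic potentials against the Green function\<close>

text \<open>The contour limit for g = ln ((x - J)/(y - J)) \<open>extlog\<close>
  \<open>J_log_rate\<close>, which decays at infinity. The real axis contributes only where the
  logarithm has an imaginary part, that is where the value of J lies between the end value and x.
  Hence there is nothing for x inside the support, and for x outside an integral of the conjugate
  function against d ln J, estimated by the value at 1/th.\<close>

lemma arc_log_potential:
 assumes th: "th > 0" and p: "0 < p" "p < pi" and y: "0 < y" "y < arcv th 0"
  and x: "0 < x" "x ~= arcv th 0"
 defines "f \<equiv> %ph. arc_rate th ph * ((ln \<bar>x - arcv th ph\<bar> - ln \<bar>y - arcv th ph\<bar>) * arc_green th p ph
   - pi * (of_bool (y < arcv th ph) - of_bool (x < arcv th ph)) * arc_phase th p ph)"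
 shows "f integrable_on {0<..<pi}"
  "x < arcv th 0 ==> integral {0<..<pi} f = 0"
  "x > arcv th 0 ==> integral {0<..<pi} f <= pi * arc_phase th p 0 * ln (x / arcv th 0)"
proof -
 define b where "b = arcv th 0"
 define a where "a = arcp th p"
 define px py where "px = arca th x" and "py = arca th y"
 have b0: "b > 0" using arcv_pos[OF th] by (simp add: b_def)
 have py: "0 < py" "py < pi" using arca_interior[OF th y] by (auto simp: py_def)
 have px: "px = 0 | 0 < px" "px < pi"
  using arca_interior[OF th x(1)] by (cases "x < b"; auto simp: px_def b_def arca_def)+
 have Xx: "arcv th ph = x \<longleftrightarrow> ph = px" if "ph \<in> {0<..<pi}" "x < b" for ph
  using arca(1)[OF th, of x] arca_of_value[OF th, of ph] that x by (auto simp: px_def b_def)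
 have Xx': "arcv th ph ~= x" if "ph \<in> {0<..<pi}" "ph ~= px" for ph
  using arca_of_value[OF th, of ph] that by (auto simp: px_def)
 have Xy': "arcv th ph ~= y" if "ph \<in> {0<..<pi}" "ph ~= py" for ph
  using arca_of_value[OF th, of ph] that by (auto simp: py_def)
 define s where "s = (%l ph. of_real l * arcp th ph)"
 define L where "L = (%s. real_log_dist x (J_map th s) - real_log_dist y (J_map th s))"
 define EH where "EH = (%s. extlog th p s * J_log_rate th s)"
 define g where "g = (%s. L s * EH s)"
 define S where "S = {s. 0 < Im s & 0 < Im (J_map th s) & s / a - 1 \<notin> \<real>\<^sub>\<le>\<^sub>0}"
 have gd: "g field_differentiable at z"
  if "0 <= Im z" "z ~= 0" "z ~= -1" "0 <= Im (J_map th z)" "J_map th z ~= of_real x" "J_map th z ~= of_real y" "z / a - 1 \<notin> \<real>\<^sub>\<le>\<^sub>0" for z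
  unfolding g_def L_def EH_def
  by (intro field_differentiable_mult field_differentiable_diff log_dist_J_differentiable isCont_exterior_rate th p)
    (use that in \<open>auto simp: a_def\<close>)
 have S: "open S" unfolding S_def by (rule open_exterior[OF th])
 have hol: "g holomorphic_on S" unfolding holomorphic_on_def
 proof
  fix z assume "z \<in> S"
  hence z: "0 < Im z" "0 < Im (J_map th z)" "z / a - 1 \<notin> \<real>\<^sub>\<le>\<^sub>0" by (auto simp: S_def)
  have "J_map th z ~= of_real x" "J_map th z ~= of_real y" using z(2) by (metis Im_complex_of_real less_irrefl)+
  moreover have "z ~= 0" "z ~= -1" using z(1) by auto
  ultimately have "g field_differentiable at z" by (intro gd) (use z in auto)
  thus "g field_differentiable at z within S" by (rule field_differentiable_at_within)
 qed
 have inS: "of_real l * arcp th ph \<in> S" if "l > 1" "0 < ph" "ph < pi" for l ph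
  using scaled_arc_props(1,6)[OF th p that] Im_J_map_exterior[OF th that] unfolding S_def a_def by blast
 obtain C1 where C1: "C1 > 0" "!!l ph. 1 < l ==> 0 < ph ==> ph < pi ==> \<bar>Im (L (s l ph))\<bar> <= C1 / l"
  "!!l ph. 1 < l ==> 0 < ph ==> ph < pi ==> ph ~= px ==> ph ~= py ==>
   norm (L (s l ph)) <= C1 / l * (\<bar>ph - px\<bar> powr (-1/4) + \<bar>ph - py\<bar> powr (-1/4))"
  using log_ratio_bound[OF th x y(1)] y(2) unfolding L_def s_def px_def py_def by (metis less_irrefl)
 obtain C2 where C2: "C2 > 0" "!!l ph. l > 1 ==> 0 < ph ==> ph < pi ==> ph ~= p ==> norm (EH (s l ph)) <= C2 * \<bar>ph - p\<bar> powr (-1/4)"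
  using extlog_rate_bound[OF th p] unfolding EH_def s_def by metis
 define F where "F = {px, py, p}"
 \<comment> \<open>Each product of two powers -1/4 is split by 2 u w <= u^2 + w^2, which leaves
   single singularities with exponent -1/2.\<close>
 define B where "B = (%ph. C1 * C2 * (\<bar>ph - px\<bar> powr (-1/2) + \<bar>ph - py\<bar> powr (-1/2) + \<bar>ph - p\<bar> powr (-1/2)))"
 have B: "B integrable_on {0<..<pi}"
 proof -
  have "B integrable_on {0..pi}" unfolding B_def
   by (intro integrable_on_mult_right integrable_add abs_powr_integrable_on) auto
  thus ?thesis by (simp add: integrable_on_open_interval_real)
 qed
 have sq: "(u + v) * w <= u\<^sup>2 + v\<^sup>2 + w\<^sup>2" for u v w :: real
 proof -
  have "2 * (u * w) <= u\<^sup>2 + w\<^sup>2" "2 * (v * w) <= v\<^sup>2 + w\<^sup>2"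
   using sum_squares_bound[of u w] sum_squares_bound[of v w] by (simp_all add: mult.assoc)
  thus ?thesis unfolding distrib_right using zero_le_power2[of u] zero_le_power2[of v] by linarith
 qed
 have pw: "(\<bar>t\<bar> powr (-1/4))\<^sup>2 = \<bar>t\<bar> powr (-1/2)" for t :: real by (simp add: power2_eq_square flip: powr_add)
 have bd': "norm (g (s l ph)) <= B ph / l" if a: "l > 1" "ph \<in> {0<..<pi} - F" for l ph
 proof -
  define u v w where "u = \<bar>ph - px\<bar> powr (-1/4)" and "v = \<bar>ph - py\<bar> powr (-1/4)" and "w = \<bar>ph - p\<bar> powr (-1/4)"
  have "norm (g (s l ph)) <= (C1 / l * (u + v)) * (C2 * w)" unfolding g_def norm_mult u_def v_def w_def
   by (intro mult_mono C1 C2) (use a C1 C2 in \<open>auto simp: F_def\<close>)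
  also have "... = (C1 * C2 / l) * ((u + v) * w)" by simp
  also have "... <= (C1 * C2 / l) * (u\<^sup>2 + v\<^sup>2 + w\<^sup>2)" using C1(1) C2(1) a by (intro mult_left_mono sq) auto
  also have "... = B ph / l" unfolding B_def u_def v_def w_def pw by simp
  finally show ?thesis .
 qed
 have B0: "B ph >= 0" for ph using C1(1) C2(1) by (simp add: B_def)
 have bd: "norm (g (of_real l * arcp th ph)) <= B ph" if a: "l > 1" "ph \<in> {0<..<pi} - F" for l ph
 proof -
  have "B ph / l <= B ph / 1" using a B0 by (intro divide_left_mono) auto
  thus ?thesis using bd'[OF a] by (simp add: s_def)
 qed
 define g1 where "g1 = (%ph. g (arcp th ph))"
 have lim1: "((%l. g (of_real l * arcp th ph)) \<longlongrightarrow> g1 ph) (at_right 1)" if a: "ph \<in> {0<..<pi} - F" for ph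
 proof -
  have hp: "0 < ph" "ph < pi" "ph ~= px" "ph ~= py" "ph ~= p" using a by (auto simp: F_def)
  have Im: "Im (arcp th ph) > 0" using Im_arcp_pos[OF th] hp by simp
  have J: "J_map th (arcp th ph) = of_real (arcv th ph)" using J_map_arc[OF th] hp by simp
  have cut: "arcp th ph / a - 1 \<notin> \<real>\<^sub>\<le>\<^sub>0" using arc_cut[OF th p, of 1 ph] hp by (auto simp: a_def)
  have n0: "arcp th ph ~= 0" "arcp th ph ~= -1" using Im by auto
  have "g field_differentiable at (arcp th ph)"
   by (rule gd) (use Im n0 cut J Xx' Xy' hp in auto)
  hence "isCont g (arcp th ph)" by (rule field_differentiable_imp_continuous_at)
  moreover have "((%l. of_real l * arcp th ph) \<longlongrightarrow> of_real 1 * arcp th ph) (at_right 1)"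
   by (intro tendsto_intros)
  ultimately show ?thesis unfolding g1_def by (intro isCont_tendsto_compose[of _ g]) auto
 qed
 have liminf: "((%l. g (of_real l * arcp th ph)) \<longlongrightarrow> \<i> * of_real 0) at_top" if a: "ph \<in> {0<..<pi} - F" for ph
 proof -
  have "((%l. B ph / l) \<longlongrightarrow> 0) at_top" by real_asymp
  moreover have "\<forall>\<^sub>F l in at_top. norm (g (of_real l * arcp th ph)) <= B ph / l"
   using eventually_gt_at_top[of 1] by eventually_elim (use bd'[OF _ a] in \<open>auto simp: s_def\<close>)
  ultimately have "((%l. g (of_real l * arcp th ph)) \<longlongrightarrow> 0) at_top" by (rule Lim_null_comparison[rotated])
  thus ?thesis by simp
 qed
 \<comment> \<open>Half the distances of the singular angles from 0 and pi. For x beyond the end px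
   = 0, and its entry is replaced by pi/4, since that singularity sits on the edge itself.\<close>
 define D where "D = {pi/4, p/2, (pi-p)/2, py/2, (pi-py)/2, (if px = 0 then pi/4 else px/2), (pi-px)/2}"
 define d where "d = Min D"
 have Dpos: "u > 0" if "u \<in> D" for u using that p py px pi_gt_zero by (auto simp: D_def split: if_splits)
 have Dfin: "finite D" "D ~= {}" by (simp_all add: D_def)
 have d: "d > 0" using Dpos[OF Min_in[OF Dfin]] by (simp add: d_def)
 have dD: "d <= u" if "u \<in> D" for u unfolding d_def by (rule Min_le[OF Dfin(1) that])
 have d1: "d <= pi/4" "d <= p/2" "d <= (pi-p)/2" "d <= py/2" "d <= (pi-py)/2" "px ~= 0 ==> d <= px/2" "d <= (pi-px)/2"
  by (rule dD, unfold D_def, simp)+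
 have d2: "d < pi/2" using d1(1) pi_gt_zero by linarith
 define Ce where "Ce = (C1 * (8 * ((8 / d\<^sup>2 * (2 + 1/th) + 16 * (1 + 1/th)))) + C1 * (C2 * d powr (-1/4))) + C1 * (2 * d powr (-1/4)) * (C2 * d powr (-1/4))"
 have edge: "\<bar>Re (g (of_real l * arcp th ph))\<bar> <= Ce / l" if l: "l > 1" and hp: "ph \<in> {0<..<d} \<union> {pi-d<..<pi}" for l ph
 proof (cases "ph < d")
  \<comment> \<open>Near angle 0 the logarithm may be as large as ph^(-1/4), but it is multiplied by
    a real part of order ph; the other product involves Im L, which is bounded by C1/l.\<close>
  case True
  have ph: "0 < ph" "ph < pi" "ph < pi/2" using hp True d1(1) pi_gt_zero by auto
  have dist: "d <= \<bar>ph - p\<bar>" "ph <= \<bar>ph - px\<bar>" "ph <= \<bar>ph - py\<bar>" "ph ~= px" "ph ~= py" "ph ~= p"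
   using True d1 d ph by (cases "px = 0"; auto)+
  define K where "K = 8 / d\<^sup>2 * (2 + 1/th) + 16 * (1 + 1/th)"
  have K: "K >= 0" using th by (simp add: K_def)
  have u: "\<bar>ph - px\<bar> powr (-1/4) <= ph powr (-1/4)" "\<bar>ph - py\<bar> powr (-1/4) <= ph powr (-1/4)"
   using dist ph by (intro powr_mono2'; simp)+
  have w: "\<bar>ph - p\<bar> powr (-1/4) <= d powr (-1/4)" using dist d by (intro powr_mono2'; simp)
  have n1: "norm (L (s l ph)) <= C1 / l * (2 * ph powr (-1/4))"
  proof -
   have "norm (L (s l ph)) <= C1 / l * (\<bar>ph - px\<bar> powr (-1/4) + \<bar>ph - py\<bar> powr (-1/4))"
    by (rule C1(3)) (use l ph dist in auto)
   also have "... <= C1 / l * (2 * ph powr (-1/4))" using u C1(1) l by (intro mult_left_mono) auto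
   finally show ?thesis .
  qed
  have n2: "\<bar>Re (EH (s l ph))\<bar> <= K * ph" unfolding EH_def s_def K_def
   by (rule Re_exterior_rate_edge[OF th p l ph(1,3) d dist(1)])
  have n3: "\<bar>Im (EH (s l ph))\<bar> <= C2 * d powr (-1/4)"
   using C2(2)[OF l ph(1,2) dist(6)] abs_Im_le_cmod[of "EH (s l ph)"] mult_left_mono[OF w, of C2] C2(1) by linarith
  have n4: "ph powr (-1/4) * ph <= 4"
  proof -
   have "ph powr (-1/4) * ph = ph powr (3/4)" using ph powr_add[of ph "-1/4" 1] by simp
   also have "... <= 4 powr (3/4)" using ph pi_less_4 by (intro powr_mono2) auto
   also have "... <= 4 powr 1" by (intro powr_mono) auto
   finally show ?thesis by simp
  qed
  have "\<bar>Re (g (s l ph))\<bar> <= \<bar>Re (L (s l ph))\<bar> * \<bar>Re (EH (s l ph))\<bar> + \<bar>Im (L (s l ph))\<bar> * \<bar>Im (EH (s l ph))\<bar>"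
   unfolding g_def times_complex.sel by (simp add: abs_mult[symmetric])
  also have "... <= (C1 / l * (2 * ph powr (-1/4))) * (K * ph) + (C1 / l) * (C2 * d powr (-1/4))"
   using n1 abs_Re_le_cmod[of "L (s l ph)"] n2 n3 C1(2)[OF l ph(1,2)] C1(1) l
   by (intro add_mono mult_mono) auto
  also have "(C1 / l * (2 * ph powr (-1/4))) * (K * ph) = (C1 / l * 2 * K) * (ph powr (-1/4) * ph)" by simp
  also have "... <= (C1 / l * 2 * K) * 4" using n4 C1(1) K l by (intro mult_left_mono) auto
  also have "(C1 / l * 2 * K) * 4 + (C1 / l) * (C2 * d powr (-1/4)) = (C1 * (8 * K) + C1 * (C2 * d powr (-1/4))) / l"
   by (simp add: add_divide_distrib)
  also have "... <= Ce / l" unfolding Ce_def K_def[symmetric] using l C1(1) C2(1) by (intro divide_right_mono) auto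
  finally show ?thesis by (simp add: s_def)
 next
  \<comment> \<open>Near angle pi all three singular angles are at distance at least d, so the norms
    suffice.\<close>
  case False
  have ph: "0 < ph" "ph < pi" "pi - d < ph" using hp False d d1(1) by auto
  have dist: "d <= \<bar>ph - p\<bar>" "d <= \<bar>ph - px\<bar>" "d <= \<bar>ph - py\<bar>" "ph ~= px" "ph ~= py" "ph ~= p"
   using ph d1(3,5,7) d by (auto simp: field_simps)
  have u: "\<bar>ph - px\<bar> powr (-1/4) <= d powr (-1/4)" "\<bar>ph - py\<bar> powr (-1/4) <= d powr (-1/4)" "\<bar>ph - p\<bar> powr (-1/4) <= d powr (-1/4)"
   using dist d by (intro powr_mono2'; simp)+
  have "\<bar>Re (g (s l ph))\<bar> <= norm (L (s l ph)) * norm (EH (s l ph))" unfolding g_def norm_mult[symmetric] by (rule abs_Re_le_cmod)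
  also have "... <= (C1 / l * (\<bar>ph - px\<bar> powr (-1/4) + \<bar>ph - py\<bar> powr (-1/4))) * (C2 * \<bar>ph - p\<bar> powr (-1/4))"
   by (intro mult_mono C1(3) C2(2)) (use l ph dist C1(1) in auto)
  also have "... <= (C1 / l * (2 * d powr (-1/4))) * (C2 * d powr (-1/4))"
   using u C1(1) C2(1) l by (intro mult_mono) auto
  also have "... = (C1 * (2 * d powr (-1/4)) * (C2 * d powr (-1/4))) / l" by simp
  also have "... <= Ce / l" unfolding Ce_def using l C1(1) C2(1) th by (intro divide_right_mono) auto
  finally show ?thesis by (simp add: s_def)
 qed
 \<comment> \<open>The edge value Re g at the real point t = l/th: Re \<open>extlog\<close> vanishes
   there, so only - Im L times Im \<open>extlog\<close> times the real rate remains.\<close>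
 define e0 where "e0 = (%l. - (pi * of_bool (J_real th (l/th) < x) * Im (extlog th p (of_real (l/th))) * (1 - (1 + 1/th) / (l/th + 1))))"
 \<comment> \<open>The dilation at which the edge point hits the logarithmic singularity; by
   monotonicity there is at most one.\<close>
 define E where "E = {l. l > 1 & J_real th (l/th) = x}"
 have Jmono: "J_real th (l/th) < J_real th (l'/th)" if "1 <= l" "l < l'" for l l'
  using J_real_strict_mono[OF th, of "l/th" "l'/th"] that th by (simp add: divide_strict_right_mono divide_right_mono)
 have Jb: "J_real th (l/th) > b" if "l > 1" for l
  using Jmono[of 1 l] that J_real_at_end[OF th] by (simp add: b_def)
 have E: "finite E"
 proof (cases "E = {}")
  case False
  then obtain l0 where l0: "l0 \<in> E" by auto
  have "E \<subseteq> {l0}"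
  proof
   fix l assume "l \<in> E"
   thus "l \<in> {l0}" using l0 Jmono[of l l0] Jmono[of l0 l] by (cases l l0 rule: linorder_cases) (auto simp: E_def)
  qed
  thus ?thesis by (rule finite_subset) simp
 qed simp
 have arc_lim: "((%ph. of_real l * arcp th ph) \<longlongrightarrow> of_real l * arcp th 0) (at_right 0)"
  "((%ph. of_real l * arcp th ph) \<longlongrightarrow> of_real l * arcp th pi) (at_left pi)" for l
 proof -
  have "(arcp th \<longlongrightarrow> arcp th 0) (at 0 within {0..pi})" "(arcp th \<longlongrightarrow> arcp th pi) (at pi within {0..pi})"
   using continuous_on_arcp[OF th] by (auto simp: continuous_on)
  thus "((%ph. of_real l * arcp th ph) \<longlongrightarrow> of_real l * arcp th 0) (at_right 0)"
   "((%ph. of_real l * arcp th ph) \<longlongrightarrow> of_real l * arcp th pi) (at_left pi)"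
   by (auto intro!: tendsto_mult tendsto_const simp: at_within_Icc_at_right at_within_Icc_at_left)
 qed
 have e0: "((%ph. Re (g (of_real l * arcp th ph))) \<longlongrightarrow> e0 l) (at_right 0)" if l: "l \<in> {1<..} - E" for l
 proof -
  define t where "t = l / th"
  have t: "t > 0" using l th by (simp add: t_def)
  have st: "of_real l * arcp th 0 = of_real t" by (simp add: arcp_0 t_def)
  have J: "J_map th (of_real t) = of_real (J_real th t)" by (rule J_map_pos_real[OF th t])
  have Jt: "J_real th t > b" "J_real th t ~= x" using Jb l by (auto simp: t_def E_def)
  have yt: "J_real th t > y" using Jt y by (simp add: b_def)
  have cut: "of_real t / a - 1 \<notin> \<real>\<^sub>\<le>\<^sub>0"
   using arc_cut[OF th p, of l 0] l p unfolding st a_def[symmetric] by auto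
  have "g field_differentiable at (of_real t)"
   by (rule gd) (use t J Jt yt cut in \<open>auto simp: complex_eq_iff\<close>)
  hence "isCont g (of_real t)" by (rule field_differentiable_imp_continuous_at)
  hence "((%ph. g (of_real l * arcp th ph)) \<longlongrightarrow> g (of_real t)) (at_right 0)"
   using arc_lim(1)[of l] unfolding st by (rule isCont_tendsto_compose)
  hence lim: "((%ph. Re (g (of_real l * arcp th ph))) \<longlongrightarrow> Re (g (of_real t))) (at_right 0)" by (rule tendsto_Re)
  \<comment> \<open>J exceeds y here, so the imaginary part is the jump pi exactly while J is still
    below x.\<close>
  have ImL: "Im (L (of_real t)) = pi * of_bool (J_real th t < x)"
  proof (cases "J_real th t < x")
   case True
   thus ?thesis unfolding L_def J real_log_dist_of_real(1)[OF True] real_log_dist_of_real(2)[OF yt] by simp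
  next
   case False
   hence gt: "J_real th t > x" using Jt(2) by simp
   show ?thesis unfolding L_def J real_log_dist_of_real(2)[OF gt] real_log_dist_of_real(2)[OF yt] using False by simp
  qed
  have EHv: "Re (EH (of_real t)) = 0" "Im (EH (of_real t)) = Im (extlog th p (of_real t)) * (1 - (1 + 1/th) / (t + 1))"
   unfolding EH_def J_log_rate_real using extlog_real[OF th p, of t] by auto
  have "Re (g (of_real t)) = - (pi * of_bool (J_real th t < x) * Im (extlog th p (of_real t)) * (1 - (1 + 1/th) / (t + 1)))"
   unfolding g_def times_complex.sel EHv ImL by simp
  hence "Re (g (of_real t)) = e0 l" by (simp only: e0_def t_def)
  thus ?thesis using lim by simp
 qed
 have epi: "((%ph. Re (g (of_real l * arcp th ph))) \<longlongrightarrow> 0) (at_left pi)" if l: "l \<in> {1<..} - E" for l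
 proof -
  have l1: "l > 1" using l by simp
  have st: "of_real l * arcp th pi = of_real (- l)" by (simp add: arcp_pi[OF th])
  obtain v where v: "v > 0" "J_map th (of_real (- l)) = of_real (- v)" using J_map_neg_real[OF th l1] by blast
  have cut: "of_real (- l) / a - 1 \<notin> \<real>\<^sub>\<le>\<^sub>0"
   using arc_cut[OF th p, of l pi] l p unfolding st a_def[symmetric] by auto
  have n1: "of_real (- l) ~= (-1 :: complex)" using l1 by (metis less_irrefl neg_equal_iff_equal of_real_1 of_real_eq_iff of_real_minus)
  have "g field_differentiable at (of_real (- l))"
   by (rule gd) (use v x y l1 cut n1 in \<open>auto simp: complex_eq_iff\<close>)
  hence "isCont g (of_real (- l))" by (rule field_differentiable_imp_continuous_at)
  hence "((%ph. g (of_real l * arcp th ph)) \<longlongrightarrow> g (of_real (- l))) (at_left pi)"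
   using arc_lim(2)[of l] unfolding st by (rule isCont_tendsto_compose)
  hence lim: "((%ph. Re (g (of_real l * arcp th ph))) \<longlongrightarrow> Re (g (of_real (- l)))) (at_left pi)" by (rule tendsto_Re)
  \<comment> \<open>J is negative on this axis, to the left of both x and y, so the two branches
    have the same imaginary part.\<close>
  have ImL: "Im (L (of_real (- l))) = 0"
   unfolding L_def v(2) using real_log_dist_of_real(1)[of "- v" x] real_log_dist_of_real(1)[of "- v" y] v x y by simp
  have EHv: "Re (EH (of_real (- l))) = 0"
   unfolding EH_def J_log_rate_real using extlog_real[OF th p, of "- l"] by auto
  have "Re (g (of_real (- l))) = 0" unfolding g_def times_complex.sel EHv ImL by simp
  thus ?thesis using lim by simp
 qed
 have F: "finite F" by (simp add: F_def)
 note R = arc_contour_limit[OF th S hol inS F B bd lim1 liminf d d2 edge E e0 epi]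
 \<comment> \<open>On the arc the rate times ds/s is real, so taking real parts affects only the
   product L \<open>extlog\<close>; its two terms are the two terms of f.\<close>
 have fg: "Re (g1 ph * arc_log_deriv th ph) = - f ph" if a: "ph \<in> {0<..<pi} - F" for ph
 proof -
  have hp: "0 < ph" "ph < pi" "ph ~= px" "ph ~= py" "ph ~= p" using a by (auto simp: F_def)
  define X where "X = arcv th ph"
  have J: "J_map th (arcp th ph) = of_real X" using J_map_arc[OF th] hp by (simp add: X_def)
  have ne: "X ~= x" "X ~= y" using Xx' Xy' hp by (auto simp: X_def)
  have ReL: "Re (L (arcp th ph)) = ln \<bar>x - X\<bar> - ln \<bar>y - X\<bar>"
   unfolding L_def J using ne by (simp add: Re_real_log_dist flip: of_real_diff)
  have ImL: "Im (L (arcp th ph)) = pi * (of_bool (y < X) - of_bool (x < X))"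
   unfolding L_def J using real_log_dist_of_real(1)[of X x] real_log_dist_of_real(1)[of X y] real_log_dist_of_real(2)[of x X] real_log_dist_of_real(2)[of y X] ne
   by (cases X x rule: linorder_cases; cases X y rule: linorder_cases) auto
  have "g1 ph * arc_log_deriv th ph = L (arcp th ph) * extlog th p (arcp th ph) * (J_log_rate th (arcp th ph) * arc_log_deriv th ph)"
   by (simp add: g1_def g_def EH_def mult_ac)
  also have "... = - (of_real (arc_rate th ph) * (L (arcp th ph) * extlog th p (arcp th ph)))"
   unfolding J_log_rate_arc[OF th hp(1,2)] by simp
  finally have eq: "g1 ph * arc_log_deriv th ph = - (of_real (arc_rate th ph) * (L (arcp th ph) * extlog th p (arcp th ph)))" .
  have "Re (g1 ph * arc_log_deriv th ph) = - (arc_rate th ph * (Re (L (arcp th ph)) * Re (extlog th p (arcp th ph))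
    - Im (L (arcp th ph)) * Im (extlog th p (arcp th ph))))"
   unfolding eq by simp
  thus ?thesis unfolding f_def X_def[symmetric] arc_green_def arc_phase_def ReL ImL .
 qed
 have ri: "(%ph. Re (g1 ph * arc_log_deriv th ph)) integrable_on {0<..<pi}"
  using integrable_linear[OF R(1) bounded_linear_Re] by (simp only: o_def)
 have fi: "(%ph. - f ph) integrable_on {0<..<pi}"
  by (rule integrable_spike_finite[OF F _ ri]) (use fg in auto)
 show "f integrable_on {0<..<pi}" using integrable_neg[OF fi] by simp
 have "integral {0<..<pi} (%ph. Re (g1 ph * arc_log_deriv th ph)) = Re (integral {0<..<pi} (%ph. g1 ph * arc_log_deriv th ph))"
  using integral_linear[OF R(1) bounded_linear_Re] by (simp only: o_def)
 also have "... = integral {1<..} (%l. e0 l / l)" using R(3) by simp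
 finally have "integral {0<..<pi} (%ph. - f ph) = integral {1<..} (%l. e0 l / l)"
  using integral_spike[OF negligible_finite[OF F], of "{0<..<pi}" "%ph. - f ph" "%ph. Re (g1 ph * arc_log_deriv th ph)"] fg by simp
 hence main: "integral {0<..<pi} f = - integral {1<..} (%l. e0 l / l)" by simp
 show "integral {0<..<pi} f = 0" if "x < arcv th 0"
 proof -
  have "integral {1<..} (%l. e0 l / l) = integral {1<..} (%l::real. 0::real)"
  proof (rule Henstock_Kurzweil_Integration.integral_cong)
   fix l :: real assume "l \<in> {1<..}"
   hence "~ J_real th (l/th) < x" using Jb[of l] that by (simp add: b_def)
   thus "e0 l / l = 0" by (simp add: e0_def)
  qed
  thus ?thesis using main by simp
 qed
 show "integral {0<..<pi} f <= pi * arc_phase th p 0 * ln (x / arcv th 0)" if xb: "x > arcv th 0"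
 proof -
  from exterior_preimage[OF th x] xb obtain rh where rho: "rh > 1/th" "J_real th rh = x" by (metis less_asym)
  \<comment> \<open>The dilation at which the edge reaches the value x; the edge integral runs over
    1 < l < lx.\<close>
  define lx where "lx = rh * th"
  have lx: "lx > 1" "J_real th (lx/th) = x" using rho th by (auto simp: lx_def divide_less_eq)
  define \<Theta> where "\<Theta> = arc_phase th p 0"
  \<comment> \<open>The derivative of ln J along the axis, as a function of l; its integral from 1
    to lx is ln (x/b).\<close>
  define h where "h = (%l. (1 - (1 + 1/th) / (l/th + 1)) / l)"
  have "(h has_integral ln (J_real th (lx/th)) - ln (J_real th (1/th))) {1..lx}"
  proof (rule fundamental_theorem_of_calculus)
   fix l assume l: "l \<in> {1..lx}"
   have "((%t. ln (J_real th t)) has_real_derivative (1 - (1 + 1/th) / (l/th + 1)) / (l/th)) (at (l/th))"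
    by (rule J_real_deriv[OF th]) (use l th in simp)
   moreover have "((%l. l/th) has_real_derivative 1/th) (at l)" using th by (auto intro!: derivative_eq_intros)
   ultimately have "((%l. ln (J_real th (l/th))) has_real_derivative (1 - (1 + 1/th) / (l/th + 1)) / (l/th) * (1/th)) (at l)"
    by (rule DERIV_chain2)
   moreover have "(1 - (1 + 1/th) / (l/th + 1)) / (l/th) * (1/th) = h l" using th by (simp add: h_def)
   ultimately show "((%l. ln (J_real th (l/th))) has_vector_derivative h l) (at l within {1..lx})"
    by (simp add: has_real_derivative_iff_has_vector_derivative has_vector_derivative_at_within)
  qed (use lx in auto)
  hence hI: "(h has_integral ln (x / b)) {1..lx}"
   unfolding lx(2) J_real_at_end[OF th] using x b0 by (simp add: ln_div b_def)
  have "((%l. - (pi * \<Theta>) * h l) has_integral - (pi * \<Theta>) * ln (x / b)) {1..lx}"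
   by (rule has_integral_mult_right[OF hI])
  hence "((%l. if l \<in> {1..lx} then - (pi * \<Theta>) * h l else 0) has_integral - (pi * \<Theta>) * ln (x / b)) UNIV"
   unfolding has_integral_restrict_UNIV .
  hence kU: "((%l. if l \<in> {1<..} then (if l \<in> {1<..<lx} then - (pi * \<Theta>) * h l else 0) else 0) has_integral - (pi * \<Theta>) * ln (x / b)) UNIV"
   by (rule has_integral_spike_finite[of "{1, lx}", rotated 2]) auto
  hence k: "((%l. if l \<in> {1<..<lx} then - (pi * \<Theta>) * h l else 0) has_integral - (pi * \<Theta>) * ln (x / b)) {1<..}"
   unfolding has_integral_restrict_UNIV .
  have "- (pi * \<Theta>) * ln (x / b) <= integral {1<..} (%l. e0 l / l)"
  proof (rule has_integral_le[OF k integrable_integral[OF R(2)]])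
   fix l :: real assume l: "l \<in> {1<..}"
   show "(if l \<in> {1<..<lx} then - (pi * \<Theta>) * h l else 0) <= e0 l / l"
   proof (cases "l < lx")
    case True
    have J: "J_real th (l/th) < x" using Jmono[of l lx] True l lx by simp
    have lt: "1/th <= l/th" using l th by (simp add: divide_right_mono)
    have im: "Im (extlog th p (of_real (l/th))) <= \<Theta>" unfolding \<Theta>_def by (rule arc_phase_real_mono[OF th p lt])
    have "l/th > 0" using l th by simp
    hence "l/th + 1 > 0" by linarith
    hence "(1 + 1/th) / (l/th + 1) <= 1" using lt by (subst divide_le_eq_1_pos) auto
    hence h0: "h l >= 0" using l by (simp add: h_def)
    have "e0 l / l = - (pi * Im (extlog th p (of_real (l/th)))) * h l" using J by (simp add: e0_def h_def)
    moreover have "pi * Im (extlog th p (of_real (l/th))) * h l <= pi * \<Theta> * h l"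
     using im h0 by (intro mult_right_mono mult_left_mono) auto
    ultimately show ?thesis using True l by simp
   next
    case False
    hence "~ J_real th (l/th) < x" using Jmono[of lx l] lx by (cases "l = lx") auto
    thus ?thesis using False by (simp add: e0_def)
   qed
  qed
  thus ?thesis using main by (simp add: \<Theta>_def b_def)
 qed
qed

text \<open>The same contour without the logarithmic factor. Now g has the nonzero limit i 2 p/(1 +
  th) at infinity, while Re g vanishes on both real axes, so the whole integral comes from
  infinity.\<close>

lemma integral_arc_rate_green:
 assumes th: "th > 0" and p: "0 < p" "p < pi"
 shows "((%ph. arc_rate th ph * arc_green th p ph) has_integral 2 * pi * (p / (1 + th))) {0<..<pi}"
proof -
 define a where "a = arcp th p"
 define t where "t = arcr th p"
 have t: "t > 0" using arcr_pos[OF th] p by (simp add: t_def)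
 define s where "s = (%l ph. of_real l * arcp th ph)"
 define g where "g = (%s. extlog th p s * J_log_rate th s)"
 define S where "S = {s. 0 < Im s & 0 < Im (J_map th s) & s / a - 1 \<notin> \<real>\<^sub>\<le>\<^sub>0}"
 have gd: "g field_differentiable at z" if "0 <= Im z" "z ~= -1" "z / a - 1 \<notin> \<real>\<^sub>\<le>\<^sub>0" for z
  unfolding g_def by (intro isCont_exterior_rate th p) (use that in \<open>auto simp: a_def\<close>)
 have S: "open S" unfolding S_def by (rule open_exterior[OF th])
 have hol: "g holomorphic_on S" unfolding holomorphic_on_def
 proof
  fix z assume "z \<in> S"
  hence z: "0 < Im z" "z / a - 1 \<notin> \<real>\<^sub>\<le>\<^sub>0" by (auto simp: S_def)
  hence "z ~= -1" by auto
  hence "g field_differentiable at z" by (intro gd) (use z in auto)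
  thus "g field_differentiable at z within S" by (rule field_differentiable_at_within)
 qed
 have inS: "of_real l * arcp th ph \<in> S" if "l > 1" "0 < ph" "ph < pi" for l ph
  using scaled_arc_props(1,6)[OF th p that] Im_J_map_exterior[OF th that] unfolding S_def a_def by blast
 obtain C2 where C2: "C2 > 0" "!!l ph. l > 1 ==> 0 < ph ==> ph < pi ==> ph ~= p ==> norm (g (s l ph)) <= C2 * \<bar>ph - p\<bar> powr (-1/4)"
  using extlog_rate_bound[OF th p] unfolding g_def s_def by metis
 define B where "B = (%ph. C2 * \<bar>ph - p\<bar> powr (-1/4))"
 have B: "B integrable_on {0<..<pi}"
 proof -
  have "B integrable_on {0..pi}" unfolding B_def
   by (intro integrable_on_mult_right abs_powr_integrable_on) auto
  thus ?thesis by (simp add: integrable_on_open_interval_real)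
 qed
 have bd: "norm (g (of_real l * arcp th ph)) <= B ph" if "l > 1" "ph \<in> {0<..<pi} - {p}" for l ph
  using C2(2)[of l ph] that by (simp add: B_def s_def)
 have lim1: "((%l. g (of_real l * arcp th ph)) \<longlongrightarrow> g (arcp th ph)) (at_right 1)" if a: "ph \<in> {0<..<pi} - {p}" for ph
 proof -
  have Im: "Im (arcp th ph) > 0" using Im_arcp_pos[OF th] a by simp
  have cut: "arcp th ph / arcp th p - 1 \<notin> \<real>\<^sub>\<le>\<^sub>0" using arc_cut[OF th p, of 1 ph] a by auto
  have n0: "arcp th ph ~= -1" using Im by auto
  have "g field_differentiable at (arcp th ph)"
   by (rule gd) (use Im n0 cut a_def in auto)
  hence "isCont g (arcp th ph)" by (rule field_differentiable_imp_continuous_at)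
  moreover have "((%l. of_real l * arcp th ph) \<longlongrightarrow> of_real 1 * arcp th ph) (at_right 1)"
   by (intro tendsto_intros)
  ultimately show ?thesis by (intro isCont_tendsto_compose[of _ g]) auto
 qed
 define L where "L = 2 * p / (1 + th)"
 have liminf: "((%l. g (of_real l * arcp th ph)) \<longlongrightarrow> \<i> * of_real L) at_top" if a: "ph \<in> {0<..<pi} - {p}" for ph
 proof -
  have hp: "0 < ph" "ph < pi" using a by auto
  define z where "z = arcp th ph"
  have z: "Im z > 0" using Im_arcp_pos[OF th hp] by (simp add: z_def)
  have inv0: "((%l::real. of_real (inverse l) :: complex) \<longlongrightarrow> of_real 0) at_top"
   by (intro tendsto_of_real tendsto_inverse_0_at_top filterlim_ident)
  have "((%l::real. 1 - of_real (1 + 1/th) * (of_real (inverse l) / (z + of_real (inverse l)))) \<longlongrightarrow> 1 - of_real (1 + 1/th) * (of_real 0 / (z + of_real 0))) at_top"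
   using z by (intro tendsto_intros inv0) auto
  hence l: "((%l::real. 1 - of_real (1 + 1/th) * (of_real (inverse l) / (z + of_real (inverse l)))) \<longlongrightarrow> 1) at_top" by simp
  have h: "((%l. J_log_rate th (of_real l * arcp th ph)) \<longlongrightarrow> 1) at_top"
  proof (rule Lim_transform_eventually[OF l])
   show "\<forall>\<^sub>F l in at_top. 1 - of_real (1 + 1/th) * (of_real (inverse l) / (z + of_real (inverse l))) = J_log_rate th (of_real l * arcp th ph)"
    using eventually_gt_at_top[of 0]
   proof eventually_elim
    fix l :: real assume l: "l > 0"
    have "of_real l * z + 1 = of_real l * (z + of_real (inverse l))" using l by (simp add: field_simps)
    moreover have "z + of_real (inverse l) ~= 0" using z by (auto simp: complex_eq_iff)
    ultimately show "1 - of_real (1 + 1/th) * (of_real (inverse l) / (z + of_real (inverse l))) = J_log_rate th (of_real l * arcp th ph)"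
     unfolding J_log_rate_def z_def[symmetric] using l by (simp add: field_simps)
   qed
  qed
  show ?thesis unfolding g_def L_def using tendsto_mult[OF extlog_at_infinity[OF th p hp] h] by simp
 qed
 define D where "D = {pi/4, p/2, (pi-p)/2}"
 define d where "d = Min D"
 have Dpos: "u > 0" if "u \<in> D" for u using that p pi_gt_zero by (auto simp: D_def)
 have Dfin: "finite D" "D ~= {}" by (simp_all add: D_def)
 have d: "d > 0" using Dpos[OF Min_in[OF Dfin]] by (simp add: d_def)
 have dD: "d <= u" if "u \<in> D" for u unfolding d_def by (rule Min_le[OF Dfin(1) that])
 have d1: "d <= pi/4" "d <= p/2" "d <= (pi-p)/2"
  by (rule dD, unfold D_def, simp)+
 have d2: "d < pi/2" using d1(1) pi_gt_zero by linarith
 obtain m where m: "m > 0" "!!ph. 0 <= ph ==> ph <= pi ==> m <= arcr th ph" using arcr_lower[OF th] by blast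
 define K where "K = 1 + 1/th"
 have K: "K > 0" using th by (simp add: K_def add_pos_pos)
 \<comment> \<open>Beyond Lm both |s| >= 2 and |s| >= 2 |a| hold, and then Re \<open>extlog\<close>
   and Im \<open>J_log_rate\<close> are O(1/l) each. Below Lm the angular majorant is bounded near
   the edges.\<close>
 define Lm where "Lm = max 1 (max (2/m) (2*t/m))"
 have Lm: "Lm >= 1" "Lm >= 2/m" "Lm >= 2*t/m" by (auto simp: Lm_def)
 define Ce where "Ce = C2 * d powr (-1/4) * Lm + (8 * t / m * (1 + K) + 16 * (2 * K / m))"
 have edge: "\<bar>Re (g (of_real l * arcp th ph))\<bar> <= Ce / l" if l: "l > 1" and hp: "ph \<in> {0<..<d} \<union> {pi-d<..<pi}" for l ph
 proof -
  have ph: "0 < ph" "ph < pi" using hp d d1(1) pi_gt_zero by auto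
  have dist: "d <= \<bar>ph - p\<bar>" using hp d1 d by (auto simp: abs_if field_simps)
  hence np: "ph ~= p" using d by auto
  show ?thesis
  proof (cases "l <= Lm")
   case True
   have "\<bar>ph - p\<bar> powr (-1/4) <= d powr (-1/4)" using dist d by (intro powr_mono2'; simp)
   hence "C2 * \<bar>ph - p\<bar> powr (-1/4) <= C2 * d powr (-1/4)" using C2(1) by (intro mult_left_mono) auto
   hence "\<bar>Re (g (s l ph))\<bar> <= C2 * d powr (-1/4)"
    using C2(2)[OF l ph np] abs_Re_le_cmod[of "g (s l ph)"] by linarith
   also have "... <= Ce / l"
   proof -
    have "C2 * d powr (-1/4) * l <= C2 * d powr (-1/4) * Lm" using True C2(1) by (intro mult_left_mono) auto
    moreover have "8 * t / m * (1 + K) + 16 * (2 * K / m) >= 0" using t m K by simp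
    ultimately have "C2 * d powr (-1/4) * l <= Ce" unfolding Ce_def by linarith
    thus ?thesis using l by (simp add: le_divide_eq)
   qed
   finally show ?thesis by (simp add: s_def)
  next
   case False
   define z where "z = s l ph"
   define r where "r = l * arcr th ph"
   have zr: "z = of_real r * cis ph" by (simp add: z_def s_def r_def arcp_def)
   have rm: "r >= l * m" using m(2)[of ph] ph l by (simp add: r_def)
   have "l * m >= Lm * m" using False m by simp
   moreover have "Lm * m >= 2" "Lm * m >= 2 * t" using Lm(2,3) m by (simp_all add: divide_le_eq)
   ultimately have r2: "r >= 2" "r >= 2 * t" using rm by linarith+
   have nz: "norm z = r" unfolding zr norm_mult norm_cis norm_of_real using r2 by simp
   have lm: "l * m > 0" using l m by simp
   have z1: "norm (z + 1) >= r / 2"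
    using norm_triangle_ineq2[of z "-1"] nz r2 by simp
   have Iz: "0 < Im z" "z ~= a" "z ~= cnj a"
    using scaled_arc_props(1,4,5)[OF th p l ph] unfolding z_def s_def a_def by blast+
   have ER: "\<bar>Re (extlog th p z)\<bar> <= 8 * t / r"
   proof -
    define A B where "A = (norm (z - a))\<^sup>2" and "B = (norm (z - cnj a))\<^sup>2"
    have aa: "a = of_real t * cis p" "cnj a = of_real t * cis (-p)" by (simp_all add: a_def arcp_def t_def cis_cnj)
    have sn: "0 <= sin ph" "sin ph <= 1" "0 <= sin p" "sin p <= 1" using ph p by (auto intro!: sin_ge_zero)
    have na: "norm a = t" unfolding aa(1) norm_mult norm_cis norm_of_real using t by simp
    have "norm (z - a) >= r / 2" using norm_triangle_ineq2[of z a] nz na r2 by simp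
    hence "A >= (r/2)\<^sup>2" unfolding A_def using r2 by (intro power_mono) auto
    hence A: "A >= r\<^sup>2 / 4" by (simp add: power_divide)
    have A0: "A > 0" using A r2 by (smt (verit) divide_pos_pos zero_less_power)
    have BA: "B = A + 4 * r * t * sin ph * sin p" unfolding A_def B_def zr aa cmod_power2
     by (simp add: power2_eq_square algebra_simps)
    have ge: "4 * r * t * sin ph * sin p >= 0" using r2 t sn by simp
    have "Re (extlog th p z) = ln (norm (z - cnj a) / norm (z - a))"
     using Re_extlog[OF th p] Iz unfolding a_def by simp
    also have "... = ln (B / A) / 2"
     using Iz unfolding A_def B_def by (simp add: ln_div ln_realpow diff_divide_distrib)
    also have "B / A = 1 + (4 * r * t * sin ph * sin p) / A" using BA A0 by (simp add: add_divide_distrib)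
    finally have eq: "Re (extlog th p z) = ln (1 + (4 * r * t * sin ph * sin p) / A) / 2" .
    have q0: "0 <= (4 * r * t * sin ph * sin p) / A" using ge A0 by simp
    have "ln (1 + (4 * r * t * sin ph * sin p) / A) <= (4 * r * t * sin ph * sin p) / A"
     using q0 by (intro ln_add_one_self_le_self) auto
    also have "... <= (4 * r * t * (1 * 1)) / (r\<^sup>2 / 4)"
    proof (rule frac_le)
     have "(4 * r * t) * (sin ph * sin p) <= (4 * r * t) * (1 * 1)" using sn r2 t by (intro mult_left_mono mult_mono) auto
     thus "4 * r * t * sin ph * sin p <= 4 * r * t * (1 * 1)" by (simp add: mult.assoc)
    qed (use A r2 t in auto)
    also have "... = 16 * t / r" using r2 by (simp add: power2_eq_square)
    finally have "Re (extlog th p z) <= 8 * t / r" using eq by simp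
    moreover have "Re (extlog th p z) >= 0" unfolding eq using q0 by simp
    ultimately show ?thesis by simp
   qed
   have EI: "\<bar>Im (extlog th p z)\<bar> <= 16"
    using abs_Im_extlog[OF th p] Iz pi_less_4 by (fastforce simp: a_def)
   have hb: "norm (J_log_rate th z - 1) <= 2 * K / r"
   proof -
    have "norm (J_log_rate th z - 1) = K / norm (z + 1)" unfolding J_log_rate_def K_def[symmetric] using K by (simp add: norm_divide)
    also have "... <= K / (r / 2)"
    proof (rule divide_left_mono[OF z1])
     have "0 < norm (z + 1)" using z1 r2 by linarith
     thus "0 < norm (z + 1) * (r / 2)" using r2 by (intro mult_pos_pos) auto
    qed (use K in simp)
    finally show ?thesis by (simp add: mult.commute)
   qed
   have "2 * K / r <= 2 * K / 2" using r2 K by (intro divide_left_mono) auto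
   hence hR: "\<bar>Re (J_log_rate th z)\<bar> <= 1 + K" using hb abs_Re_le_cmod[of "J_log_rate th z - 1"] by simp
   have hI: "\<bar>Im (J_log_rate th z)\<bar> <= 2 * K / r" using hb abs_Im_le_cmod[of "J_log_rate th z - 1"] by simp
   have "\<bar>Re (g z)\<bar> <= \<bar>Re (extlog th p z)\<bar> * \<bar>Re (J_log_rate th z)\<bar> + \<bar>Im (extlog th p z)\<bar> * \<bar>Im (J_log_rate th z)\<bar>"
    unfolding g_def times_complex.sel by (simp add: abs_mult[symmetric])
   also have "... <= (8 * t / r) * (1 + K) + 16 * (2 * K / r)"
    by (intro add_mono mult_mono ER hR EI hI) (use r2 t K in auto)
   also have "... <= (8 * t / (l * m)) * (1 + K) + 16 * (2 * K / (l * m))"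
    using rm lm t K by (intro add_mono mult_mono mult_right_mono mult_left_mono divide_left_mono) auto
   also have "... = (8 * t / m * (1 + K) + 16 * (2 * K / m)) / l" using l m by (simp add: field_simps)
   also have "... <= Ce / l" unfolding Ce_def using l C2(1) Lm(1) by (intro divide_right_mono) auto
   finally show ?thesis by (simp add: z_def s_def)
  qed
 qed
 have arc_lim: "((%ph. of_real l * arcp th ph) \<longlongrightarrow> of_real l * arcp th 0) (at_right 0)"
  "((%ph. of_real l * arcp th ph) \<longlongrightarrow> of_real l * arcp th pi) (at_left pi)" for l
 proof -
  have "(arcp th \<longlongrightarrow> arcp th 0) (at 0 within {0..pi})" "(arcp th \<longlongrightarrow> arcp th pi) (at pi within {0..pi})"
   using continuous_on_arcp[OF th] by (auto simp: continuous_on)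
  thus "((%ph. of_real l * arcp th ph) \<longlongrightarrow> of_real l * arcp th 0) (at_right 0)"
   "((%ph. of_real l * arcp th ph) \<longlongrightarrow> of_real l * arcp th pi) (at_left pi)"
   by (auto intro!: tendsto_mult tendsto_const simp: at_within_Icc_at_right at_within_Icc_at_left)
 qed
 have real_pt: "isCont g (of_real v)" "Re (g (of_real v)) = 0"
  if "of_real v = of_real l * arcp th q" "l > 1" "q = 0 | q = pi" "v ~= -1" for v l q
 proof -
  have cut: "of_real v / a - 1 \<notin> \<real>\<^sub>\<le>\<^sub>0" using arc_cut[OF th p, of l q] that p unfolding that(1) a_def by auto
  have "of_real v ~= (-1::complex)" using that(4) by (metis of_real_1 of_real_eq_iff of_real_minus)
  hence "g field_differentiable at (of_real v)" by (intro gd) (use cut in auto)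
  thus "isCont g (of_real v)" by (rule field_differentiable_imp_continuous_at)
  show "Re (g (of_real v)) = 0" unfolding g_def J_log_rate_real using extlog_real[OF th p, of v] by simp
 qed
 have e0: "((%ph. Re (g (of_real l * arcp th ph))) \<longlongrightarrow> 0) (at_right 0)" if l: "l \<in> {1<..} - {}" for l
 proof -
  have v: "of_real (l/th) = of_real l * arcp th 0" by (simp add: arcp_0)
  have "l/th > 0" using l th by simp
  hence "l/th ~= -1" by linarith
  note rp = real_pt[OF v _ _ this]
  from isCont_tendsto_compose[OF rp(1) arc_lim(1)[of l, folded v]]
  have "((%ph. g (of_real l * arcp th ph)) \<longlongrightarrow> g (of_real (l/th))) (at_right 0)" using l by simp
  from tendsto_Re[OF this] rp(2) l show ?thesis by simp
 qed
 have epi: "((%ph. Re (g (of_real l * arcp th ph))) \<longlongrightarrow> 0) (at_left pi)" if l: "l \<in> {1<..} - {}" for l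
 proof -
  have v: "of_real (- l) = of_real l * arcp th pi" by (simp add: arcp_pi[OF th])
  have "- l ~= -1" using l by simp
  note rp = real_pt[OF v _ _ this]
  from isCont_tendsto_compose[OF rp(1) arc_lim(2)[of l, folded v]]
  have "((%ph. g (of_real l * arcp th ph)) \<longlongrightarrow> g (of_real (- l))) (at_left pi)" using l by simp
  from tendsto_Re[OF this] rp(2) l show ?thesis by simp
 qed
 note R = arc_contour_limit[OF th S hol inS finite.insertI[OF finite.emptyI] B bd lim1 liminf d d2 edge finite.emptyI e0 epi]
 have fg: "Re (g (arcp th ph) * arc_log_deriv th ph) = - (arc_rate th ph * arc_green th p ph)" if "ph \<in> {0<..<pi}" for ph
 proof -
  have hp: "0 < ph" "ph < pi" using that by auto
  have "g (arcp th ph) * arc_log_deriv th ph = extlog th p (arcp th ph) * (J_log_rate th (arcp th ph) * arc_log_deriv th ph)"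
   by (simp add: g_def mult_ac)
  thus ?thesis unfolding J_log_rate_arc[OF th hp] by (simp add: arc_green_def)
 qed
 have "((%ph. Re (g (arcp th ph) * arc_log_deriv th ph)) has_integral Re (integral {0<..<pi} (%ph. g (arcp th ph) * arc_log_deriv th ph))) {0<..<pi}"
  using has_integral_linear[OF integrable_integral[OF R(1)] bounded_linear_Re] by (simp only: o_def)
 hence "((%ph. - (arc_rate th ph * arc_green th p ph)) has_integral Re (integral {0<..<pi} (%ph. g (arcp th ph) * arc_log_deriv th ph))) {0<..<pi}"
  by (rule has_integral_eq[rotated]) (rule fg)
 from has_integral_neg[OF this]
 have "((%ph. arc_rate th ph * arc_green th p ph) has_integral - Re (integral {0<..<pi} (%ph. g (arcp th ph) * arc_log_deriv th ph))) {0<..<pi}"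
  by (simp only: minus_minus)
 moreover have "- Re (integral {0<..<pi} (%ph. g (arcp th ph) * arc_log_deriv th ph)) = 2 * pi * (p / (1 + th))"
 proof -
  have "Re (integral {0<..<pi} (%ph. g (arcp th ph) * arc_log_deriv th ph)) = - pi * L + integral {1<..} (%l::real. 0 / l)"
   by (rule R(3))
  hence "Re (integral {0<..<pi} (%ph. g (arcp th ph) * arc_log_deriv th ph)) = - pi * L" by simp
  thus ?thesis by (simp add: L_def)
 qed
 ultimately show ?thesis by (simp only:)
qed

subsection \<open>Duality between \<open>th\<close> and \<open>1/th\<close>\<close>

text \<open>Replacing th by 1/th exchanges the angles at -1 and at s in the triangle that defines
  the arc. So the arc for 1/th has the same angles and reciprocal radii.\<close>

lemma dual_angles: "th > 0 ==> ph / (1 + 1/th) = th * ph / (1 + th)" "th > 0 ==> 1/th * ph / (1 + 1/th) = ph / (1 + th)" for th ph :: real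
 by (simp_all add: divide_simps) (simp_all add: algebra_simps)?

lemma arcr_dual: "th > 0 ==> arcr (1/th) ph = 1 / arcr th ph"
 unfolding arcr_def dual_angles by simp

lemma arc_shift_dual:
 assumes "th > 0" "0 <= ph" "ph <= pi" shows "arc_shift (1/th) ph = arc_shift th ph / arcr th ph"
proof (cases "ph = 0")
 case True
 thus ?thesis using assms by (simp add: arc_shift_def arcr_def field_simps)
next
 case False
 thus ?thesis unfolding arc_shift_def arcr_def dual_angles[OF assms(1)]
  using arcas(5,6)[of th ph] assms by simp
qed

text \<open>The power th is exactly what turns |x^th - u^th| into a distance between values of the
  dual map.\<close>

lemma arcv_dual:
 assumes "th > 0" "0 <= ph" "ph <= pi" shows "arcv (1/th) ph = arcv th ph powr th"
proof -
 define R r where "R = arc_shift th ph" and "r = arcr th ph"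
 have R: "R >= 0" "r > 0" using arc_shift_nonneg[OF assms] arcr_pos[OF assms] by (auto simp: R_def r_def)
 have "arcv (1/th) ph = (R / r) * R powr th"
  unfolding arcv_def arc_shift_dual[OF assms] arcr_dual[OF assms(1)] R_def[symmetric] r_def[symmetric] using R by simp
 also have "... = (R * (R / r) powr (1/th)) powr th"
  using R assms by (simp add: powr_mult powr_powr)
 finally show ?thesis by (simp add: arcv_def R_def r_def)
qed

lemma arc_rate_dual:
 assumes "th > 0" shows "arc_rate (1/th) ph = th * arc_rate th ph"
proof -
 define P Q R where "P = cot (ph / (1 + th))" and "Q = cot (th * ph / (1 + th))" and "R = cot ph"
 have c: "1/th / (1 + 1/th) = 1 / (1 + th)" "1 / (1/th * (1 + 1/th)) = th * (th / (1 + th))" "1 + 1 / (1/th) = th * (1 + 1/th)"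
  using assms by (simp_all add: field_simps)
 have "arc_rate (1/th) ph = 1/th / (1 + 1/th) * P + 1 / (1/th * (1 + 1/th)) * Q - (1 + 1 / (1/th)) * R"
  unfolding arc_rate_def dual_angles[OF assms] P_def Q_def R_def by simp
 also have "... = 1 / (1 + th) * P + th * (th / (1 + th)) * Q - th * (1 + 1/th) * R" unfolding c ..
 also have "... = th * (th / (1 + th) * Q + P / (th * (1 + th)) - (1 + 1/th) * R)"
 proof -
  have gen: "th * (x + y - z) = th * x + th * y - th * z" for x y z by (simp add: algebra_simps)
  have "th * (P / (th * (1 + th))) = 1 / (1 + th) * P" using assms by simp
  moreover have "th * (th / (1 + th) * Q) = th * (th / (1 + th)) * Q" "th * ((1 + 1/th) * R) = th * (1 + 1/th) * R" by (simp_all only: mult.assoc)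
  ultimately show ?thesis unfolding gen by (simp only: add.commute)
 qed
 finally show ?thesis by (simp add: arc_rate_def P_def Q_def R_def)
qed

text \<open>Inverting both radii at fixed angles divides every distance by the product of the
  original radii. The factor is the same for a and for its conjugate, so it drops out of the Green
  function.\<close>

lemma arcp_polar_diff:
 assumes "th > 0" "0 < p" "p < pi" "0 <= ph" "ph <= pi"
 shows "norm (arcp (1/th) ph - arcp (1/th) p) = norm (arcp th ph - arcp th p) / (arcr th ph * arcr th p)"
  "norm (arcp (1/th) ph - cnj (arcp (1/th) p)) = norm (arcp th ph - cnj (arcp th p)) / (arcr th ph * arcr th p)"
proof -
 define r t where "r = arcr th ph" and "t = arcr th p"
 have rt: "r > 0" "t > 0" using arcr_pos[OF assms(1)] assms by (auto simp: r_def t_def)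
 have gen: "norm (of_real (1/r) * cis ph - of_real (1/t) * cis q) = norm (of_real r * cis ph - of_real t * cis q) / (r * t)" for q
 proof -
  have e: "(1/r - 1/t)\<^sup>2 = (r - t)\<^sup>2 / (r * t)\<^sup>2" using rt by (simp add: field_simps power2_eq_square)
  have "(norm (of_real (1/r) * cis ph - of_real (1/t) * cis q))\<^sup>2 = (norm (of_real r * cis ph - of_real t * cis q))\<^sup>2 / (r * t)\<^sup>2"
   unfolding polar_dist_sq e add_divide_distrib using rt by (simp add: field_simps power2_eq_square)
  also have "... = (norm (of_real r * cis ph - of_real t * cis q) / (r * t))\<^sup>2" by (simp add: power_divide)
  finally have sq: "(norm (of_real (1/r) * cis ph - of_real (1/t) * cis q))\<^sup>2 = (norm (of_real r * cis ph - of_real t * cis q) / (r * t))\<^sup>2" .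
  have "0 <= norm (of_real r * cis ph - of_real t * cis q) / (r * t)" using rt by (intro divide_nonneg_nonneg mult_nonneg_nonneg) simp_all
  thus ?thesis by (rule power2_eq_imp_eq[OF sq norm_ge_zero])
 qed
 show "norm (arcp (1/th) ph - arcp (1/th) p) = norm (arcp th ph - arcp th p) / (arcr th ph * arcr th p)"
  using gen[of p] unfolding arcp_def arcr_dual[OF assms(1)] r_def t_def by simp
 show "norm (arcp (1/th) ph - cnj (arcp (1/th) p)) = norm (arcp th ph - cnj (arcp th p)) / (arcr th ph * arcr th p)"
  using gen[of "-p"] unfolding arcp_def arcr_dual[OF assms(1)] r_def t_def by (simp add: cis_cnj)
qed

lemma arcp_ne:
 assumes "th > 0" "0 < p" "p < pi" "0 <= ph" "ph < pi" "ph ~= p"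
 shows "arcp th ph ~= arcp th p" "arcp th ph ~= cnj (arcp th p)" "Im (arcp th ph) >= 0"
proof -
 have "arcv th ph ~= arcv th p" using inj_onD[OF arcv_inj[OF assms(1)], of ph p] assms by auto
 thus "arcp th ph ~= arcp th p" using J_map_arc[OF assms(1), of ph] J_map_arc[OF assms(1), of p] assms
  by (metis less_imp_le of_real_eq_iff)
 show I: "Im (arcp th ph) >= 0" using Im_scaled_arc_nonneg[OF assms(1), of 1 ph] assms by simp
 show "arcp th ph ~= cnj (arcp th p)" using I Im_arcp_pos[OF assms(1-3)] by (auto simp: complex_eq_iff)
qed

lemma arc_green_eq:
 assumes "th > 0" "0 < p" "p < pi" "0 <= ph" "ph < pi" "ph ~= p"
 shows "arc_green th p ph = ln (norm (arcp th ph - cnj (arcp th p)) / norm (arcp th ph - arcp th p))"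
 unfolding arc_green_def by (rule Re_extlog[OF assms(1-3) arcp_ne(1,2)[OF assms]])

lemma arc_green_dual:
 assumes "th > 0" "0 < p" "p < pi" "0 <= ph" "ph < pi" "ph ~= p"
 shows "arc_green (1/th) p ph = arc_green th p ph"
proof -
 have "1/th > 0" using assms by simp
 note e = arc_green_eq[OF this assms(2-)]
 have "arcr th ph > 0" "arcr th p > 0" using arcr_pos[OF assms(1)] assms by auto
 thus ?thesis unfolding e arc_green_eq[OF assms] using arcp_polar_diff[OF assms(1-4)] assms(5) by simp
qed

lemma Ln_polar: "k > 0 ==> - pi < x ==> x <= pi ==> Im (Ln (of_real k * cis x)) = x"
 using Ln_rcis[of k x] by (simp add: rcis_def)

lemma polar_upper:
 assumes "Im z > 0" obtains k x where "z = of_real k * cis x" "k > 0" "0 < x" "x < pi"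
proof -
 have "z = of_real (norm z) * cis (Arg z)" using rcis_cmod_Arg[of z] by (simp add: rcis_def)
 moreover have "norm z > 0" using assms by auto
 ultimately show ?thesis using that Arg_lt_pi[of z] assms by blast
qed

lemma sin_pos_range: 
 assumes "sin x > 0" "- pi < x" "x < 2 * pi" shows "0 < x" "x < pi"
proof -
 show "0 < x"
 proof (rule ccontr)
  assume "~ 0 < x"
  hence "sin (- x) >= 0" using assms by (intro sin_ge_zero) auto
  thus False using assms by simp
 qed
 show "x < pi"
 proof (rule ccontr)
  assume "~ x < pi"
  hence "sin (x - pi) >= 0" using assms by (intro sin_ge_zero) auto
  thus False using assms by (simp add: sin_diff)
 qed
qed

lemma polar_shift_sine:
 assumes "of_real q * cis a - 1 = of_real k * cis d" shows "k * sin (d - a) = sin a"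
proof -
 have "(of_real q * cis a - 1) * cis (- a) = of_real q * (cis a * cis (- a)) - cis (- a)" by (simp add: left_diff_distrib mult.assoc)
 also have "cis a * cis (- a) = 1" unfolding cis_mult by simp
 finally have "of_real q * 1 - cis (- a) = of_real k * (cis d * cis (- a))" unfolding assms by (simp only: mult.assoc)
 hence "of_real q - cis (- a) = of_real k * cis (d - a)" unfolding cis_mult by simp
 from arg_cong[OF this, of Im] show ?thesis by simp
qed

text \<open>Inversion maps s - cnj a and s - a to their conjugates up to a rotation and a positive
  factor, so the arguments for th and 1/th have known sums modulo 2 pi. The branches are pinned down
  by the ranges of the angles, and they jump exactly when s passes the pole.\<close>

lemma arc_phase_sum:
 assumes th: "th > 0" and p: "0 < p" "p < pi" and hp: "0 <= ph" "ph < pi" "ph ~= p"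
 shows "arc_phase th p ph + arc_phase (1/th) p ph = 2 * pi * of_bool (ph < p)"
proof -
 define r t where "r = arcr th ph" and "t = arcr th p"
 have rt: "r > 0" "t > 0" using arcr_pos[OF th] p hp by (auto simp: r_def t_def)
 define s a s' a' where "s = arcp th ph" and "a = arcp th p" and "s' = arcp (1/th) ph" and "a' = arcp (1/th) p"
 have s: "s = of_real r * cis ph" "a = of_real t * cis p" "s' = of_real (1/r) * cis ph" "a' = of_real (1/t) * cis p"
  unfolding s_def a_def s'_def a'_def arcp_def arcr_dual[OF th] r_def t_def by simp_all
 have sn: "sin ph >= 0" "sin p > 0" using p hp by (auto intro: sin_ge_zero sin_gt_zero)
 have "Im (s - cnj a) > 0" unfolding s using rt sn by (simp add: add_nonneg_pos)
 from polar_upper[OF this] obtain k et where k: "s - cnj a = of_real k * cis et" "k > 0" "0 < et" "et < pi" by blast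
 have c: "of_real k * cis (- et) = of_real r * cis (- ph) - of_real t * cis p"
  using arg_cong[OF k(1), of cnj] unfolding s by (simp add: cis_cnj)
 \<comment> \<open>The candidate for the dual argument of s' - cnj a'; that it lies in (0, pi)
   follows from the positive imaginary part.\<close>
 define \<psi> where "\<psi> = ph - p + pi - et"
 have e: "s' - cnj a' = of_real (k / (r * t)) * cis \<psi>"
 proof -
  have "cis \<psi> = cis (ph - p) * cis (- et) * cis pi" unfolding \<psi>_def cis_mult by (rule arg_cong[where f = cis]) simp
  hence "cis \<psi> = - (cis (ph - p) * cis (- et))" by simp
  hence "of_real (k / (r * t)) * cis \<psi> = - (of_real (1 / (r * t)) * (cis (ph - p) * (of_real k * cis (- et))))" by simp
  also have "cis (ph - p) * (of_real k * cis (- et)) = of_real r * (cis (ph - p) * cis (- ph)) - of_real t * (cis (ph - p) * cis p)"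
   unfolding c by (simp add: algebra_simps)
  also have "... = of_real r * cis (- p) - of_real t * cis ph" by (simp add: cis_mult)
  also have "- (of_real (1 / (r * t)) * (of_real r * cis (- p) - of_real t * cis ph)) = s' - cnj a'"
   unfolding s using rt by (simp add: field_simps cis_cnj)
  finally show ?thesis by simp
 qed
 have "Im (s' - cnj a') > 0" unfolding s using rt sn by (simp add: add_nonneg_pos)
 hence "k / (r * t) * sin \<psi> > 0" unfolding e by simp
 moreover have "k / (r * t) > 0" using k rt by simp
 ultimately have "sin \<psi> > 0" by (metis zero_less_mult_pos)
 hence \<psi>: "0 < \<psi>" "\<psi> < pi" using sin_pos_range[of \<psi>] k p hp unfolding \<psi>_def by auto
 have U: "Im (up_ln (s - cnj a)) = et" "Im (up_ln (s' - cnj a')) = \<psi>"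
  unfolding k(1) e using up_ln_cis[of k et] up_ln_cis[of "k / (r * t)" \<psi>] k \<psi> rt by auto
 define z where "z = s / a - 1"
 have z: "z = of_real (r / t) * cis (ph - p) - 1" unfolding z_def s by (simp flip: cis_divide)
 have z': "s' / a' - 1 = of_real (t / r) * cis (ph - p) - 1" unfolding s by (simp flip: cis_divide)
 have Imz: "Im z = r / t * sin (ph - p)" unfolding z by simp
 \<comment> \<open>The half turn between the arguments of s/a - 1 and of its dual; its sign depends
   on the side of the pole, and this is the source of the step function.\<close>
 define sg :: real where "sg = (if p < ph then pi else - pi)"
 have "\<exists>k2 dl. z = of_real k2 * cis dl & k2 > 0 & - pi < dl & dl < pi & - pi < ph - p - dl + sg & ph - p - dl + sg < pi"
 proof (cases "p < ph")
  case True
  have sp: "sin (ph - p) > 0" using True p hp by (intro sin_gt_zero) auto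
  hence "Im z > 0" unfolding Imz using rt by simp
  from polar_upper[OF this] obtain k2 dl where k2: "z = of_real k2 * cis dl" "k2 > 0" "0 < dl" "dl < pi" by blast
  have "k2 * sin (dl - (ph - p)) = sin (ph - p)" by (rule polar_shift_sine[of "r / t"]) (simp only: z[symmetric] k2(1)[symmetric])
  hence "sin (dl - (ph - p)) > 0" using sp k2(2) by (metis zero_less_mult_pos)
  hence "ph - p < dl" by (rule sin_diff_pos_imp_less) (use k2 True p hp in auto)
  thus ?thesis using k2 True p hp by (intro exI[of _ k2] exI[of _ dl]) (auto simp: sg_def)
 next
  case False
  hence lt: "ph < p" using hp by simp
  have sp: "sin (p - ph) > 0" using lt p hp by (intro sin_gt_zero) auto
  have "sin (ph - p) = - sin (p - ph)" by (metis minus_diff_eq sin_minus)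
  hence "Im (cnj z) > 0" using sp rt Imz by simp
  from polar_upper[OF this] obtain k2 dl where k2: "cnj z = of_real k2 * cis dl" "k2 > 0" "0 < dl" "dl < pi" by blast
  have cz: "cnj z = of_real (r / t) * cis (p - ph) - 1" unfolding z by (simp add: cis_cnj)
  have "k2 * sin (dl - (p - ph)) = sin (p - ph)" by (rule polar_shift_sine[of "r / t"]) (simp only: cz[symmetric] k2(1)[symmetric])
  hence "sin (dl - (p - ph)) > 0" using sp k2(2) by (metis zero_less_mult_pos)
  hence "p - ph < dl" by (rule sin_diff_pos_imp_less) (use k2 lt p hp in auto)
  moreover have "z = of_real k2 * cis (- dl)" using arg_cong[OF k2(1), of cnj] by (simp add: cis_cnj)
  ultimately show ?thesis using k2 lt p hp by (intro exI[of _ k2] exI[of _ "- dl"]) (auto simp: sg_def)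
 qed
 then obtain k2 dl where k2: "z = of_real k2 * cis dl" "k2 > 0" "- pi < dl" "dl < pi" "- pi < ph - p - dl + sg" "ph - p - dl + sg < pi" by blast
 have cz: "of_real k2 * cis (- dl) = of_real (r / t) * cis (p - ph) - 1"
  using arg_cong[OF k2(1), of cnj] unfolding z by (simp add: cis_cnj)
 have e2: "s' / a' - 1 = of_real (k2 * t / r) * cis (ph - p - dl + sg)"
 proof -
  have "cis (ph - p - dl + sg) = cis (ph - p) * cis (- dl) * cis sg" unfolding cis_mult by (rule arg_cong[where f = cis]) simp
  moreover have "cis sg = -1" by (simp add: sg_def complex_eq_iff)
  ultimately have "cis (ph - p - dl + sg) = - (cis (ph - p) * cis (- dl))" by simp
  hence "of_real (k2 * t / r) * cis (ph - p - dl + sg) = - (of_real (t / r) * (cis (ph - p) * (of_real k2 * cis (- dl))))" by simp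
  also have "cis (ph - p) * (of_real k2 * cis (- dl)) = of_real (r / t) * (cis (ph - p) * cis (p - ph)) - cis (ph - p)"
   unfolding cz by (simp add: algebra_simps)
  also have "... = of_real (r / t) - cis (ph - p)" by (simp add: cis_mult)
  also have "- (of_real (t / r) * (of_real (r / t) - cis (ph - p))) = s' / a' - 1"
   unfolding z' using rt by (simp add: right_diff_distrib)
  finally show ?thesis by simp
 qed
 have V: "Im (Ln (s / a - 1)) = dl" "Im (Ln (s' / a' - 1)) = ph - p - dl + sg"
  unfolding z_def[symmetric] k2(1) e2 using Ln_polar[of k2 dl] Ln_polar[of "k2 * t / r" "ph - p - dl + sg"] k2 rt by auto
 have q: "2 * p / (1 + th) + 2 * p / (1 + 1/th) = 2 * p"
 proof -
  have "2 * p / (1 + 1/th) = th * (2 * p) / (1 + th)" using dual_angles(1)[OF th, of "2 * p"] .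
  moreover have "2 * p / (1 + th) + th * (2 * p) / (1 + th) = (1 + th) * (2 * p) / (1 + th)" by (simp add: add_divide_distrib[symmetric] ring_distribs)
  ultimately show ?thesis using th by simp
 qed
 have "arc_phase th p ph = et - dl - (p - 2 * p / (1 + th))"
  unfolding arc_phase_def extlog_def s_def[symmetric] a_def[symmetric] using U V by simp
 moreover have "arc_phase (1/th) p ph = \<psi> - (ph - p - dl + sg) - (p - 2 * p / (1 + 1/th))"
  unfolding arc_phase_def extlog_def s'_def[symmetric] a'_def[symmetric] using U V by simp
 ultimately have "arc_phase th p ph + arc_phase (1/th) p ph = pi - sg" unfolding \<psi>_def using q by linarith
 thus ?thesis using hp by (auto simp: sg_def)
qed

section \<open>Integrals of d ln X and the potential of the pair of logarithms\<close>

lemma arc_rate_integral: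
 assumes "th > 0" "0 <= q" "q < pi"
 shows "(arc_rate th has_integral ln (arcv th 0) - ln (arcv th q)) {0..q}"
proof -
 have "(arc_rate th has_integral - ln (arcv th q) - (- ln (arcv th 0))) {0..q}"
 proof (rule fundamental_theorem_of_calculus_interior[OF assms(2)])
  have pos: "arcv th x > 0" if "x \<in> {0..q}" for x using arcv_pos[OF assms(1)] that assms by auto
  show "continuous_on {0..q} (%x. - ln (arcv th x))"
   using pos by (intro continuous_intros continuous_on_subset[OF continuous_on_arcv[OF assms(1)]]) (use assms in force)+
  fix x assume x: "x \<in> {0<..<q}"
  hence x': "0 < x" "x < pi" "x \<in> {0..q}" using assms by auto
  have "((%x. ln (arcv th x)) has_real_derivative 1 / arcv th x * - (arcv th x * arc_rate th x)) (at x)"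
   by (rule DERIV_chain2[OF DERIV_ln_divide[OF pos[OF x'(3)]] arcv_deriv[OF assms(1) x'(1,2)]])
  from DERIV_minus[OF this] show "((%x. - ln (arcv th x)) has_vector_derivative arc_rate th x) (at x)"
   using pos[OF x'(3)] by (simp add: has_real_derivative_iff_has_vector_derivative)
 qed
 thus ?thesis by simp
qed

text \<open>X decreases, so v < X ph means ph < \<open>arca th v\<close>, and both step functions
  together restrict to an initial interval; there ln X is the antiderivative.\<close>

lemma arc_rate_integral_above:
 assumes th: "th > 0" and p: "0 < p" "p < pi" and v: "0 < v" "v < arcv th 0"
 shows "((%ph. arc_rate th ph * of_bool (v < arcv th ph) * of_bool (ph < p)) has_integral
   ln (arcv th 0) - max (ln (arcv th p)) (ln v)) {0<..<pi}"
proof -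
 define q where "q = min p (arca th v)"
 note av = arca_interior[OF th v]
 have q: "0 < q" "q < pi" using p av by (auto simp: q_def)
 have vX: "v < arcv th ph \<longleftrightarrow> ph < arca th v" if "0 <= ph" "ph <= pi" for ph
 proof -
  have e: "arcv th (arca th v) = v" using arca(1)[OF th] v by simp
  show ?thesis using arcv_strict_antimono[OF th, of ph "arca th v"] arcv_strict_antimono[OF th, of "arca th v" ph] that av e
   by (cases ph "arca th v" rule: linorder_cases) auto
 qed
 have X: "arcv th q = max (arcv th p) v"
 proof (cases "p < arca th v")
  case True
  thus ?thesis using vX[of p] p by (simp add: q_def)
 next
  case False
  hence "~ v < arcv th p" using vX[of p] p by simp
  thus ?thesis using False arca(1)[OF th, of v] v by (simp add: q_def)
 qed
 have "ln (max (arcv th p) v) = max (ln (arcv th p)) (ln v)"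
  using arcv_pos[OF th, of p] p v by (simp add: max_def)
 hence "(arc_rate th has_integral ln (arcv th 0) - max (ln (arcv th p)) (ln v)) {0..q}"
  using arc_rate_integral[OF th, of q] q X by simp
 hence "((%ph. if ph \<in> {0..q} then arc_rate th ph else 0) has_integral ln (arcv th 0) - max (ln (arcv th p)) (ln v)) UNIV"
  unfolding has_integral_restrict_UNIV .
 hence "((%ph. if ph \<in> {0<..<pi} then arc_rate th ph * of_bool (v < arcv th ph) * of_bool (ph < p) else 0) has_integral ln (arcv th 0) - max (ln (arcv th p)) (ln v)) UNIV"
  by (rule has_integral_spike_finite[of "{0, q}", rotated 2]) (use q vX in \<open>auto simp: q_def\<close>)
 thus ?thesis unfolding has_integral_restrict_UNIV .
qed

definition log_pair :: "real => real => real => real" where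
 "log_pair th x u = ln \<bar>x - u\<bar> + ln \<bar>x powr th - u powr th\<bar>"

text \<open>The single-logarithm identities for th and, with weight 1/th, for the dual are added.
  The weight cancels the factor th in the dual rate, the Green functions agree, and the two
  conjugate functions add up to a step function. The remaining integral is elementary.\<close>

lemma arc_pair_potential:
 assumes th: "th > 0" and p: "0 < p" "p < pi" and y: "0 < y" "y < arcv th 0"
  and x: "0 < x" "x ~= arcv th 0"
 defines "h \<equiv> %ph. arc_rate th ph * ((log_pair th x (arcv th ph) - log_pair th y (arcv th ph)) * arc_green th p ph)"
  and "T \<equiv> 2 * pi\<^sup>2 * (max (ln (arcv th p)) (ln x) - max (ln (arcv th p)) (ln y))"
 shows "h integrable_on {0<..<pi}" "integral {0<..<pi} h <= T" "x < arcv th 0 ==> integral {0<..<pi} h = T"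
proof -
 define b where "b = arcv th 0"
 have b0: "b > 0" using arcv_pos[OF th] by (simp add: b_def)
 have th': "1/th > 0" using th by simp
 have b': "arcv (1/th) 0 = b powr th" using arcv_dual[OF th, of 0] by (simp add: b_def)
 have pw: "u powr th < v powr th \<longleftrightarrow> u < v" if "0 <= u" "0 <= v" for u v
  using that th powr_less_mono2[of th u v] powr_less_mono2[of th v u] by (cases u v rule: linorder_cases) auto
 have y': "0 < y powr th" "y powr th < arcv (1/th) 0" unfolding b' using pw[of y b] y b0 by (auto simp: b_def)
 have x': "0 < x powr th" "x powr th ~= arcv (1/th) 0" unfolding b' using pw[of x b] pw[of b x] x b0 by (auto simp: b_def)
 define f1 where "f1 = (%ph. arc_rate th ph * ((ln \<bar>x - arcv th ph\<bar> - ln \<bar>y - arcv th ph\<bar>) * arc_green th p ph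
   - pi * (of_bool (y < arcv th ph) - of_bool (x < arcv th ph)) * arc_phase th p ph))"
 define f2 where "f2 = (%ph. arc_rate (1/th) ph * ((ln \<bar>x powr th - arcv (1/th) ph\<bar> - ln \<bar>y powr th - arcv (1/th) ph\<bar>) * arc_green (1/th) p ph
   - pi * (of_bool (y powr th < arcv (1/th) ph) - of_bool (x powr th < arcv (1/th) ph)) * arc_phase (1/th) p ph))"
 note F1 = arc_log_potential[OF th p y x, folded f1_def b_def]
 note F2 = arc_log_potential[OF th' p y' x', folded f2_def, unfolded b']
 define A where "A = (%v ph. arc_rate th ph * of_bool (v < arcv th ph) * of_bool (ph < p))"
 \<comment> \<open>For x beyond the end no point of the arc has X > x, so the integral is 0.\<close>
 define Ix where "Ix = (if x < b then ln b - max (ln (arcv th p)) (ln x) else 0)"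
 have Ay: "(A y has_integral ln b - max (ln (arcv th p)) (ln y)) {0<..<pi}"
  unfolding A_def b_def by (rule arc_rate_integral_above[OF th p y])
 have Ax: "(A x has_integral Ix) {0<..<pi}"
 proof (cases "x < b")
  case True
  thus ?thesis unfolding A_def Ix_def using arc_rate_integral_above[OF th p x(1)] by (simp add: b_def)
 next
  case False
  have "(A x has_integral 0) {0<..<pi} \<longleftrightarrow> ((%_. 0) has_integral (0::real)) {0<..<pi}"
  proof (rule has_integral_cong)
   fix ph assume "ph \<in> {0<..<pi}"
   thus "A x ph = 0" using arcv_le_end[OF th, of ph] False by (auto simp: A_def b_def)
  qed
  thus ?thesis using False by (simp add: Ix_def)
 qed
 \<comment> \<open>The factor 2 pi^2 is pi from the jump of the logarithm times 2 pi from the sum of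
   the conjugates.\<close>
 have S: "((%ph. f1 ph + 1/th * f2 ph + 2 * pi\<^sup>2 * (A y ph - A x ph)) has_integral
   integral {0<..<pi} f1 + 1/th * integral {0<..<pi} f2 + 2 * pi\<^sup>2 * ((ln b - max (ln (arcv th p)) (ln y)) - Ix)) {0<..<pi}"
  by (intro has_integral_add has_integral_mult_right has_integral_diff integrable_integral F1(1) F2(1) Ay Ax)
 have eq: "h ph = f1 ph + 1/th * f2 ph + 2 * pi\<^sup>2 * (A y ph - A x ph)" if "ph \<in> {0<..<pi} - {p}" for ph
 proof -
  have hp: "0 <= ph" "ph < pi" "ph ~= p" "ph <= pi" using that by auto
  define X D G B P P' c where "X = arcv th ph" and "D = arc_rate th ph" and "G = arc_green th p ph"
   and "B = (of_bool (y < X) - of_bool (x < X) :: real)" and "P = arc_phase th p ph" and "P' = arc_phase (1/th) p ph" and "c = (of_bool (ph < p) :: real)"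
  have X0: "X >= 0" using arcv_le_end[OF th hp(1,4)] by (simp add: X_def)
  have v: "arcv (1/th) ph = X powr th" unfolding X_def by (rule arcv_dual[OF th hp(1,4)])
  have bl: "(y powr th < X powr th) = (y < X)" "(x powr th < X powr th) = (x < X)" using pw X0 x y by auto
  define L1 L2 where "L1 = ln \<bar>x - X\<bar> - ln \<bar>y - X\<bar>" and "L2 = ln \<bar>x powr th - X powr th\<bar> - ln \<bar>y powr th - X powr th\<bar>"
  have "f1 ph = D * (L1 * G - pi * B * P)" by (simp add: f1_def D_def L1_def G_def B_def P_def X_def)
  moreover have "f2 ph = th * D * (L2 * G - pi * B * P')"
   unfolding f2_def v bl arc_rate_dual[OF th] arc_green_dual[OF th p hp(1-3)] D_def L2_def G_def B_def P'_def by simp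
  hence "1/th * f2 ph = D * (L2 * G - pi * B * P')" using th by simp
  moreover have "A y ph - A x ph = D * B * c" unfolding A_def X_def[symmetric] D_def[symmetric] B_def c_def by (simp add: algebra_simps)
  moreover have "h ph = D * ((L1 + L2) * G)" by (simp add: h_def log_pair_def D_def L1_def L2_def G_def X_def)
  moreover have "P' = 2 * pi * c - P" using arc_phase_sum[OF th p hp(1-3)] by (simp add: P_def P'_def c_def)
  ultimately show ?thesis by (simp add: algebra_simps power2_eq_square)
 qed
 have H: "(h has_integral integral {0<..<pi} f1 + 1/th * integral {0<..<pi} f2 + 2 * pi\<^sup>2 * ((ln b - max (ln (arcv th p)) (ln y)) - Ix)) {0<..<pi}"
  by (rule has_integral_spike_finite[of "{p}", OF _ _ S]) (use eq in auto)
 show "h integrable_on {0<..<pi}" using H by blast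
 have I: "integral {0<..<pi} h = integral {0<..<pi} f1 + 1/th * integral {0<..<pi} f2 + 2 * pi\<^sup>2 * ((ln b - max (ln (arcv th p)) (ln y)) - Ix)"
  using H by (rule integral_unique)
 show eqT: "integral {0<..<pi} h = T" if "x < arcv th 0"
 proof -
  have "x < b" using that by (simp add: b_def)
  moreover have "x powr th < b powr th" using pw[of x b] x b0 \<open>x < b\<close> by simp
  ultimately show ?thesis using I F1(2) F2(2) by (simp add: Ix_def T_def)
 qed
 show "integral {0<..<pi} h <= T"
 proof (cases "x < b")
  case True thus ?thesis using eqT by (simp add: b_def)
 next
  case False
  hence xb: "x > b" using x by (simp add: b_def)
  have xb': "x powr th > b powr th" using pw[of b x] x b0 xb by simp
  have "ln (x powr th / b powr th) = th * ln (x / b)" using x b0 by (simp add: ln_div ln_powr right_diff_distrib)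
  hence "1/th * integral {0<..<pi} f2 <= 1/th * (pi * arc_phase (1/th) p 0 * (th * ln (x / b)))"
   using F2(3)[OF xb'] th by (intro mult_left_mono) auto
  also have "... = pi * arc_phase (1/th) p 0 * ln (x / b)" using th by simp
  finally have "integral {0<..<pi} f1 + 1/th * integral {0<..<pi} f2 <= pi * (arc_phase th p 0 + arc_phase (1/th) p 0) * ln (x / b)"
   using F1(3)[OF xb] by (simp add: algebra_simps)
  \<comment> \<open>At the end point the angle 0 lies before the pole, so the two conjugates add up
    to 2 pi.\<close>
  also have "... = 2 * pi\<^sup>2 * (ln x - ln b)"
   using arc_phase_sum[OF th p, of 0] p x b0 by (simp add: ln_div power2_eq_square)
  finally have le: "integral {0<..<pi} f1 + 1/th * integral {0<..<pi} f2 <= 2 * pi\<^sup>2 * (ln x - ln b)" .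
  have "arcv th p <= b" using arcv_le_end[OF th, of p] p by (simp add: b_def)
  moreover have "arcv th p > 0" using arcv_pos[OF th, of p] p by simp
  ultimately have mx: "max (ln (arcv th p)) (ln x) = ln x" using xb by (simp add: max_def)
  have "integral {0<..<pi} h = integral {0<..<pi} f1 + 1/th * integral {0<..<pi} f2 + 2 * pi\<^sup>2 * (ln b - max (ln (arcv th p)) (ln y))"
   using I False by (simp add: Ix_def)
  also have "... <= 2 * pi\<^sup>2 * (ln x - ln b) + 2 * pi\<^sup>2 * (ln b - max (ln (arcv th p)) (ln y))" using le by simp
  also have "... = T" unfolding T_def mx by (simp add: algebra_simps)
  finally show ?thesis .
 qed
qed

subsection \<open>Preimages under \<open>J\<^sub>c\<close> and the equation for \<open>c\<close>\<close>

text \<open>The argument al - ph of (s + 1)/s lies in the principal range, so the principal power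
  can be computed in polar form.\<close>

lemma Jc_polar:
 assumes "s = of_real r * cis ph" "s + 1 = of_real k * cis al" "r > 0" "k > 0" "al <= ph" "ph - al < pi"
 shows "Jc th c s = of_real (c * (k * (k / r) powr (1/th))) * cis (al + (al - ph) / th)"
proof -
 have q: "(s + 1) / s = of_real (k / r) * cis (al - ph)" unfolding assms(1,2)[symmetric]
  using assms by (simp add: cis_divide[symmetric])
 have kr: "k / r > 0" using assms by simp
 define w where "w = Complex (ln (k / r)) (al - ph)"
 have ew: "exp w = (s + 1) / s" unfolding q w_def using kr by (simp add: exp_eq_polar exp_of_real[symmetric])
 have L: "Ln ((s + 1) / s) = w" by (rule Ln_unique[OF ew]) (use assms in \<open>auto simp: w_def\<close>)
 have nz: "(s + 1) / s ~= 0" using ew by (metis exp_not_eq_zero)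
 have "((s + 1) / s) powr complex_of_real (1 / th) = exp (of_real (1 / th) * w)" using nz L by (simp add: powr_def)
 also have "... = of_real (exp (1 / th * ln (k / r))) * cis (1 / th * (al - ph))"
  by (simp add: exp_eq_polar w_def)
 also have "exp (1 / th * ln (k / r)) = (k / r) powr (1/th)" using kr using assms(3,4) by (simp only: powr_def) simp
 finally have P: "((s + 1) / s) powr complex_of_real (1 / th) = of_real ((k / r) powr (1/th)) * cis ((al - ph) / th)" by simp
 have "cis (al + (al - ph) / th) = cis al * cis ((al - ph) / th)" by (simp only: cis_mult)
 thus ?thesis unfolding Jc_def assms(2) P[unfolded assms(2)] by (simp only: of_real_mult mult_ac)
qed

text \<open>ph - al is the angle at s in the triangle -1, 0, s: it is nonnegative, and it reaches pi
  only on the excluded segment.\<close>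

lemma arg_pair:
 assumes "0 <= Im s" "s \<notin> complex_of_real ` {-1..0}"
 obtains r k ph al where "s = of_real r * cis ph" "s + 1 = of_real k * cis al" "r > 0" "k > 0"
  "0 <= al" "al <= ph" "ph <= pi" "ph - al < pi" "r * sin (ph - al) = sin al"
proof -
 have n0: "s ~= 0" using assms(2) by auto
 have n1: "s + 1 ~= 0"
 proof
  assume "s + 1 = 0"
  hence "s = complex_of_real (-1)" by (simp add: add_eq_0_iff2)
  moreover have "complex_of_real (-1) \<in> complex_of_real ` {-1..0}" by (rule imageI) simp
  ultimately show False using assms(2) by metis
 qed
 define r k ph al where "r = norm s" and "k = norm (s + 1)" and "ph = Arg s" and "al = Arg (s + 1)"
 have s: "s = of_real r * cis ph" "s + 1 = of_real k * cis al"
  using rcis_cmod_Arg[of s] rcis_cmod_Arg[of "s + 1"] by (simp_all add: rcis_def r_def k_def ph_def al_def)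
 have p: "r > 0" "k > 0" using n0 n1 by (auto simp: r_def k_def)
 have a: "0 <= ph" "ph <= pi" "0 <= al" "al <= pi"
  using Arg_eq_0 Arg_le_pi Arg_less_0 assms(1) by (auto simp: ph_def al_def not_less[symmetric] Arg_less_0)
 have e: "of_real r * cis (ph - al) + cis (- al) = of_real k"
 proof -
  have "(of_real r * cis ph + 1) * cis (- al) = of_real k * cis al * cis (- al)" using s by metis
  thus ?thesis by (simp add: cis_mult distrib_right mult.assoc)
 qed
 have sine: "r * sin (ph - al) = sin al" using arg_cong[OF e, of Im] by simp
 have cose: "r * cos (ph - al) + cos al = k" using arg_cong[OF e, of Re] by simp
 have ge: "al <= ph"
 proof (rule ccontr)
  assume n: "~ al <= ph"
  have "sin al >= 0" using a by (intro sin_ge_zero) auto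
  hence "sin (ph - al) >= 0" using sine p by (metis zero_le_mult_iff not_less)
  moreover have "sin (ph - al) = - sin (al - ph)" by (metis minus_diff_eq sin_minus)
  ultimately have "~ al - ph < pi" using sin_gt_zero[of "al - ph"] n by auto
  hence "ph = 0" "al = pi" using a by linarith+
  thus False using cose p by simp
 qed
 have lt: "ph - al < pi"
 proof (rule ccontr)
  assume "~ ph - al < pi"
  hence z: "ph = pi" "al = 0" using a by linarith+
  have "s = complex_of_real (- r)" using s(1) z by simp
  moreover have "- r \<in> {-1..0}" using cose z p by auto
  ultimately show False using assms(2) by blast
 qed
 show ?thesis by (rule that[OF s p a(3) ge a(2) lt sine])
qed

text \<open>The logarithmic derivative of J on the positive axis changes sign at 1/th.\<close>

lemma J_real_min:
 assumes "th > 0" "t > 0" "t ~= 1/th" shows "J_real th (1/th) < J_real th t"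
proof (cases "t > 1/th")
 case True
 thus ?thesis using J_real_strict_mono[OF assms(1), of "1/th" t] by simp
next
 case False
 hence t: "t < 1/th" using assms by simp
 have "ln (J_real th (1/th)) < ln (J_real th t)"
 proof (rule DERIV_neg_imp_decreasing_open[OF t])
  fix x assume x: "t < x" "x < 1/th"
  hence x0: "x > 0" using assms by linarith
  have "(1 + 1/th) / (x + 1) > 1" using x x0 by simp
  hence "(1 - (1 + 1/th) / (x + 1)) / x < 0" using x0 by (simp add: divide_neg_pos)
  thus "\<exists>y. ((%t. ln (J_real th t)) has_real_derivative y) (at x) & y < 0"
   using J_real_deriv[OF assms(1) x0] by blast
 next
  show "continuous_on {t..1/th} (%t. ln (J_real th t))"
   by (intro continuous_at_imp_continuous_on ballI DERIV_isCont[OF J_real_deriv[OF assms(1)]]) (use assms(2) in auto)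
 qed
 thus ?thesis using J_real_pos[of t th] J_real_pos[of "1/th" th] assms by simp
qed

lemma Jc_neg_one: "Jc th c (-1) = 0" by (simp add: Jc_def)

lemma Jc_arcp:
 assumes "th > 0" "0 <= ph" "ph <= pi" shows "Jc th c (arcp th ph) = of_real (c * arcv th ph)"
proof (cases "ph = pi")
 case True
 thus ?thesis using arcp_pi[OF assms(1)] arcv_pi[OF assms(1)] by (simp add: Jc_neg_one)
next
 case False
 have le: "ph / (1 + th) <= ph" using assms by (simp add: divide_le_eq mult_le_cancel_left1)
 have "Jc th c (arcp th ph) = of_real (c * (arc_shift th ph * (arc_shift th ph / arcr th ph) powr (1/th))) * cis (ph / (1 + th) + (ph / (1 + th) - ph) / th)"
 proof (rule Jc_polar)
  show "arcp th ph = of_real (arcr th ph) * cis ph" by (simp add: arcp_def)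
  show "arcp th ph + 1 = of_real (arc_shift th ph) * cis (ph / (1 + th))" by (rule arcp_add_1[OF assms])
  have "0 <= ph / (1 + th)" using assms by simp
  moreover have "ph < pi" using assms False by simp
  ultimately show "ph - ph / (1 + th) < pi" by linarith
 qed (use le arcr_pos[OF assms] arc_shift_pos[of th ph] assms False in auto)
 also have "ph / (1 + th) + (ph / (1 + th) - ph) / th = 0" using assms(1) by (simp add: divide_simps) (simp add: algebra_simps)?
 finally show ?thesis by (simp add: arcv_def)
qed

lemma arcp_not_cut:
 assumes "th > 0" "0 <= ph" "ph <= pi" shows "0 <= Im (arcp th ph)" "arcp th ph \<notin> complex_of_real ` {-1<..0}"
proof -
 have r: "arcr th ph > 0" by (rule arcr_pos[OF assms])
 show "0 <= Im (arcp th ph)" using r assms sin_ge_zero[of ph] by (simp add: arcp_def)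
 show "arcp th ph \<notin> complex_of_real ` {-1<..0}"
 proof (cases "ph = 0 | ph = pi")
  case True
  thus ?thesis
  proof
   assume "ph = 0"
   hence "arcp th ph = of_real (1/th)" using arcp_0 by simp
   thus ?thesis using assms(1) by (auto simp del: of_real_divide)
  next
   assume "ph = pi"
   hence "arcp th ph = of_real (-1)" using arcp_pi[OF assms(1)] by simp
   thus ?thesis by (auto simp del: of_real_minus)
  qed
 next
  case False
  hence "sin ph > 0" using assms by (intro sin_gt_zero) auto
  hence "Im (arcp th ph) > 0" using r by (simp add: arcp_def)
  thus ?thesis by auto
 qed
qed

text \<open>A positive value of J forces the angle al + (al - ph)/th to be 0, that is al = ph/(1 +
  th). The triangle then determines s for ph > 0. On the positive axis only 1/th is possible,
  because all other values exceed the end value.\<close>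

lemma Jc_upper_preimage:
 assumes th: "th > 1" and c: "c > 0" and x: "0 <= x" "x <= c * arcv th 0"
  and s: "0 <= Im s" "s \<notin> complex_of_real ` {-1<..0}" "Jc th c s = of_real x"
 shows "s = arcp th (arca th (x / c))"
proof (cases "s = -1")
 case True
 hence "x = 0" using s(3) by (simp add: Jc_neg_one)
 moreover have "arca th 0 = pi" using arca_of_value[of th pi] arcv_pi[of th] th by simp
 ultimately show ?thesis using True arcp_pi[of th] th by simp
next
 case False
 have th0: "th > 0" using th by simp
 have "s \<notin> complex_of_real ` {-1..0}"
 proof
  assume "s \<in> complex_of_real ` {-1..0}"
  then obtain t where t: "s = of_real t" "-1 <= t" "t <= 0" by auto
  hence "t ~= -1" using False by auto
  thus False using s(2) t by auto
 qed
 then obtain r k ph al where p: "s = of_real r * cis ph" "s + 1 = of_real k * cis al" "r > 0" "k > 0"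
  "0 <= al" "al <= ph" "ph <= pi" "ph - al < pi" "r * sin (ph - al) = sin al" by (rule arg_pair[OF s(1)])
 define \<beta> where "\<beta> = al + (al - ph) / th"
 define m where "m = c * (k * (k / r) powr (1/th))"
 have m: "m > 0" using p c by (simp add: m_def)
 have J: "of_real m * cis \<beta> = complex_of_real x" using Jc_polar[OF p(1-4,6,8), of th c] s(3) unfolding m_def \<beta>_def by simp
 have "norm (of_real m * cis \<beta>) = m" using m by (simp add: norm_mult)
 hence mx: "m = x" using J x(1) by simp
 hence "cis \<beta> = 1" using J m by simp
 hence c1: "cos \<beta> = 1" by (metis cis.sel(1) one_complex.sel(1))
 \<comment> \<open>th > 1 enters here: dividing the angle ph - al < pi by th does not enlarge
   it.\<close>
 have lo: "- pi < \<beta>"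
 proof -
  have "(ph - al) / th <= ph - al" using th p(6) by (simp add: divide_le_eq mult_le_cancel_left1)
  hence "- ((al - ph) / th) < pi" using p(8) by (simp add: minus_divide_left)
  thus ?thesis using p(5) unfolding \<beta>_def by linarith
 qed
 have hi: "\<beta> <= pi"
 proof -
  have "(al - ph) / th <= 0" using p(6) th by (simp add: divide_nonpos_pos)
  thus ?thesis using p(6,7) unfolding \<beta>_def by linarith
 qed
 have "\<beta> = 0"
 proof -
  have "cos \<bar>\<beta>\<bar> = cos 0" using c1 by simp
  hence "\<bar>\<beta>\<bar> = 0" using cos_inj_pi[of "\<bar>\<beta>\<bar>" 0] lo hi by (auto simp: abs_if)
  thus ?thesis by simp
 qed
 hence "th * al + (al - ph) = 0" using th0 by (simp add: \<beta>_def field_simps)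
 hence al0: "al = ph / (1 + th)" using th0 by (simp add: field_simps)
 show ?thesis
 proof (cases "ph = 0")
  case True
  have r: "r = 1/th"
  proof (rule ccontr)
   assume n: "r ~= 1/th"
   have k: "k = r + 1"
   proof -
    have "complex_of_real k = of_real (r + 1)" using p(1,2) True al0 by simp
    thus ?thesis by (simp only: of_real_eq_iff)
   qed
   have "c * J_real th (1/th) < c * J_real th r" using J_real_min[OF th0 p(3) n] c by simp
   also have "... = x" using mx by (simp add: m_def J_real_def k)
   finally show False using x(2) J_real_at_end[OF th0] by simp
  qed
  have sp: "s = arcp th 0" using p(1) True r arcp_0 by simp
  hence "of_real x = complex_of_real (c * arcv th 0)" using s(3) Jc_arcp[OF th0, of 0 c] by simp
  hence "x / c = arcv th 0" using c by (simp only: of_real_eq_iff) simp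
  thus ?thesis using sp arca_of_value[OF th0, of 0] by simp
 next
  case False
  hence hp: "ph > 0" using p(5,6) by simp
  note an = arcas[OF th0 hp p(7)]
  have pa: "ph - al = th * ph / (1 + th)" using an(7) unfolding al0 by linarith
  have "r * sin (th * ph / (1 + th)) = sin (ph / (1 + th))" using p(9) unfolding pa by (simp only: al0)
  hence "r = sin (ph / (1 + th)) / sin (th * ph / (1 + th))" using an(6) by (simp only: eq_divide_eq) simp
  hence sp: "s = arcp th ph" using p(1) False by (simp add: arcp_def arcr_def)
  hence "of_real x = complex_of_real (c * arcv th ph)" using s(3) Jc_arcp[OF th0, of ph c] hp p(7) by simp
  hence "x / c = arcv th ph" using c by (simp only: of_real_eq_iff) simp
  thus ?thesis using sp arca_of_value[OF th0, of ph] hp p(7) by simp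
 qed
qed

text \<open>(s + 1)/s is a nonpositive real only for s in [-1, 0), so off the cut the principal
  power commutes with conjugation; the remaining point -1 has value 0.\<close>

lemma Jc_cnj:
 assumes "s \<notin> complex_of_real ` {-1<..0}" shows "Jc th c (cnj s) = cnj (Jc th c s)"
proof (cases "s = -1")
 case True
 thus ?thesis by (simp add: Jc_neg_one)
next
 case False
 have nz: "s ~= 0" using assms by auto
 have n1: "s + 1 ~= 0" using False by (metis add_eq_0_iff2)
 have q: "(s + 1) / s \<notin> \<real>\<^sub>\<le>\<^sub>0"
 proof
  assume "(s + 1) / s \<in> \<real>\<^sub>\<le>\<^sub>0"
  then obtain t where t: "(s + 1) / s = of_real t" "t <= 0" by (auto elim: nonpos_Reals_cases)
  have "s * (of_real t - 1) = 1" using t(1) nz by (simp add: field_simps)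
  moreover have "complex_of_real t - 1 ~= 0" using t(2) by (metis eq_iff_diff_eq_0 not_one_le_zero of_real_1 of_real_eq_iff)
  ultimately have "s = 1 / (of_real t - 1)" by (simp add: field_simps)
  hence e: "s = complex_of_real (1 / (t - 1))" by simp
  have "t ~= 0" using t(1) n1 nz by auto
  hence "1 / (t - 1) \<in> {-1<..0}" using t(2) by (auto simp: field_simps)
  thus False using assms e by blast
 qed
 have c: "cnj (Ln ((s + 1) / s)) = Ln ((cnj s + 1) / cnj s)" using cnj_Ln[OF q] by simp
 have "cnj s + 1 = cnj (s + 1)" by simp
 hence "cnj s + 1 ~= 0" using n1 by (metis complex_cnj_zero_iff)
 hence "(s + 1) / s ~= 0" "(cnj s + 1) / cnj s ~= 0" using nz n1 by simp_all
 thus ?thesis by (simp add: Jc_def powr_def exp_cnj c)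
qed

lemma Iplus_eq:
 assumes th: "th > 1" and c: "c > 0" and x: "0 <= x" "x <= c * arcv th 0"
 shows "Iplus th c x = arcp th (arca th (x / c))" "Iminus th c x = cnj (arcp th (arca th (x / c)))"
  "Jc th c (arcp th (arca th (x / c))) = of_real x" "Jc th c (cnj (arcp th (arca th (x / c)))) = of_real x"
proof -
 have th0: "th > 0" using th by simp
 have xc: "0 <= x / c" "x / c <= arcv th 0" using x c by (simp_all add: divide_le_eq mult.commute)
 define s where "s = arcp th (arca th (x / c))"
 note a = arca[OF th0 xc]
 note cut = arcp_not_cut[OF th0 a(2,3), folded s_def]
 have J: "Jc th c s = of_real x" using Jc_arcp[OF th0 a(2,3), of c] a(1) c by (simp add: s_def)
 have cutc: "cnj z \<notin> complex_of_real ` {-1<..0}" if z: "z \<notin> complex_of_real ` {-1<..0}" for z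
 proof
  assume "cnj z \<in> complex_of_real ` {-1<..0}"
  then obtain t where "t \<in> {-1<..0}" "cnj z = of_real t" by auto
  hence "z = of_real t" by (metis complex_cnj_cnj complex_cnj_complex_of_real)
  thus False using z \<open>t \<in> {-1<..0}\<close> by auto
 qed
 have Jc': "Jc th c (cnj s) = of_real x" using Jc_cnj[OF cut(2), of th c] J by simp
 show "Iplus th c x = arcp th (arca th (x / c))"
  unfolding Iplus_def s_def[symmetric]
 proof (rule the_equality)
  show "0 <= Im s & s \<notin> complex_of_real ` {-1<..0} & Jc th c s = complex_of_real x"
   by (intro conjI cut J)
  show "z = s" if "0 <= Im z & z \<notin> complex_of_real ` {-1<..0} & Jc th c z = complex_of_real x" for z
   unfolding s_def using Jc_upper_preimage[OF th c x] that by blast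
 qed
 show "Iminus th c x = cnj (arcp th (arca th (x / c)))"
  unfolding Iminus_def s_def[symmetric]
 proof (rule the_equality)
  show "Im (cnj s) <= 0 & cnj s \<notin> complex_of_real ` {-1<..0} & Jc th c (cnj s) = complex_of_real x"
   using cut(1) cutc[OF cut(2)] Jc' by (intro conjI) simp_all
  fix z assume z: "Im z <= 0 & z \<notin> complex_of_real ` {-1<..0} & Jc th c z = complex_of_real x"
  have J': "Jc th c (cnj z) = of_real x" using Jc_cnj[of z th c] z by simp
  have "0 <= Im (cnj z)" using z by simp
  hence "cnj z = s" unfolding s_def using z cutc J' Jc_upper_preimage[OF th c x] by blast
  thus "z = cnj s" by (metis complex_cnj_cnj)
 qed
 show "Jc th c (arcp th (arca th (x / c))) = of_real x" "Jc th c (cnj (arcp th (arca th (x / c)))) = of_real x"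
  using J Jc' by (simp_all add: s_def)
qed

section \<open>The inverse of X and the contour integral over gamma\<close>

lemma continuous_on_arca:
 assumes "th > 0" shows "continuous_on {0..arcv th 0} (arca th)"
proof -
 have "continuous_on (arcv th ` {0..pi}) (arca th)"
  by (rule continuous_on_inv[OF continuous_on_arcv[OF assms]]) (use arca_of_value[OF assms] in auto)
 thus ?thesis by (simp add: arcv_image[OF assms])
qed

lemma arca_strict_antimono:
 assumes "th > 0" "0 <= x" "x < y" "y <= arcv th 0" shows "arca th y < arca th x"
proof (rule ccontr)
 assume n: "~ arca th y < arca th x"
 note x = arca[of th x] and y = arca[of th y]
 have "arcv th (arca th y) <= arcv th (arca th x)"
  using arcv_strict_antimono[OF assms(1), of "arca th x" "arca th y"] n x y assms by (cases "arca th x = arca th y") auto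
 thus False using x(1) y(1) assms by simp
qed

lemma arca_deriv:
 assumes "th > 0" "0 < x" "x < arcv th 0"
 shows "(arca th has_real_derivative - 1 / (x * arc_rate th (arca th x))) (at x)"
proof -
 note i = arca_interior[OF assms] and a = arca[of th x]
 have ax: "arcv th (arca th x) = x" using a assms by simp
 have r: "arc_rate th (arca th x) > 0" by (rule arc_rate_pos[OF assms(1) i])
 have "(arca th has_real_derivative inverse (- (x * arc_rate th (arca th x)))) (at x)"
 proof (rule DERIV_inverse_function)
  show "(arcv th has_real_derivative - (x * arc_rate th (arca th x))) (at (arca th x))"
   using arcv_deriv[OF assms(1) i] unfolding ax .
  show "- (x * arc_rate th (arca th x)) ~= 0" using r assms by simp
  show "0 < x" "x < arcv th 0" by fact+
  show "arcv th (arca th y) = y" if "0 < y" "y < arcv th 0" for y using arca(1)[OF assms(1), of y] that by simp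
  show "isCont (arca th) x"
   by (rule continuous_on_interior[OF continuous_on_arca[OF assms(1)]]) (use assms in simp)
 qed
 thus ?thesis by (simp add: inverse_eq_divide)
qed

text \<open>The integrand is k(x) = x V'(x) against d ln s. As the lower arc is the reversed
  conjugate of the upper one, the contour integral is 2 i times the imaginary part over the upper
  arc, and integration by parts turns it into the moment of W = k' against the angle.\<close>

lemma contour_integral_gammapath:
 fixes V1 W :: "real => real"
 assumes th: "th > 1" and c: "c > 0"
  and k: "!!x. x >= 0 ==> ((%x. x * V1 x) has_real_derivative W x) (at x within {0..})"
  and W: "continuous_on {0..} W"
 defines "b \<equiv> c * arcv th 0"
 shows "contour_integral (gammapath th c) (%s. of_real (V1 (Re (Jc th c s))) * Jc th c s / s) / (2 * pi * \<i>)
  = of_real (integral {0..b} (%y. W y * arca th (y / c)) / pi)"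
proof -
 have th0: "th > 0" using th by simp
 define X where "X = arcv th 0"
 have X: "X > 0" using arcv_pos[OF th0, of 0] by (simp add: X_def)
 have b: "b = c * X" "b > 0" using X c by (simp_all add: b_def X_def)
 have bcb: "bc th c = b" using arcv_0[OF th0] by (simp add: bc_def b_def)
 define k where "k = (%x. x * V1 x)"
 define ph where "ph = (%t. arca th (X * (1 - 2 * t)))"
 define x where "x = (%t :: real. b * (1 - 2 * t))"
 \<comment> \<open>A continuous logarithm of s along the upper arc; its imaginary part is the
   angle.\<close>
 define Lm where "Lm = (%t. of_real (ln (arcr th (ph t))) + \<i> * of_real (ph t))"
 define ph' where "ph' = (%t. 2 / ((1 - 2 * t) * arc_rate th (ph t)))"
 define Lm' where "Lm' = (%t. of_real (ph' t) * (of_real (arc_logder th (ph t)) + \<i>))"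
 define sg where "sg = (%t. arcp th (ph t))"
 define h where "h = (%t. of_real (k (x t)) * Lm' t)"
 have rng: "0 <= X * (1 - 2 * t) & X * (1 - 2 * t) <= X" if "0 <= t" "t <= 1/2" for t
  using that X by (simp add: mult_le_cancel_left1)
 have rngi: "0 < X * (1 - 2 * t) & X * (1 - 2 * t) < X" if "0 < t" "t < 1/2" for t
  using that X by (simp add: mult_less_cancel_left1)
 have phr: "0 <= ph t" "ph t <= pi" if "0 <= t" "t <= 1/2" for t
  using arca(2,3)[OF th0, of "X * (1 - 2 * t)"] rng[OF that] by (auto simp: ph_def X_def)
 have phi_int: "0 < ph t" "ph t < pi" if "0 < t" "t < 1/2" for t
  using arca_interior[OF th0, of "X * (1 - 2 * t)"] rngi[OF that] by (auto simp: ph_def X_def)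
 have cphi: "continuous_on {0..1/2} ph" unfolding ph_def
  by (rule continuous_on_compose2[OF continuous_on_arca[OF th0]]) (use rng in \<open>auto intro!: continuous_intros simp: X_def\<close>)
 have crad: "continuous_on {0..1/2} (%t. arcr th (ph t))"
  by (rule continuous_on_compose2[OF continuous_on_arcr[OF th0] cphi]) (use phr in auto)
 have rpos: "arcr th (ph t) > 0" if "0 <= t" "t <= 1/2" for t by (rule arcr_pos[OF th0 phr[OF that]])
 have cLm: "continuous_on {0..1/2} Lm" unfolding Lm_def
  by (intro continuous_intros cphi crad continuous_on_ln) (use rpos in force)
 have dphi: "(ph has_real_derivative ph' t) (at t)" if t: "0 < t" "t < 1/2" for t
 proof -
  define y where "y = X * (1 - 2 * t)"
  have y: "0 < y" "y < arcv th 0" using rngi[OF t] by (auto simp: y_def X_def)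
  have d: "((%t. X * (1 - 2 * t)) has_real_derivative - 2 * X) (at t)" by (auto intro!: derivative_eq_intros)
  have "((%t. arca th (X * (1 - 2 * t))) has_real_derivative - 1 / (y * arc_rate th (arca th y)) * (- 2 * X)) (at t)"
   by (rule DERIV_chain2[where f = "arca th", OF _ d]) (use arca_deriv[OF th0 y] in \<open>simp add: y_def\<close>)
  moreover have "arc_rate th (arca th y) > 0" using arc_rate_pos[OF th0 phi_int[OF t]] by (simp add: ph_def y_def)
  hence "- 1 / (y * arc_rate th (arca th y)) * (- 2 * X) = ph' t"
   using X t by (simp add: ph'_def ph_def y_def field_simps)
  ultimately show ?thesis by (simp add: ph_def)
 qed
 have dsg: "(sg has_vector_derivative sg t * Lm' t) (at t)" if t: "0 < t" "t < 1/2" for t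
  using vector_diff_chain_at[OF dphi[OF t, unfolded has_real_derivative_iff_has_vector_derivative] arcp_deriv[OF th0 phi_int[OF t]]]
  by (simp add: sg_def Lm'_def o_def scaleR_conv_of_real mult_ac)
 have dLm: "(Lm has_vector_derivative Lm' t) (at t)" if t: "0 < t" "t < 1/2" for t
 proof -
  have r0: "arcr th (ph t) > 0" using rpos[of t] t by simp
  have "((%t. arcr th (ph t)) has_real_derivative arcr th (ph t) * arc_logder th (ph t) * ph' t) (at t)"
   by (rule DERIV_chain2[OF arcr_deriv[OF th0 phi_int[OF t]] dphi[OF t]])
  note d = DERIV_chain2[where f = ln, OF DERIV_ln[OF r0] this]
  have "inverse (arcr th (ph t)) * (arcr th (ph t) * arc_logder th (ph t) * ph' t) = arc_logder th (ph t) * ph' t"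
   using r0 by simp
  with d have "((%t. ln (arcr th (ph t))) has_real_derivative arc_logder th (ph t) * ph' t) (at t)" by (simp only:)
  hence "((%t. of_real (ln (arcr th (ph t))) :: complex) has_vector_derivative of_real (arc_logder th (ph t) * ph' t)) (at t)"
   by (intro has_vector_derivative_of_real) (simp add: has_real_derivative_iff_has_vector_derivative)
  moreover have "((%t. \<i> * of_real (ph t)) has_vector_derivative \<i> * of_real (ph' t)) (at t)"
   by (intro has_vector_derivative_mult_right has_vector_derivative_of_real) (use dphi[OF t] in \<open>simp add: has_real_derivative_iff_has_vector_derivative\<close>)
  ultimately have "(Lm has_vector_derivative of_real (arc_logder th (ph t) * ph' t) + \<i> * of_real (ph' t)) (at t)"
   unfolding Lm_def by (rule has_vector_derivative_add)
  thus ?thesis by (simp add: Lm'_def algebra_simps)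
 qed
 have xr: "0 <= x t" "x t <= b" if "0 <= t" "t <= 1/2" for t
 proof -
  show "0 <= x t" using that b by (simp add: x_def)
  have "b * (1 - 2 * t) <= b * 1" using that b(2) by (intro mult_left_mono) auto
  thus "x t <= b" by (simp add: x_def)
 qed
 have ck: "continuous_on {0..} k" unfolding k_def
  using k by (intro DERIV_continuous_on) auto
 have ckx: "continuous_on {0..1/2} (%t. k (x t))" 
  by (rule continuous_on_compose2[OF ck]) (use xr in \<open>auto simp: x_def intro!: continuous_intros\<close>)
 have cWx: "continuous_on {0..1/2} (%t. W (x t))" 
  by (rule continuous_on_compose2[OF W]) (use xr in \<open>auto simp: x_def intro!: continuous_intros\<close>)
 have dkx: "((%t. k (x t)) has_real_derivative W (x t) * (- 2 * b)) (at t)" if t: "0 < t" "t < 1/2" for t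
 proof -
  have x0: "x t > 0" using t b by (simp add: x_def)
  have "(k has_real_derivative W (x t)) (at (x t) within {0<..})" unfolding k_def
   by (rule DERIV_subset[OF k]) (use x0 in auto)
  hence dk: "(k has_real_derivative W (x t)) (at (x t))" using x0 by (simp add: at_within_open[of _ "{0<..}"])
  have "(x has_real_derivative - 2 * b) (at t)" unfolding x_def by (auto intro!: derivative_eq_intros)
  from DERIV_chain2[OF dk this] show ?thesis .
 qed
 \<comment> \<open>The term left over by integration by parts. It is continuous on the closed
   interval, so the derivative of the angle, known only in the interior, need not be integrated
   directly.\<close>
 define B where "B = (%t. of_real (W (x t) * (- 2 * b)) * Lm t)"
 have cB: "continuous_on {0..1/2} B" unfolding B_def by (intro continuous_intros cLm cWx)
 define I1 where "I1 = of_real (k (x (1/2))) * Lm (1/2) - of_real (k (x 0)) * Lm 0 - integral {0..1/2} B"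
 have "((%t. of_real (k (x t)) * Lm' t + B t) has_integral of_real (k (x (1/2))) * Lm (1/2) - of_real (k (x 0)) * Lm 0) {0..1/2}"
 proof (rule fundamental_theorem_of_calculus_interior)
  show "continuous_on {0..1/2} (%t. of_real (k (x t)) * Lm t)" by (intro continuous_intros cLm ckx)
  fix t :: real assume "t \<in> {0<..<1/2}"
  hence t: "0 < t" "t < 1/2" by auto
  have "((%t. of_real (k (x t)) :: complex) has_vector_derivative of_real (W (x t) * (- 2 * b))) (at t)"
   by (rule has_vector_derivative_of_real) (use dkx[OF t] in \<open>simp add: has_real_derivative_iff_has_vector_derivative\<close>)
  from has_vector_derivative_mult[OF this dLm[OF t]]
  show "((%t. of_real (k (x t)) * Lm t) has_vector_derivative of_real (k (x t)) * Lm' t + B t) (at t)"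
   by (simp add: B_def)
 qed simp
 from has_integral_diff[OF this integrable_integral[OF integrable_continuous_interval[OF cB]]]
 have hI1: "(h has_integral I1) {0..1/2}" by (simp add: h_def I1_def)
 have hI1c: "((%t. cnj (h t)) has_integral cnj I1) {0..1/2}"
  using has_integral_linear[OF hI1 bounded_linear_cnj] by (simp add: o_def)
 \<comment> \<open>The substitution t -> 1 - t for the lower arc, which runs back from -1 to
   1/th.\<close>
 have hI2: "((%t. - cnj (h (1 - t))) has_integral - cnj I1) {1/2..1}"
 proof -
  have "((%t. cnj (h (- 1 * t + 1))) has_integral (1 / \<bar>- 1 :: real\<bar> ^ DIM(real)) *\<^sub>R cnj I1) ((%t. (1 / - 1) *\<^sub>R t + - ((1 / - 1) *\<^sub>R 1)) ` cbox 0 (1/2))"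
   using has_integral_affinity[of "%t. cnj (h t)" "cnj I1" 0 "1/2" "-1" 1] hI1c by simp
  moreover have "(%t::real. (1 / - 1) *\<^sub>R t + - ((1 / - 1) *\<^sub>R 1)) ` cbox 0 (1/2) = {1/2..1}"
  proof -
   have "(%t::real. (1 / - 1) *\<^sub>R t + - ((1 / - 1) *\<^sub>R 1)) = (%t. 1 - t)" by (simp add: fun_eq_iff)
   moreover have "(%t::real. 1 - t) ` {0..1/2} = {1/2..1}" by (simp add: image_diff_atLeastAtMost)
   ultimately show ?thesis by (simp only: box_real)
  qed
  ultimately have "((%t. cnj (h (1 - t))) has_integral cnj I1) {1/2..1}" by (simp add: add.commute)
  thus ?thesis by (rule has_integral_neg)
 qed
 define f where "f = (%s. of_real (V1 (Re (Jc th c s))) * Jc th c s / s)"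
 have gp1: "gammapath th c t = sg t" "Jc th c (sg t) = of_real (x t)" if t: "0 <= t" "t <= 1/2" for t
 proof -
  have e: "x t / c = X * (1 - 2 * t)" using c by (simp add: x_def b)
  note I = Iplus_eq[OF th c, of "x t", folded b_def, OF xr[OF t], unfolded e, folded ph_def sg_def]
  show "gammapath th c t = sg t" using t I(1) unfolding gammapath_def bcb by (simp add: x_def sg_def ph_def)
  show "Jc th c (sg t) = of_real (x t)" using I(3) by (simp add: sg_def ph_def)
 qed
 have gp2: "gammapath th c t = cnj (sg (1 - t))" "Jc th c (cnj (sg (1 - t))) = of_real (x (1 - t))" if t: "1/2 < t" "t <= 1" for t
 proof -
  have t': "0 <= 1 - t" "1 - t <= 1/2" using t by auto
  have e: "x (1 - t) / c = X * (1 - 2 * (1 - t))" using c by (simp add: x_def b)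
  note I = Iplus_eq[OF th c, of "x (1 - t)", folded b_def, OF xr[OF t'], unfolded e]
  have e2: "b * (2 * t - 1) = x (1 - t)" by (simp add: x_def algebra_simps)
  show "gammapath th c t = cnj (sg (1 - t))" using t I(2) unfolding gammapath_def bcb e2 by (simp add: sg_def ph_def)
  show "Jc th c (cnj (sg (1 - t))) = of_real (x (1 - t))" using I(4) by (simp add: sg_def ph_def)
 qed
 have sgnz: "sg t ~= 0" if "0 <= t" "t <= 1/2" for t using rpos[OF that] by (simp add: sg_def arcp_def)
 have i1: "((%t. f (gammapath th c t) * vector_derivative (gammapath th c) (at t within {0..1})) has_integral I1) {0..1/2}"
 proof (rule has_integral_spike_finite[OF _ _ hI1, of "{0, 1/2}"])
  fix t :: real assume "t \<in> {0..1/2} - {0, 1/2}"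
  hence t: "0 < t" "t < 1/2" by auto
  have "(gammapath th c has_vector_derivative sg t * Lm' t) (at t)"
   by (rule has_vector_derivative_transform_within_open[OF dsg[OF t], of "{0<..<1/2}"]) (use t gp1 in auto)
  hence v: "vector_derivative (gammapath th c) (at t within {0..1}) = sg t * Lm' t"
   by (subst at_within_interior) (use t in \<open>auto simp: vector_derivative_at\<close>)
  have t': "0 <= t" "t <= 1/2" using t by auto
  show "f (gammapath th c t) * vector_derivative (gammapath th c) (at t within {0..1}) = h t"
   unfolding v f_def gp1[OF t'] using sgnz[OF t'] by (simp add: h_def k_def mult_ac)
 qed simp
 have i2: "((%t. f (gammapath th c t) * vector_derivative (gammapath th c) (at t within {0..1})) has_integral - cnj I1) {1/2..1}"
 proof (rule has_integral_spike_finite[OF _ _ hI2, of "{1/2, 1}"])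
  fix t :: real assume "t \<in> {1/2..1} - {1/2, 1}"
  hence t: "1/2 < t" "t < 1" by auto
  hence s: "0 < 1 - t" "1 - t < 1/2" by auto
  have d1: "((%t. 1 - t) has_vector_derivative (-1::real)) (at t)" by (auto intro!: derivative_eq_intros)
  have "((%t. sg (1 - t)) has_vector_derivative - (sg (1 - t) * Lm' (1 - t))) (at t)"
   using vector_diff_chain_at[OF d1 dsg[OF s]] by (simp add: o_def)
  from bounded_linear.has_vector_derivative[OF bounded_linear_cnj this]
  have "((%t. cnj (sg (1 - t))) has_vector_derivative - cnj (sg (1 - t) * Lm' (1 - t))) (at t)" by simp
  hence "(gammapath th c has_vector_derivative - cnj (sg (1 - t) * Lm' (1 - t))) (at t)"
   by (rule has_vector_derivative_transform_within_open[where S = "{1/2<..<1}"]) (use t gp2 in auto)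
  hence v: "vector_derivative (gammapath th c) (at t within {0..1}) = - cnj (sg (1 - t) * Lm' (1 - t))"
   by (subst at_within_interior) (use t in \<open>auto simp: vector_derivative_at\<close>)
  have t': "1/2 < t" "t <= 1" using t by auto
  have nz: "cnj (sg (1 - t)) ~= 0" using sgnz[of "1 - t"] t by simp
  show "f (gammapath th c t) * vector_derivative (gammapath th c) (at t within {0..1}) = - cnj (h (1 - t))"
   unfolding v f_def gp2[OF t'] using nz by (simp add: h_def k_def mult_ac)
 qed simp
 have "(f has_contour_integral I1 + - cnj I1) (gammapath th c)"
  unfolding has_contour_integral_def by (rule has_integral_combine[OF _ _ i1 i2]) auto
 hence ci: "contour_integral (gammapath th c) f = I1 - cnj I1" by (simp add: contour_integral_unique)
 have ImB: "Im (integral {0..1/2} B) = - integral {0..b} (%y. W y * arca th (y / c))"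
 proof -
  have "Im (integral {0..1/2} B) = integral {0..1/2} (%t. Im (B t))"
   using integral_linear[OF integrable_continuous_interval[OF cB] bounded_linear_Im] by (simp add: o_def)
  also have "(%t. Im (B t)) = (%t. (- 2 * b) * (W (x t) * ph t))" by (simp add: B_def Lm_def fun_eq_iff)
  also have "integral {0..1/2} (%t. (- 2 * b) * (W (x t) * ph t)) = - integral {0..b} (%y. W y * arca th (y / c))"
  proof -
   define g where "g = (%y. W y * arca th (y / c))"
   have cg: "continuous_on {0..b} g" unfolding g_def
    by (intro continuous_intros continuous_on_subset[OF W] continuous_on_compose2[OF continuous_on_arca[OF th0]])
      (use c in \<open>auto simp: b X_def field_simps\<close>)
   have e: "g (x t) = W (x t) * ph t" for t using c by (simp add: g_def x_def ph_def b)
   have "((%t. g (- (2 * b) * t + b)) has_integral (1 / \<bar>- (2 * b)\<bar> ^ DIM(real)) *\<^sub>R integral {0..b} g)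
     ((%y. (1 / - (2 * b)) *\<^sub>R y + - ((1 / - (2 * b)) *\<^sub>R b)) ` cbox 0 b)"
    using has_integral_affinity[of g "integral {0..b} g" 0 b "- (2 * b)" b] integrable_integral[OF integrable_continuous_interval[OF cg]] b(2) by simp
   moreover have "(%y. (1 / - (2 * b)) *\<^sub>R y + - ((1 / - (2 * b)) *\<^sub>R b)) ` cbox 0 b = {0..1/2}"
   proof -
    have "(%y. (1 / - (2 * b)) *\<^sub>R y + - ((1 / - (2 * b)) *\<^sub>R b)) = (%y. (-1 / (2 * b)) * y + 1/2)"
     using b(2) by (simp add: fun_eq_iff field_simps)
    thus ?thesis unfolding box_real using b(2) by (simp only: image_affinity_atLeastAtMost) (simp add: field_simps divide_neg_pos)
   qed
   moreover have "- (2 * b) * t + b = x t" for t by (simp add: x_def algebra_simps)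
   ultimately have "((%t. g (x t)) has_integral integral {0..b} g / (2 * b)) {0..1/2}" using b(2) by (simp del: minus_mult_left)
   from integral_unique[OF has_integral_mult_right[OF this, of "- 2 * b"]] b(2)
   show ?thesis unfolding e by (simp add: g_def)
  qed
  finally show ?thesis .
 qed
 \<comment> \<open>Both boundary terms have imaginary part 0: at -1 because k 0 = 0, at 1/th because
   the angle is 0.\<close>
 have "k (x (1/2)) = 0" by (simp add: x_def k_def)
 moreover have "Im (Lm 0) = 0" using arca_of_value[OF th0, of 0] by (simp add: Lm_def ph_def X_def)
 ultimately have ImI: "Im I1 = integral {0..b} (%y. W y * arca th (y / c))" unfolding I1_def by (simp add: ImB)
 have "I1 - cnj I1 = 2 * \<i> * of_real (Im I1)" by (simp add: complex_eq_iff)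
 hence "contour_integral (gammapath th c) f / (2 * pi * \<i>) = 2 * \<i> * of_real (Im I1) / (2 * pi * \<i>)" unfolding ci by (simp only:)
 also have "... = of_real (Im I1 / pi)" by simp
 finally show ?thesis unfolding f_def ImI .
qed

section \<open>Existence and uniqueness of c\<close>

lemma rate_unbounded:
 fixes V V1 :: "real => real"
 assumes V1: "!!x. x > 0 ==> (V has_real_derivative V1 x) (at x)"
  and mono: "!!x y. 0 < x ==> x <= y ==> x * V1 x <= y * V1 y"
  and growth: "filterlim (%x. V x / ln x) at_top at_top"
 shows "filterlim (%x. x * V1 x) at_top at_top"
 unfolding filterlim_at_top
proof
 fix Z :: real
 have "\<exists>x0>0. x0 * V1 x0 >= Z"
 proof (rule ccontr)
  assume "~ (\<exists>x0>0. x0 * V1 x0 >= Z)"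
  hence lt: "x * V1 x < Z" if "x > 0" for x using that by (meson not_le)
  \<comment> \<open>If x V'(x) stayed below Z, V would grow at most like Z ln x, against the growth
    hypothesis.\<close>
  have le: "V x <= V 1 + Z * ln x" if x: "x >= 1" for x
  proof -
   have "(%x. Z * ln x - V x) 1 <= (%x. Z * ln x - V x) x"
   proof (rule DERIV_nonneg_imp_nondecreasing[OF x])
    fix t :: real assume t: "1 <= t" "t <= x"
    hence "((%x. Z * ln x - V x) has_real_derivative Z / t - V1 t) (at t)"
     by (auto intro!: derivative_eq_intros V1)
    moreover have "0 <= Z / t - V1 t" using lt[of t] t by (simp add: field_simps)
    ultimately show "\<exists>y. ((%x. Z * ln x - V x) has_real_derivative y) (at t) & 0 <= y" by blast
   qed
   thus ?thesis by simp
  qed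
  have "\<forall>\<^sub>F x in at_top. V x / ln x >= Z + \<bar>V 1\<bar> + 1" using growth by (auto simp: filterlim_at_top)
  moreover have "\<forall>\<^sub>F x :: real in at_top. exp 1 <= x" by (rule eventually_ge_at_top)
  ultimately have "\<forall>\<^sub>F x :: real in at_top. False"
  proof eventually_elim
   fix x :: real assume x: "Z + \<bar>V 1\<bar> + 1 <= V x / ln x" "exp 1 <= x"
   have "1 <= x" using x(2) one_le_exp_iff[of "1::real"] by linarith
   have l: "1 <= ln x" using x(2) by (subst ln_ge_iff) (use \<open>1 <= x\<close> in auto)
   have "(Z + \<bar>V 1\<bar> + 1) * ln x <= V x" using x(1) l by (simp add: le_divide_eq)
   moreover have "\<bar>V 1\<bar> * 1 <= \<bar>V 1\<bar> * ln x" using l by (intro mult_left_mono) auto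
   ultimately show False using le[OF \<open>1 <= x\<close>] l by (simp add: algebra_simps)
  qed
  thus False by simp
 qed
 then obtain x0 where x0: "x0 > 0" "x0 * V1 x0 >= Z" by blast
 show "\<forall>\<^sub>F x in at_top. Z <= x * V1 x"
  using eventually_ge_at_top[of x0] by eventually_elim (use mono[OF x0(1)] x0(2) in fastforce)
qed

lemma moment_scaling:
 assumes "th > 0" "c > 0" and W: "continuous_on {0..} (W :: real => real)"
 shows "integral {0..c * arcv th 0} (%y. W y * arca th (y / c)) = c * integral {0..arcv th 0} (%v. W (c * v) * arca th v)"
proof -
 define X where "X = arcv th 0"
 have X: "X > 0" using arcv_pos[OF assms(1), of 0] by (simp add: X_def)
 define g where "g = (%y. W y * arca th (y / c))"
 have cg: "continuous_on {0..c * X} g" unfolding g_def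
  by (intro continuous_intros continuous_on_subset[OF W] continuous_on_compose2[OF continuous_on_arca[OF assms(1)]])
    (use assms(2) in \<open>auto simp: X_def field_simps\<close>)
 have "((%v. g (c * v + 0)) has_integral (1 / \<bar>c\<bar> ^ DIM(real)) *\<^sub>R integral {0..c * X} g) ((%y. (1 / c) *\<^sub>R y + - ((1 / c) *\<^sub>R 0)) ` cbox 0 (c * X))"
  using has_integral_affinity[of g "integral {0..c * X} g" 0 "c * X" c 0] integrable_integral[OF integrable_continuous_interval[OF cg]] assms(2) by simp
 moreover have "(%y. (1 / c) *\<^sub>R y + - ((1 / c) *\<^sub>R 0)) ` cbox 0 (c * X) = {0..X}"
 proof -
  have "(%y. (1 / c) *\<^sub>R y + - ((1 / c) *\<^sub>R 0)) = (%y. (1 / c) * y)" by (simp add: fun_eq_iff)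
  thus ?thesis unfolding box_real using assms(2) X by (simp only: image_mult_atLeastAtMost_if) simp
 qed
 ultimately have "((%v. g (c * v)) has_integral integral {0..c * X} g / c) {0..X}" using assms(2) by simp
 from integral_unique[OF this] show ?thesis using assms(2) by (simp add: g_def X_def)
qed

text \<open>The moment is strictly increasing in c, since the interval grows and the angle of y/c
  increases at every y > 0. It starts at 0 and is unbounded because k is.\<close>

lemma unique_scale:
 fixes k W :: "real => real"
 assumes th: "th > 0" and m: "m > 0"
  and k: "!!x. x >= 0 ==> (k has_real_derivative W x) (at x within {0..})" and k0: "k 0 = 0"
  and W: "continuous_on {0..} W" and Wpos: "!!x. x > 0 ==> W x > 0"
  and unbounded: "filterlim k at_top at_top"
 defines "F \<equiv> %c. integral {0..c * arcv th 0} (%y. W y * arca th (y / c))"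
 shows "\<exists>c>0. F c = m & (\<forall>c'>0. F c' = m --> c' = c)"
proof -
 define X where "X = arcv th 0"
 have X: "X > 0" using arcv_pos[OF th, of 0] by (simp add: X_def)
 have W0: "W x >= 0" if "x >= 0" for x
 proof (cases "x = 0")
  case True
  have "(W \<longlongrightarrow> W 0) (at 0 within {0..})" using W by (simp add: continuous_on)
  hence t: "(W \<longlongrightarrow> W 0) (at_right 0)" by (rule tendsto_within_subset) auto
  have "\<forall>\<^sub>F x in at_right 0. 0 <= W x" using Wpos by (auto simp: eventually_at_right_field intro!: exI[of _ 1] less_imp_le)
  thus ?thesis using tendsto_lowerbound[OF t] True by simp
 qed (use Wpos[of x] that in auto)
 define A where "A = arca th"
 have A: "continuous_on {0..X} A" using continuous_on_arca[OF th] by (simp add: A_def X_def)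
 have A0: "0 <= A v" if "0 <= v" "v <= X" for v using arca(2)[OF th, of v] that by (simp add: A_def X_def)
 \<comment> \<open>Over a fixed interval the moment is visibly continuous in c, including c = 0,
   where it vanishes.\<close>
 define G where "G = (%c. c * integral {0..X} (%v. W (c * v) * A v))"
 have FG: "F c = G c" if "c > 0" for c using moment_scaling[OF th that W] by (simp add: F_def G_def X_def A_def)
 have cF: "continuous_on {0..c * X} (%y. W y * A (y / c))" if "c > 0" for c
  by (intro continuous_intros continuous_on_subset[OF W] continuous_on_compose2[OF A]) (use that in \<open>auto simp: field_simps\<close>)
 have strict: "F c < F c'" if cc: "0 < c" "c < c'" for c c'
 proof -
  have sub: "{0..c * X} \<subseteq> {0..c' * X}" using cc X by auto
  have c2: "continuous_on {0..c * X} (%y. W y * A (y / c'))" by (rule continuous_on_subset[OF cF sub]) (use cc in simp)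
  have le: "W y * A (y / c) <= W y * A (y / c')" if y: "y \<in> {0..c * X}" for y
  proof (cases "y = 0")
   case False
   have "y / c' < y / c" using y False cc by (intro divide_strict_left_mono) auto
   moreover have "y / c <= X" using y cc by (simp add: divide_le_eq mult.commute)
   ultimately have "A (y / c) < A (y / c')" using arca_strict_antimono[OF th, of "y / c'" "y / c"] y cc by (simp add: A_def X_def)
   thus ?thesis using W0[of y] y by (intro mult_left_mono) auto
  qed simp
  have i: "(%y. W y * A (y / c)) integrable_on {0..c * X}" "(%y. W y * A (y / c')) integrable_on {0..c * X}" "(%y. W y * A (y / c')) integrable_on {0..c' * X}"
   using integrable_continuous_interval[OF cF] integrable_continuous_interval[OF c2] cc by auto
  have 1: "integral {0..c * X} (%y. W y * A (y / c)) <= integral {0..c * X} (%y. W y * A (y / c'))"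
   by (rule integral_le[OF i(1,2) le])
  have 2: "integral {0..c * X} (%y. W y * A (y / c')) <= integral {0..c' * X} (%y. W y * A (y / c'))"
  proof (rule integral_subset_le[OF sub i(2,3)], rule ballI)
   fix y assume y: "y \<in> {0..c' * X}"
   hence "0 <= A (y / c')" using cc by (intro A0) (auto simp: divide_le_eq mult.commute)
   thus "0 <= W y * A (y / c')" using W0[of y] y by simp
  qed
  \<comment> \<open>Strictness already holds on the smaller interval: the integrands are continuous
    and differ at its midpoint.\<close>
  have ne: "integral {0..c * X} (%y. W y * A (y / c)) ~= integral {0..c * X} (%y. W y * A (y / c'))"
  proof
   assume eq: "integral {0..c * X} (%y. W y * A (y / c)) = integral {0..c * X} (%y. W y * A (y / c'))"
   have "integral {0..c * X} (%y. W y * A (y / c') - W y * A (y / c)) = 0" using Henstock_Kurzweil_Integration.integral_diff[OF i(2,1)] eq by simp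
   hence z: "\<forall>y\<in>{0..c * X}. W y * A (y / c') - W y * A (y / c) = 0"
    by (subst (asm) integral_eq_0_iff) (use le cc X cF[OF cc(1)] c2 in \<open>auto intro!: continuous_intros\<close>)
   define y where "y = c * X / 2"
   have y: "0 < y" "y \<in> {0..c * X}" using cc X by (auto simp: y_def)
   have "y / c' < y / c" using y cc by (intro divide_strict_left_mono) auto
   moreover have "y / c <= X" using y cc by (simp add: divide_le_eq mult.commute)
   ultimately have "A (y / c) < A (y / c')" using arca_strict_antimono[OF th, of "y / c'" "y / c"] y cc by (simp add: A_def X_def)
   hence "W y * A (y / c) < W y * A (y / c')" using Wpos[OF y(1)] by simp
   thus False using z y(2) by fastforce
  qed
  show ?thesis unfolding F_def X_def[symmetric] A_def[symmetric] using 1 2 ne by linarith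
 qed
 \<comment> \<open>On the left half of the interval the angle is at least its value at the middle,
   and W integrates to k.\<close>
 have lower: "A (X / 2) * k (c * X / 2) <= F c" if c: "c > 0" for c
 proof -
  have sub: "{0..c * X / 2} \<subseteq> {0..c * X}" using c X by auto
  have i: "(%y. W y * A (y / c)) integrable_on {0..c * X / 2}" "(%y. W y * A (y / c)) integrable_on {0..c * X}"
   using integrable_continuous_interval[OF cF[OF c]] integrable_continuous_interval[OF continuous_on_subset[OF cF[OF c] sub]] by auto
  have "(W has_integral k (c * X / 2) - k 0) {0..c * X / 2}"
   by (rule fundamental_theorem_of_calculus)
     (use c X in \<open>auto simp: has_real_derivative_iff_has_vector_derivative[symmetric] intro!: DERIV_subset[OF k]\<close>)
  hence WI: "((%y. A (X / 2) * W y) has_integral A (X / 2) * k (c * X / 2)) {0..c * X / 2}"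
   using has_integral_mult_right[of W] k0 by auto
  have "A (X / 2) * k (c * X / 2) <= integral {0..c * X / 2} (%y. W y * A (y / c))"
  proof (rule has_integral_le[OF WI integrable_integral[OF i(1)]])
   fix y assume y: "y \<in> {0..c * X / 2}"
   hence "y / c <= X / 2" using c by (simp add: divide_le_eq mult.commute)
   have "A (X / 2) <= A (y / c)"
   proof (cases "y / c = X / 2")
    case True
    thus ?thesis by (simp only: order_refl)
   next
    case False
    with `y / c <= X / 2` have "A (X / 2) < A (y / c)" unfolding A_def
     by (intro arca_strict_antimono[OF th]) (use y c X in \<open>auto simp: X_def\<close>)
    thus ?thesis by simp
   qed
   thus "A (X / 2) * W y <= W y * A (y / c)" using W0[of y] y by (simp add: mult.commute mult_left_mono)
  qed
  also have "... <= F c" unfolding F_def X_def[symmetric] A_def[symmetric]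
  proof (rule integral_subset_le[OF sub i], rule ballI)
   fix y assume y: "y \<in> {0..c * X}"
   hence "0 <= A (y / c)" using c by (intro A0) (auto simp: divide_le_eq mult.commute)
   thus "0 <= W y * A (y / c)" using W0[of y] y by simp
  qed
  finally show ?thesis .
 qed
 have AX: "A (X / 2) > 0" using arca_interior(1)[OF th, of "X / 2"] X by (simp add: A_def X_def)
 have "\<forall>\<^sub>F x in at_top. k x >= m / A (X / 2)" using unbounded by (auto simp: filterlim_at_top)
 then obtain x1 where x1: "!!x. x >= x1 ==> k x >= m / A (X / 2)" unfolding eventually_at_top_linorder by blast
 define C where "C = 2 * (\<bar>x1\<bar> + 1) / X"
 have C: "C > 0" using X by (simp add: C_def)
 have "k (C * X / 2) >= m / A (X / 2)" using X by (intro x1) (simp add: C_def)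
 hence "A (X / 2) * k (C * X / 2) >= m" using AX by (simp add: divide_le_eq mult.commute)
 hence GC: "G C >= m" using lower[OF C] FG[OF C] by linarith
 have "continuous_on {0..C} (%c. integral (cbox 0 X) (%v. W (c * v) * A v))"
 proof (rule integral_continuous_on_param)
  have a: "continuous_on ({0..C} \<times> cbox 0 X) (%z. W (fst z * snd z))"
   by (rule continuous_on_compose2[OF W]) (auto intro!: continuous_intros)
  have b: "continuous_on ({0..C} \<times> cbox 0 X) (%z. A (snd z))"
   by (rule continuous_on_compose2[OF A]) (auto intro!: continuous_intros)
  show "continuous_on ({0..C} \<times> cbox 0 X) (%(c, v). W (c * v) * A v)"
   using continuous_on_mult[OF a b] by (simp add: case_prod_beta')
 qed
 hence cG: "continuous_on {0..C} G" unfolding G_def by (intro continuous_intros) simp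
 have "\<exists>c\<ge>0. c <= C & G c = m" by (rule IVT') (use cG GC m C in \<open>auto simp: G_def\<close>)
 then obtain c where c: "c >= 0" "G c = m" by blast
 hence c0: "c > 0" using m by (cases "c = 0") (auto simp: G_def)
 have "\<forall>c'>0. F c' = m --> c' = c"
 proof (intro allI impI)
  fix c' assume "c' > 0" "F c' = m"
  thus "c' = c" using strict[of c c'] strict[of c' c] FG[OF c0] c c0 by (cases c c' rule: linorder_cases) auto
 qed
 moreover have "F c = m" using FG[OF c0] c(2) by (simp only:)
 ultimately show ?thesis using c0 by blast
qed

subsection \<open>The density\<close>

text \<open>The bound is uniform in x; the factor 2 counts the two sides of the singularity.\<close>

lemma integral_abs_powr_le:
 fixes x b e :: real assumes e: "-1 < e" "e <= 0" and b: "b > 0" and x: "x >= 0"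
 defines "f \<equiv> %u. indicator {0<..<b} u * \<bar>x - u\<bar> powr e"
 shows "integrable lborel f" "(\<integral>u. f u \<partial>lborel) <= 2 * b powr (e + 1) / (e + 1)"
proof -
 define B where "B = 2 * b powr (e + 1) / (e + 1)"
 have B: "B >= 0" using e by (simp add: B_def)
 have [measurable]: "f \<in> borel_measurable borel" unfolding f_def by measurable
 have inner: "(\<integral>\<^sup>+u. ennreal (indicator {0<..<b} u * \<bar>x - u\<bar> powr e) \<partial>lborel) <= ennreal B"
  if x: "0 <= x" "x <= b" for x
 proof -
  have "(\<integral>\<^sup>+u. ennreal (indicator {0<..<b} u * \<bar>x - u\<bar> powr e) \<partial>lborel) <= (\<integral>\<^sup>+u. ennreal (indicator {0..b} u * \<bar>u - x\<bar> powr e) \<partial>lborel)"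
   by (rule nn_integral_mono) (auto simp: indicator_def abs_minus_commute)
  also have "... = ennreal ((max 0 (b - x) powr (e+1) - max 0 (x - b) powr (e+1)) / (e+1) - (max 0 (0 - x) powr (e+1) - max 0 (x - 0) powr (e+1)) / (e+1))"
   by (rule nn_integral_has_integral_lebesgue[OF _ abs_powr_has_integral[OF e(1) less_imp_le[OF b]]]) (use b in auto)
  also have "... <= ennreal B"
  proof (rule ennreal_leI)
   have "(b - x) powr (e+1) <= b powr (e+1)" "x powr (e+1) <= b powr (e+1)" using x e by (auto intro!: powr_mono2)
   hence "((b - x) powr (e+1) + x powr (e+1)) / (e+1) <= 2 * b powr (e + 1) / (e + 1)" using e by (intro divide_right_mono) auto
   moreover have "max 0 (b - x) = b - x" "max 0 (x - b) = 0" "max 0 (0 - x) = 0" "max 0 (x - 0) = x" using x by auto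
   ultimately show "(max 0 (b - x) powr (e+1) - max 0 (x - b) powr (e+1)) / (e+1) - (max 0 (0 - x) powr (e+1) - max 0 (x - 0) powr (e+1)) / (e+1) <= B"
    using e by (simp add: B_def add_divide_distrib)
  qed
  finally show ?thesis .
 qed
 have nn: "(\<integral>\<^sup>+u. ennreal (f u) \<partial>lborel) <= ennreal B"
 proof (cases "x <= b")
  case True
  show ?thesis unfolding f_def by (rule inner[OF x True])
 next
  case False
  \<comment> \<open>For x beyond b, moving the singularity to b only increases the integrand, as the
    exponent is not positive.\<close>
  have "f u <= indicator {0<..<b} u * \<bar>b - u\<bar> powr e" for u
  proof (cases "u \<in> {0<..<b}")
   case True
   hence "\<bar>x - u\<bar> powr e <= \<bar>b - u\<bar> powr e" using False e by (intro powr_mono2') auto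
   thus ?thesis using True by (simp add: f_def)
  qed (simp add: f_def)
  hence "(\<integral>\<^sup>+u. ennreal (f u) \<partial>lborel) <= (\<integral>\<^sup>+u. ennreal (indicator {0<..<b} u * \<bar>b - u\<bar> powr e) \<partial>lborel)"
   by (intro nn_integral_mono ennreal_leI)
  also have "... <= ennreal B" by (rule inner) (use b in auto)
  finally show ?thesis .
 qed
 have f0: "f u >= 0" for u by (simp add: f_def)
 show i: "integrable lborel f"
  by (rule integrableI_nonneg) (use f0 nn in \<open>auto intro: le_less_trans\<close>)
 have "ennreal (\<integral>u. f u \<partial>lborel) <= ennreal B" using nn nn_integral_eq_integral[OF i] f0 by simp
 thus "(\<integral>u. f u \<partial>lborel) <= 2 * b powr (e + 1) / (e + 1)" using B by (simp add: B_def)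
qed

text \<open>Splitting according to whether \<open>u\<close> or \<open>\<bar>x - u\<bar>\<close> is smaller gives a bound uniform in \<open>x\<close>.\<close>
lemma log_singularity_bound:
 fixes kp b x :: real assumes k: "0 < kp" "kp < 1" and b: "b > 0" and x: "x >= 0" and u: "0 < u" "u < b"
 shows "u powr (kp - 1) * \<bar>ln \<bar>x - u\<bar>\<bar> <= (ln (1 + x) + ln (1 + b)) * u powr (kp - 1)
  + (4/kp) * (u powr (kp/2 - 1) + \<bar>x - u\<bar> powr (kp/2 - 1))"
  "\<bar>ln \<bar>x - u\<bar>\<bar> <= ln (1 + x) + ln (1 + b) + (4/kp) * \<bar>x - u\<bar> powr (-kp/2)"
proof -
 define d where "d = \<bar>x - u\<bar>"
 have l0: "0 <= ln (1 + x)" "0 <= ln (1 + b)" using x b by auto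
 show 1: "\<bar>ln \<bar>x - u\<bar>\<bar> <= ln (1 + x) + ln (1 + b) + (4/kp) * \<bar>x - u\<bar> powr (-kp/2)"
 proof (cases "d = 0")
  case True
  thus ?thesis using l0 by (simp add: d_def)
 next
  case False
  hence d: "d > 0" by (simp add: d_def)
  have "d <= (1 + x) * (1 + b)"
  proof -
   have "d <= x + b" using x u by (auto simp: d_def)
   also have "... <= (1 + x) * (1 + b)" using mult_nonneg_nonneg[OF x less_imp_le[OF b]] by (simp add: algebra_simps)
   finally show ?thesis .
  qed
  hence "ln d <= ln ((1 + x) * (1 + b))" using d by (intro ln_mono) auto
  also have "... = ln (1 + x) + ln (1 + b)" using x b by (intro ln_mult_pos) auto
  finally have up: "ln d <= ln (1 + x) + ln (1 + b)" .
  have "ln (d powr (-kp/2)) <= d powr (-kp/2)" using d by (intro ln_bound) auto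
  hence "- ln d * (kp/2) <= d powr (-kp/2)" using d by (simp add: ln_powr mult.commute)
  hence "- ln d <= (2/kp) * d powr (-kp/2)" using k by (simp add: field_simps)
  also have "... <= (4/kp) * d powr (-kp/2)" using k by (intro mult_right_mono divide_right_mono) auto
  finally have lo: "- ln d <= (4/kp) * d powr (-kp/2)" .
  have "0 <= (4/kp) * d powr (-kp/2)" using k by simp
  hence "\<bar>ln d\<bar> <= ln (1 + x) + ln (1 + b) + (4/kp) * d powr (-kp/2)" using up lo l0 by (simp only: abs_le_iff) linarith
  thus ?thesis by (simp only: d_def)
 qed
 have prod: "u powr (kp - 1) * d powr (-kp/2) <= u powr (kp/2 - 1) + d powr (kp/2 - 1)"
 proof (cases "u <= d")
  case True
  have "d powr (-kp/2) <= u powr (-kp/2)" using True u k by (intro powr_mono2') auto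
  hence "u powr (kp - 1) * d powr (-kp/2) <= u powr (kp - 1) * u powr (-kp/2)" by (intro mult_left_mono) auto
  also have "... = u powr (kp/2 - 1)" by (simp add: powr_add[symmetric] field_simps)
  finally show ?thesis by (simp add: add_increasing2)
 next
  case False
  show ?thesis
  proof (cases "d = 0")
   case False
   hence d: "0 < d" "d <= u" using `~ u <= d` by (auto simp: d_def)
   have "u powr (kp - 1) <= d powr (kp - 1)" using d k by (intro powr_mono2') auto
   hence "u powr (kp - 1) * d powr (-kp/2) <= d powr (kp - 1) * d powr (-kp/2)" by (intro mult_right_mono) auto
   also have "... = d powr (kp/2 - 1)" by (simp add: powr_add[symmetric] field_simps)
   finally show ?thesis by (simp add: add_increasing)
  qed simp
 qed
 have "u powr (kp - 1) * \<bar>ln \<bar>x - u\<bar>\<bar> <= u powr (kp - 1) * (ln (1 + x) + ln (1 + b) + (4/kp) * d powr (-kp/2))"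
  using 1 by (intro mult_left_mono) (auto simp: d_def)
 also have "... = (ln (1 + x) + ln (1 + b)) * u powr (kp - 1) + (4/kp) * (u powr (kp - 1) * d powr (-kp/2))"
  by (simp add: algebra_simps)
 also have "... <= (ln (1 + x) + ln (1 + b)) * u powr (kp - 1) + (4/kp) * (u powr (kp/2 - 1) + d powr (kp/2 - 1))"
  using prod k by (intro add_left_mono mult_left_mono) auto
 finally show "u powr (kp - 1) * \<bar>ln \<bar>x - u\<bar>\<bar> <= (ln (1 + x) + ln (1 + b)) * u powr (kp - 1)
  + (4/kp) * (u powr (kp/2 - 1) + \<bar>x - u\<bar> powr (kp/2 - 1))" by (simp only: d_def)
qed

lemma integrable_log_singularity:
 fixes kp b x :: real assumes k: "0 < kp" "kp < 1" and b: "b > 0" and x: "x >= 0"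
 shows "integrable lborel (%u. indicator {0<..<b} u * u powr (kp - 1) * \<bar>ln \<bar>x - u\<bar>\<bar>)"
proof -
 have 1: "integrable lborel (%u. indicator {0<..<b} u * \<bar>0 - u\<bar> powr (kp - 1))" by (rule integral_abs_powr_le(1)) (use k b in auto)
 have 2: "integrable lborel (%u. indicator {0<..<b} u * \<bar>0 - u\<bar> powr (kp/2 - 1))" by (rule integral_abs_powr_le(1)) (use k b in auto)
 have 3: "integrable lborel (%u. indicator {0<..<b} u * \<bar>x - u\<bar> powr (kp/2 - 1))" by (rule integral_abs_powr_le(1)) (use k b x in auto)
 show ?thesis
 proof (rule Bochner_Integration.integrable_bound)
  show "integrable lborel (%u. (ln (1 + x) + ln (1 + b)) * (indicator {0<..<b} u * \<bar>0 - u\<bar> powr (kp - 1))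
   + (4/kp) * (indicator {0<..<b} u * \<bar>0 - u\<bar> powr (kp/2 - 1) + indicator {0<..<b} u * \<bar>x - u\<bar> powr (kp/2 - 1)))"
   using 1 2 3 by (intro Bochner_Integration.integrable_add integrable_mult_right) auto
  show "(%u. indicator {0<..<b} u * u powr (kp - 1) * \<bar>ln \<bar>x - u\<bar>\<bar>) \<in> borel_measurable lborel" by measurable
  show "AE u in lborel. norm (indicator {0<..<b} u * u powr (kp - 1) * \<bar>ln \<bar>x - u\<bar>\<bar>) <=
   norm ((ln (1 + x) + ln (1 + b)) * (indicator {0<..<b} u * \<bar>0 - u\<bar> powr (kp - 1))
   + (4/kp) * (indicator {0<..<b} u * \<bar>0 - u\<bar> powr (kp/2 - 1) + indicator {0<..<b} u * \<bar>x - u\<bar> powr (kp/2 - 1)))"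
  proof (rule AE_I2)
   fix u :: real
   show "norm (indicator {0<..<b} u * u powr (kp - 1) * \<bar>ln \<bar>x - u\<bar>\<bar>) <=
   norm ((ln (1 + x) + ln (1 + b)) * (indicator {0<..<b} u * \<bar>0 - u\<bar> powr (kp - 1))
   + (4/kp) * (indicator {0<..<b} u * \<bar>0 - u\<bar> powr (kp/2 - 1) + indicator {0<..<b} u * \<bar>x - u\<bar> powr (kp/2 - 1)))"
   proof (cases "u \<in> {0<..<b}")
    case True
    hence u: "0 < u" "u < b" by auto
    have "norm (indicator {0<..<b} u * u powr (kp - 1) * \<bar>ln \<bar>x - u\<bar>\<bar>) = u powr (kp - 1) * \<bar>ln \<bar>x - u\<bar>\<bar>"
     using True by (simp add: abs_mult)
    also note log_singularity_bound(1)[OF k b x u]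
    finally show ?thesis using True u by (simp add: abs_of_pos)
   qed simp
  qed
 qed
qed

section \<open>Bounds for the Green function in terms of the value on the support\<close>

lemma arc_speed_bounded:
 assumes th: "th > 0" obtains L where "L > 0" "!!ph. 0 < ph ==> ph < pi ==> arcv th ph * arc_rate th ph <= L"
proof -
 obtain C where C: "C > 0" "!!ph. 0 < ph ==> ph < pi ==> \<bar>arc_logder th ph\<bar> <= C" using arc_logder_bounded[OF th] by blast
 obtain m where m: "m > 0" "!!ph. 0 <= ph ==> ph <= pi ==> m <= arcr th ph" using arcr_lower[OF th] by blast
 have "compact (arc_shift th ` {0..pi})" by (intro compact_continuous_image continuous_on_arc_shift[OF th]) auto
 then obtain M where "\<forall>ph\<in>{0..pi}. \<bar>arc_shift th ph\<bar> <= M" using compact_imp_bounded[of "arc_shift th ` {0..pi}"] unfolding bounded_iff by auto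
 hence M: "!!ph. ph \<in> {0..pi} ==> \<bar>arc_shift th ph\<bar> <= M" by blast
 have M0: "M >= 0" using M[of 0] by simp
 define Q where "Q = (M / m) powr (1/th)"
 define L where "L = (C + 1) * ((M + (1 + 1/th)) * Q) + 1"
 have "arcv th ph * arc_rate th ph <= L" if hp: "0 < ph" "ph < pi" for ph
 proof -
  define R where "R = arc_shift th ph"
  define q where "q = (R / arcr th ph) powr (1/th)"
  have R: "R > 0" "R <= M" using arc_shift_pos[of th ph] M[of ph] th hp by (auto simp: R_def)
  have r: "m <= arcr th ph" using m(2) hp by simp
  have "R / arcr th ph <= M / m" using R r m by (intro frac_le) auto
  hence q: "0 <= q" "q <= Q" unfolding q_def Q_def using R r m th by (auto intro!: powr_mono2)
  have nR: "norm (arcp th ph + 1) = R" using arc_shift_eq_norm[of th ph] th hp by (simp add: R_def)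
  have "arc_rate th ph <= norm (J_log_rate th (arcp th ph) * arc_log_deriv th ph)"
   unfolding J_log_rate_arc[OF th hp] norm_minus_cancel norm_of_real by simp
  also have "... = norm (J_log_rate th (arcp th ph)) * norm (arc_log_deriv th ph)" by (rule norm_mult)
  also have "... <= (1 + (1 + 1/th) / R) * (C + 1)"
  proof (rule mult_mono)
   have "norm (J_log_rate th (arcp th ph)) <= norm (1::complex) + norm (of_real (1 + 1/th) / (arcp th ph + 1))"
    unfolding J_log_rate_def by (rule norm_triangle_ineq4)
   also have "... = 1 + (1 + 1/th) / R" using th by (simp only: norm_divide nR norm_of_real norm_one) simp
   finally show "norm (J_log_rate th (arcp th ph)) <= 1 + (1 + 1/th) / R" .
   have "norm (arc_log_deriv th ph) <= norm (complex_of_real (arc_logder th ph)) + norm \<i>" by (rule norm_triangle_ineq)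
   also have "... <= C + 1" using C(2)[OF hp] by simp
   finally show "norm (arc_log_deriv th ph) <= C + 1" .
  qed (use R th in auto)
  finally have D: "arc_rate th ph <= (1 + (1 + 1/th) / R) * (C + 1)" .
  have X: "arcv th ph = R * q" by (simp add: arcv_def R_def q_def)
  have "arcv th ph * arc_rate th ph <= (R * q) * ((1 + (1 + 1/th) / R) * (C + 1))"
   unfolding X using D R q by (intro mult_left_mono) auto
  \<comment> \<open>The factor R = |s + 1| of X cancels the pole of \<open>J_log_rate\<close> at
    -1.\<close>
  also have "... = (C + 1) * ((R + (1 + 1/th)) * q)" using R(1) by (simp add: field_simps)
  also have "... <= (C + 1) * ((M + (1 + 1/th)) * Q)" using C R q th M0 by (intro mult_left_mono mult_mono add_right_mono) auto
  finally show ?thesis by (simp add: L_def)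
 qed
 moreover have "L > 0" using C M0 th by (simp add: L_def Q_def add_nonneg_pos)
 ultimately show ?thesis using that by blast
qed

text \<open>Turns a singularity in the difference of angles into one in the difference of values:
  the angular distance is at least a multiple of the distance of the values.\<close>

lemma arcv_lipschitz:
 assumes th: "th > 0" obtains L where "L > 0"
  "!!ph p. ph \<in> {0..pi} ==> p \<in> {0..pi} ==> \<bar>arcv th ph - arcv th p\<bar> <= L * \<bar>ph - p\<bar>"
proof -
 obtain L where L: "L > 0" "!!ph. 0 < ph ==> ph < pi ==> arcv th ph * arc_rate th ph <= L" using arc_speed_bounded[OF th] by blast
 have *: "\<bar>arcv th q - arcv th p\<bar> <= L * (q - p)" if pq: "0 <= p" "p < q" "q <= pi" for p q
 proof -
  have d: "(arcv th has_real_derivative - (arcv th z * arc_rate th z)) (at z)" if "p < z" "z < q" for z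
   by (rule arcv_deriv[OF th]) (use that pq in auto)
  obtain l z where z: "p < z" "z < q" "(arcv th has_real_derivative l) (at z)" "arcv th q - arcv th p = (q - p) * l"
   using MVT[OF pq(2) continuous_on_subset[OF continuous_on_arcv[OF th]]] d pq by (auto simp: real_differentiable_def)
  have l: "l = - (arcv th z * arc_rate th z)" by (rule DERIV_unique[OF z(3) d[OF z(1,2)]])
  have zr: "0 < z" "z < pi" using z pq by auto
  have "0 <= arcv th z * arc_rate th z" using arcv_pos[OF th, of z] arc_rate_pos[OF th zr] zr by simp
  hence "\<bar>l\<bar> <= L" using L(2)[OF zr] l by simp
  hence "(q - p) * \<bar>l\<bar> <= (q - p) * L" using pq by (intro mult_left_mono) auto
  thus ?thesis unfolding z(4) abs_mult using pq by (simp add: mult.commute)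
 qed
 show ?thesis
 proof (rule that[OF L(1)])
  fix ph p assume "ph \<in> {0..pi}" "p \<in> {0..pi}"
  thus "\<bar>arcv th ph - arcv th p\<bar> <= L * \<bar>ph - p\<bar>"
   using *[of p ph] *[of ph p] by (cases ph p rule: linorder_cases) (auto simp: abs_minus_commute)
 qed
qed

text \<open>sin ph <= |s + 1|, and X is |s + 1|^(1 + 1/th) divided by |s|^(1/th); solving for |s +
  1| gives the exponent th/(1 + th). So the Green function decays at the end 0 of the
  support.\<close>

lemma sin_arca_bound:
 assumes th: "th > 0" obtains K where "K > 0"
  "!!ph. 0 < ph ==> ph < pi ==> sin ph <= K * arcv th ph powr (th / (1 + th))"
proof -
 have "compact (arcr th ` {0..pi})" by (intro compact_continuous_image continuous_on_arcr[OF th]) auto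
 then obtain M where "\<forall>ph\<in>{0..pi}. \<bar>arcr th ph\<bar> <= M" using compact_imp_bounded[of "arcr th ` {0..pi}"] unfolding bounded_iff by auto
 hence M: "!!ph. ph \<in> {0..pi} ==> \<bar>arcr th ph\<bar> <= M" by blast
 have M0: "M > 0" using M[of 0] arcr_pos[OF th, of 0] by simp
 define K where "K = (M powr (1/th)) powr (th / (1 + th))"
 have "sin ph <= K * arcv th ph powr (th / (1 + th))" if hp: "0 < ph" "ph < pi" for ph
 proof -
  define S where "S = sin ph"
  define R where "R = arc_shift th ph"
  define r where "r = arcr th ph"
  have S: "S > 0" using hp by (simp add: S_def sin_gt_zero)
  note an = arcas[OF th hp(1) less_imp_le[OF hp(2)]]
  have "S * sin (th * ph / (1 + th)) <= S" using S by (simp add: mult_le_cancel_left1)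
  hence RS: "S <= R" using an(6) hp by (simp add: R_def S_def arc_shift_def le_divide_eq)
  have r: "0 < r" "r <= M" using arcr_pos[OF th, of ph] M[of ph] hp by (auto simp: r_def)
  have "S powr (1 + 1/th) = S * (S powr (1/th))" using S by (simp add: powr_add)
  also have "... <= R * (R powr (1/th))" using RS S th by (intro mult_mono powr_mono2) auto
  also have "... = arcv th ph * r powr (1/th)" using r RS S by (simp add: arcv_def R_def[symmetric] r_def[symmetric] powr_divide)
  also have "... <= arcv th ph * M powr (1/th)" using r th arcv_pos[OF th, of ph] hp by (intro mult_left_mono powr_mono2) auto
  finally have "(S powr (1 + 1/th)) powr (th / (1 + th)) <= (arcv th ph * M powr (1/th)) powr (th / (1 + th))"
   using th by (intro powr_mono2) auto
  moreover have "(S powr (1 + 1/th)) powr (th / (1 + th)) = S"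
  proof -
   have "1 + 1/th = (1 + th) / th" using th by (simp add: field_simps)
   hence e: "(1 + 1/th) * (th / (1 + th)) = 1" using th by simp
   show ?thesis unfolding powr_powr e using S by simp
  qed
  ultimately have "S <= (arcv th ph * M powr (1/th)) powr (th / (1 + th))" by (simp only:)
  also have "... = K * arcv th ph powr (th / (1 + th))" using arcv_pos[OF th, of ph] hp by (simp add: K_def powr_mult)
  finally show ?thesis by (simp add: S_def)
 qed
 moreover have "K > 0" using M0 by (simp add: K_def)
 ultimately show ?thesis using that by blast
qed

text \<open>With w = q^4, 1 + q^4 <= (1 + q)^4 reduces the claim to ln (1 + q) <= q.\<close>

lemma ln_one_plus_le_root:
 fixes w :: real assumes "w >= 0" shows "ln (1 + w) <= 4 * w powr (1/4)"
proof -
 define q where "q = w powr (1/4)"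
 have q0: "q >= 0" by (simp add: q_def)
 have "q ^ 4 = q powr 4" using q0 by simp
 also have "... = w powr (1/4 * 4)" unfolding q_def powr_powr ..
 also have "... = w" using assms by simp
 finally have q: "q >= 0" "q ^ 4 = w" using q0 by simp_all
 have "1 + q ^ 4 <= (1 + q) ^ 4" using q(1) by (simp add: power4_eq_xxxx algebra_simps)
 hence "ln (1 + w) <= ln ((1 + q) ^ 4)" using q assms by (intro ln_mono) auto
 also have "... = 4 * ln (1 + q)" using q(1) by (simp add: ln_realpow)
 also have "... <= 4 * q" using ln_add_one_self_le_self[OF q(1)] by simp
 finally show ?thesis by (simp add: q_def)
qed

text \<open>The fourth root trades the logarithm for an integrable singularity -1/2 in the angles
  while keeping a positive power of sin ph, which is needed against the factor 1/u of the
  density.\<close>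

lemma arc_green_bounds:
 assumes th: "th > 0" and p: "0 < p" "p < pi" and hp: "0 < ph" "ph < pi" "ph ~= p"
 shows "0 < arc_green th p ph" "arc_green th p ph <= 4 * (sin ph powr (1/4) * \<bar>ph - p\<bar> powr (-1/2))"
  "arc_green th p ph = arc_green th ph p"
proof -
 define s a where "s = arcp th ph" and "a = arcp th p"
 have e: "arc_green th p ph = ln (norm (s - cnj a) / norm (s - a))"
  using arc_green_eq[OF th p, of ph] hp by (simp add: s_def a_def)
 have e2: "arc_green th ph p = ln (norm (a - cnj s) / norm (a - s))"
  using arc_green_eq[OF th hp(1,2), of p] hp(3) p by (simp add: s_def a_def)
 have "norm (a - cnj s) = norm (cnj (a - cnj s))" by (rule complex_mod_cnj[symmetric])
 also have "... = norm (s - cnj a)" by (simp add: norm_minus_commute)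
 finally show "arc_green th p ph = arc_green th ph p" unfolding e e2 by (simp add: norm_minus_commute)
 have Im: "Im s > 0" "Im a > 0" using Im_arcp_pos[OF th] p hp by (auto simp: s_def a_def)
 have ne: "s ~= a" using arcp_ne(1)[OF th p, of ph] hp by (simp add: s_def a_def)
 have "(norm (s - cnj a))\<^sup>2 - (norm (s - a))\<^sup>2 = 4 * Im s * Im a" unfolding cmod_power2 by (simp add: power2_eq_square algebra_simps)
 hence "(norm (s - a))\<^sup>2 < (norm (s - cnj a))\<^sup>2" using Im by (metis diff_gt_0_iff_gt mult_pos_pos zero_less_numeral)
 hence "norm (s - a) < norm (s - cnj a)" by (rule power2_less_imp_less) simp
 hence "1 < norm (s - cnj a) / norm (s - a)" using ne by simp
 thus "0 < arc_green th p ph" unfolding e by simp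
 define z where "z = sin ph * sin p / (ph - p)\<^sup>2"
 have sp: "0 < sin ph" "0 < sin p" "sin p <= 1" using p hp by (auto intro: sin_gt_zero)
 have z: "z >= 0" using sp by (simp add: z_def)
 have "arc_green th p ph <= ln (1 + 16 * sin ph * sin p / (ph - p)\<^sup>2) / 2"
  using Re_extlog_bounds(2)[OF th p arcr_pos[OF th, of ph], of ph] hp unfolding arc_green_def arcp_def by simp
 also have "16 * sin ph * sin p / (ph - p)\<^sup>2 = 16 * z" by (simp add: z_def)
 also have "ln (1 + 16 * z) / 2 <= 2 * (16 * z) powr (1/4)" using ln_one_plus_le_root[of "16 * z"] z by simp
 also have "(16 * z) powr (1/4) = 2 * z powr (1/4)"
 proof -
  have "(16::real) powr (1/4) = (2 powr 4) powr (1/4)" by simp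
  also have "... = 2" by (simp only: powr_powr) simp
  finally show ?thesis using z by (simp add: powr_mult)
 qed
 also have "2 * (2 * z powr (1/4)) = 4 * z powr (1/4)" by simp
 also have "z powr (1/4) = (sin ph) powr (1/4) * (sin p) powr (1/4) * \<bar>ph - p\<bar> powr (-1/2)"
 proof -
  have "(ph - p)\<^sup>2 = \<bar>ph - p\<bar> powr 2" using hp(3) by (simp add: powr_numeral)
  hence "((ph - p)\<^sup>2) powr (1/4) = (\<bar>ph - p\<bar> powr 2) powr (1/4)" by (simp only:)
  also have "... = \<bar>ph - p\<bar> powr (1/2)" unfolding powr_powr by simp
  finally have h: "((ph - p)\<^sup>2) powr (1/4) = \<bar>ph - p\<bar> powr (1/2)" .
  have m: "\<bar>ph - p\<bar> powr (-1/2) = 1 / \<bar>ph - p\<bar> powr (1/2)" using powr_minus_divide[of "\<bar>ph - p\<bar>" "1/2"] by simp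
  have "z powr (1/4) = (sin ph * sin p) powr (1/4) / ((ph - p)\<^sup>2) powr (1/4)" unfolding z_def by (rule powr_divide)
  also have "(sin ph * sin p) powr (1/4) = sin ph powr (1/4) * sin p powr (1/4)" by (rule powr_mult)
  finally show ?thesis unfolding h m by simp
 qed
 also have "4 * ... <= 4 * (sin ph powr (1/4) * \<bar>ph - p\<bar> powr (-1/2))"
 proof -
  have "sin p powr (1/4) <= 1 powr (1/4)" using sp by (intro powr_mono2) auto
  hence "sin ph powr (1/4) * sin p powr (1/4) <= sin ph powr (1/4) * 1" by (intro mult_left_mono) auto
  hence "sin ph powr (1/4) * sin p powr (1/4) * \<bar>ph - p\<bar> powr (-1/2) <= sin ph powr (1/4) * 1 * \<bar>ph - p\<bar> powr (-1/2)" by (intro mult_right_mono) auto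
  thus ?thesis by simp
 qed
 finally show "arc_green th p ph <= 4 * (sin ph powr (1/4) * \<bar>ph - p\<bar> powr (-1/2))" .
qed

section \<open>The density as an integral of Green functions\<close>

locale arc_density =
 fixes th c :: real and W :: "real => real"
 assumes theta: "th > 0" and c: "c > 0" and W_cont: "continuous_on {0..} W" and W_pos: "!!x. x > 0 ==> W x > 0"
begin

definition b :: real where "b = c * arcv th 0"

text \<open>Clipping to the range of X makes the angle continuous on the whole line, which gives
  measurability of everything built from it.\<close>

definition ang :: "real => real" where "ang y = arca th (max 0 (min (arcv th 0) (y / c)))"

definition pt :: "real => complex" where "pt y = arcp th (ang y)"

definition green :: "real => real => real" where
 "green y u = ln (cmod ((pt y - cnj (pt u)) / (pt y - pt u)))"

text \<open>Truncated to the open square and with W clipped at 0, the integrand of the density is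
  measurable and nonnegative on the whole plane, ready for Fubini over
  \<open>lborel\<close>.\<close>

definition kern :: "real => real => real" where
 "kern u y = indicator {0<..<b} u * indicator {0<..<b} y * (W (max 0 y) * green y u / (2 * pi\<^sup>2 * u))"

definition dens :: "real => real" where "dens u = (\<integral>y. kern u y \<partial>lborel)"

text \<open>One quarter, from the root bound of the Green function, times the exponent th/(1 + th)
  of \<open>sin_arca_bound\<close>. The density is O(u^(kappa - 1)) at 0.\<close>

definition kappa :: real where "kappa = th / (4 * (1 + th))"

lemma kappa: "0 < kappa" "kappa < 1" using theta by (auto simp: kappa_def divide_less_eq)

lemma b_pos: "b > 0" using c arcv_pos[OF theta, of 0] by (simp add: b_def)

lemma clip_range: "0 <= max 0 (min (arcv th 0) (y / c))" "max 0 (min (arcv th 0) (y / c)) <= arcv th 0"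
 using arcv_pos[OF theta, of 0] by auto

lemma ang_range: "0 <= ang y" "ang y <= pi" using arca(2,3)[OF theta clip_range] by (auto simp: ang_def)

lemma continuous_ang: "continuous_on UNIV ang" unfolding ang_def
 by (rule continuous_on_compose2[OF continuous_on_arca[OF theta]]) (use clip_range c in \<open>auto intro!: continuous_intros\<close>)

lemma continuous_pt: "continuous_on UNIV pt" unfolding pt_def
 by (rule continuous_on_compose2[OF continuous_on_arcp[OF theta] continuous_ang]) (use ang_range in auto)

lemma pt_measurable[measurable]: "pt \<in> borel_measurable borel"
 by (rule borel_measurable_continuous_onI[OF continuous_pt])

lemma ang_measurable[measurable]: "ang \<in> borel_measurable borel"
 by (rule borel_measurable_continuous_onI[OF continuous_ang])

lemma W_measurable[measurable]: "(%y. W (max 0 y)) \<in> borel_measurable borel"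
 by (intro borel_measurable_continuous_onI continuous_on_compose2[OF W_cont] continuous_intros) auto

lemma green_measurable[measurable]: "(%z. green (snd z) (fst z)) \<in> borel_measurable (borel \<Otimes>\<^sub>M borel)"
proof -
 have c: "cnj \<in> borel_measurable borel" by (intro borel_measurable_continuous_onI continuous_intros)
 have [measurable]: "(%z :: real \<times> real. pt (fst z)) \<in> borel_measurable (borel \<Otimes>\<^sub>M borel)"
  "(%z :: real \<times> real. pt (snd z)) \<in> borel_measurable (borel \<Otimes>\<^sub>M borel)"
  by (rule measurable_compose[OF measurable_fst pt_measurable], rule measurable_compose[OF measurable_snd pt_measurable])
 have [measurable]: "(%z :: real \<times> real. cnj (pt (fst z))) \<in> borel_measurable (borel \<Otimes>\<^sub>M borel)"
  by (rule measurable_compose[OF _ c]) measurable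
 have "(%z :: real \<times> real. pt (snd z) - cnj (pt (fst z))) \<in> borel_measurable (borel \<Otimes>\<^sub>M borel)"
  "(%z :: real \<times> real. pt (snd z) - pt (fst z)) \<in> borel_measurable (borel \<Otimes>\<^sub>M borel)"
  by (intro borel_measurable_diff; measurable)+
 thus ?thesis unfolding green_def norm_divide by measurable
qed

lemma kern_measurable[measurable]: "(%z. kern (fst z) (snd z)) \<in> borel_measurable (borel \<Otimes>\<^sub>M borel)"
 unfolding kern_def by measurable

lemma ang_eq:
 assumes "0 <= y" "y <= b" shows "ang y = arca th (y / c)" "c * arcv th (ang y) = y"
proof -
 have "0 <= y / c" "y / c <= arcv th 0" using assms c by (simp_all add: b_def divide_le_eq mult.commute)
 thus 1: "ang y = arca th (y / c)" by (simp add: ang_def)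
 show "c * arcv th (ang y) = y" unfolding 1 using arca(1)[OF theta] \<open>0 <= y / c\<close> \<open>y / c <= _\<close> c by simp
qed

lemma ang_interior:
 assumes "0 < y" "y < b" shows "0 < ang y" "ang y < pi"
proof -
 have "0 < y / c" "y / c < arcv th 0" using assms c by (simp_all add: b_def divide_less_eq mult.commute)
 thus "0 < ang y" "ang y < pi" using arca_interior[OF theta] ang_eq(1)[of y] assms by auto
qed

lemma ang_of_value:
 assumes "0 <= ph" "ph <= pi" shows "ang (c * arcv th ph) = ph" "0 <= c * arcv th ph" "c * arcv th ph <= b"
proof -
 have v: "arcv th ph \<in> {0..arcv th 0}" by (rule arcv_le_end[OF theta assms])
 show "0 <= c * arcv th ph" "c * arcv th ph <= b" using v c by (auto simp: b_def)
 thus "ang (c * arcv th ph) = ph" using ang_eq(1) arca_of_value[OF theta assms] c by simp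
qed

lemma green_eq:
 assumes "0 < y" "y < b" "0 < u" "u < b" "y ~= u"
 shows "green y u = arc_green th (ang u) (ang y)" "ang y ~= ang u" "green y u = arc_green th (ang y) (ang u)"
proof -
 note iy = ang_interior[OF assms(1,2)] and iu = ang_interior[OF assms(3,4)]
 show ne: "ang y ~= ang u" using ang_eq(2)[of y] ang_eq(2)[of u] assms by auto
 show 1: "green y u = arc_green th (ang u) (ang y)"
  using arc_green_eq[OF theta iu, of "ang y"] iy ne by (simp add: green_def pt_def norm_divide)
 show "green y u = arc_green th (ang y) (ang u)" unfolding 1 by (rule arc_green_bounds(3)[OF theta iu iy ne])
qed

lemma green_pos: "0 < y ==> y < b ==> 0 < u ==> u < b ==> y ~= u ==> 0 < green y u"
 using green_eq(1,2)[of y u] arc_green_bounds(1)[OF theta ang_interior ang_interior] by metis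

lemma green_diag: "green y y = 0" by (simp add: green_def)

text \<open>The sine of the angle of u supplies the power of u, and the Lipschitz bound supplies the
  distance |u - y|; by symmetry of the Green function the sine may be taken at u.\<close>

lemma green_bound:
 obtains C where "C > 0" "!!y u. 0 < y ==> y < b ==> 0 < u ==> u < b ==> green y u <= C * (u powr kappa * \<bar>u - y\<bar> powr (-1/2))"
proof -
 from arcv_lipschitz[OF theta] obtain L where L: "L > 0"
  "!!ph p. ph \<in> {0..pi} ==> p \<in> {0..pi} ==> \<bar>arcv th ph - arcv th p\<bar> <= L * \<bar>ph - p\<bar>" by blast
 from sin_arca_bound[OF theta] obtain K where K: "K > 0"
  "!!ph. 0 < ph ==> ph < pi ==> sin ph <= K * arcv th ph powr (th / (1 + th))" by blast
 define C where "C = 4 * ((K * (1 / c) powr (th / (1 + th))) powr (1/4) * (1 / (c * L)) powr (-1/2))"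
 have C: "C > 0" using K(1) L(1) c by (simp add: C_def)
 have "green y u <= C * (u powr kappa * \<bar>u - y\<bar> powr (-1/2))" if y: "0 < y" "y < b" and u: "0 < u" "u < b" for y u
 proof (cases "y = u")
  case True
  thus ?thesis by (simp add: green_diag)
 next
  case False
  note iy = ang_interior[OF y] and iu = ang_interior[OF u]
  note g = green_eq[OF y u False]
  have vu: "arcv th (ang u) = u / c" "arcv th (ang y) = y / c" using ang_eq(2)[of u] ang_eq(2)[of y] u y c by (auto simp: field_simps)
  have 1: "green y u <= 4 * (sin (ang u) powr (1/4) * \<bar>ang u - ang y\<bar> powr (-1/2))"
   unfolding g(3) by (rule arc_green_bounds(2)[OF theta iy iu]) (use g(2) in simp)
  have "sin (ang u) <= K * (u / c) powr (th / (1 + th))" using K(2)[OF iu] vu by simp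
  also have "... = (K * (1 / c) powr (th / (1 + th))) * u powr (th / (1 + th))" using u c by (simp add: powr_divide)
  finally have "sin (ang u) powr (1/4) <= ((K * (1 / c) powr (th / (1 + th))) * u powr (th / (1 + th))) powr (1/4)"
   using sin_gt_zero[OF iu] by (intro powr_mono2) auto
  also have "... = (K * (1 / c) powr (th / (1 + th))) powr (1/4) * u powr kappa"
  proof -
   have "(u powr (th / (1 + th))) powr (1/4) = u powr kappa" unfolding powr_powr by (simp add: kappa_def field_simps)
   thus ?thesis using K(1) by (simp add: powr_mult)
  qed
  finally have s: "sin (ang u) powr (1/4) <= (K * (1 / c) powr (th / (1 + th))) powr (1/4) * u powr kappa" .
  have "\<bar>u / c - y / c\<bar> <= L * \<bar>ang u - ang y\<bar>" using L(2)[of "ang u" "ang y"] iu iy vu by simp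
  hence "\<bar>u - y\<bar> / c <= L * \<bar>ang u - ang y\<bar>" using c by (simp add: diff_divide_distrib[symmetric])
  hence "1 / (c * L) * \<bar>u - y\<bar> <= \<bar>ang u - ang y\<bar>" using c L(1) by (simp add: field_simps)
  hence "\<bar>ang u - ang y\<bar> powr (-1/2) <= (1 / (c * L) * \<bar>u - y\<bar>) powr (-1/2)" using False c L(1) by (intro powr_mono2') auto
  also have "... = (1 / (c * L)) powr (-1/2) * \<bar>u - y\<bar> powr (-1/2)" by (rule powr_mult)
  finally have d: "\<bar>ang u - ang y\<bar> powr (-1/2) <= (1 / (c * L)) powr (-1/2) * \<bar>u - y\<bar> powr (-1/2)" .
  have "sin (ang u) powr (1/4) * \<bar>ang u - ang y\<bar> powr (-1/2) <=
    ((K * (1 / c) powr (th / (1 + th))) powr (1/4) * u powr kappa) * ((1 / (c * L)) powr (-1/2) * \<bar>u - y\<bar> powr (-1/2))"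
   by (intro mult_mono s d) auto
  thus ?thesis using 1 unfolding C_def by (simp only: mult_ac)
 qed
 thus ?thesis using that C by blast
qed

lemma W_bound: obtains B where "B > 0" "!!y. 0 <= y ==> y <= b ==> W y <= B"
proof -
 have "compact (W ` {0..b})" by (intro compact_continuous_image continuous_on_subset[OF W_cont]) auto
 then obtain B where "\<forall>y\<in>{0..b}. \<bar>W y\<bar> <= B" using compact_imp_bounded[of "W ` {0..b}"] unfolding bounded_iff by auto
 hence B: "!!y. y \<in> {0..b} ==> \<bar>W y\<bar> <= B" by blast
 show ?thesis by (rule that[of "\<bar>B\<bar> + 1"]) (use B in \<open>auto intro: order_trans[OF abs_ge_self] order_trans[OF B]\<close>, (use B in fastforce)?)
qed

lemma kern_nonneg: "0 <= kern u y"
proof (cases "u \<in> {0<..<b} & y \<in> {0<..<b}")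
 case True
 hence "0 <= green y u" using green_pos[of y u] green_diag[of y] by (cases "y = u") auto
 thus ?thesis using True W_pos[of y] by (simp add: kern_def max_def)
qed (auto simp: kern_def)

lemma kern_bound:
 obtains C where "C > 0" "!!u y. kern u y <= C * (indicator {0<..<b} u * u powr (kappa - 1) * (indicator {0<..<b} y * \<bar>u - y\<bar> powr (-1/2)))"
proof -
 from green_bound obtain C where C: "C > 0" "!!y u. 0 < y ==> y < b ==> 0 < u ==> u < b ==> green y u <= C * (u powr kappa * \<bar>u - y\<bar> powr (-1/2))" by blast
 from W_bound obtain B where B: "B > 0" "!!y. 0 <= y ==> y <= b ==> W y <= B" by blast
 define C' where "C' = B * C / (2 * pi\<^sup>2)"
 have "kern u y <= C' * (indicator {0<..<b} u * u powr (kappa - 1) * (indicator {0<..<b} y * \<bar>u - y\<bar> powr (-1/2)))" for u y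
 proof (cases "u \<in> {0<..<b} & y \<in> {0<..<b}")
  case True
  hence r: "0 < u" "u < b" "0 < y" "y < b" by auto
  have g0: "0 <= green y u" using green_pos[of y u] green_diag[of y] r by (cases "y = u") auto
  have "W y * green y u <= B * (C * (u powr kappa * \<bar>u - y\<bar> powr (-1/2)))"
   using B C g0 W_pos[of y] r by (intro mult_mono) auto
  hence "W y * green y u / (2 * pi\<^sup>2 * u) <= B * (C * (u powr kappa * \<bar>u - y\<bar> powr (-1/2))) / (2 * pi\<^sup>2 * u)"
   using r by (intro divide_right_mono) auto
  also have "... = C' * (u powr kappa / u * \<bar>u - y\<bar> powr (-1/2))" by (simp add: C'_def field_simps)
  also have "u powr kappa / u = u powr (kappa - 1)" using r by (simp add: powr_diff)
  finally show ?thesis using r by (simp add: kern_def max_def)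
 next
  case False
  thus ?thesis by (auto simp: kern_def)
 qed
 moreover have "C' > 0" using B C by (simp add: C'_def)
 ultimately show ?thesis using that by blast
qed

lemma kern_integrable: "integrable lborel (kern u)"
 and dens_bound: "\<exists>C>0. \<forall>u. dens u <= C * (indicator {0<..<b} u * u powr (kappa - 1))"
proof -
 from kern_bound obtain C where C: "C > 0" "!!u y. kern u y <= C * (indicator {0<..<b} u * u powr (kappa - 1) * (indicator {0<..<b} y * \<bar>u - y\<bar> powr (-1/2)))" by blast
 define D where "D = 2 * b powr (-1/2 + 1) / (-1/2 + 1)"
 have i: "integrable lborel (%y. indicator {0<..<b} y * \<bar>u - y\<bar> powr (-1/2))" "(\<integral>y. indicator {0<..<b} y * \<bar>u - y\<bar> powr (-1/2) \<partial>lborel) <= D" if "u >= 0" for u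
  using integral_abs_powr_le[of "-1/2" b u] b_pos that by (simp_all add: D_def)
 have km: "kern u \<in> borel_measurable lborel" for u
  using measurable_compose[OF measurable_Pair1' kern_measurable, of u] by simp
 show ki: "integrable lborel (kern u)" for u
 proof (cases "u \<in> {0<..<b}")
  case True
  show ?thesis
  proof (rule Bochner_Integration.integrable_bound)
   show "integrable lborel (%y. C * (u powr (kappa - 1)) * (indicator {0<..<b} y * \<bar>u - y\<bar> powr (-1/2)))"
    by (intro integrable_mult_right i(1)) (use True in auto)
   show "AE y in lborel. norm (kern u y) <= norm (C * (u powr (kappa - 1)) * (indicator {0<..<b} y * \<bar>u - y\<bar> powr (-1/2)))"
   proof (rule AE_I2)
    fix y
    have "kern u y <= C * (u powr (kappa - 1)) * (indicator {0<..<b} y * \<bar>u - y\<bar> powr (-1/2))"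
     using C(2)[of u y] True by (simp add: mult.assoc)
    thus "norm (kern u y) <= norm (C * (u powr (kappa - 1)) * (indicator {0<..<b} y * \<bar>u - y\<bar> powr (-1/2)))"
     unfolding real_norm_def abs_of_nonneg[OF kern_nonneg] by (rule order_trans[OF _ abs_ge_self])
   qed
  qed (rule km)
 next
  case False
  hence "kern u = (%y. 0)" by (auto simp: kern_def)
  thus ?thesis by simp
 qed
 have b1: "b powr (-1/2 + 1) > 0" using b_pos by simp
 have D: "D > 0" unfolding D_def using b1 by simp
 show "\<exists>C>0. \<forall>u. dens u <= C * (indicator {0<..<b} u * u powr (kappa - 1))"
 proof (intro exI[of _ "C * D"] conjI allI)
  show "C * D > 0" using C D by simp
  fix u
  show "dens u <= C * D * (indicator {0<..<b} u * u powr (kappa - 1))"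
  proof (cases "u \<in> {0<..<b}")
   case True
   have "dens u <= (\<integral>y. C * (u powr (kappa - 1)) * (indicator {0<..<b} y * \<bar>u - y\<bar> powr (-1/2)) \<partial>lborel)"
    unfolding dens_def
    by (rule integral_mono[OF ki]) (use C(2)[of u] True i(1) in \<open>auto simp: mult.assoc\<close>)
   also have "... = C * (u powr (kappa - 1)) * (\<integral>y. indicator {0<..<b} y * \<bar>u - y\<bar> powr (-1/2) \<partial>lborel)"
    by simp
   also have "... <= C * (u powr (kappa - 1)) * D" using C i(2)[of u] True by (intro mult_left_mono) auto
   finally show ?thesis using True by (simp add: mult_ac)
  next
   case False
   hence "kern u = (%y. 0)" by (auto simp: kern_def)
   thus ?thesis using False by (simp add: dens_def)
  qed
 qed
qed

lemma dens_nonneg: "0 <= dens u" unfolding dens_def by (rule integral_nonneg_AE) (simp add: kern_nonneg)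

lemma dens_outside: "u \<notin> {0<..<b} ==> dens u = 0"
proof -
 assume "u \<notin> {0<..<b}"
 hence "kern u = (%y. 0)" by (auto simp: kern_def)
 thus ?thesis by (simp add: dens_def)
qed

lemma dens_measurable[measurable]: "dens \<in> borel_measurable borel"
proof -
 have "(%u. \<integral>y. kern u y \<partial>lborel) \<in> borel_measurable borel"
  by (rule lborel.borel_measurable_lebesgue_integral) (use kern_measurable in \<open>simp add: case_prod_beta'\<close>)
 thus ?thesis by (simp add: dens_def[abs_def])
qed

lemma dens_pos:
 assumes "0 < u" "u < b" shows "0 < dens u"
proof -
 have "dens u ~= 0"
 proof
  assume "dens u = 0"
  hence "AE y in lborel. kern u y = 0" unfolding dens_def
   by (subst (asm) integral_nonneg_eq_0_iff_AE[OF kern_integrable]) (auto simp: kern_nonneg)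
  moreover have "kern u y ~= 0" if "y \<in> {0<..<u}" for y
  proof -
   have y: "0 < y" "y < b" "y ~= u" using that assms by auto
   hence "0 < W y * green y u / (2 * pi\<^sup>2 * u)" using green_pos[OF y(1,2) assms y(3)] W_pos[of y] assms by simp
   moreover have "kern u y = W y * green y u / (2 * pi\<^sup>2 * u)" using y assms by (simp add: kern_def max_def)
   ultimately show ?thesis by linarith
  qed
  ultimately have "AE y in lborel. y \<notin> {0<..<u}" by (auto elim!: eventually_mono)
  hence "emeasure lborel {0<..<u} = 0" by (subst (asm) AE_iff_measurable[of "{0<..<u}"]) auto
  thus False using assms by simp
 qed
 thus ?thesis using dens_nonneg[of u] by simp
qed

text \<open>Since the kernel is nonnegative, the integral of |g| against it over y is |g| times the
  density, and the bound u^(kappa - 1) is the only integrability needed.\<close>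

lemma dens_Fubini:
 fixes g :: "real => real"
 assumes [measurable]: "g \<in> borel_measurable borel"
  and g: "integrable lborel (%u. indicator {0<..<b} u * u powr (kappa - 1) * \<bar>g u\<bar>)"
 shows "integrable lborel (%u. g u * dens u)" "AE y in lborel. integrable lborel (%u. g u * kern u y)"
  "integrable lborel (%y. \<integral>u. g u * kern u y \<partial>lborel)"
  "(\<integral>u. g u * dens u \<partial>lborel) = (\<integral>y. (\<integral>u. g u * kern u y \<partial>lborel) \<partial>lborel)"
proof -
 obtain C where C: "C > 0" "!!u. dens u <= C * (indicator {0<..<b} u * u powr (kappa - 1))" using dens_bound by blast
 have bd: "\<bar>g u * dens u\<bar> <= C * (indicator {0<..<b} u * u powr (kappa - 1) * \<bar>g u\<bar>)" for u
 proof -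
  have "\<bar>g u * dens u\<bar> = \<bar>g u\<bar> * dens u" using dens_nonneg[of u] by (simp add: abs_mult)
  also have "... <= \<bar>g u\<bar> * (C * (indicator {0<..<b} u * u powr (kappa - 1)))" using C(2) by (intro mult_left_mono) auto
  finally show ?thesis by (simp only: mult_ac)
 qed
 show gd: "integrable lborel (%u. g u * dens u)"
 proof (rule Bochner_Integration.integrable_bound)
  show "integrable lborel (%u. C * (indicator {0<..<b} u * u powr (kappa - 1) * \<bar>g u\<bar>))" using g by (rule integrable_mult_right)
  show "AE u in lborel. norm (g u * dens u) <= norm (C * (indicator {0<..<b} u * u powr (kappa - 1) * \<bar>g u\<bar>))"
   unfolding real_norm_def by (intro AE_I2 order_trans[OF bd abs_ge_self])
 qed measurable
 have m: "(%z. g (fst z) * kern (fst z) (snd z)) \<in> borel_measurable (borel \<Otimes>\<^sub>M borel)" by measurable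
 have inner: "(\<integral>y. norm (g u * kern u y) \<partial>lborel) = \<bar>g u * dens u\<bar>" for u
 proof -
  have "(\<integral>y. norm (g u * kern u y) \<partial>lborel) = (\<integral>y. \<bar>g u\<bar> * kern u y \<partial>lborel)"
   using kern_nonneg by (simp add: abs_mult)
  also have "... = \<bar>g u\<bar> * dens u" by (simp add: dens_def)
  finally show ?thesis using dens_nonneg[of u] by (simp add: abs_mult)
 qed
 have int: "integrable (lborel \<Otimes>\<^sub>M lborel) (%z. g (fst z) * kern (fst z) (snd z))"
 proof (rule lborel_pair.Fubini_integrable)
  show "(%z. g (fst z) * kern (fst z) (snd z)) \<in> borel_measurable (lborel \<Otimes>\<^sub>M lborel)" using m by (simp cong: measurable_cong_sets)
  show "integrable lborel (%u. \<integral>y. norm (g (fst (u, y)) * kern (fst (u, y)) (snd (u, y))) \<partial>lborel)"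
   using integrable_abs[OF gd] inner by simp
  show "AE u in lborel. integrable lborel (%y. g (fst (u, y)) * kern (fst (u, y)) (snd (u, y)))"
   using kern_integrable by simp
 qed
 hence int': "integrable (lborel \<Otimes>\<^sub>M lborel) (%(u, y). g u * kern u y)" by (simp add: case_prod_beta')
 show "AE y in lborel. integrable lborel (%u. g u * kern u y)" by (rule lborel_pair.AE_integrable_snd[OF int'])
 show "integrable lborel (%y. \<integral>u. g u * kern u y \<partial>lborel)" by (rule lborel_pair.integrable_snd[OF int'])
 have "(\<integral>u. g u * dens u \<partial>lborel) = (\<integral>u. (\<integral>y. g u * kern u y \<partial>lborel) \<partial>lborel)" by (simp add: dens_def)
 also have "... = (\<integral>y. (\<integral>u. g u * kern u y \<partial>lborel) \<partial>lborel)" by (rule lborel_pair.Fubini_integral[OF int', symmetric])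
 finally show "(\<integral>u. g u * dens u \<partial>lborel) = (\<integral>y. (\<integral>u. g u * kern u y \<partial>lborel) \<partial>lborel)" .
qed

text \<open>With u = c X(ph), du/u is - \<open>arc_rate\<close> dph, so the factor 1/u of the
  density is what makes the arc integrals applicable, and c disappears from the kernel.\<close>

lemma kern_change_of_variables:
 fixes g :: "real => real"
 assumes y: "0 < y" "y < b" and int: "integrable lborel (%u. g u * kern u y)"
 shows "(\<integral>u. g u * kern u y \<partial>lborel) = W y / (2 * pi\<^sup>2) *
  integral {0<..<pi} (%ph. arc_rate th ph * (g (c * arcv th ph) * arc_green th (ang y) ph))"
proof -
 define K where "K = W y / (2 * pi\<^sup>2)"
 have K: "K > 0" using W_pos[OF y(1)] by (simp add: K_def)
 define F where "F = (%u. g u * green y u / u)"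
 have e: "g u * kern u y = K * (indicator {0<..<b} u *\<^sub>R F u)" for u
  using y by (simp add: kern_def F_def K_def max_def field_simps)
 have "integrable lborel (%u. (1/K) * (g u * kern u y))" using int by (rule integrable_mult_right)
 hence si: "set_integrable lborel {0<..<b} F" unfolding set_integrable_def e using K by simp
 have LI: "(\<integral>u. g u * kern u y \<partial>lborel) = K * (LINT u:{0<..<b}|lborel. F u)"
  unfolding e set_lebesgue_integral_def by simp
 also have "(LINT u:{0<..<b}|lborel. F u) = integral {0<..<b} F" by (rule set_borel_integral_eq_integral(2)[OF si])
 \<comment> \<open>The substitution reverses the orientation, which the absolute value of the
   derivative takes into account.\<close>
 also have "integral {0<..<b} F = integral {0<..<pi} (%ph. \<bar>- (c * (arcv th ph * arc_rate th ph))\<bar> * F (c * arcv th ph))"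
 proof -
  have img: "(%ph. c * arcv th ph) ` {0<..<pi} = {0<..<b}"
  proof (intro equalityI subsetI)
   fix u assume "u \<in> (%ph. c * arcv th ph) ` {0<..<pi}"
   then obtain ph where "0 < ph" "ph < pi" "u = c * arcv th ph" by auto
   thus "u \<in> {0<..<b}" using arcv_pos[OF theta, of ph] arcv_strict_antimono[OF theta, of 0 ph] c by (simp add: b_def)
  next
   fix u assume "u \<in> {0<..<b}"
   hence "0 < u" "u < b" by auto
   thus "u \<in> (%ph. c * arcv th ph) ` {0<..<pi}"
    using ang_interior[of u] ang_eq(2)[of u] by (intro image_eqI[of _ _ "ang u"]) auto
  qed
  have inj: "inj_on (%ph. c * arcv th ph) {0<..<pi}"
   using arcv_inj[OF theta] c by (auto simp: inj_on_def)
  have der: "((%ph. c * arcv th ph) has_field_derivative - (c * (arcv th ph * arc_rate th ph))) (at ph within {0<..<pi})" if "ph \<in> {0<..<pi}" for ph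
  proof -
   have "((%ph. c * arcv th ph) has_field_derivative c * - (arcv th ph * arc_rate th ph)) (at ph)"
    by (intro DERIV_cmult arcv_deriv[OF theta]) (use that in auto)
   thus ?thesis by (simp add: has_field_derivative_at_within)
  qed
  have "set_integrable lebesgue {0<..<b} F"
  proof -
   have "(%u. indicator {0<..<b} u *\<^sub>R F u) \<in> borel_measurable lborel" using si by (simp add: set_integrable_def)
   thus ?thesis using si unfolding set_integrable_def by (subst integrable_completion) auto
  qed
  thus ?thesis
   using has_absolute_integral_change_of_variables_1'[OF _ der inj, of F "integral {0<..<b} F"] img by auto
 qed
 also have "... = integral {0<..<pi} (%ph. arc_rate th ph * (g (c * arcv th ph) * arc_green th (ang y) ph))"
 proof (rule integral_spike[of "{ang y}"])
  fix ph assume "ph \<in> {0<..<pi} - {ang y}"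
  hence hp: "0 < ph" "ph < pi" "ph ~= ang y" by auto
  define u where "u = c * arcv th ph"
  have v: "arcv th ph > 0" using arcv_pos[OF theta, of ph] hp by simp
  have au: "ang u = ph" using ang_of_value(1)[of ph] hp by (simp add: u_def)
  have ur: "0 < u" "u < b" using v arcv_strict_antimono[OF theta, of 0 ph] hp c by (auto simp: u_def b_def)
  have "y ~= u" using hp au by auto
  note gr = green_eq(3)[OF y ur this, unfolded au]
  have r: "arc_rate th ph > 0" by (rule arc_rate_pos[OF theta hp(1,2)])
  have "\<bar>- (c * (arcv th ph * arc_rate th ph))\<bar> = u * arc_rate th ph" using c v r by (simp add: u_def abs_mult)
  thus "arc_rate th ph * (g (c * arcv th ph) * arc_green th (ang y) ph) = \<bar>- (c * (arcv th ph * arc_rate th ph))\<bar> * F (c * arcv th ph)"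
   using ur(1) by (simp add: F_def gr u_def[symmetric])
 qed simp
 finally show ?thesis by (simp add: K_def)
qed

end

section \<open>Mass and potential of the density\<close>

lemma abs_log_pair_le:
 assumes th: "th >= 1" and xu: "0 <= x" "0 <= u"
 shows "\<bar>log_pair th x u\<bar> <= (1 + th) * \<bar>ln \<bar>x - u\<bar>\<bar> + th * (ln (1 + x) + ln (1 + u))"
proof (cases "x = u")
 case False
 note b = ln_abs_powr_diff_bounds[OF th xu False]
 have "0 <= th * (ln (1 + x) + ln (1 + u))" using th xu by simp
 moreover have "th * ln \<bar>x - u\<bar> >= - (th * \<bar>ln \<bar>x - u\<bar>\<bar>)"
 proof -
  have "th * (- \<bar>ln \<bar>x - u\<bar>\<bar>) <= th * ln \<bar>x - u\<bar>" using th by (intro mult_left_mono) auto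
  thus ?thesis by simp
 qed
 moreover have "0 <= th * \<bar>ln \<bar>x - u\<bar>\<bar>" using th by simp
 ultimately have "\<bar>ln \<bar>x powr th - u powr th\<bar>\<bar> <= th * \<bar>ln \<bar>x - u\<bar>\<bar> + th * (ln (1 + x) + ln (1 + u))"
  using b(2,3) unfolding abs_le_iff by linarith
 moreover have "(1 + th) * \<bar>ln \<bar>x - u\<bar>\<bar> = \<bar>ln \<bar>x - u\<bar>\<bar> + th * \<bar>ln \<bar>x - u\<bar>\<bar>" by (simp add: distrib_right)
 moreover have "\<bar>log_pair th x u\<bar> <= \<bar>ln \<bar>x - u\<bar>\<bar> + \<bar>ln \<bar>x powr th - u powr th\<bar>\<bar>" unfolding log_pair_def by (rule abs_triangle_ineq)
 ultimately show ?thesis by linarith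
next
 case True
 thus ?thesis using th xu by (simp add: log_pair_def)
qed

text \<open>Scaling by c adds a constant that is the same for all points, so differences of
  potentials can be computed for c = 1.\<close>

lemma log_pair_scale:
 assumes "c > 0" "th > 0" "x > 0" "v >= 0" "x ~= v"
 shows "log_pair th (c * x) (c * v) = (1 + th) * ln c + log_pair th x v"
proof -
 have ne: "x powr th ~= v powr th"
  using assms powr_less_mono2[of th x v] powr_less_mono2[of th v x] by (cases x v rule: linorder_cases) auto
 have 1: "\<bar>c * x - c * v\<bar> = c * \<bar>x - v\<bar>" using assms by (simp add: abs_mult flip: right_diff_distrib)
 have 2: "\<bar>(c * x) powr th - (c * v) powr th\<bar> = c powr th * \<bar>x powr th - v powr th\<bar>"
  using assms by (simp add: powr_mult abs_mult flip: right_diff_distrib)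
 show ?thesis unfolding log_pair_def 1 2 using assms ne by (simp add: ln_mult ln_powr algebra_simps)
qed

lemma integral_open_interval_continuous:
 fixes f :: "real => real" assumes "continuous_on {0..b} f"
 shows "integrable lborel (%y. indicator {0<..<b} y * f y)" "(\<integral>y. indicator {0<..<b} y * f y \<partial>lborel) = integral {0..b} f"
proof -
 have s: "set_integrable lborel {0..b} f" by (rule borel_integrable_atLeastAtMost'[OF assms])
 have s': "set_integrable lborel {0<..<b} f" by (rule set_integrable_subset[OF s]) auto
 thus "integrable lborel (%y. indicator {0<..<b} y * f y)" by (simp add: set_integrable_def)
 have "(\<integral>y. indicator {0<..<b} y * f y \<partial>lborel) = (LINT y:{0<..<b}|lborel. f y)" by (simp add: set_lebesgue_integral_def)
 also have "... = integral {0<..<b} f" by (rule set_borel_integral_eq_integral(2)[OF s'])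
 also have "... = integral {0..b} f" by (simp add: integral_open_interval_real)
 finally show "(\<integral>y. indicator {0<..<b} y * f y \<partial>lborel) = integral {0..b} f" .
qed

text \<open>\<open>y \<mapsto> k y * ln (max y x) - V (max y x)\<close> is an antiderivative because \<open>k y = y * V' y\<close>.\<close>
lemma log_max_moment:
 fixes V V1 W :: "real => real"
 assumes V1: "!!y. y > 0 ==> (V has_real_derivative V1 y) (at y)" and Vc: "continuous_on {0..} V"
  and W: "!!y. y > 0 ==> ((%y. y * V1 y) has_real_derivative W y) (at y)" and kc: "continuous_on {0..} (%y. y * V1 y)"
  and x: "x > 0" and b: "b > 0"
 shows "((%y. W y * ln (max y x)) has_integral b * V1 b * ln (max b x) - V (max b x) + V x) {0..b}"
proof -
 define Ph where "Ph = (%y. y * V1 y * ln (max y x) - V (max y x))"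
 have "((%y. W y * ln (max y x)) has_integral Ph b - Ph 0) {0..b}"
 proof (rule fundamental_theorem_of_calculus_interior_strong[of "{x}"])
  show "continuous_on {0..b} Ph" unfolding Ph_def
   by (intro continuous_on_diff continuous_on_mult continuous_on_subset[OF kc] continuous_on_ln continuous_on_compose2[OF Vc] continuous_on_max continuous_intros)
     (use x in \<open>auto simp: max_def\<close>)
  fix y assume "y \<in> {0<..<b} - {x}"
  hence y: "0 < y" "y ~= x" by auto
  have "(Ph has_real_derivative W y * ln (max y x)) (at y)"
  proof (cases "y < x")
   case True
   have "((%y. y * V1 y * ln x - V x) has_real_derivative W y * ln x) (at y)"
    using DERIV_diff[OF DERIV_cmult_right[OF W[OF y(1)], of "ln x"] DERIV_const[of "V x"]] by simp
   hence "(Ph has_real_derivative W y * ln x) (at y)"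
    by (rule has_field_derivative_transform_within_open[where S = "{..<x}"]) (use True in \<open>auto simp: Ph_def max_def\<close>)
   thus ?thesis using True by (simp add: max_def)
  next
   case False
   hence yx: "x < y" using y by simp
   have "((%y. y * V1 y * ln y - V y) has_real_derivative (W y * ln y + (1 / y) * (y * V1 y)) - V1 y) (at y)"
    by (rule DERIV_diff[OF DERIV_mult[OF W[OF y(1)]] V1[OF y(1)]]) (use y in \<open>auto intro!: derivative_eq_intros\<close>)
   hence "((%y. y * V1 y * ln y - V y) has_real_derivative W y * ln y) (at y)" using y by simp
   hence "(Ph has_real_derivative W y * ln y) (at y)"
    by (rule has_field_derivative_transform_within_open[where S = "{x<..}"]) (use yx in \<open>auto simp: Ph_def max_def\<close>)
   thus ?thesis using yx by (simp add: max_def)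
  qed
  thus "(Ph has_vector_derivative W y * ln (max y x)) (at y)" by (simp add: has_real_derivative_iff_has_vector_derivative)
 qed (use b in auto)
 moreover have "Ph b - Ph 0 = b * V1 b * ln (max b x) - V (max b x) + V x" using x by (simp add: Ph_def max_def)
 ultimately show ?thesis by simp
qed

context arc_density
begin

lemma integrable_powr_weight: "integrable lborel (%u. indicator {0<..<b} u * u powr (kappa - 1))"
proof -
 have "integrable lborel (%u. indicator {0<..<b} u * \<bar>0 - u\<bar> powr (kappa - 1))"
  by (rule integral_abs_powr_le(1)) (use kappa b_pos in auto)
 moreover have "(%u. indicator {0<..<b} u * \<bar>0 - u\<bar> powr (kappa - 1)) = (%u. indicator {0<..<b} u * u powr (kappa - 1))"
  by (rule ext) (auto simp: indicator_def)
 ultimately show ?thesis by (simp only:)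
qed

text \<open>Each y contributes W y/(2 pi^2) times the integral 2 pi ang y/(1 + th) of its Green
  function, so the total mass is the angular moment of W divided by pi (1 + th).\<close>

lemma dens_mass:
 assumes m: "integral {0..b} (%y. W y * arca th (y / c)) = pi * (1 + th)"
 shows "integrable lborel dens" "(\<integral>u. dens u \<partial>lborel) = 1"
proof -
 have g: "integrable lborel (%u. indicator {0<..<b} u * u powr (kappa - 1) * \<bar>1::real\<bar>)" using integrable_powr_weight by simp
 note F = dens_Fubini[of "%u. 1", OF _ g, simplified]
 show "integrable lborel dens" using F(1) by simp
 have cW: "continuous_on {0..b} (%y. W y * arca th (y / c))"
  by (intro continuous_intros continuous_on_subset[OF W_cont] continuous_on_compose2[OF continuous_on_arca[OF theta]])
    (use c in \<open>auto simp: b_def field_simps\<close>)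
 note O = integral_open_interval_continuous[OF cW]
 have "(\<integral>u. dens u \<partial>lborel) = (\<integral>y. (\<integral>u. kern u y \<partial>lborel) \<partial>lborel)" by (rule F(4))
 also have "... = (\<integral>y. (1 / (pi * (1 + th))) * (indicator {0<..<b} y * (W y * arca th (y / c))) \<partial>lborel)"
 proof (rule integral_cong_AE)
  show "(%y. \<integral>u. kern u y \<partial>lborel) \<in> borel_measurable lborel" using F(3) by simp
  show "(%y. (1 / (pi * (1 + th))) * (indicator {0<..<b} y * (W y * arca th (y / c)))) \<in> borel_measurable lborel"
   using borel_measurable_integrable[OF O(1)] by (rule borel_measurable_times[OF borel_measurable_const])
  show "AE y in lborel. (\<integral>u. kern u y \<partial>lborel) = (1 / (pi * (1 + th))) * (indicator {0<..<b} y * (W y * arca th (y / c)))"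
   using F(2)
  proof eventually_elim
   fix y assume i: "integrable lborel (%u. kern u y)"
   show "(\<integral>u. kern u y \<partial>lborel) = (1 / (pi * (1 + th))) * (indicator {0<..<b} y * (W y * arca th (y / c)))"
   proof (cases "y \<in> {0<..<b}")
    case True
    hence y: "0 < y" "y < b" by auto
    have "(\<integral>u. 1 * kern u y \<partial>lborel) = W y / (2 * pi\<^sup>2) * integral {0<..<pi} (%ph. arc_rate th ph * (1 * arc_green th (ang y) ph))"
     by (rule kern_change_of_variables[OF y]) (use i in simp)
    also have "integral {0<..<pi} (%ph. arc_rate th ph * (1 * arc_green th (ang y) ph)) = 2 * pi * (ang y / (1 + th))"
     using integral_unique[OF integral_arc_rate_green[OF theta ang_interior[OF y]]] by simp
    also have "W y / (2 * pi\<^sup>2) * (2 * pi * (ang y / (1 + th))) = (1 / (pi * (1 + th))) * (W y * ang y)"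
     by (simp add: power2_eq_square)
    finally show ?thesis using True ang_eq(1)[of y] y by simp
   next
    case False
    thus ?thesis by (simp add: kern_def)
   qed
  qed
 qed
 also have "... = 1" using O(2) m theta by simp
 finally show "(\<integral>u. dens u \<partial>lborel) = 1" .
qed

lemma log_moment:
 assumes x: "x >= 0"
 shows "integrable lborel (%u. ln \<bar>x - u\<bar> * dens u)"
proof -
 have [measurable]: "(%u. ln \<bar>x - u\<bar>) \<in> borel_measurable borel" by measurable
 show ?thesis by (rule dens_Fubini(1)) (use integrable_log_singularity[OF kappa b_pos x] in auto)
qed

text \<open>The linear dependence on ln (1 + x) is what the minimisation needs: the mixed
  logarithmic energy with any measure having a logarithmic moment is finite.\<close>

lemma log_moment_bound:
 obtains K where "!!x. x >= 0 ==> (\<integral>u. \<bar>ln \<bar>x - u\<bar>\<bar> * dens u \<partial>lborel) <= K * (1 + ln (1 + x))"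
proof -
 obtain C where C: "C > 0" "!!u. dens u <= C * (indicator {0<..<b} u * u powr (kappa - 1))" using dens_bound by blast
 define I where "I = (%e x. \<integral>u. indicator {0<..<b} u * \<bar>x - u\<bar> powr e \<partial>lborel)"
 define B where "B = 2 * b powr (kappa/2 - 1 + 1) / (kappa/2 - 1 + 1)"
 define B1 where "B1 = 2 * b powr (kappa - 1 + 1) / (kappa - 1 + 1)"
 have i: "integrable lborel (%u. indicator {0<..<b} u * \<bar>x - u\<bar> powr (kappa/2 - 1))" "I (kappa/2 - 1) x <= B"
  "integrable lborel (%u. indicator {0<..<b} u * \<bar>x - u\<bar> powr (kappa - 1))" "I (kappa - 1) x <= B1" if "x >= 0" for x
  using integral_abs_powr_le[of "kappa/2 - 1" b x] integral_abs_powr_le[of "kappa - 1" b x] kappa b_pos that by (auto simp: I_def B_def B1_def)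
 have BB: "0 <= B" "0 <= B1" using kappa by (auto simp: B_def B1_def)
 have lb: "0 <= ln (1 + b)" using b_pos by simp
 define K where "K = C * ((1 + ln (1 + b)) * B1 + (4/kappa) * (B + B))"
 have "(\<integral>u. \<bar>ln \<bar>x - u\<bar>\<bar> * dens u \<partial>lborel) <= K * (1 + ln (1 + x))" if x: "x >= 0" for x
 proof -
  define h where "h = (%u. C * ((ln (1 + x) + ln (1 + b)) * (indicator {0<..<b} u * \<bar>0 - u\<bar> powr (kappa - 1))
   + (4/kappa) * (indicator {0<..<b} u * \<bar>0 - u\<bar> powr (kappa/2 - 1) + indicator {0<..<b} u * \<bar>x - u\<bar> powr (kappa/2 - 1))))"
  have ih: "integrable lborel h" unfolding h_def
   by (intro integrable_mult_right Bochner_Integration.integrable_add i) (use x in auto)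
  have lx: "0 <= ln (1 + x)" using x by simp
  have "(\<integral>u. \<bar>ln \<bar>x - u\<bar>\<bar> * dens u \<partial>lborel) <= (\<integral>u. h u \<partial>lborel)"
  proof (rule integral_mono[OF _ ih])
   show "integrable lborel (%u. \<bar>ln \<bar>x - u\<bar>\<bar> * dens u)"
    using integrable_abs[OF log_moment[OF x]] dens_nonneg by (simp add: abs_mult)
   fix u
   show "\<bar>ln \<bar>x - u\<bar>\<bar> * dens u <= h u"
   proof (cases "u \<in> {0<..<b}")
    case True
    hence u: "0 < u" "u < b" by auto
    have "\<bar>ln \<bar>x - u\<bar>\<bar> * dens u <= \<bar>ln \<bar>x - u\<bar>\<bar> * (C * (indicator {0<..<b} u * u powr (kappa - 1)))" using C(2) by (intro mult_left_mono) auto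
    also have "... = C * (u powr (kappa - 1) * \<bar>ln \<bar>x - u\<bar>\<bar>)" using True by simp
    also have "... <= C * ((ln (1 + x) + ln (1 + b)) * u powr (kappa - 1) + (4/kappa) * (u powr (kappa/2 - 1) + \<bar>x - u\<bar> powr (kappa/2 - 1)))"
     using log_singularity_bound(1)[OF kappa b_pos x u] C(1) by (intro mult_left_mono) auto
    finally show ?thesis using True u by (simp add: h_def abs_of_pos)
   next
    case False
    thus ?thesis by (simp add: h_def dens_outside)
   qed
  qed
  also have "... = C * ((ln (1 + x) + ln (1 + b)) * I (kappa - 1) 0 + (4/kappa) * (I (kappa/2 - 1) 0 + I (kappa/2 - 1) x))"
   unfolding h_def I_def using i[of 0] i[OF x] by simp
  also have "... <= C * ((ln (1 + x) + ln (1 + b)) * B1 + (4/kappa) * (B + B))"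
   using i(2)[of 0] i(4)[of 0] i(2)[OF x] C lx lb kappa by (intro mult_left_mono add_mono) auto
  also have "... <= C * (((1 + ln (1 + b)) * B1 + (4/kappa) * (B + B)) * (1 + ln (1 + x)))"
  proof (rule mult_left_mono)
   have e: "((1 + ln (1 + b)) * B1 + (4/kappa) * (B + B)) * (1 + ln (1 + x)) = (ln (1 + x) + ln (1 + b)) * B1 + (4/kappa) * (B + B)
    + (B1 + ln (1 + b) * ln (1 + x) * B1 + (4/kappa) * (B + B) * ln (1 + x))" by (simp add: algebra_simps add_divide_distrib)
   have "0 <= B1 + ln (1 + b) * ln (1 + x) * B1 + (4/kappa) * (B + B) * ln (1 + x)"
    using BB lx lb kappa by (intro add_nonneg_nonneg mult_nonneg_nonneg) auto
   thus "(ln (1 + x) + ln (1 + b)) * B1 + (4/kappa) * (B + B) <= ((1 + ln (1 + b)) * B1 + (4/kappa) * (B + B)) * (1 + ln (1 + x))" unfolding e by linarith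
  qed (use C in simp)
  finally show ?thesis by (simp add: K_def mult_ac)
 qed
 thus ?thesis using that by blast
qed

lemma log_pair_weight:
 assumes th: "th > 1" and x: "x >= 0"
 shows "(%u. log_pair th x u) \<in> borel_measurable borel"
  "integrable lborel (%u. indicator {0<..<b} u * u powr (kappa - 1) * \<bar>log_pair th x u\<bar>)"
proof -
 show m[measurable]: "(%u. log_pair th x u) \<in> borel_measurable borel" unfolding log_pair_def by measurable
 show "integrable lborel (%u. indicator {0<..<b} u * u powr (kappa - 1) * \<bar>log_pair th x u\<bar>)"
 proof (rule Bochner_Integration.integrable_bound)
  show "integrable lborel (%u. (1 + th) * (indicator {0<..<b} u * u powr (kappa - 1) * \<bar>ln \<bar>x - u\<bar>\<bar>)
   + th * (ln (1 + x) + ln (1 + b)) * (indicator {0<..<b} u * u powr (kappa - 1)))"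
   using integrable_log_singularity[OF kappa b_pos x] integrable_powr_weight
   by (intro Bochner_Integration.integrable_add integrable_mult_right)
  show "AE u in lborel. norm (indicator {0<..<b} u * u powr (kappa - 1) * \<bar>log_pair th x u\<bar>) <=
   norm ((1 + th) * (indicator {0<..<b} u * u powr (kappa - 1) * \<bar>ln \<bar>x - u\<bar>\<bar>)
   + th * (ln (1 + x) + ln (1 + b)) * (indicator {0<..<b} u * u powr (kappa - 1)))"
  proof (rule AE_I2)
   fix u :: real
   show "norm (indicator {0<..<b} u * u powr (kappa - 1) * \<bar>log_pair th x u\<bar>) <=
   norm ((1 + th) * (indicator {0<..<b} u * u powr (kappa - 1) * \<bar>ln \<bar>x - u\<bar>\<bar>)
   + th * (ln (1 + x) + ln (1 + b)) * (indicator {0<..<b} u * u powr (kappa - 1)))"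
   proof (cases "u \<in> {0<..<b}")
    case True
    hence u: "0 < u" "u < b" by auto
    have "\<bar>log_pair th x u\<bar> <= (1 + th) * \<bar>ln \<bar>x - u\<bar>\<bar> + th * (ln (1 + x) + ln (1 + u))"
     using abs_log_pair_le[of th x u] th x u by simp
    also have "... <= (1 + th) * \<bar>ln \<bar>x - u\<bar>\<bar> + th * (ln (1 + x) + ln (1 + b))"
     using u th by (intro add_left_mono mult_left_mono) auto
    finally have "u powr (kappa - 1) * \<bar>log_pair th x u\<bar> <= u powr (kappa - 1) * ((1 + th) * \<bar>ln \<bar>x - u\<bar>\<bar> + th * (ln (1 + x) + ln (1 + b)))"
     by (intro mult_left_mono) auto
    also have "... = (1 + th) * (u powr (kappa - 1) * \<bar>ln \<bar>x - u\<bar>\<bar>) + th * (ln (1 + x) + ln (1 + b)) * u powr (kappa - 1)"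
     by (simp only: distrib_left mult_ac)
    finally have R: "u powr (kappa - 1) * \<bar>log_pair th x u\<bar> <= (1 + th) * (u powr (kappa - 1) * \<bar>ln \<bar>x - u\<bar>\<bar>) + th * (ln (1 + x) + ln (1 + b)) * u powr (kappa - 1)" .
    have i1: "indicator {0<..<b} u = (1::real)" using True by simp
    have "\<bar>u powr (kappa - 1) * \<bar>log_pair th x u\<bar>\<bar> <= u powr (kappa - 1) * \<bar>log_pair th x u\<bar>" by (simp add: abs_mult)
    thus ?thesis unfolding i1 mult_1 real_norm_def by (rule order_trans[OF _ order_trans[OF R abs_ge_self]])
   qed simp
  qed
 qed measurable
qed

text \<open>After exchanging the integrals, the potential of each Green function is known from
  \<open>arc_pair_potential\<close>, and W y/(2 pi^2) removes the factor 2 pi^2. A second point x'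
  inside the support is kept because only differences are known.\<close>

lemma potential_difference:
 assumes th: "th > 1" and x: "0 < x" "x ~= b" and x': "0 < x'" "x' < b"
 defines "U \<equiv> %x. \<integral>u. log_pair th x u * dens u \<partial>lborel"
  and "T \<equiv> integral {0..b} (%y. W y * (ln (max y x) - ln (max y x')))"
 shows "integrable lborel (%u. log_pair th x u * dens u)" "U x - U x' <= T" "x < b ==> U x - U x' = T"
proof -
 note wx = log_pair_weight[OF th less_imp_le[OF x(1)]] and wx' = log_pair_weight[OF th less_imp_le[OF x'(1)]]
 note F = dens_Fubini[OF wx] and F' = dens_Fubini[OF wx']
 show "integrable lborel (%u. log_pair th x u * dens u)" by (rule F(1))
 define J where "J = (%y. (\<integral>u. log_pair th x u * kern u y \<partial>lborel) - (\<integral>u. log_pair th x' u * kern u y \<partial>lborel))"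
 have UJ: "U x - U x' = (\<integral>y. J y \<partial>lborel)" unfolding U_def J_def F(4) F'(4) using F(3) F'(3) by simp
 have iJ: "integrable lborel J" unfolding J_def using F(3) F'(3) by simp
 define m where "m = (%y. W y * (ln (max y x) - ln (max y x')))"
 have cm: "continuous_on {0..b} m" unfolding m_def
  by (intro continuous_intros continuous_on_subset[OF W_cont] continuous_on_ln continuous_on_max) (use x x' in \<open>auto simp: max_def\<close>)
 note O = integral_open_interval_continuous[OF cm]
 have key: "AE y in lborel. J y <= indicator {0<..<b} y * m y & (x < b --> J y = indicator {0<..<b} y * m y)"
  using F(2) F'(2)
 proof eventually_elim
  fix y assume i: "integrable lborel (%u. log_pair th x u * kern u y)" "integrable lborel (%u. log_pair th x' u * kern u y)"
  show "J y <= indicator {0<..<b} y * m y & (x < b --> J y = indicator {0<..<b} y * m y)"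
  proof (cases "y \<in> {0<..<b}")
   case False
   thus ?thesis by (simp add: J_def kern_def)
  next
   case True
   hence y: "0 < y" "y < b" by auto
   define g where "g = (%u. log_pair th x u - log_pair th x' u)"
   have ig: "integrable lborel (%u. g u * kern u y)" using Bochner_Integration.integrable_diff[OF i] by (simp add: g_def left_diff_distrib)
   have Jg: "J y = (\<integral>u. g u * kern u y \<partial>lborel)" using i by (simp add: J_def g_def left_diff_distrib)
   define \<xi> et where "\<xi> = x / c" and "et = x' / c"
   have cx: "x = c * \<xi>" "x' = c * et" using c by (simp_all add: \<xi>_def et_def)
   have xe: "0 < \<xi>" "\<xi> ~= arcv th 0" "0 < et" "et < arcv th 0"
    using x x' c by (auto simp: cx b_def zero_less_mult_iff)
   define h where "h = (%ph. arc_rate th ph * ((log_pair th \<xi> (arcv th ph) - log_pair th et (arcv th ph)) * arc_green th (ang y) ph))"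
   define T0 where "T0 = 2 * pi\<^sup>2 * (max (ln (arcv th (ang y))) (ln \<xi>) - max (ln (arcv th (ang y))) (ln et))"
   note A = arc_pair_potential[OF theta ang_interior[OF y] xe(3,4,1,2), folded h_def T0_def]
   have "integral {0<..<pi} (%ph. arc_rate th ph * (g (c * arcv th ph) * arc_green th (ang y) ph)) = integral {0<..<pi} h"
   \<comment> \<open>The two angles where a logarithm is taken at 0 are left out, since scaling is
     false for the default value.\<close>
   proof (rule integral_spike[of "{arca th \<xi>, arca th et}"])
    fix ph assume hp: "ph \<in> {0<..<pi} - {arca th \<xi>, arca th et}"
    hence "arca th (arcv th ph) = ph" using arca_of_value[OF theta, of ph] by auto
    hence "\<xi> ~= arcv th ph" "et ~= arcv th ph" using hp by auto
    moreover have "arcv th ph >= 0" using arcv_pos[OF theta, of ph] hp by auto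
    ultimately have "g (c * arcv th ph) = log_pair th \<xi> (arcv th ph) - log_pair th et (arcv th ph)"
     unfolding g_def cx using log_pair_scale[OF c theta] xe by simp
    thus "h ph = arc_rate th ph * (g (c * arcv th ph) * arc_green th (ang y) ph)" by (simp add: h_def)
   qed simp
   hence Jh: "J y = W y / (2 * pi\<^sup>2) * integral {0<..<pi} h"
    unfolding Jg using kern_change_of_variables[OF y ig] by simp
   have Tm: "W y / (2 * pi\<^sup>2) * T0 = m y"
   proof -
    have lm: "max (ln u) (ln v) = ln (max u v)" if "0 < u" "0 < v" for u v :: real using that by (auto simp: max_def)
    have v: "arcv th (ang y) = y / c" using ang_eq(2)[of y] y c by (auto simp: field_simps)
    have yc: "0 < y / c" using y c by simp
    have mx: "max (y / c) \<xi> = max y x / c" "max (y / c) et = max y x' / c" using c by (auto simp: \<xi>_def et_def max_def divide_le_cancel)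
    have "max (ln (arcv th (ang y))) (ln \<xi>) - max (ln (arcv th (ang y))) (ln et) = ln (max y x) - ln (max y x')"
    proof -
     have "0 < max y x" "0 < max y x'" using y by auto
     thus ?thesis unfolding v lm[OF yc xe(1)] lm[OF yc xe(3)] mx using c by (simp add: ln_divide_pos)
    qed
    thus ?thesis by (simp add: T0_def m_def)
   qed
   have Wp: "0 < W y / (2 * pi\<^sup>2)" using W_pos[OF y(1)] by simp
   have "J y <= m y" unfolding Jh Tm[symmetric] using A(2) Wp by (intro mult_left_mono) auto
   moreover have "J y = m y" if "x < b"
   proof -
    have "\<xi> < arcv th 0" using that c by (simp add: cx b_def)
    thus ?thesis unfolding Jh Tm[symmetric] using A(3) by simp
   qed
   ultimately show ?thesis using True by simp
  qed
 qed
 have T: "T = (\<integral>y. indicator {0<..<b} y * m y \<partial>lborel)" unfolding T_def O(2) by (simp add: m_def)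
 show "U x - U x' <= T" unfolding UJ T by (rule integral_mono_AE[OF iJ O(1)]) (use key in \<open>auto elim!: eventually_mono\<close>)
 show "U x - U x' = T" if "x < b" unfolding UJ T
  by (rule integral_cong_AE) (use iJ O(1) key that in \<open>auto elim!: eventually_mono\<close>)
qed

text \<open>By \<open>log_max_moment\<close> the integral of W against the difference of ln max
  telescopes to V x - V (b/2) inside the support. Outside, b V'(b) ln (x/b) replaces V x - V b, and
  it is not larger because x V'(x) increases. The midpoint b/2 is just a reference point.\<close>

lemma euler_lagrange:
 fixes V V1 :: "real => real"
 assumes th: "th > 1" and V1: "!!y. y > 0 ==> (V has_real_derivative V1 y) (at y)" and Vc: "continuous_on {0..} V"
  and W: "!!y. y > 0 ==> ((%y. y * V1 y) has_real_derivative W y) (at y)" and kc: "continuous_on {0..} (%y. y * V1 y)"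
 defines "U \<equiv> %x. \<integral>u. log_pair th x u * dens u \<partial>lborel"
 shows "0 < x ==> x < b ==> V x - U x = V (b/2) - U (b/2)" "b < x ==> V x - U x >= V (b/2) - U (b/2)"
proof -
 have h: "0 < b/2" "b/2 < b" using b_pos by auto
 have T: "integral {0..b} (%y. W y * (ln (max y x) - ln (max y (b/2)))) = b * V1 b * (ln (max b x) - ln b) - V (max b x) + V x + V b - V (b/2)"
  if x: "0 < x" for x
 proof -
  have "((%y. W y * ln (max y x) - W y * ln (max y (b/2))) has_integral
   (b * V1 b * ln (max b x) - V (max b x) + V x) - (b * V1 b * ln (max b (b/2)) - V (max b (b/2)) + V (b/2))) {0..b}"
   by (intro has_integral_diff log_max_moment[OF V1 Vc W kc]) (use x h b_pos in auto)
  from integral_unique[OF this] show ?thesis using b_pos by (simp add: right_diff_distrib max_def)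
 qed
 show "V x - U x = V (b/2) - U (b/2)" if x: "0 < x" "x < b"
 proof -
  have "U x - U (b/2) = V x - V (b/2)"
   using potential_difference(3)[OF th x(1) _ h x(2)] x T[OF x(1)] by (simp add: U_def max_def)
  thus ?thesis by simp
 qed
 show "V x - U x >= V (b/2) - U (b/2)" if x: "b < x"
 proof -
  have x0: "0 < x" using x b_pos by simp
  have "U x - U (b/2) <= b * V1 b * (ln x - ln b) + V b - V (b/2)"
   using potential_difference(2)[OF th x0 _ h] x T[OF x0] by (simp add: U_def max_def)
  moreover have "b * V1 b * (ln x - ln b) <= V x - V b"
  proof -
   \<comment> \<open>The derivative of t V'(t) is W, which is positive.\<close>
   have mono: "b * V1 b <= t * V1 t" if "b <= t" for t
   proof (rule DERIV_nonneg_imp_nondecreasing[of b t "%s. s * V1 s", OF that])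
    fix s assume "b <= s" "s <= t"
    hence s: "s > 0" using b_pos by simp
    show "\<exists>d. ((%s. s * V1 s) has_real_derivative d) (at s) & 0 <= d" using W[OF s] W_pos[OF s] by (intro exI[of _ "W s"]) simp
   qed
   have "V b - b * V1 b * ln b <= V x - b * V1 b * ln x"
   proof (rule DERIV_nonneg_imp_nondecreasing[of b x "%t. V t - b * V1 b * ln t"])
    show "b <= x" using x by simp
    fix t assume t: "b <= t" "t <= x"
    hence t0: "t > 0" using b_pos by simp
    have "((%t. V t - b * V1 b * ln t) has_real_derivative V1 t - b * V1 b * (1 / t)) (at t)"
     by (intro DERIV_diff V1[OF t0] DERIV_cmult) (use t0 in \<open>auto intro!: derivative_eq_intros\<close>)
    moreover have "0 <= V1 t - b * V1 b * (1 / t)" using mono[OF t(1)] t0 by (simp add: field_simps)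
    ultimately show "\<exists>y. ((%t. V t - b * V1 b * ln t) has_real_derivative y) (at t) & 0 <= y" by blast
   qed
   thus ?thesis by (simp add: algebra_simps)
  qed
  ultimately show ?thesis by linarith
 qed
qed

end

section \<open>The probability measure with this density\<close>

context arc_density
begin

definition equil :: "real measure" where "equil = density lborel (%u. ennreal (dens u))"

lemma sets_equil: "sets equil = sets borel" by (simp add: equil_def)

lemma AE_equil: "AE u in equil. 0 < u & u < b" "AE u in equil. u ~= x"
proof -
 have m: "(%u. ennreal (dens u)) \<in> borel_measurable lborel" by measurable
 show "AE u in equil. 0 < u & u < b" unfolding equil_def AE_density[OF m]
  by (rule AE_I2) (use dens_outside in \<open>auto simp: ennreal_0\<close>, (metis dens_outside greaterThanLessThan_iff less_irrefl)+)
 show "AE u in equil. u ~= x" unfolding equil_def AE_density[OF m]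
  using AE_lborel_singleton[of x] by eventually_elim simp
qed

lemma integral_equil:
 fixes f :: "real => real" assumes [measurable]: "f \<in> borel_measurable borel"
 shows "integrable equil f \<longleftrightarrow> integrable lborel (%u. f u * dens u)" "(\<integral>u. f u \<partial>equil) = (\<integral>u. f u * dens u \<partial>lborel)"
proof -
 show "integrable equil f \<longleftrightarrow> integrable lborel (%u. f u * dens u)"
  unfolding equil_def by (subst integrable_density) (auto simp: dens_nonneg mult.commute)
 show "(\<integral>u. f u \<partial>equil) = (\<integral>u. f u * dens u \<partial>lborel)"
  unfolding equil_def by (subst integral_density) (auto simp: dens_nonneg mult.commute)
qed

lemma prob_on_halfline_equil:
 assumes m: "integral {0..b} (%y. W y * arca th (y / c)) = pi * (1 + th)"
 shows "prob_on_halfline equil"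
proof -
 note M = dens_mass[OF m]
 have "emeasure equil UNIV = (\<integral>\<^sup>+u. ennreal (dens u) \<partial>lborel)" by (simp add: equil_def emeasure_density)
 also have "... = 1" using nn_integral_eq_integral[OF M(1)] M(2) dens_nonneg by simp
 finally have U: "emeasure equil UNIV = 1" .
 have sp: "space equil = UNIV" by (simp add: equil_def)
 have p: "prob_space equil" by (rule prob_spaceI) (simp add: sp U)
 interpret prob_space equil by (rule p)
 have "AE u in equil. u \<in> {0..}" using AE_equil(1) by eventually_elim auto
 hence "emeasure equil {0..} = 1" by (subst emeasure_eq_1_AE) (auto simp: sets_equil)
 thus ?thesis using p sets_equil by (simp add: prob_on_halfline_def)
qed

lemma support_equil: "measure_support equil = {0..b}"
proof (intro equalityI subsetI)
 have em: "emeasure equil A = (\<integral>\<^sup>+u. ennreal (dens u) * indicator A u \<partial>lborel)" if "A \<in> sets borel" for A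
  using that by (simp add: equil_def emeasure_density)
 fix x assume x: "x \<in> measure_support equil"
 show "x \<in> {0..b}"
 proof (rule ccontr)
  assume n: "x \<notin> {0..b}"
  define e where "e = (if x < 0 then - x else x - b)"
  have e: "e > 0" using n by (auto simp: e_def)
  have "dens u = 0" if "u \<in> ball x e" for u
   by (rule dens_outside) (use that n in \<open>auto simp: e_def dist_real_def split: if_splits\<close>)
  hence z: "ennreal (dens u) * indicator (ball x e) u = 0" for u by (auto simp: indicator_def)
  have "emeasure equil (ball x e) = 0" unfolding em[OF borel_open[OF open_ball]] z by simp
  thus False using x e by (auto simp: measure_support_def)
 qed
next
 have em: "emeasure equil A = (\<integral>\<^sup>+u. ennreal (dens u) * indicator A u \<partial>lborel)" if "A \<in> sets borel" for A
  using that by (simp add: equil_def emeasure_density)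
 fix x assume x: "x \<in> {0..b}"
 show "x \<in> measure_support equil" unfolding measure_support_def
 proof (intro CollectI allI impI)
  fix e :: real assume e: "e > 0"
  \<comment> \<open>Also for x = 0 or x = b the ball contains an open interval inside (0, b), where
    the density is positive.\<close>
  define l r where "l = max 0 (x - e)" and "r = min b (x + e)"
  have lr: "l < r" using x e b_pos by (auto simp: l_def r_def)
  have sub: "{l<..<r} \<subseteq> ball x e" "{l<..<r} \<subseteq> {0<..<b}" by (auto simp: l_def r_def dist_real_def)
  show "emeasure equil (ball x e) > 0"
  proof (rule ccontr)
   assume "~ emeasure equil (ball x e) > 0"
   hence "(\<integral>\<^sup>+u. ennreal (dens u) * indicator (ball x e) u \<partial>lborel) = 0"
    unfolding em[OF borel_open[OF open_ball]] by simp
   moreover have "(%u. ennreal (dens u) * indicator (ball x e) u) \<in> borel_measurable lborel"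
    by (intro borel_measurable_times_ennreal borel_measurable_indicator measurable_compose[OF _ measurable_ennreal]) simp_all
   ultimately have "AE u in lborel. ennreal (dens u) * indicator (ball x e) u = 0"
    by (simp only: nn_integral_0_iff_AE)
   hence "AE u in lborel. u \<notin> {l<..<r}"
   proof eventually_elim
    fix u assume z: "ennreal (dens u) * indicator (ball x e) u = 0"
    show "u \<notin> {l<..<r}"
    proof
     assume u: "u \<in> {l<..<r}"
     hence "u \<in> ball x e" "0 < u" "u < b" using sub by auto
     thus False using z dens_pos[of u] by simp
    qed
   qed
   hence "emeasure lborel {l<..<r} = 0" by (subst (asm) AE_iff_measurable[of "{l<..<r}"]) auto
   thus False using lr by simp
  qed
 qed
qed

lemma measure_equil:
 assumes A: "A \<in> sets borel" and psi: "!!u. 0 < u ==> u < b ==> f u = dens u" and i: "integrable lborel dens"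
 shows "measure equil A = (\<integral>u\<in>A \<inter> {0<..<b}. f u \<partial>lborel)"
proof -
 have e: "indicator (A \<inter> {0<..<b}) u *\<^sub>R f u = indicator A u * dens u" for u :: real
  using psi[of u] dens_outside[of u] by (cases "u \<in> {0<..<b}") (auto simp: indicator_def)
 have ii: "integrable lborel (%u. indicator A u * dens u)" using integrable_mult_indicator[OF _ i, of A] A by simp
 have "emeasure equil A = (\<integral>\<^sup>+u. ennreal (indicator A u * dens u) \<partial>lborel)"
  using A by (simp add: equil_def emeasure_density) (rule nn_integral_cong, auto simp: indicator_def)
 also have "... = ennreal (\<integral>u. indicator A u * dens u \<partial>lborel)"
  by (rule nn_integral_eq_integral[OF ii]) (auto simp: dens_nonneg)
 finally have "measure equil A = (\<integral>u. indicator A u * dens u \<partial>lborel)"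
  by (simp add: measure_def dens_nonneg)
 thus ?thesis unfolding set_lebesgue_integral_def e .
qed

text \<open>The Lebesgue integral over the open interval is compared with the gauge integral over
  the closed one; \<open>pt\<close> and its conjugate are the two preimages of a point of
  [0, b].\<close>

lemma psi_eq_dens:
 assumes th: "th > 1" and W: "!!y. 0 <= y ==> W y = V2 y * y + V1 y" and u: "0 < u" "u < b"
 shows "psi th c V1 V2 u = dens u"
proof -
 have bb: "bc th c = b" using arcv_0[OF theta] by (simp add: bc_def b_def)
 have I: "Iplus th c y = pt y" "Iminus th c y = cnj (pt y)" if "0 <= y" "y <= b" for y
  using Iplus_eq(1,2)[OF th c, of y] that ang_eq(1)[OF that] by (simp_all add: pt_def b_def)
 define f where "f = (%y. W (max 0 y) * green y u / (2 * pi\<^sup>2 * u))"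
 have k: "kern u y = indicator {0<..<b} y *\<^sub>R f y" for y using u by (simp add: kern_def f_def)
 have si: "set_integrable lborel {0<..<b} f" unfolding set_integrable_def k[symmetric] by (rule kern_integrable)
 have "dens u = (LINT y:{0<..<b}|lborel. f y)" unfolding dens_def set_lebesgue_integral_def k ..
 also have "... = integral {0<..<b} f" by (rule set_borel_integral_eq_integral(2)[OF si])
 also have "... = integral {0..b} f" by (simp add: integral_open_interval_real)
 also have "... = integral {0..b} (%y. 1 / (2 * pi\<^sup>2 * u) * ((V2 y * y + V1 y) * ln (cmod ((Iplus th c y - Iminus th c u) / (Iplus th c y - Iplus th c u)))))"
 proof (rule integral_cong)
  fix y assume "y \<in> {0..b}"
  hence y: "0 <= y" "y <= b" by auto
  show "f y = 1 / (2 * pi\<^sup>2 * u) * ((V2 y * y + V1 y) * ln (cmod ((Iplus th c y - Iminus th c u) / (Iplus th c y - Iplus th c u))))"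
   using I[OF y] I[of u] u W[OF y(1)] y by (simp add: f_def green_def)
 qed
 also have "... = psi th c V1 V2 u" unfolding psi_def bb by (simp only: integral_mult_right)
 finally show ?thesis ..
qed

end

text \<open>Compactness handles a bounded interval, and beyond it V x >= K ln x with 1 + x <= 2 x,
  which accounts for the term K ln 2.\<close>

lemma log_growth_lower:
 fixes V :: "real => real"
 assumes V: "continuous_on {0..} V" and growth: "filterlim (%x. V x / ln x) at_top at_top" and K: "K >= 0"
 obtains C0 where "C0 >= 0" "!!x. x >= 0 ==> V x >= K * ln (1 + x) - C0"
proof -
 have "\<forall>\<^sub>F x in at_top. V x / ln x >= K" using growth by (auto simp: filterlim_at_top)
 then obtain x1 where x1: "!!x. x >= x1 ==> V x / ln x >= K" unfolding eventually_at_top_linorder by blast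
 define x2 where "x2 = max 2 x1"
 have "compact (V ` {0..x2})" by (intro compact_continuous_image continuous_on_subset[OF V]) auto
 then obtain B where "\<forall>x\<in>{0..x2}. \<bar>V x\<bar> <= B" using compact_imp_bounded[of "V ` {0..x2}"] unfolding bounded_iff by auto
 hence B: "!!x. x \<in> {0..x2} ==> \<bar>V x\<bar> <= B" by blast
 define C0 where "C0 = \<bar>B\<bar> + K * ln (1 + x2) + K * ln 2"
 have C: "C0 >= 0" using K by (auto simp: C0_def x2_def)
 have "V x >= K * ln (1 + x) - C0" if x: "x >= 0" for x
 proof (cases "x <= x2")
  case True
  have "K * ln (1 + x) <= K * ln (1 + x2)" using True x K by (intro mult_left_mono) auto
  moreover have "0 <= K * ln 2" using K by simp
  ultimately show ?thesis using B[of x] True x by (auto simp: C0_def)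
 next
  case False
  hence x': "x >= 2" "x >= x1" by (auto simp: x2_def)
  have l: "ln x > 0" using x' by simp
  have "K * ln x <= V x" using x1[OF x'(2)] l by (simp add: le_divide_eq)
  moreover have "ln (1 + x) <= ln (2 * x)" using x' by (intro ln_mono) auto
  hence "K * ln (1 + x) <= K * (ln 2 + ln x)" using x' K by (intro mult_left_mono) (auto simp: ln_mult)
  moreover have "0 <= K * ln (1 + x2)" using K by (auto simp: x2_def)
  ultimately show ?thesis by (simp add: C0_def distrib_left)
 qed
 thus ?thesis using that C by blast
qed

subsection \<open>The equilibrium measure\<close>

theorem theorem1p4:
  fixes \<theta> :: real and V V1 V2 :: "real \<Rightarrow> real"
  assumes theta: "\<theta> > 1"
    and V1: "\<And>x. x \<ge> 0 \<Longrightarrow> (V has_real_derivative V1 x) (at x within {0..})"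
    and V2: "\<And>x. x \<ge> 0 \<Longrightarrow> (V1 has_real_derivative V2 x) (at x within {0..})"
    and V2_cont: "continuous_on {0..} V2"
    and growth: "filterlim (\<lambda>x. V x / ln x) at_top at_top"
    and cond_i: "\<And>x. x > 0 \<Longrightarrow> V2 x * x + V1 x > 0"
    and cond_ii: "\<And>x. x > 0 \<Longrightarrow> V2 x \<ge> 0"
  shows "\<exists>c>0.
     contour_integral (gammapath \<theta> c) (\<lambda>s. complex_of_real (V1 (Re (Jc \<theta> c s))) * Jc \<theta> c s / s)
        / (2 * pi * \<i>) = complex_of_real (1 + \<theta>)
   \<and> (\<forall>c'>0. contour_integral (gammapath \<theta> c') (\<lambda>s. complex_of_real (V1 (Re (Jc \<theta> c' s))) * Jc \<theta> c' s / s)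
        / (2 * pi * \<i>) = complex_of_real (1 + \<theta>) \<longrightarrow> c' = c)
   \<and> (\<exists>!\<mu>. is_equilibrium_measure \<theta> V \<mu>)
   \<and> (\<forall>\<mu>. is_equilibrium_measure \<theta> V \<mu> \<longrightarrow>
        measure_support \<mu> = {0..bc \<theta> c}
      \<and> set_integrable lborel {0<..<bc \<theta> c} (psi \<theta> c V1 V2)
      \<and> (\<forall>A\<in>sets borel. measure \<mu> A = (\<integral>x\<in>A \<inter> {0<..<bc \<theta> c}. psi \<theta> c V1 V2 x \<partial>lborel)))"
proof -
 note th1 = theta
 have th0: "\<theta> > 0" using theta by simp
 define W where "W = (%y. V2 y * y + V1 y)"
 have V1c: "continuous_on {0..} V1" using V2 by (intro DERIV_continuous_on) auto
 have Vc: "continuous_on {0..} V" using V1 by (intro DERIV_continuous_on) auto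
 have Wc: "continuous_on {0..} W" unfolding W_def by (intro continuous_intros V2_cont V1c)
 have kd: "((%x. x * V1 x) has_real_derivative W x) (at x within {0..})" if "x >= 0" for x
  using DERIV_mult[OF DERIV_ident V2[OF that]] by (simp add: W_def add.commute)
 have at: "at y within {0..} = at y" if "y > 0" for y :: real
  by (rule at_within_interior) (use that in simp)
 have V1': "(V has_real_derivative V1 y) (at y)" if "y > 0" for y
  using V1[OF less_imp_le[OF that]] unfolding at[OF that] .
 have kd': "((%x. x * V1 x) has_real_derivative W y) (at y)" if "y > 0" for y
  using kd[OF less_imp_le[OF that]] unfolding at[OF that] .
 have Wp: "W y > 0" if "y > 0" for y using cond_i[OF that] by (simp add: W_def)
 have kc: "continuous_on {0..} (%x. x * V1 x)" by (intro continuous_intros V1c)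
 have kmono: "x * V1 x <= y * V1 y" if xy: "0 < x" "x <= y" for x y
 proof (rule DERIV_nonneg_imp_nondecreasing[of x y "%s. s * V1 s", OF xy(2)])
  fix s assume "x <= s" "s <= y"
  hence s: "s > 0" using xy by simp
  show "\<exists>d. ((%s. s * V1 s) has_real_derivative d) (at s) & 0 <= d" using kd'[OF s] Wp[OF s] by (intro exI[of _ "W s"]) simp
 qed
 have ku: "filterlim (%x. x * V1 x) at_top at_top" by (rule rate_unbounded[OF V1' kmono growth])
 define F where "F = (%c. integral {0..c * arcv \<theta> 0} (%y. W y * arca \<theta> (y / c)))"
 have pos: "pi * (1 + \<theta>) > 0" using th0 by simp
 have "\<exists>c>0. F c = pi * (1 + \<theta>) & (\<forall>c'>0. F c' = pi * (1 + \<theta>) --> c' = c)"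
  unfolding F_def by (rule unique_scale[OF th0 pos kd _ Wc Wp ku]) simp_all
 then obtain c where cF: "c > 0" "F c = pi * (1 + \<theta>)" "!!c'. c' > 0 ==> F c' = pi * (1 + \<theta>) ==> c' = c" by blast
 \<comment> \<open>Links the contour equation, for every positive candidate, to the moment whose
   unique solution has been found; this transfers both existence and uniqueness of c.\<close>
 have ci: "contour_integral (gammapath \<theta> c') (%s. complex_of_real (V1 (Re (Jc \<theta> c' s))) * Jc \<theta> c' s / s) / (2 * pi * \<i>) = complex_of_real (1 + \<theta>)
   \<longleftrightarrow> F c' = pi * (1 + \<theta>)" if c': "c' > 0" for c'
 proof -
  have "contour_integral (gammapath \<theta> c') (%s. complex_of_real (V1 (Re (Jc \<theta> c' s))) * Jc \<theta> c' s / s) / (2 * pi * \<i>) = complex_of_real (F c' / pi)"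
   using contour_integral_gammapath[OF theta c' kd Wc] by (simp add: F_def)
  moreover have "F c' / pi = 1 + \<theta> \<longleftrightarrow> F c' = pi * (1 + \<theta>)" by (simp add: divide_eq_eq mult.commute)
  ultimately show ?thesis by (simp only: of_real_eq_iff)
 qed
 interpret arc_density \<theta> c W by (rule arc_density.intro[OF th0 cF(1) Wc Wp])
 have bb: "bc \<theta> c = b" using arcv_0[OF th0] by (simp add: bc_def b_def)
 \<comment> \<open>The equation for c, now read as the normalisation of the density.\<close>
 have mass: "integral {0..b} (%y. W y * arca \<theta> (y / c)) = pi * (1 + \<theta>)" using cF(2) unfolding F_def b_def .
 have "\<theta> + 4 >= 0" using th0 by simp
 from log_growth_lower[OF Vc growth this]
 obtain C where C: "C >= 0" "!!x. x >= 0 ==> V x >= (\<theta> + 4) * ln (1 + x) - C" by blast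
 interpret log_gas \<theta> C V by (rule log_gas.intro[OF th1 C(1) Vc C(2)])
 obtain K where K: "!!x. x >= 0 ==> (\<integral>u. \<bar>ln \<bar>x - u\<bar>\<bar> * dens u \<partial>lborel) <= K * (1 + ln (1 + x))" using log_moment_bound by blast
 have lm: "(%u. ln \<bar>x - u\<bar>) \<in> borel_measurable borel" "(%u. \<bar>ln \<bar>x - u\<bar>\<bar>) \<in> borel_measurable borel" for x :: real by measurable
 have U: "(\<integral>u. ln \<bar>x - u\<bar> + ln \<bar>x powr \<theta> - u powr \<theta>\<bar> \<partial>equil) = (\<integral>u. log_pair \<theta> x u * dens u \<partial>lborel)" for x
 proof -
  have "(%u. log_pair \<theta> x u) \<in> borel_measurable borel" unfolding log_pair_def by measurable
  from integral_equil(2)[OF this] show ?thesis by (simp only: log_pair_def)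
 qed
 note EL = euler_lagrange[OF th1 V1' Vc kd' kc, folded U]
 have i0: "integrable equil (%u. ln \<bar>x - u\<bar>)" if "x >= 0" for x
  unfolding integral_equil(1)[OF lm(1)] by (rule log_moment[OF that])
 have K': "(\<integral>u. \<bar>ln \<bar>x - u\<bar>\<bar> \<partial>equil) <= K * (1 + ln (1 + x))" if "x >= 0" for x
  unfolding integral_equil(2)[OF lm(2)] by (rule K[OF that])
 note opt = optimal_measure[OF prob_on_halfline_equil[OF mass] AE_equil(1) i0 K' AE_equil(2) EL]
 have psi: "psi \<theta> c V1 V2 u = dens u" if "0 < u" "u < b" for u
  by (rule psi_eq_dens[OF th1 _ that]) (simp add: W_def)
 have id: "integrable lborel dens" by (rule dens_mass(1)[OF mass])
 have "(%u. indicator {0<..<b} u *\<^sub>R psi \<theta> c V1 V2 u) = dens"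
 proof
  show "indicator {0<..<b} u *\<^sub>R psi \<theta> c V1 V2 u = dens u" for u
   using psi[of u] dens_outside[of u] by (cases "u \<in> {0<..<b}") auto
 qed
 hence si: "set_integrable lborel {0<..<b} (psi \<theta> c V1 V2)" unfolding set_integrable_def using id by (simp only:)
 show ?thesis
 proof (intro exI[of _ c] conjI allI impI)
  show "c > 0" by (rule cF(1))
  show "contour_integral (gammapath \<theta> c) (%s. complex_of_real (V1 (Re (Jc \<theta> c s))) * Jc \<theta> c s / s) / (2 * pi * \<i>) = complex_of_real (1 + \<theta>)"
   by (rule iffD2[OF ci[OF cF(1)] cF(2)])
  show "c' = c" if c': "c' > 0" and e: "contour_integral (gammapath \<theta> c') (%s. complex_of_real (V1 (Re (Jc \<theta> c' s))) * Jc \<theta> c' s / s) / (2 * pi * \<i>) = complex_of_real (1 + \<theta>)" for c'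
   by (rule cF(3)[OF c' iffD1[OF ci[OF c'] e]])
  show "\<exists>!\<mu>. is_equilibrium_measure \<theta> V \<mu>" using opt by blast
  fix \<mu> assume "is_equilibrium_measure \<theta> V \<mu>"
  hence mu: "\<mu> = equil" using opt by blast
  show "measure_support \<mu> = {0..bc \<theta> c}" unfolding mu bb by (rule support_equil)
  show "set_integrable lborel {0<..<bc \<theta> c} (psi \<theta> c V1 V2)" unfolding bb by (rule si)
  show "\<forall>A\<in>sets borel. measure \<mu> A = (\<integral>x\<in>A \<inter> {0<..<bc \<theta> c}. psi \<theta> c V1 V2 x \<partial>lborel)"
   unfolding mu bb using measure_equil[OF _ psi id] by blast
 qed
qed

end
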